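(* Let $m\ge 0$, $r\geq 1$, $d\geq 2$ be integers, let $T:\mathbb A^m_{\mathbb C}\to\mathbb A^m_{\mathbb C}$ be a polynomial map, let $M(u)\in\operatorname{GL}_r(\mathbb C[u_1,\ldots,u_m])$, let $0\neq\rho(u,\boldsymbol z)\in(z_1,\ldots,z_r)^{d-1}\mathbb C[u_1,\ldots,u_m,z_1,\ldots,z_r]$, and put $$F(u,\boldsymbol z)=\bigl(T(u),\rho(u,\boldsymbol z)M(u)\boldsymbol z\bigr).$$ Assume that at least one of the following holds. (a) $T$ is affine-linear, and, with $N\geq 0$ chosen so that $S=T^N(\mathbb A^m)=T^{N+1}(\mathbb A^m)$, and with $Z=S\times\{0\}$ and $C=V(\det D_{\boldsymbol z}(\rho(u,\boldsymbol z)M(u)\boldsymbol z))\subseteq S\times\mathbb A^r$, there is $\ell\geq1$ with $(F|_{S\times\mathbb A^r})^\ell(C)\subseteq Z$ set-theoretically. (b) $m\geq 1$, $T$ is étale, and, with $Z=\mathbb A^m\times\{0\}$ and $C=V(\det D_{\boldsymbol z}(\rho(u,\boldsymbol z)M(u)\boldsymbol z))\subseteq\mathbb A^m\times\mathbb A^r$, there are $q,\ell\geq 1$ with $\deg(T^q)<d^q$ and $F^\ell(C)\subseteq Z$ set-theoretically. Fix an orbit $(u_n,\boldsymbol z_n)=F^n(u_0,\boldsymbol z_0)$, $n\ge0$, choose $a\geq1$ and $A(t)\in\operatorname{GL}_a(\mathbb C[t])$, and set $$Y_0=I_a,\qquad Y_{n+1}=A(n)Y_n,\qquad \boldsymbol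 x_n=(n,u_n,\boldsymbol z_n,Y_n),$$ where the entries of $Y_n$ are regarded as separate coordinates. Then there is an integer $p\geq1$, depending only on $F$, the initial point $(u_0,\boldsymbol z_0)$, and $A$, with the following property. For every $h\geq0$ and every pair of polynomials $P,D$ (with complex coefficients) in the coordinates of $h+1$ states, the set $$\{n\geq0:\ P(\boldsymbol x_n,\ldots,\boldsymbol x_{n+h})=0\ \text{ and }\ D(\boldsymbol x_n,\ldots,\boldsymbol x_{n+h})\neq0\}$$ agrees, outside a finite set, with a union of residue classes modulo $p$. The exceptional finite set may depend on $h,P,D$, but $p$ does not. Moreover, let $\mathcal R\subseteq\operatorname{Seq}_{\mathbb C}$ be the $\mathbb C$-algebra generated by the coordinate sequences of $(\boldsymbol x_n)_{n\ge 0}$. Its total quotient ring $L:=\operatorname{Quot}(\mathcal R)$ embeds in $\operatorname{Seq}_{\mathbb C}$ and has a decomposition $L\simeq L_0\times\cdots\times L_{p-1}$ into fields (with the same $p$). The shift $\sigma$ extends injectively to $L$, permutes the primitive idempotents of $L$ in a single cycle, and satisfies $L^\sigma=\mathbb C$.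
   Context: $u=(u_1,\ldots,u_m)$ are base coordinates and $\boldsymbol z=(z_1,\ldots,z_r)$ (a column vector) are fiber coordinates. $M\in\operatorname{GL}_r(\mathbb C[u])$ and $A\in\operatorname{GL}_a(\mathbb C[t])$ mean that the matrix and its inverse have polynomial entries. $(z_1,\ldots,z_r)^{d-1}$ consists of the polynomials all of whose monomials have total degree at least $d-1$ in $z_1,\ldots,z_r$. $D_{\boldsymbol z}$ is the Jacobian matrix with respect to $\boldsymbol z$ with $u$ fixed; $V(h)$ is the zero set of $h$. A polynomial self-map of $\mathbb A^m_{\mathbb C}$ is étale if its differential is everywhere invertible. The degree of a polynomial map is the maximum of the total degrees of its nonzero coordinate polynomials; $T^q$ is the $q$-th iterate and $\deg(T^q)$ is the degree of the composed map. The tuple $\boldsymbol x_n$ is called a state; a polynomial in $h+1$ states may use every coordinate of each of $\boldsymbol x_n,\ldots,\boldsymbol x_{n+h}$. $\operatorname{Seq}_{\mathbb C}$ is the ring of complex sequences $(a_n)_{n\ge0}$ modulo eventual equality (two sequences are identified if they agree at all sufficiently large indices), with componentwise operations; complex numbers are identified with constant sequences. The shift is $\sigma((a_n)_{n\geq0})=(a_{n+1})_{n\geq0}$. The total quotient ring $\operatorname{Quot}(R)$ of a commutative ring $R$ is obtained by inverting all non-zero-divisors. A nonzero idempotent is primitive if it cannot be written as a sum of two nonzero idempotents whose product is zero. $L^\sigma$ is the set of elements of $L$ fixed by the shift. *)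

theory Defs
  imports
    "HOL-Library.Poly_Mapping"
    "HOL-Combinatorics.Orbits"
    "HOL-Computational_Algebra.Polynomial"
    "HOL-Algebra.Chinese_Remainder"
    "HOL-Algebra.Generated_Rings"
    "Jordan_Normal_Form.Matrix"
    "Jordan_Normal_Form.Determinant"
begin

section \<open>Multivariate polynomials over the complex numbers\<close>

text \<open>
  Finitely supported functions from monomials to coefficients; a monomial is a finitely supported
  function from variables to exponents.  Multiplication is the convolution product of
  \<^theory>\<open>HOL-Library.Poly_Mapping\<close>.  The number of variables is imposed by bounding
  \<open>mp_vars\<close>, so any number of variables, 0 included, is possible.
\<close>

type_synonym 'v cpoly = "('v \<Rightarrow>\<^sub>0 nat) \<Rightarrow>\<^sub>0 complex"

definition mp_const :: "complex \<Rightarrow> 'v cpoly" where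
  "mp_const c = Poly_Mapping.single 0 c"

definition mp_var :: "'v \<Rightarrow> 'v cpoly" where
  "mp_var v = Poly_Mapping.single (Poly_Mapping.single v 1) 1"

definition mp_vars :: "'v cpoly \<Rightarrow> 'v set" where
  "mp_vars f = (\<Union>\<mu>\<in>Poly_Mapping.keys f. Poly_Mapping.keys \<mu>)"

definition mp_insertion :: "(complex \<Rightarrow> 'b) \<Rightarrow> ('v \<Rightarrow> 'b) \<Rightarrow> 'v cpoly \<Rightarrow> 'b::comm_ring_1" where
  "mp_insertion \<kappa> s f =
     (\<Sum>\<mu>\<in>Poly_Mapping.keys f. \<kappa> (Poly_Mapping.lookup f \<mu>) *
       (\<Prod>v\<in>Poly_Mapping.keys \<mu>. s v ^ Poly_Mapping.lookup \<mu> v))"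

definition mp_eval :: "('v \<Rightarrow> complex) \<Rightarrow> 'v cpoly \<Rightarrow> complex" where
  "mp_eval = mp_insertion (\<lambda>c. c)"

definition mp_subst :: "('v \<Rightarrow> 'w cpoly) \<Rightarrow> 'v cpoly \<Rightarrow> 'w cpoly" where
  "mp_subst = mp_insertion mp_const"

definition mp_deriv :: "'v \<Rightarrow> 'v cpoly \<Rightarrow> 'v cpoly" where
  "mp_deriv v f =
     (\<Sum>\<mu>\<in>Poly_Mapping.keys f. Poly_Mapping.single (\<mu> - Poly_Mapping.single v 1)
       (of_nat (Poly_Mapping.lookup \<mu> v) * Poly_Mapping.lookup f \<mu>))"

definition mp_monom_degree :: "('v \<Rightarrow>\<^sub>0 nat) \<Rightarrow> nat" where
  "mp_monom_degree \<mu> = (\<Sum>v\<in>Poly_Mapping.keys \<mu>. Poly_Mapping.lookup \<mu> v)"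

text \<open>The inserted 0 only matters for the zero polynomial.\<close>

definition mp_total_degree :: "'v cpoly \<Rightarrow> nat" where
  "mp_total_degree f = Max (insert 0 (mp_monom_degree ` Poly_Mapping.keys f))"


section \<open>Polynomial maps of affine space\<close>

text \<open>
  Affine \<open>m\<close>-space is \<open>carrier_vec m\<close>.  A polynomial self-map of it is a vector of \<open>m\<close> polynomials
  in the variables \<open>0, \<dots>, m - 1\<close>.
\<close>

definition polynomial_map :: "nat \<Rightarrow> nat cpoly vec \<Rightarrow> bool" where
  "polynomial_map m T \<longleftrightarrow> T \<in> carrier_vec m \<and> (\<forall>i<m. mp_vars (T $ i) \<subseteq> {..<m})"

definition pm_eval :: "nat cpoly vec \<Rightarrow> complex vec \<Rightarrow> complex vec" where
  "pm_eval T u = map_vec (mp_eval (($) u)) T"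

definition pm_comp :: "nat cpoly vec \<Rightarrow> nat cpoly vec \<Rightarrow> nat cpoly vec" where
  "pm_comp S T = map_vec (mp_subst (($) T)) S"

definition pm_iterate :: "nat cpoly vec \<Rightarrow> nat \<Rightarrow> nat cpoly vec" where
  "pm_iterate T q = (pm_comp T ^^ q) (vec (dim_vec T) mp_var)"

text \<open>The inserted 0 only matters when all coordinate polynomials are zero.\<close>

definition pm_degree :: "nat cpoly vec \<Rightarrow> nat" where
  "pm_degree T = Max (insert 0 {mp_total_degree (T $ i) | i. i < dim_vec T \<and> T $ i \<noteq> 0})"

definition pm_affine_linear :: "nat cpoly vec \<Rightarrow> bool" where
  "pm_affine_linear T \<longleftrightarrow> (\<forall>i<dim_vec T. mp_total_degree (T $ i) \<le> 1)"

definition pm_differential :: "nat cpoly vec \<Rightarrow> complex vec \<Rightarrow> complex mat" where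
  "pm_differential T u =
     mat (dim_vec T) (dim_vec T) (\<lambda>(i, j). mp_eval (($) u) (mp_deriv j (T $ i)))"

definition pm_etale :: "nat cpoly vec \<Rightarrow> bool" where
  "pm_etale T \<longleftrightarrow> (\<forall>u\<in>carrier_vec (dim_vec T). invertible_mat (pm_differential T u))"

text \<open>\<open>GL n P\<close>: invertible matrices such that the entries of the matrix and of its inverse lie in \<open>P\<close>.\<close>

definition GL :: "nat \<Rightarrow> 'a::comm_ring_1 set \<Rightarrow> 'a mat set" where
  "GL n P = {X \<in> carrier_mat n n. elements_mat X \<subseteq> P \<and>
     (\<exists>Y\<in>carrier_mat n n. elements_mat Y \<subseteq> P \<and> inverts_mat X Y \<and> inverts_mat Y X)}"


section \<open>The skew product\<close>

text \<open>In polynomials on the total space, \<open>Inl i\<close> is a base and \<open>Inr j\<close> a fiber variable.\<close>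

definition fiber_order_ge :: "nat \<Rightarrow> nat \<Rightarrow> (nat + nat) cpoly \<Rightarrow> bool" where
  "fiber_order_ge r k f \<longleftrightarrow>
     (\<forall>\<mu>\<in>Poly_Mapping.keys f. k \<le> (\<Sum>j<r. Poly_Mapping.lookup \<mu> (Inr j)))"

definition total_eval :: "complex vec \<Rightarrow> complex vec \<Rightarrow> (nat + nat) cpoly \<Rightarrow> complex" where
  "total_eval u z = mp_eval (case_sum (($) u) (($) z))"

text \<open>The vector of polynomials \<open>\<rho>(u, z) M(u) z\<close>.\<close>

definition fiber_map :: "nat \<Rightarrow> (nat + nat) cpoly \<Rightarrow> nat cpoly mat \<Rightarrow> (nat + nat) cpoly vec" where
  "fiber_map r \<rho> M =
     \<rho> \<cdot>\<^sub>v (map_mat (mp_subst (\<lambda>i. mp_var (Inl i))) M *\<^sub>v vec r (\<lambda>j. mp_var (Inr j)))"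

definition skew_product ::
    "nat \<Rightarrow> nat cpoly vec \<Rightarrow> (nat + nat) cpoly \<Rightarrow> nat cpoly mat \<Rightarrow>
      complex vec \<times> complex vec \<Rightarrow> complex vec \<times> complex vec" where
  "skew_product r T \<rho> M =
     (\<lambda>(u, z). (pm_eval T u, map_vec (total_eval u z) (fiber_map r \<rho> M)))"

definition fiber_jacobian :: "nat \<Rightarrow> (nat + nat) cpoly vec \<Rightarrow> (nat + nat) cpoly mat" where
  "fiber_jacobian r g = mat r r (\<lambda>(i, j). mp_deriv (Inr j) (g $ i))"

definition critical_locus ::
    "nat \<Rightarrow> (nat + nat) cpoly \<Rightarrow> nat cpoly mat \<Rightarrow> complex vec set \<Rightarrow> (complex vec \<times> complex vec) set" where
  "critical_locus r \<rho> M S =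
     {(u, z) \<in> S \<times> carrier_vec r. total_eval u z (det (fiber_jacobian r (fiber_map r \<rho> M))) = 0}"


section \<open>States\<close>

fun cocycle :: "complex poly mat \<Rightarrow> nat \<Rightarrow> complex mat" where
  "cocycle A 0 = 1\<^sub>m (dim_row A)"
| "cocycle A (Suc n) = map_mat (\<lambda>f. poly f (of_nat n)) A * cocycle A n"

datatype coord = Time | Base nat | Fiber nat | Entry nat nat

definition state_coords :: "nat \<Rightarrow> nat \<Rightarrow> nat \<Rightarrow> coord set" where
  "state_coords m r a =
     {Time} \<union> Base ` {..<m} \<union> Fiber ` {..<r} \<union> {Entry i j | i j. i < a \<and> j < a}"

text \<open>Coordinates of the \<open>n\<close>-th state \<open>(n, u\<^sub>n, z\<^sub>n, Y\<^sub>n)\<close> for a map \<open>F\<close> and initial point \<open>w\<close>.\<close>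

fun state ::
    "(complex vec \<times> complex vec \<Rightarrow> complex vec \<times> complex vec) \<Rightarrow> complex vec \<times> complex vec \<Rightarrow>
      complex poly mat \<Rightarrow> nat \<Rightarrow> coord \<Rightarrow> complex" where
  "state F w A n Time = of_nat n"
| "state F w A n (Base i) = fst ((F ^^ n) w) $ i"
| "state F w A n (Fiber j) = snd ((F ^^ n) w) $ j"
| "state F w A n (Entry i j) = cocycle A n $$ (i, j)"

text \<open>
  The polynomials in \<open>h + 1\<close> states; the variable \<open>(k, c)\<close> stands for coordinate \<open>c\<close> of the
  \<open>k\<close>-th of these states.
\<close>

definition state_polys :: "nat \<Rightarrow> nat \<Rightarrow> nat \<Rightarrow> nat \<Rightarrow> (nat \<times> coord) cpoly set" where
  "state_polys m r a h = {f. mp_vars f \<subseteq> {..h} \<times> state_coords m r a}"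

definition window_eval :: "(nat \<Rightarrow> coord \<Rightarrow> complex) \<Rightarrow> nat \<Rightarrow> (nat \<times> coord) cpoly \<Rightarrow> complex" where
  "window_eval x n = mp_eval (\<lambda>(k, c). x (n + k) c)"


section \<open>Sequences modulo eventual equality\<close>

definition all_seqs :: "(nat \<Rightarrow> complex) ring" where
  "all_seqs = \<lparr>carrier = UNIV, mult = (\<lambda>s t n. s n * t n), one = (\<lambda>_. 1),
     zero = (\<lambda>_. 0), add = (\<lambda>s t n. s n + t n)\<rparr>"

definition null_seqs :: "(nat \<Rightarrow> complex) set" where
  "null_seqs = {s. eventually (\<lambda>n. s n = 0) sequentially}"

definition Seq :: "(nat \<Rightarrow> complex) set ring" where
  "Seq = all_seqs Quot null_seqs"

definition seq_class :: "(nat \<Rightarrow> complex) \<Rightarrow> (nat \<Rightarrow> complex) set" where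
  "seq_class s = null_seqs +>\<^bsub>all_seqs\<^esub> s"

definition const_seq :: "complex \<Rightarrow> (nat \<Rightarrow> complex) set" where
  "const_seq c = seq_class (\<lambda>_. c)"

text \<open>The image of a class under the shift of sequences is again a full class, see below.\<close>

definition seq_shift :: "(nat \<Rightarrow> complex) set \<Rightarrow> (nat \<Rightarrow> complex) set" where
  "seq_shift X = (\<lambda>s n. s (Suc n)) ` X"

lemma seq_class_eq: "seq_class s = {t. eventually (\<lambda>n. t n = s n) sequentially}"
proof -
  have "seq_class s = (\<lambda>h n. h n + s n) ` null_seqs"
    by (auto simp: seq_class_def a_r_coset_def' all_seqs_def)
  also have "\<dots> = {t. eventually (\<lambda>n. t n = s n) sequentially}"
  proof (intro equalityI subsetI)
    fix t assume "t \<in> {t. eventually (\<lambda>n. t n = s n) sequentially}"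
    then have "(\<lambda>n. t n - s n) \<in> null_seqs" by (simp add: null_seqs_def)
    then show "t \<in> (\<lambda>h n. h n + s n) ` null_seqs"
      by (rule rev_image_eqI) simp
  qed (auto simp: null_seqs_def)
  finally show ?thesis .
qed

lemma seq_shift_class: "seq_shift (seq_class s) = seq_class (\<lambda>n. s (Suc n))"
proof -
  have "t \<in> seq_shift (seq_class s)" if t: "eventually (\<lambda>n. t n = s (Suc n)) sequentially" for t
  proof -
    define t' where "t' = (\<lambda>n. case n of 0 \<Rightarrow> 0 | Suc k \<Rightarrow> t k)"
    have "eventually (\<lambda>n. t' (Suc n) = s (Suc n)) sequentially" using t by (simp add: t'_def)
    then have "eventually (\<lambda>n. t' n = s n) sequentially" by (subst (asm) eventually_sequentially_Suc)
    moreover have "t = (\<lambda>n. t' (Suc n))" by (simp add: t'_def)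
    ultimately show ?thesis by (auto simp: seq_shift_def seq_class_eq)
  qed
  moreover have "eventually (\<lambda>n. t (Suc n) = s (Suc n)) sequentially"
    if "eventually (\<lambda>n. t n = s n) sequentially" for t
    using that by (subst eventually_sequentially_Suc)
  ultimately show ?thesis by (auto simp: seq_shift_def seq_class_eq)
qed

text \<open>The \<open>\<complex>\<close>-subalgebra of \<open>Seq\<close> generated by the coordinate sequences of a sequence of states.\<close>

definition state_algebra :: "nat \<Rightarrow> nat \<Rightarrow> nat \<Rightarrow> (nat \<Rightarrow> coord \<Rightarrow> complex) \<Rightarrow> (nat \<Rightarrow> complex) set ring" where
  "state_algebra m r a x =
     Seq\<lparr>carrier := generate_ring Seq
       (range const_seq \<union> (\<lambda>c. seq_class (\<lambda>n. x n c)) ` state_coords m r a)\<rparr>"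


section \<open>Total quotient rings and idempotents\<close>

definition nonzerodivisors :: "('a, 'b) ring_scheme \<Rightarrow> 'a set" where
  "nonzerodivisors R =
     {s \<in> carrier R. \<forall>x\<in>carrier R. s \<otimes>\<^bsub>R\<^esub> x = \<zero>\<^bsub>R\<^esub> \<longrightarrow> x = \<zero>\<^bsub>R\<^esub>}"

text \<open>The fraction \<open>b / s\<close>, as an equivalence class of pairs.\<close>

definition fraction :: "('a, 'b) ring_scheme \<Rightarrow> 'a \<Rightarrow> 'a \<Rightarrow> ('a \<times> 'a) set" where
  "fraction R b s =
     {(c, t) \<in> carrier R \<times> nonzerodivisors R. b \<otimes>\<^bsub>R\<^esub> t = c \<otimes>\<^bsub>R\<^esub> s}"

definition total_quotient_ring :: "('a, 'b) ring_scheme \<Rightarrow> ('a \<times> 'a) set ring" where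
  "total_quotient_ring R =
     \<lparr>carrier = {fraction R b s | b s. b \<in> carrier R \<and> s \<in> nonzerodivisors R},
      mult = (\<lambda>X Y. \<Union>(b, s)\<in>X. \<Union>(c, t)\<in>Y. fraction R (b \<otimes>\<^bsub>R\<^esub> c) (s \<otimes>\<^bsub>R\<^esub> t)),
      one = fraction R \<one>\<^bsub>R\<^esub> \<one>\<^bsub>R\<^esub>,
      zero = fraction R \<zero>\<^bsub>R\<^esub> \<one>\<^bsub>R\<^esub>,
      add = (\<lambda>X Y. \<Union>(b, s)\<in>X. \<Union>(c, t)\<in>Y.
        fraction R (b \<otimes>\<^bsub>R\<^esub> t \<oplus>\<^bsub>R\<^esub> c \<otimes>\<^bsub>R\<^esub> s) (s \<otimes>\<^bsub>R\<^esub> t))\<rparr>"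

definition to_quotient :: "('a, 'b) ring_scheme \<Rightarrow> 'a \<Rightarrow> ('a \<times> 'a) set" where
  "to_quotient R b = fraction R b \<one>\<^bsub>R\<^esub>"

lemma UN_pairs_constant:
  assumes "\<And>b s c t. (b, s) \<in> X \<Longrightarrow> (c, t) \<in> Y \<Longrightarrow> G b s c t = Z"
    and "(b\<^sub>0, s\<^sub>0) \<in> X" and "(c\<^sub>0, t\<^sub>0) \<in> Y"
  shows "(\<Union>(b, s)\<in>X. \<Union>(c, t)\<in>Y. G b s c t) = Z"
proof (intro equalityI subsetI)
  fix y assume "y \<in> (\<Union>(b, s)\<in>X. \<Union>(c, t)\<in>Y. G b s c t)"
  then obtain b s c t where "(b, s) \<in> X" "(c, t) \<in> Y" "y \<in> G b s c t" by blast
  then show "y \<in> Z" using assms(1) by blast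
next
  fix y assume "y \<in> Z"
  then have "y \<in> G b\<^sub>0 s\<^sub>0 c\<^sub>0 t\<^sub>0" using assms by blast
  then show "y \<in> (\<Union>(b, s)\<in>X. \<Union>(c, t)\<in>Y. G b s c t)" using assms(2,3) by blast
qed

text \<open>Multiplication and addition do not depend on the chosen representatives.\<close>

context cring
begin

lemma nonzerodivisors_closed: "s \<in> nonzerodivisors R \<Longrightarrow> s \<in> carrier R"
  by (simp add: nonzerodivisors_def)

lemma nonzerodivisors_mult:
  assumes "s \<in> nonzerodivisors R" "t \<in> nonzerodivisors R"
  shows "s \<otimes> t \<in> nonzerodivisors R"
proof -
  have st: "s \<in> carrier R" "t \<in> carrier R"
    using assms by (auto dest: nonzerodivisors_closed)
  have "x = \<zero>" if x: "x \<in> carrier R" and eq: "s \<otimes> t \<otimes> x = \<zero>" for x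
  proof -
    have "s \<otimes> (t \<otimes> x) = \<zero>" using eq st x by (simp only: m_assoc)
    then have "t \<otimes> x = \<zero>" using assms(1) st x by (simp add: nonzerodivisors_def)
    then show ?thesis using assms(2) x by (simp add: nonzerodivisors_def)
  qed
  then show ?thesis using st by (simp add: nonzerodivisors_def)
qed

lemma nonzerodivisors_cancel:
  assumes s: "s \<in> nonzerodivisors R" and bc: "b \<in> carrier R" "c \<in> carrier R"
    and eq: "s \<otimes> b = s \<otimes> c"
  shows "b = c"
proof -
  have sc: "s \<in> carrier R" using s by (simp add: nonzerodivisors_def)
  have "s \<otimes> (b \<ominus> c) = s \<otimes> b \<ominus> s \<otimes> c"
    using sc bc by (simp add: a_minus_def r_distr r_minus)
  also have "\<dots> = \<zero>" using eq sc bc by (simp add: a_minus_def r_neg)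
  finally have "b \<ominus> c = \<zero>" using s bc by (simp add: nonzerodivisors_def)
  then show ?thesis using bc by (simp only: r_right_minus_eq)
qed

lemma fraction_eq_iff:
  assumes b: "b \<in> carrier R" and s: "s \<in> nonzerodivisors R"
    and c: "c \<in> carrier R" and t: "t \<in> nonzerodivisors R"
  shows "fraction R b s = fraction R c t \<longleftrightarrow> b \<otimes> t = c \<otimes> s"
proof
  assume "fraction R b s = fraction R c t"
  moreover have "(c, t) \<in> fraction R c t" using c t by (simp add: fraction_def)
  ultimately have "(c, t) \<in> fraction R b s" by simp
  then show "b \<otimes> t = c \<otimes> s" by (simp add: fraction_def)
next
  have *: "(e, v) \<in> fraction R c t" if "b \<otimes> t = c \<otimes> s" "(e, v) \<in> fraction R b s"
    "b \<in> carrier R" "s \<in> nonzerodivisors R" "c \<in> carrier R" "t \<in> nonzerodivisors R" for b s c t e v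
  proof -
    have car: "s \<in> carrier R" "t \<in> carrier R" "e \<in> carrier R" "v \<in> carrier R"
      using that by (auto simp: fraction_def dest: nonzerodivisors_closed)
    have bv: "b \<otimes> v = e \<otimes> s" using that by (simp add: fraction_def)
    have "s \<otimes> (c \<otimes> v) = (c \<otimes> s) \<otimes> v" using car that(5) by (simp add: m_ac)
    also have "\<dots> = (b \<otimes> t) \<otimes> v" by (simp only: that(1))
    also have "\<dots> = (b \<otimes> v) \<otimes> t" using car that(3) by (simp add: m_ac)
    also have "\<dots> = (e \<otimes> s) \<otimes> t" by (simp only: bv)
    also have "\<dots> = s \<otimes> (e \<otimes> t)" using car by (simp add: m_ac)
    finally have "c \<otimes> v = e \<otimes> t"
      by (rule nonzerodivisors_cancel[OF that(4), rotated -1]) (use car that(5) in auto)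
    then show ?thesis using that by (simp add: fraction_def)
  qed
  assume "b \<otimes> t = c \<otimes> s"
  then show "fraction R b s = fraction R c t"
    by (intro equalityI subrelI) (erule (1) *[OF _ _ b s c t] *[OF sym _ c t b s])+
qed

lemma mult_fraction:
  assumes b: "b \<in> carrier R" and s: "s \<in> nonzerodivisors R"
    and c: "c \<in> carrier R" and t: "t \<in> nonzerodivisors R"
  shows "fraction R b s \<otimes>\<^bsub>total_quotient_ring R\<^esub> fraction R c t = fraction R (b \<otimes> c) (s \<otimes> t)"
proof -
  have rep: "fraction R (b' \<otimes> c') (s' \<otimes> t') = fraction R (b \<otimes> c) (s \<otimes> t)"
    if "(b', s') \<in> fraction R b s" "(c', t') \<in> fraction R c t" for b' s' c' t'
  proof -
    have nz: "s' \<in> nonzerodivisors R" "t' \<in> nonzerodivisors R"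
      using that by (auto simp: fraction_def)
    have car: "s \<in> carrier R" "t \<in> carrier R" "b' \<in> carrier R" "s' \<in> carrier R"
        "c' \<in> carrier R" "t' \<in> carrier R"
      using that s t nz by (auto simp: fraction_def dest: nonzerodivisors_closed)
    have eq: "b \<otimes> s' = b' \<otimes> s" "c \<otimes> t' = c' \<otimes> t"
      using that by (auto simp: fraction_def)
    have "(b' \<otimes> c') \<otimes> (s \<otimes> t) = (b' \<otimes> s) \<otimes> (c' \<otimes> t)" using car by (simp add: m_ac)
    also have "\<dots> = (b \<otimes> s') \<otimes> (c \<otimes> t')" by (simp only: eq)
    also have "\<dots> = (b \<otimes> c) \<otimes> (s' \<otimes> t')" using car b c by (simp add: m_ac)
    finally show ?thesis
      by (subst fraction_eq_iff) (simp_all add: car nz s t b c nonzerodivisors_mult)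
  qed
  have mem: "(b, s) \<in> fraction R b s" "(c, t) \<in> fraction R c t"
    using b c s t by (simp_all add: fraction_def)
  show ?thesis
    unfolding total_quotient_ring_def monoid.simps ring.simps
    by (rule UN_pairs_constant) (fact rep mem)+
qed

lemma add_fraction:
  assumes b: "b \<in> carrier R" and s: "s \<in> nonzerodivisors R"
    and c: "c \<in> carrier R" and t: "t \<in> nonzerodivisors R"
  shows "fraction R b s \<oplus>\<^bsub>total_quotient_ring R\<^esub> fraction R c t =
    fraction R (b \<otimes> t \<oplus> c \<otimes> s) (s \<otimes> t)"
proof -
  have rep: "fraction R (b' \<otimes> t' \<oplus> c' \<otimes> s') (s' \<otimes> t') = fraction R (b \<otimes> t \<oplus> c \<otimes> s) (s \<otimes> t)"
    if "(b', s') \<in> fraction R b s" "(c', t') \<in> fraction R c t" for b' s' c' t'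
  proof -
    have nz: "s' \<in> nonzerodivisors R" "t' \<in> nonzerodivisors R"
      using that by (auto simp: fraction_def)
    have car: "s \<in> carrier R" "t \<in> carrier R" "b' \<in> carrier R" "s' \<in> carrier R"
        "c' \<in> carrier R" "t' \<in> carrier R"
      using that s t nz by (auto simp: fraction_def dest: nonzerodivisors_closed)
    have eq: "b \<otimes> s' = b' \<otimes> s" "c \<otimes> t' = c' \<otimes> t"
      using that by (auto simp: fraction_def)
    have "(b' \<otimes> t' \<oplus> c' \<otimes> s') \<otimes> (s \<otimes> t) =
        (b' \<otimes> s) \<otimes> (t \<otimes> t') \<oplus> (c' \<otimes> t) \<otimes> (s \<otimes> s')" using car by (simp add: l_distr r_distr m_ac)
    also have "\<dots> = (b \<otimes> s') \<otimes> (t \<otimes> t') \<oplus> (c \<otimes> t') \<otimes> (s \<otimes> s')" by (simp only: eq)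
    also have "\<dots> = (b \<otimes> t \<oplus> c \<otimes> s) \<otimes> (s' \<otimes> t')" using car b c by (simp add: l_distr r_distr m_ac)
    finally show ?thesis
      by (subst fraction_eq_iff) (simp_all add: car nz s t b c nonzerodivisors_mult)
  qed
  have mem: "(b, s) \<in> fraction R b s" "(c, t) \<in> fraction R c t"
    using b c s t by (simp_all add: fraction_def)
  show ?thesis
    unfolding total_quotient_ring_def monoid.simps ring.simps
    by (rule UN_pairs_constant) (fact rep mem)+
qed

end

definition idempotents :: "('a, 'b) ring_scheme \<Rightarrow> 'a set" where
  "idempotents R = {e \<in> carrier R. e \<otimes>\<^bsub>R\<^esub> e = e}"

definition primitive_idempotents :: "('a, 'b) ring_scheme \<Rightarrow> 'a set" where
  "primitive_idempotents R = {e \<in> idempotents R. e \<noteq> \<zero>\<^bsub>R\<^esub> \<and>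
     \<not> (\<exists>f\<in>idempotents R. \<exists>g\<in>idempotents R.
          f \<noteq> \<zero>\<^bsub>R\<^esub> \<and> g \<noteq> \<zero>\<^bsub>R\<^esub> \<and> f \<otimes>\<^bsub>R\<^esub> g = \<zero>\<^bsub>R\<^esub> \<and> e = f \<oplus>\<^bsub>R\<^esub> g)}"

end

theory Submission
  imports
    Defs
    "HOL-Computational_Algebra.Fundamental_Theorem_Algebra"
    "HOL-Library.Function_Algebras"
    "HOL-Analysis.Continuum_Not_Denumerable"
begin

text \<open>
  All coordinates of the orbit lie in a finitely generated subring \<open>R\<close> of the complex numbers.  Such a ring
  carries a decreasing filtration \<open>I 0, I 1, \<dots>\<close> by ideals of finite index, resembling the powers of a prime
  \<open>p\<close>, in which a nonzero element of small height cannot lie deep.  If the fiber Jacobian is invertible modulo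
  \<open>I 1\<close> along the orbit, the orbit is eventually periodic modulo each \<open>I j\<close>, and on a suitable residue class
  every polynomial in the coordinates is a Newton series \<open>\<Sum>k. (n choose k) * b k\<close> with \<open>b k \<in> I (2 * k)\<close>;
  by Skolem's argument it vanishes identically as soon as it has infinitely many zeros.  Otherwise the orbit meets
  the critical locus modulo \<open>I 1\<close>.  By the Nullstellensatz the fiber coordinates then become nilpotent modulo
  \<open>I 1\<close>, so that \<open>z n = s n * w n\<close> with a linear cocycle \<open>w\<close> and \<open>s n\<close> of depth about \<open>d ^ n\<close>.
  Expanding in powers of \<open>s n\<close> leaves polynomials in the base, \<open>w\<close> and \<open>Y\<close>, to which the first case applies
  and whose heights grow like \<open>\<theta> ^ n\<close> with \<open>\<theta> < d\<close>, too slowly for a nonzero value to be divisible by \<open>s n\<close>.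
  An affine \<open>T\<close> need not be invertible; its orbit satisfies a linear recurrence whose lowest coefficient is nonzero,
  and the companion system of this recurrence replaces the base.

  For the least period \<open>p\<close>, no class modulo \<open>p\<close> has the property that everything in the state algebra vanishing
  on it vanishes on another class.  Hence the indicators of the classes are fractions of state sequences, and they
  are the primitive idempotents.
\<close>

text \<open>Skolem's argument alone needs only p-adic depth. The critical case also needs a lower
  bound for nonzero values, so the filtration carries an inequality of Liouville type: depth is at
  most linear in the logarithmic height. The filtration must moreover exist with any prescribed
  nonzero element as a unit modulo \<open>I 1\<close>; this stronger form survives adjoining an
  algebraic element, whose equation has a leading coefficient that must become invertible. Dividing
  the k-th Newton coefficient by k! costs depth up to k, for p = 2 as well. Hence the period is
  chosen so that the orbit returns modulo \<open>I 4\<close> with derivative the identity modulo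
  \<open>I 2\<close>: every difference then gains depth 2. The period must not depend on the
  polynomials, whose coefficients may lie outside \<open>R\<close>. Linear relations over
  \<open>R\<close> among these coefficients reduce the question to coefficients in \<open>R\<close>.
  The common p of both assertions is the least period of the zero-set property, not the period that
  the analysis happens to deliver; a larger one could leave several classes inseparable in the
  algebra.\<close>

abbreviation ev :: "(nat => bool) => bool" where
  "ev P \<equiv> eventually P sequentially"

section \<open>Filtered subrings of the complex numbers\<close>

definition subring_set :: "'a::comm_ring_1 set => bool" where
  "subring_set R \<longleftrightarrow> 0 \<in> R \<and> 1 \<in> R \<and> (\<forall>x\<in>R. \<forall>y\<in>R. x + y \<in> R \<and> x * y \<in> R) \<and> (\<forall>x\<in>R. - x \<in> R)"

lemma subring_setD:
  assumes "subring_set R"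
  shows "0 \<in> R" "1 \<in> R" "x \<in> R ==> y \<in> R ==> x + y \<in> R" "x \<in> R ==> y \<in> R ==> x * y \<in> R"
    "x \<in> R ==> - x \<in> R" "x \<in> R ==> y \<in> R ==> x - y \<in> R"
proof -
  show "x \<in> R ==> y \<in> R ==> x - y \<in> R" using assms unfolding subring_set_def diff_conv_add_uminus by blast
qed (use assms in "auto simp: subring_set_def")

lemma subring_power: "subring_set R ==> x \<in> R ==> x ^ n \<in> R" by (induction n) (auto intro: subring_setD)

lemma subring_set_sum: "subring_set R ==> (\<And>i. i \<in> A ==> f i \<in> R) ==> sum f A \<in> R"
  by (induction A rule: infinite_finite_induct) (auto intro: subring_setD)

lemma subring_set_prod: "subring_set R ==> (\<And>i. i \<in> A ==> f i \<in> R) ==> prod f A \<in> R"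
  by (induction A rule: infinite_finite_induct) (auto intro: subring_setD)

lemma subring_set_of_nat: "subring_set R ==> of_nat n \<in> R" by (induction n) (auto intro: subring_setD)

lemma subring_set_of_int: "subring_set R ==> of_int n \<in> R" by (cases n) (auto simp del: of_nat_Suc intro: subring_setD subring_set_of_nat)

definition ideal_set :: "'a::comm_ring_1 set => 'a set => bool" where
  "ideal_set R J \<longleftrightarrow> J \<subseteq> R \<and> 0 \<in> J \<and> (\<forall>x\<in>J. \<forall>y\<in>J. x + y \<in> J) \<and> (\<forall>a\<in>R. \<forall>x\<in>J. a * x \<in> J)"

lemma ideal_setD:
  assumes "ideal_set R J"
  shows "J \<subseteq> R" "0 \<in> J" "x \<in> J ==> y \<in> J ==> x + y \<in> J" "a \<in> R ==> x \<in> J ==> a * x \<in> J"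
    "a \<in> R ==> x \<in> J ==> x * a \<in> J" using assms by (auto simp: ideal_set_def mult.commute)

lemma ideal_set_uminus:
  assumes "subring_set R" "ideal_set R J" "x \<in> J" shows "- x \<in> J"
  using ideal_setD(4)[OF assms(2), of "- 1" x] subring_setD[OF assms(1)] assms(3) by simp

lemma ideal_set_minus:
  assumes "subring_set R" "ideal_set R J" "x \<in> J" "y \<in> J" shows "x - y \<in> J"
  using ideal_setD(3)[OF assms(2,3) ideal_set_uminus[OF assms(1,2,4)]] by simp

lemma ideal_set_sum: "ideal_set R J ==> (\<And>i. i \<in> A ==> f i \<in> J) ==> sum f A \<in> J"
  by (induction A rule: infinite_finite_induct) (auto intro: ideal_setD)

lemma ideal_set_power:
  assumes "subring_set R" "ideal_set R J" "x ^ k \<in> J" "x \<in> R" "k \<le> n"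
  shows "x ^ n \<in> J"
proof -
  have "x ^ n = x ^ (n - k) * x ^ k" using assms(5) by (simp flip: power_add)
  thus ?thesis using assms by (auto intro: ideal_setD subring_power)
qed

text \<open>\<open>N\<close> is maximal among the ideals that contain \<open>J\<close> and miss the
  powers of \<open>g\<close>. Adjoining any further \<open>a\<close> must produce a power of
  \<open>g\<close>, so \<open>R/N\<close> becomes a field once \<open>g\<close> is inverted. With
  \<open>g = 1\<close> this yields a prime over a proper ideal; with general \<open>g\<close> it
  replaces the Rabinowitsch trick in the Nullstellensatz.\<close>

lemma prime_ideal_avoiding_powers:
  assumes R: "subring_set R" and J: "ideal_set R J" and g: "g \<in> R" and gJ: "\<And>k. g ^ k \<notin> J"
  obtains N where "ideal_set R N" "J \<subseteq> N" "\<And>k. g ^ k \<notin> N"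
    "\<And>a b. a \<in> R ==> b \<in> R ==> a * b \<in> N ==> a \<in> N \<or> b \<in> N"
    "\<And>a. a \<in> R ==> a \<notin> N ==> \<exists>h\<in>R. \<exists>k. h * a - g ^ k \<in> N"
proof -
  define \<C> where "\<C> = {N. ideal_set R N \<and> J \<subseteq> N \<and> (\<forall>k. g ^ k \<notin> N)}"
  have "\<exists>N\<in>\<C>. \<forall>X\<in>\<C>. N \<subseteq> X --> X = N"
  proof (rule subset_Zorn_nonempty)
    show "\<C> \<noteq> {}" using J gJ by (auto simp: \<C>_def)
    fix \<D> assume D: "\<D> \<noteq> {}" "subset.chain \<C> \<D>"
    have tot: "X \<subseteq> Y \<or> Y \<subseteq> X" if "X \<in> \<D>" "Y \<in> \<D>" for X Y using D(2) that unfolding subset_chain_def by blast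
    have sub: "\<D> \<subseteq> \<C>" using D(2) by (simp add: subset_chain_def)
    have idl: "ideal_set R X" if "X \<in> \<D>" for X using that sub by (auto simp: \<C>_def)
    have "ideal_set R (\<Union>\<D>)" unfolding ideal_set_def
    proof (intro conjI ballI)
      show "\<Union>\<D> \<subseteq> R" using idl by (auto dest: ideal_setD(1))
      show "0 \<in> \<Union>\<D>" using D(1) idl by (auto dest: ideal_setD(2))
      show "a * x \<in> \<Union>\<D>" if "a \<in> R" "x \<in> \<Union>\<D>" for a x using that idl ideal_setD(4) by blast
      show "x + y \<in> \<Union>\<D>" if xy: "x \<in> \<Union>\<D>" "y \<in> \<Union>\<D>" for x y
      proof -
        obtain X Y where "X \<in> \<D>" "Y \<in> \<D>" "x \<in> X" "y \<in> Y" using xy by blast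
        thus ?thesis using tot[of X Y] idl ideal_setD(3)[of R] by (meson UnionI subsetD)
      qed
    qed
    thus "\<Union>\<D> \<in> \<C>" using D(1) sub by (auto simp: \<C>_def)
  qed
  then obtain N where N: "N \<in> \<C>" and mx: "\<And>X. X \<in> \<C> ==> N \<subseteq> X ==> X = N" by blast
  have iN: "ideal_set R N" and JN: "J \<subseteq> N" and gN: "\<And>k. g ^ k \<notin> N" using N by (auto simp: \<C>_def)
  have key: "\<exists>h\<in>R. \<exists>k. h * a - g ^ k \<in> N" if a: "a \<in> R" "a \<notin> N" for a
  proof -
    define X where "X = {h * a + n |h n. h \<in> R \<and> n \<in> N}"
    have "ideal_set R X" unfolding ideal_set_def
    proof (intro conjI ballI)
      show "X \<subseteq> R" using a R ideal_setD(1)[OF iN] by (auto simp: X_def intro!: subring_setD)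
      show "0 \<in> X" using subring_setD(1)[OF R] ideal_setD(2)[OF iN] unfolding X_def by force
      fix x y assume "x \<in> X" "y \<in> X"
      then obtain h n h' n' where *: "x = h * a + n" "y = h' * a + n'" "h \<in> R" "h' \<in> R" "n \<in> N" "n' \<in> N" by (auto simp: X_def)
      have "x + y = (h + h') * a + (n + n')" using * by (simp add: algebra_simps)
      moreover have "h + h' \<in> R" "n + n' \<in> N" using * R iN by (auto intro: subring_setD ideal_setD(3))
      ultimately show "x + y \<in> X" unfolding X_def by blast
    next
      fix b x assume b: "b \<in> R" and "x \<in> X"
      then obtain h n where *: "x = h * a + n" "h \<in> R" "n \<in> N" by (auto simp: X_def)
      have "b * x = (b * h) * a + b * n" using * by (simp add: algebra_simps)
      moreover have "b * h \<in> R" "b * n \<in> N" using b * R iN by (auto intro: subring_setD ideal_setD(4))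
      ultimately show "b * x \<in> X" unfolding X_def by blast
    qed
    moreover have NX: "N \<subseteq> X" using subring_setD(1)[OF R] unfolding X_def by force
    moreover have "a \<in> X" using subring_setD(2)[OF R] ideal_setD(2)[OF iN] unfolding X_def by force
    ultimately have "X \<notin> \<C>" using mx[of X] a by blast
    then obtain k where "g ^ k \<in> X" using \<open>ideal_set R X\<close> NX JN by (auto simp: \<C>_def)
    then obtain h n where *: "g ^ k = h * a + n" "h \<in> R" "n \<in> N" by (auto simp: X_def)
    hence "h * a - g ^ k = - n" by simp
    also have "- n \<in> N" by (rule ideal_set_uminus[OF R iN]) (use * in auto)
    finally show ?thesis using * by blast
  qed
  have "a \<in> N \<or> b \<in> N" if ab: "a \<in> R" "b \<in> R" "a * b \<in> N" for a b
  proof (rule ccontr)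
    assume "\<not> (a \<in> N \<or> b \<in> N)"
    then obtain h k h' k' where h: "h \<in> R" "h * a - g ^ k \<in> N" "h' \<in> R" "h' * b - g ^ k' \<in> N" using key[of a] key[of b] ab by blast
    \<comment> \<open>Modulo \<open>N\<close> the two powers of \<open>g\<close> are
      \<open>h * a\<close> and \<open>h' * b\<close>, so their product is a multiple of
      \<open>a * b\<close>.\<close>
    have "g ^ (k + k') = (h * h') * (a * b) - (h' * b) * (h * a - g ^ k) - g ^ k * (h' * b - g ^ k')" by (simp add: algebra_simps power_add)
    also have "\<dots> \<in> N"
    proof -
      have "(h * h') * (a * b) \<in> N" "(h' * b) * (h * a - g ^ k) \<in> N" "g ^ k * (h' * b - g ^ k') \<in> N"
        by (rule ideal_setD(4)[OF iN]; use h ab R g in "auto intro: subring_setD subring_power")+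
      thus ?thesis by (intro ideal_set_minus[OF R iN])
    qed
    finally show False using gN by blast
  qed
  thus thesis using that iN JN gN key by blast
qed

text \<open>\<open>x\<close> is the value at elements of \<open>G\<close> of an integer polynomial
  of degree at most \<open>D\<close> whose coefficients have absolute sum at most \<open>L\<close>.
  The rule \<open>add\<close> asks for a common degree bound, which \<open>mono\<close>
  provides.\<close>

inductive height :: "complex set => complex => nat => nat => bool" for G where
  zero: "height G 0 0 0"
| one: "height G 1 0 1"
| minus_one: "height G (- 1) 0 1"
| gen: "g \<in> G ==> height G g 1 1"
| add: "height G x D L ==> height G y D L' ==> height G (x + y) D (L + L')"
| mult: "height G x D L ==> height G y D' L' ==> height G (x * y) (D + D') (L * L')"
| mono: "height G x D L ==> D \<le> D' ==> L \<le> L' ==> height G x D' L'"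

lemma height_eq_0: "height G x D L ==> L = 0 ==> x = 0" by (induction rule: height.induct) auto

lemma height_in_subring: "height G x D L ==> subring_set R ==> G \<subseteq> R ==> x \<in> R"
  by (induction rule: height.induct) (auto intro: subring_setD)

lemma height_subset: "height G x D L ==> G \<subseteq> G' ==> height G' x D L" by (induction rule: height.induct) (blast intro: height.intros)+

lemma height_sum:
  "finite A ==> (\<And>i. i \<in> A ==> height G (f i) D (L i)) ==> height G (sum f A) D (sum L A)"
proof (induction A rule: finite_induct)
  case empty
  thus ?case using height.mono[OF height.zero] by simp
qed (auto intro: height.add)

lemma height_prod:
  "finite A ==> (\<And>i. i \<in> A ==> height G (f i) (D i) (L i)) ==> height G (prod f A) (sum D A) (prod L A)"
  by (induction A rule: finite_induct) (auto intro: height.intros)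

lemma height_power: "height G x D L ==> height G (x ^ n) (n * D) (L ^ n)" by (induction n) (auto intro: height.intros)

section \<open>Filtrations by ideals of finite index\<close>

lemma power_periodic_mod:
  assumes R: "subring_set R" and J: "ideal_set R J"
    and fin: "\<exists>F. finite F \<and> F \<subseteq> R \<and> (\<forall>x\<in>R. \<exists>r\<in>F. x - r \<in> J)" and x: "x \<in> R"
  shows "\<exists>a b. b \<ge> 1 \<and> x ^ a * (x ^ b - 1) \<in> J"
proof -
  obtain F where F: "finite F" "\<And>x. x \<in> R ==> \<exists>r\<in>F. x - r \<in> J" using fin by blast
  obtain f where f: "\<And>x. x \<in> R ==> f x \<in> F \<and> x - f x \<in> J" using F(2) by metis
  have "\<not> inj_on (\<lambda>n. f (x ^ n)) (UNIV :: nat set)"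
  proof
    assume "inj_on (\<lambda>n. f (x ^ n)) (UNIV :: nat set)"
    moreover have "range (\<lambda>n. f (x ^ n)) \<subseteq> F" using f x R by (auto intro: subring_power)
    ultimately show False using F(1) by (meson finite_imageD finite_subset infinite_UNIV_nat)
  qed
  then obtain m n :: nat where mn: "f (x ^ m) = f (x ^ n)" "m < n" by (metis injI nat_neq_iff)
  have "(x ^ n - f (x ^ n)) - (x ^ m - f (x ^ m)) \<in> J" by (rule ideal_set_minus[OF R J]) (use f x R in "auto intro: subring_power")
  hence "x ^ n - x ^ m \<in> J" using mn by simp
  moreover have "x ^ n - x ^ m = x ^ m * (x ^ (n - m) - 1)" using mn by (simp add: algebra_simps flip: power_add)
  ultimately show ?thesis using mn(2) by (intro exI[of _ m] exI[of _ "n - m"]) auto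
qed

text \<open>The model is \<open>I j = p ^ j * R\<close>. \<open>I 1\<close> need not be prime, since
  p may ramify in an extension; \<open>unit_or_nilpotent\<close> says that the finite ring
  \<open>R / I 1\<close> is local. With \<open>p_cancel\<close>, multiplication by p shifts depth by
  exactly one. \<open>separation\<close> is the Liouville inequality; its base 2 is a lower bound
  for every prime, and \<open>C\<close> depends on the generators but not on the element.\<close>

locale filtered_ring =
  fixes R :: "complex set" and I :: "nat => complex set" and p :: nat
  assumes subring: "subring_set R"
    and prime_p: "prime p"
    and I_0: "I 0 = R"
    and I_Suc: "I (Suc j) \<subseteq> I j"
    and I_ideal: "ideal_set R (I j)"
    and I_mult: "x \<in> I i ==> y \<in> I j ==> x * y \<in> I (i + j)"
    and finite_quotient: "\<exists>F. finite F \<and> F \<subseteq> R \<and> (\<forall>x\<in>R. \<exists>r\<in>F. x - r \<in> I j)"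
    and p_in_I: "of_nat p \<in> I 1"
    and p_cancel: "x \<in> R ==> of_nat p * x \<in> I (Suc j) ==> x \<in> I j"
    and one_notin: "1 \<notin> I 1"
    and unit_or_nilpotent:
      "x \<in> R ==> (\<exists>b\<ge>1. x ^ b - 1 \<in> I 1) \<or> (\<exists>b\<ge>1. x ^ b \<in> I 1)"
    and separation: "finite G ==> G \<subseteq> R ==>
      \<exists>C::nat. C \<ge> 1 \<and> (\<forall>x D L j. height G x D L --> x \<noteq> 0 --> x \<in> I j --> 2 ^ j \<le> C ^ (D + 1) * L ^ C)"
begin

lemma I_antimono: "i \<le> j ==> I j \<subseteq> I i" using lift_Suc_antimono_le[of I] I_Suc by blast

lemma I_subset: "I j \<subseteq> R" using I_ideal ideal_setD(1) by blast

definition unit_mod :: "complex => bool" where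
  "unit_mod x \<longleftrightarrow> x \<in> R \<and> (\<exists>b\<ge>1. x ^ b - 1 \<in> I 1)"

text \<open>A geometric series: with \<open>y = 1 - x ^ b\<close> in \<open>I 1\<close>, the element
  \<open>z\<close> is congruent to \<open>y * z\<close> modulo \<open>I j\<close>, hence to
  \<open>y ^ j * z\<close>, which lies in \<open>I j\<close>.\<close>

lemma unit_mod_cancel:
  assumes x: "unit_mod x" and z: "z \<in> R" and xz: "x * z \<in> I j"
  shows "z \<in> I j"
proof -
  obtain b where b: "b \<ge> 1" "x ^ b - 1 \<in> I 1" and xR: "x \<in> R" using x by (auto simp: unit_mod_def)
  define y where "y = 1 - x ^ b"
  have y: "y \<in> I 1" using ideal_set_uminus[OF subring I_ideal b(2)] by (simp add: y_def)
  have yR: "y \<in> R" using y I_subset by blast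
  have yk: "y ^ k \<in> I k" for k
  proof (induction k)
    case 0
    thus ?case using I_0 subring_setD(2)[OF subring] by simp
  next
    case (Suc k)
    thus ?case using I_mult[OF y Suc] by simp
  qed
  have zy: "z - y * z \<in> I j"
  proof -
    have "z - y * z = x ^ (b - 1) * (x * z)" using b(1) by (simp add: y_def algebra_simps flip: power_Suc)
    thus ?thesis using xz xR by (auto intro: ideal_setD[OF I_ideal] subring_power subring)
  qed
  have "z - y ^ k * z \<in> I j" for k
  proof (induction k)
    case 0
    thus ?case using ideal_setD(2)[OF I_ideal] by simp
  next
    case (Suc k)
    have "y ^ k * (z - y * z) \<in> I j" by (intro ideal_setD(4)[OF I_ideal _ zy] subring_power subring yR)
    from ideal_setD(3)[OF I_ideal Suc this] show ?case by (simp add: algebra_simps)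
  qed
  from ideal_setD(3)[OF I_ideal this[of j] ideal_setD(5)[OF I_ideal z yk[of j]]] show ?thesis by simp
qed

text \<open>Powers of \<open>x\<close> are eventually periodic modulo \<open>I j\<close>, and the
  preperiod drops out because \<open>x\<close> can be cancelled.\<close>

lemma unit_mod_power:
  assumes x: "unit_mod x" shows "\<exists>b\<ge>1. x ^ b - 1 \<in> I j"
proof -
  have xR: "x \<in> R" using x by (simp add: unit_mod_def)
  obtain a b where ab: "b \<ge> 1" "x ^ a * (x ^ b - 1) \<in> I j" using power_periodic_mod[OF subring I_ideal finite_quotient xR] by blast
  have "z \<in> I j" if "x ^ a * z \<in> I j" "z \<in> R" for z a using that
  proof (induction a)
    case (Suc a)
    hence "x * (x ^ a * z) \<in> I j" by (simp add: mult.assoc)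
    hence "x ^ a * z \<in> I j" by (rule unit_mod_cancel[OF x, rotated]) (use Suc xR in "auto intro: subring_setD subring_power subring")
    thus ?case using Suc by blast
  qed auto
  thus ?thesis using ab xR by (meson subring_setD(2,6) subring subring_power)
qed

lemma not_unit_and_nilpotent:
  assumes "unit_mod x" "x ^ a \<in> I 1" shows False
proof -
  obtain b where b: "b \<ge> 1" "x ^ b - 1 \<in> I 1" using assms(1) by (auto simp: unit_mod_def)
  have x: "x \<in> R" using assms(1) by (simp add: unit_mod_def)
  have *: "x ^ (b * n) - 1 \<in> I 1" for n
  proof (induction n)
    case 0
    thus ?case using ideal_setD(2)[OF I_ideal] by simp
  next
    case (Suc n)
    have "x ^ (b * n) * (x ^ b - 1) \<in> I 1" using b x by (intro ideal_setD(4)[OF I_ideal] subring_power subring)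
    from ideal_setD(3)[OF I_ideal this Suc] show ?case by (simp add: algebra_simps power_add)
  qed
  have "x ^ (b * a) \<in> I 1" by (rule ideal_set_power[OF subring I_ideal assms(2) x]) (use b in simp)
  from ideal_set_minus[OF subring I_ideal this *[of a]] show False using one_notin by simp
qed

lemma I_separated:
  assumes "x \<in> R" "\<And>j. x \<in> I j" shows "x = 0"
proof (rule ccontr)
  assume "x \<noteq> 0"
  \<comment> \<open>\<open>x\<close> has height 1, 1 over the generating set \<open>{x}\<close>, so
    its depth is bounded unless it is zero.\<close>
  obtain C :: nat where C: "\<And>j. 2 ^ j \<le> C ^ (1 + 1) * 1 ^ C"
    using separation[of "{x}"] assms height.gen[of x "{x}"] \<open>x \<noteq> 0\<close> by blast
  have "C ^ 2 < 2 ^ (C ^ 2)" by (rule less_exp)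
  thus False using C[of "C ^ 2"] by (simp add: numeral_2_eq_2)
qed

text \<open>\<open>p ^ j\<close> annihilates \<open>R\<close> modulo \<open>I j\<close>, so by
  Bezout an integer prime to p is invertible there.\<close>

lemma coprime_cancel:
  assumes x: "x \<in> R" and q: "coprime q p" and qx: "of_nat q * x \<in> I j"
  shows "x \<in> I j"
proof -
  have "of_nat p ^ j \<in> I j"
  proof (induction j)
    case 0
    thus ?case using I_0 subring_setD(2)[OF subring] by simp
  next
    case (Suc j)
    thus ?case using I_mult[OF p_in_I Suc] by simp
  qed
  hence pj: "of_nat p ^ j * x \<in> I j" using x I_ideal by (auto intro: ideal_setD)
  have "coprime (int q) (int p ^ j)" using q by simp
  then obtain s t :: int where st: "s * int q + t * int p ^ j = 1" using bezout_int[of "int q" "int p ^ j"] by auto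
  have "x = of_int (s * int q + t * int p ^ j) * x" unfolding st by simp
  also have "\<dots> = of_int s * (of_nat q * x) + of_int t * (of_nat p ^ j * x)" by (simp add: algebra_simps)
  also have "\<dots> \<in> I j" by (intro ideal_setD(3)[OF I_ideal] ideal_setD(4)[OF I_ideal _ pj] ideal_setD(4)[OF I_ideal _ qx]
        subring_set_of_int[OF subring])
  finally show ?thesis .
qed

end

text \<open>The freedom to make a given \<open>g\<close> a unit drives the induction over
  generators: an algebraic element can be adjoined only under a filtration for which the leading
  coefficient of its equation is a unit.\<close>

definition filterable :: "complex set => bool" where
  "filterable R \<longleftrightarrow> subring_set R \<and>
     (\<forall>g\<in>R. g \<noteq> 0 --> (\<exists>I p. filtered_ring R I p \<and> filtered_ring.unit_mod R I g))"

section \<open>Restriction to subrings, and the integers as base case\<close>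

lemma finite_quotient_subset:
  assumes R: "subring_set R" and J: "ideal_set R J" and F: "finite F" "\<And>x. x \<in> R ==> \<exists>r\<in>F. x - r \<in> J"
    and S: "S \<subseteq> R"
  shows "\<exists>F'. finite F' \<and> F' \<subseteq> S \<and> (\<forall>x\<in>S. \<exists>r\<in>F'. x - r \<in> J)"
proof -
  define c where "c r = (SOME x. x \<in> S \<and> x - r \<in> J)" for r
  have c: "c r \<in> S \<and> c r - r \<in> J" if "x \<in> S" "x - r \<in> J" for x r unfolding c_def by (rule someI[of _ x]) (use that in auto)
  let ?F = "c ` {r \<in> F. \<exists>x\<in>S. x - r \<in> J}"
  have "\<exists>r\<in>?F. x - r \<in> J" if x: "x \<in> S" for x
  proof -
    obtain r where r: "r \<in> F" "x - r \<in> J" using F(2) x S by blast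
    have "(x - r) - (c r - r) \<in> J" by (rule ideal_set_minus[OF R J r(2)]) (use c[OF x r(2)] in simp)
    thus ?thesis using r x by (intro bexI[of _ "c r"]) auto
  qed
  moreover have "finite ?F" using F(1) by simp
  moreover have "?F \<subseteq> S" using c by auto
  ultimately show ?thesis by blast
qed

text \<open>In the algebraic case the filtration is built on a ring that also contains inverses of a
  leading coefficient; it is then cut down to the ring that was wanted.\<close>

lemma filtered_ring_restrict:
  assumes "filtered_ring R I p" and S: "subring_set S" "S \<subseteq> R"
  shows "filtered_ring S (\<lambda>j. I j \<inter> S) p"
proof -
  interpret filtered_ring R I p by fact
  show ?thesis
  proof
    show "subring_set S" by fact
    show "prime p" by (rule prime_p)
    show "I 0 \<inter> S = S" using I_0 S by auto
    show "I (Suc j) \<inter> S \<subseteq> I j \<inter> S" for j using I_Suc by auto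
    show "ideal_set S (I j \<inter> S)" for j unfolding ideal_set_def
    proof (intro conjI ballI)
      show "0 \<in> I j \<inter> S" using ideal_setD(2)[OF I_ideal] subring_setD(1)[OF S(1)] by blast
      show "x + y \<in> I j \<inter> S" if "x \<in> I j \<inter> S" "y \<in> I j \<inter> S" for x y
        using that ideal_setD(3)[OF I_ideal] subring_setD(3)[OF S(1)] by blast
      show "a * x \<in> I j \<inter> S" if "a \<in> S" "x \<in> I j \<inter> S" for a x
        using that ideal_setD(4)[OF I_ideal] subring_setD(4)[OF S(1)] S(2) by blast
    qed simp
    show "x * y \<in> I (i + j) \<inter> S" if "x \<in> I i \<inter> S" "y \<in> I j \<inter> S" for x y i j
      using I_mult[of x i y j] that subring_setD(4)[OF S(1), of x y] by simp
    show "\<exists>F. finite F \<and> F \<subseteq> S \<and> (\<forall>x\<in>S. \<exists>r\<in>F. x - r \<in> I j \<inter> S)" for j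
    proof -
      obtain F where "finite F" "\<And>x. x \<in> R ==> \<exists>r\<in>F. x - r \<in> I j" using finite_quotient[of j] by blast
      from finite_quotient_subset[OF subring I_ideal this S(2)] obtain F' where
        F': "finite F'" "F' \<subseteq> S" "\<And>x. x \<in> S ==> \<exists>r\<in>F'. x - r \<in> I j" by blast
      have "\<exists>r\<in>F'. x - r \<in> I j \<inter> S" if x: "x \<in> S" for x
      proof -
        obtain r where "r \<in> F'" "x - r \<in> I j" using F'(3)[OF x] by blast
        moreover have "x - r \<in> S" using x F'(2) \<open>r \<in> F'\<close> S(1) by (blast intro: subring_setD(6))
        ultimately show ?thesis by blast
      qed
      thus ?thesis using F'(1,2) by (intro exI[of _ F']) simp
    qed
    show "of_nat p \<in> I 1 \<inter> S" using p_in_I subring_set_of_nat[OF S(1)] by blast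
    show "x \<in> I j \<inter> S" if "x \<in> S" "of_nat p * x \<in> I (Suc j) \<inter> S" for x j using p_cancel that S(2) by auto
    show "1 \<notin> I 1 \<inter> S" using one_notin by simp
    show "(\<exists>b\<ge>1. x ^ b - 1 \<in> I 1 \<inter> S) \<or> (\<exists>b\<ge>1. x ^ b \<in> I 1 \<inter> S)" if "x \<in> S" for x
    proof -
      have "x ^ b \<in> S" "x ^ b - 1 \<in> S" for b by (auto intro!: subring_setD(2,6)[OF S(1)] subring_power[OF S(1) that])
      moreover have "(\<exists>b\<ge>1. x ^ b - 1 \<in> I 1) \<or> (\<exists>b\<ge>1. x ^ b \<in> I 1)"
        by (rule unit_or_nilpotent) (use that S in auto)
      ultimately show ?thesis by simp
    qed
    show "\<exists>C::nat. C \<ge> 1 \<and> (\<forall>x D L j. height G x D L --> x \<noteq> 0 --> x \<in> I j \<inter> S --> 2 ^ j \<le> C ^ (D + 1) * L ^ C)"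
      if "finite G" "G \<subseteq> S" for G
    proof -
      have "G \<subseteq> R" using that S(2) by simp
      from separation[OF \<open>finite G\<close> this] show ?thesis by (elim ex_forward) simp
    qed
  qed
qed

lemma unit_mod_restrict:
  assumes "filtered_ring R I p" and S: "subring_set S" "S \<subseteq> R" and g: "g \<in> S" "filtered_ring.unit_mod R I g"
  shows "filtered_ring.unit_mod S (\<lambda>j. I j \<inter> S) g"
proof -
  interpret filtered_ring R I p by fact
  interpret S: filtered_ring S "\<lambda>j. I j \<inter> S" p by (rule filtered_ring_restrict) fact+
  have "g ^ b - 1 \<in> S" for b by (intro subring_setD(2,6)[OF S(1)] subring_power[OF S(1) g(1)])
  thus ?thesis using g by (simp add: unit_mod_def S.unit_mod_def)
qed

text \<open>The p-adic filtration. Separation holds because a nonzero multiple of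
  \<open>p ^ j\<close> has absolute value at least \<open>2 ^ j\<close>, while an integer of height
  \<open>D\<close>, \<open>L\<close> has absolute value at most \<open>B ^ D * L\<close>, where
  \<open>B\<close> bounds the generators.\<close>

lemma filtered_ring_Ints:
  assumes p: "prime p"
  shows "filtered_ring \<int> (\<lambda>j. {of_int z |z. int p ^ j dvd z}) p"
proof
  let ?I = "\<lambda>j. {of_int z :: complex |z. int p ^ j dvd z}"
  show sub: "subring_set (\<int> :: complex set)" by (auto simp: subring_set_def)
  show "prime p" by fact
  have p': "prime (int p)" using p by simp
  show "?I 0 = \<int>" by (auto simp: Ints_def)
  show "?I (Suc j) \<subseteq> ?I j" for j using power_le_dvd[of "int p" "Suc j" _ j] by auto
  show "ideal_set \<int> (?I j)" for j unfolding ideal_set_def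
  proof (intro conjI ballI)
    show "x + y \<in> ?I j" if "x \<in> ?I j" "y \<in> ?I j" for x y using that by (auto simp flip: of_int_add)
    show "a * x \<in> ?I j" if "a \<in> \<int>" "x \<in> ?I j" for a x using that by (auto elim!: Ints_cases simp flip: of_int_mult)
    show "0 \<in> ?I j" by (auto intro!: exI[of _ 0])
  qed auto
  show "x * y \<in> ?I (i + j)" if "x \<in> ?I i" "y \<in> ?I j" for x y i j using that by (auto simp: power_add mult_dvd_mono simp flip: of_int_mult)
  show fin: "\<exists>F. finite F \<and> F \<subseteq> \<int> \<and> (\<forall>x\<in>\<int>. \<exists>r\<in>F. x - r \<in> ?I j)" for j
  proof (intro exI[of _ "of_int ` {0..<int p ^ j}"] conjI ballI)
    fix x :: complex assume "x \<in> \<int>"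
    then obtain z where z: "x = of_int z" by (rule Ints_cases)
    have "x - of_int (z mod int p ^ j) = of_int (z - z mod int p ^ j)" by (simp add: z)
    moreover have "int p ^ j dvd z - z mod int p ^ j" by (simp add: dvd_minus_mod)
    moreover have "z mod int p ^ j \<in> {0..<int p ^ j}" using p by (auto simp: prime_gt_0_nat)
    ultimately show "\<exists>r\<in>of_int ` {0..<int p ^ j}. x - r \<in> ?I j" by blast
  qed auto
  show "of_nat p \<in> ?I 1" by (auto intro!: exI[of _ "int p"])
  show "x \<in> ?I j" if xi: "x \<in> \<int>" and px: "of_nat p * x \<in> ?I (Suc j)" for x j
  proof -
    obtain z where z: "x = of_int z" using xi by (rule Ints_cases)
    obtain w where w: "of_nat p * x = of_int w" "int p ^ Suc j dvd w" using px by blast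
    have "(of_int (int p * z) :: complex) = of_int w" using w z by simp
    hence "int p * z = w" by (simp only: of_int_eq_iff)
    hence "int p ^ j dvd z" using w(2) p by (auto simp: prime_gt_0_nat)
    thus ?thesis using z by blast
  qed
  show "1 \<notin> ?I 1"
  proof
    assume "1 \<in> ?I 1"
    then obtain z where "1 = (of_int z :: complex)" "int p dvd z" by auto
    hence "z = 1" by (metis of_int_eq_1_iff)
    thus False using \<open>int p dvd z\<close> p' by (simp add: prime_int_iff)
  qed
  show "(\<exists>b\<ge>1. x ^ b - 1 \<in> ?I 1) \<or> (\<exists>b\<ge>1. x ^ b \<in> ?I 1)" if xi: "x \<in> \<int>" for x
  proof -
    obtain z where z: "x = of_int z" using xi by (rule Ints_cases)
    obtain a b where ab: "b \<ge> 1" "x ^ a * (x ^ b - 1) \<in> ?I 1"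
      using power_periodic_mod[OF sub \<open>ideal_set \<int> (?I 1)\<close> fin[of 1] xi] by blast
    then obtain w where w: "x ^ a * (x ^ b - 1) = of_int w" "int p dvd w" by auto
    have "(of_int (z ^ a * (z ^ b - 1)) :: complex) = of_int w" using w z by simp
    hence "int p dvd z ^ a * (z ^ b - 1)" using w(2) by (simp only: of_int_eq_iff)
    then consider "int p dvd z" | "int p dvd z ^ b - 1" using prime_dvd_power[OF p'] by (auto simp: prime_dvd_mult_iff[OF p'])
    thus ?thesis
    proof cases
      case 1
      thus ?thesis using z by (intro disjI2 exI[of _ 1]) auto
    next
      case 2
      have "x ^ b - 1 = of_int (z ^ b - 1)" using z by simp
      thus ?thesis using 2 ab(1) unfolding power_one_right by blast
    qed
  qed
  show "\<exists>C::nat. C \<ge> 1 \<and> (\<forall>x D L j. height G x D L --> x \<noteq> 0 --> x \<in> ?I j --> 2 ^ j \<le> C ^ (D + 1) * L ^ C)"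
    if G: "finite G" "G \<subseteq> \<int>" for G
  proof -
    obtain B :: nat where B0: "real B \<ge> 1 + (\<Sum>g\<in>G. norm g)" using real_arch_simple by blast
    have B: "norm g \<le> B" if "g \<in> G" for g using member_le_sum[of g G norm] that G(1) B0 by simp
    have "real B \<ge> 1" using B0 sum_nonneg[of G norm] by simp
    hence B1: "B \<ge> 1" by simp
    have nrm: "norm x \<le> real (B ^ D * L)" if "height G x D L" for x D L using that
    proof (induction rule: height.induct)
      case (add x D L y L')
      thus ?case using norm_triangle_ineq[of x y] by (simp add: algebra_simps)
    next
      case (mult x D L y D' L')
      have "norm x * norm y \<le> real (B ^ D * L) * real (B ^ D' * L')" using mult by (intro mult_mono) auto
      thus ?case by (simp add: norm_mult power_add algebra_simps)
    next
      case (mono x D L D' L')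
      have "B ^ D * L \<le> B ^ D' * L'" using mono(2,3) B1 by (intro mult_mono power_increasing) auto
      thus ?case using mono(4) by (meson of_nat_mono order_trans)
    qed (use B B1 in auto)
    have "2 ^ j \<le> B ^ (D + 1) * L ^ B" if c: "height G x D L" and x: "x \<noteq> 0" "x \<in> ?I j" for x D L j
    proof -
      obtain z where z: "x = of_int z" "int p ^ j dvd z" using x by auto
      have "z \<noteq> 0" using x z by auto
      hence "int p ^ j \<le> \<bar>z\<bar>" using z(2) by (meson dvd_imp_le_int abs_ge_self order_trans)
      moreover have "2 ^ j \<le> int p ^ j" using p by (intro power_mono) (auto simp: prime_ge_2_nat)
      ultimately have "real_of_int (2 ^ j) \<le> real_of_int \<bar>z\<bar>" by (simp only: of_int_le_iff)
      also have "\<dots> = norm x" using z by simp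
      also have "\<dots> \<le> real (B ^ D * L)" by (rule nrm[OF c])
      finally have "real (2 ^ j) \<le> real (B ^ D * L)" by simp
      hence "2 ^ j \<le> B ^ D * L" by (simp only: of_nat_le_iff)
      also have "\<dots> \<le> B ^ (D + 1) * L ^ B"
      proof (rule mult_mono)
        show "L \<le> L ^ B" using B1 self_le_power[of L B] by (cases "L = 0") auto
      qed (use B1 in auto)
      finally show ?thesis .
    qed
    thus ?thesis using B1 by blast
  qed
qed

text \<open>A prime larger than the absolute value of \<open>g\<close> does not divide
  \<open>g\<close>.\<close>

lemma filterable_Ints: "filterable \<int>" unfolding filterable_def
proof (intro conjI ballI impI)
  show "subring_set (\<int> :: complex set)" by (auto simp: subring_set_def)
  fix g :: complex assume "g \<in> \<int>" "g \<noteq> 0"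
  then obtain z where z: "g = of_int z" "z \<noteq> 0" by (auto elim: Ints_cases)
  obtain p where p: "prime p" "p > nat \<bar>z\<bar>" using bigger_prime by blast
  interpret filtered_ring \<int> "\<lambda>j. {of_int z |z. int p ^ j dvd z}" p by (rule filtered_ring_Ints) fact
  have "\<not> (\<exists>b\<ge>1. g ^ b \<in> {of_int z |z. int p ^ 1 dvd z})"
  proof
    assume "\<exists>b\<ge>1. g ^ b \<in> {of_int z |z. int p ^ 1 dvd z}"
    then obtain b w where "g ^ b = of_int w" "int p dvd w" by auto
    hence "(of_int (z ^ b) :: complex) = of_int w" using z by simp
    hence "int p dvd z ^ b" using \<open>int p dvd w\<close> by (simp only: of_int_eq_iff)
    hence "int p dvd z" using p(1) prime_dvd_power[of "int p" z b] by simp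
    hence "int p \<le> \<bar>z\<bar>" using z(2) by (meson dvd_imp_le_int abs_ge_self order_trans)
    thus False using p(2) by linarith
  qed
  hence "unit_mod g" using unit_or_nilpotent[OF \<open>g \<in> \<int>\<close>] \<open>g \<in> \<int>\<close> unfolding unit_mod_def by blast
  thus "\<exists>I p. filtered_ring \<int> I p \<and> filtered_ring.unit_mod \<int> I g" using filtered_ring_axioms by blast
qed

section \<open>Transcendental extensions\<close>

definition over :: "'a::comm_ring_1 set => 'a poly => bool" where
  "over R Q \<longleftrightarrow> (\<forall>i. coeff Q i \<in> R)"

lemma overD: "over R Q ==> coeff Q i \<in> R" by (simp add: over_def)

lemma over_0 [simp]: "subring_set R ==> over R 0" by (simp add: over_def subring_setD)
lemma over_1 [simp]: "subring_set R ==> over R 1" by (auto simp: over_def coeff_pCons subring_setD one_pCons split: nat.splits)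
lemma over_pCons: "over R (pCons a Q) \<longleftrightarrow> a \<in> R \<and> over R Q" by (auto simp: over_def coeff_pCons split: nat.splits)
lemma over_add: "subring_set R ==> over R P ==> over R Q ==> over R (P + Q)" by (auto simp: over_def intro: subring_setD)
lemma over_minus: "subring_set R ==> over R P ==> over R (- P)" by (auto simp: over_def intro: subring_setD(5))
lemma over_diff: "subring_set R ==> over R P ==> over R Q ==> over R (P - Q)" by (auto simp: over_def intro: subring_setD(6))
lemma over_mult: "subring_set R ==> over R P ==> over R Q ==> over R (P * Q)"
  by (auto simp: over_def coeff_mult intro!: subring_set_sum subring_setD(4))
lemma over_smult: "subring_set R ==> a \<in> R ==> over R Q ==> over R (smult a Q)" by (auto simp: over_def intro: subring_setD(4))
lemma over_monom: "subring_set R ==> a \<in> R ==> over R (monom a n)" by (auto simp: over_def coeff_monom subring_setD(1))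
lemma over_sum: "subring_set R ==> (\<And>i. i \<in> A ==> over R (f i)) ==> over R (sum f A)"
  by (induction A rule: infinite_finite_induct) (auto intro: over_add)
lemma over_power: "subring_set R ==> over R P ==> over R (P ^ n)" by (induction n) (auto intro: over_mult)
lemma over_pcompose: "subring_set R ==> over R P ==> over R Q ==> over R (pcompose P Q)"
  by (induction P) (auto simp: pcompose_pCons over_pCons intro!: over_add over_mult)
lemma poly_over_in: "subring_set R ==> over R P ==> a \<in> R ==> poly P a \<in> R"
  by (induction P) (auto simp: over_pCons intro!: subring_setD(3,4) subring_setD(1))

definition adjoin :: "complex set => complex => complex set" where
  "adjoin R t = {poly Q t |Q. over R Q}"

lemma adjoinI: "over R Q ==> poly Q t \<in> adjoin R t" by (auto simp: adjoin_def)

lemma subring_adjoin: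
  assumes "subring_set R" shows "subring_set (adjoin R t)" unfolding subring_set_def
proof (intro conjI ballI)
  show "0 \<in> adjoin R t" "1 \<in> adjoin R t" using adjoinI[of R 0 t] adjoinI[of R 1 t] assms by auto
next
  fix x y assume "x \<in> adjoin R t" "y \<in> adjoin R t"
  then obtain P Q where "over R P" "over R Q" "x = poly P t" "y = poly Q t" by (auto simp: adjoin_def)
  thus "x + y \<in> adjoin R t" "x * y \<in> adjoin R t" using adjoinI[OF over_add[of R P Q]] adjoinI[OF over_mult[of R P Q]] assms by auto
next
  fix x assume "x \<in> adjoin R t"
  then obtain P where "over R P" "x = poly P t" by (auto simp: adjoin_def)
  thus "- x \<in> adjoin R t" using adjoinI[of R "- P" t] over_minus assms by auto
qed

lemma subset_adjoin: "subring_set R ==> R \<subseteq> adjoin R t" using adjoinI[of R "[:_:]" t] by (auto simp: over_pCons)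

lemma in_adjoin: "subring_set R ==> t \<in> adjoin R t" using adjoinI[of R "[:0, 1:]" t] by (auto simp: over_pCons subring_setD)

lemma adjoin_minimal: "subring_set S ==> R \<subseteq> S ==> t \<in> S ==> adjoin R t \<subseteq> S"
  unfolding adjoin_def by (auto intro!: poly_over_in) (auto simp: over_def)

definition transcendental_over :: "complex set => complex => bool" where
  "transcendental_over R t \<longleftrightarrow> (\<forall>Q. over R Q --> poly Q t = 0 --> Q = 0)"

lemma transcendental_inj:
  assumes "transcendental_over R t" "subring_set R" "over R P" "over R Q" "poly P t = poly Q t"
  shows "P = Q"
proof -
  have "over R (P - Q)" "poly (P - Q) t = 0" using assms by (auto intro: over_diff)
  thus ?thesis using assms(1) unfolding transcendental_over_def by fastforce
qed

text \<open>The variable \<open>t\<close> receives depth one. The coefficient of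
  \<open>t ^ i\<close> is unconstrained for \<open>i >= j\<close>, because the truncated difference
  is 0 and \<open>I 0 = R\<close>; this keeps the quotients finite. Modulo \<open>I' 1\<close> only
  the constant coefficient modulo \<open>I 1\<close> survives, which explains the criterion for
  units.\<close>

lemma filtered_ring_adjoin_transcendental:
  assumes fr: "filtered_ring R I p" and t: "transcendental_over R t"
  defines "I' \<equiv> \<lambda>j. {poly Q t |Q. \<forall>i. coeff Q i \<in> I (j - i)}"
  shows "filtered_ring (adjoin R t) I' p"
    and "over R Q ==> filtered_ring.unit_mod R I (coeff Q 0) ==> filtered_ring.unit_mod (adjoin R t) I' (poly Q t)"
proof -
  interpret filtered_ring R I p by fact
  have overI: "over R Q" if "\<forall>i. coeff Q i \<in> I (j - i)" for Q j using that I_subset by (auto simp: over_def)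
  have I'D: "coeff Q i \<in> I (j - i)" if Q: "poly Q t \<in> I' j" "over R Q" for Q i j
  proof -
    obtain P where P: "poly Q t = poly P t" "\<forall>i. coeff P i \<in> I (j - i)" using Q(1) by (auto simp: I'_def)
    have "Q = P" by (rule transcendental_inj[OF t subring Q(2) overI[OF P(2)] P(1)])
    thus ?thesis using P(2) by simp
  qed
  have I'I: "poly Q t \<in> I' j" if "\<And>i. coeff Q i \<in> I (j - i)" for Q j using that by (auto simp: I'_def)
  have sub: "subring_set (adjoin R t)" by (rule subring_adjoin[OF subring])
  have I'_sub: "I' j \<subseteq> adjoin R t" for j using overI by (force simp: I'_def adjoin_def)
  have I'_mult: "x * y \<in> I' (i + j)" if xy: "x \<in> I' i" "y \<in> I' j" for x y i j
  proof -
    obtain P Q where P: "x = poly P t" "\<And>k. coeff P k \<in> I (i - k)" and Q: "y = poly Q t" "\<And>k. coeff Q k \<in> I (j - k)"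
      using xy unfolding I'_def by blast
    have "coeff (P * Q) k \<in> I (i + j - k)" for k unfolding coeff_mult
    proof (rule ideal_set_sum[OF I_ideal])
      fix l assume "l \<in> {..k}"
      hence "i + j - k \<le> (i - l) + (j - (k - l))" by auto
      thus "coeff P l * coeff Q (k - l) \<in> I (i + j - k)" using I_antimono I_mult[OF P(2)[of l] Q(2)[of "k - l"]] by blast
    qed
    thus ?thesis using I'I[of "P * Q" "i + j"] P(1) Q(1) by simp
  qed
  have I'_0: "I' 0 = adjoin R t" using I_0 by (auto simp: I'_def adjoin_def over_def)
  have I'_ideal: "ideal_set (adjoin R t) (I' j)" for j unfolding ideal_set_def
  proof (intro conjI ballI)
    show "I' j \<subseteq> adjoin R t" by (rule I'_sub)
    show "0 \<in> I' j" using I'I[of 0 j] ideal_setD(2)[OF I_ideal] by simp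
    show "a * x \<in> I' j" if "a \<in> adjoin R t" "x \<in> I' j" for a x using I'_mult[of a 0 x j] that I'_0 by simp
    fix x y assume "x \<in> I' j" "y \<in> I' j"
    then obtain P Q where P: "x = poly P t" "\<And>k. coeff P k \<in> I (j - k)" and Q: "y = poly Q t" "\<And>k. coeff Q k \<in> I (j - k)"
      by (auto simp: I'_def)
    have "coeff (P + Q) k \<in> I (j - k)" for k using ideal_setD(3)[OF I_ideal P(2) Q(2)] by simp
    from I'I[OF this] show "x + y \<in> I' j" using P(1) Q(1) by simp
  qed
  have fin: "\<exists>F. finite F \<and> F \<subseteq> adjoin R t \<and> (\<forall>x\<in>adjoin R t. \<exists>r\<in>F. x - r \<in> I' j)" for j
  proof -
    have "\<forall>i. \<exists>F. finite F \<and> F \<subseteq> R \<and> (\<forall>x\<in>R. \<exists>r\<in>F. x - r \<in> I (j - i))" using finite_quotient by blast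
    then obtain F where F: "\<And>i. finite (F i)" "\<And>i. F i \<subseteq> R" "\<And>i x. x \<in> R ==> \<exists>r\<in>F i. x - r \<in> I (j - i)"
      by metis
    have "\<forall>i x. \<exists>r. x \<in> R --> r \<in> F i \<and> x - r \<in> I (j - i)" using F(3) by blast
    then obtain f where f: "\<And>i x. x \<in> R ==> f i x \<in> F i \<and> x - f i x \<in> I (j - i)" by metis
    let ?F = "(\<lambda>c. \<Sum>i<j. c i * t ^ i) ` (PiE {..<j} F)"
    have "finite ?F" using F(1) by (intro finite_imageI finite_PiE) auto
    moreover have "?F \<subseteq> adjoin R t" using F(2) subset_adjoin[OF subring, of t] in_adjoin[OF subring, of t]
      by (auto intro!: subring_set_sum[OF sub] subring_setD(4)[OF sub] subring_power[OF sub])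
    moreover have "\<exists>r\<in>?F. x - r \<in> I' j" if x: "x \<in> adjoin R t" for x
    proof -
      obtain Q where Q: "x = poly Q t" "over R Q" using x by (auto simp: adjoin_def)
      define c where "c = (\<lambda>i\<in>{..<j}. f i (coeff Q i))"
      have c: "c \<in> PiE {..<j} F" using f overD[OF Q(2)] by (auto simp: c_def)
      define P where "P = (\<Sum>i<j. monom (c i) i)"
      have cP: "coeff P i = (if i < j then c i else 0)" for i by (simp add: P_def coeff_sum coeff_monom)
      have "poly P t = (\<Sum>i<j. c i * t ^ i)" by (simp add: P_def poly_sum poly_monom)
      moreover have "poly (Q - P) t \<in> I' j"
      proof (rule I'I)
        fix i show "coeff (Q - P) i \<in> I (j - i)" using f[of "coeff Q i" i] overD[OF Q(2)] I_0 by (auto simp: cP c_def)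
      qed
      ultimately show ?thesis using c Q(1) by (intro bexI[of _ "poly P t"]) auto
    qed
    ultimately show ?thesis by (intro exI[of _ ?F] conjI ballI)
  qed
  show F: "filtered_ring (adjoin R t) I' p"
  proof
    show "I' (Suc j) \<subseteq> I' j" for j
    proof
      fix x assume "x \<in> I' (Suc j)"
      then obtain Q where Q: "x = poly Q t" "\<And>i. coeff Q i \<in> I (Suc j - i)" by (auto simp: I'_def)
      have "coeff Q i \<in> I (j - i)" for i by (rule subsetD[OF I_antimono Q(2)]) simp
      thus "x \<in> I' j" using I'I Q(1) by blast
    qed
    show "of_nat p \<in> I' 1" using I'I[of "[:of_nat p:]" 1] p_in_I ideal_setD(2)[OF I_ideal] by (auto simp: coeff_pCons split: nat.splits)
    show "x \<in> I' j" if x: "x \<in> adjoin R t" and px: "of_nat p * x \<in> I' (Suc j)" for x j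
    proof -
      obtain Q where Q: "x = poly Q t" "over R Q" using x by (auto simp: adjoin_def)
      have "poly (smult (of_nat p) Q) t \<in> I' (Suc j)" using px Q by simp
      moreover have "over R (smult (of_nat p) Q)" by (intro over_smult subring subring_set_of_nat Q(2))
      ultimately have *: "of_nat p * coeff Q i \<in> I (Suc j - i)" for i using I'D by fastforce
      have "coeff Q i \<in> I (j - i)" for i
      proof (cases "i \<le> j")
        case True
        thus ?thesis using *[of i] overD[OF Q(2)] by (auto intro: p_cancel simp: Suc_diff_le)
      next
        case False
        thus ?thesis using overD[OF Q(2)] I_0 by simp
      qed
      thus ?thesis using I'I Q(1) by blast
    qed
    show "1 \<notin> I' 1"
    proof
      assume "1 \<in> I' 1"
      hence "poly 1 t \<in> I' 1" by simp
      from I'D[OF this, of 0] show False using one_notin subring by simp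
    qed
    show "(\<exists>b\<ge>1. x ^ b - 1 \<in> I' 1) \<or> (\<exists>b\<ge>1. x ^ b \<in> I' 1)" if x: "x \<in> adjoin R t" for x
    proof -
      obtain Q where Q: "x = poly Q t" "over R Q" using x by (auto simp: adjoin_def)
      have oth: "coeff P i \<in> I (1 - i)" if "over R P" "coeff P 0 \<in> I 1" for P i using that overD[OF that(1)] I_0 by (cases i) auto
      have c0: "coeff (Q ^ b) 0 = coeff Q 0 ^ b" for b by (simp add: coeff_0_power)
      have "(\<exists>b\<ge>1. coeff Q 0 ^ b - 1 \<in> I 1) \<or> (\<exists>b\<ge>1. coeff Q 0 ^ b \<in> I 1)"
        by (rule unit_or_nilpotent[OF overD[OF Q(2)]])
      thus ?thesis
      proof (elim disjE exE conjE)
        fix b assume b: "b \<ge> 1" "coeff Q 0 ^ b - 1 \<in> I 1"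
        have "poly (Q ^ b - 1) t \<in> I' 1" by (intro I'I oth over_diff over_power over_1 subring Q(2)) (use b c0 in simp)
        thus ?thesis using b(1) Q(1) by auto
      next
        fix b assume b: "b \<ge> 1" "coeff Q 0 ^ b \<in> I 1"
        have "poly (Q ^ b) t \<in> I' 1" by (intro I'I oth over_power subring Q(2)) (use b c0 in simp)
        thus ?thesis using b(1) Q(1) by auto
      qed
    qed
    show "\<exists>C::nat. C \<ge> 1 \<and> (\<forall>x D L j. height G x D L --> x \<noteq> 0 --> x \<in> I' j --> 2 ^ j \<le> C ^ (D + 1) * L ^ C)"
      if G: "finite G" "G \<subseteq> adjoin R t" for G
    proof -
      have "\<forall>g\<in>G. \<exists>Q. over R Q \<and> g = poly Q t" using G(2) by (auto simp: adjoin_def)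
      then obtain q where q: "\<And>g. g \<in> G ==> over R (q g)" "\<And>g. g \<in> G ==> g = poly (q g) t" by metis
      define k where "k = (\<Sum>g\<in>G. degree (q g))"
      have k: "degree (q g) \<le> k" if "g \<in> G" for g unfolding k_def by (rule member_le_sum) (use that G(1) in auto)
      define H where "H = (\<Union>g\<in>G. coeff (q g) ` {..k})"
      have H: "finite H" "H \<subseteq> R" using G(1) q(1) by (auto simp: H_def dest: overD)
      obtain C :: nat where C: "C \<ge> 1"
        "\<And>x D L j. height H x D L ==> x \<noteq> 0 ==> x \<in> I j ==> 2 ^ j \<le> C ^ (D + 1) * L ^ C" using separation[OF H] by blast
      \<comment> \<open>\<open>P\<close> is a majorant of \<open>Q\<close>: its coefficients bound
        the heights of those of \<open>Q\<close>, its degree bounds where they can be nonzero, and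
        its value at 1 bounds all of them together.\<close>
      have rep: "\<exists>Q P. x = poly Q t \<and> over R Q \<and> (\<forall>i. height H (coeff Q i) D (coeff P i)) \<and>
          degree P \<le> k * D \<and> poly P 1 \<le> (k + 1) ^ D * L" if "height G x D L" for x D L using that
      proof (induction rule: height.induct)
        case zero
        thus ?case by (intro exI[of _ 0]) (auto simp: subring intro: height.zero)
      next
        case one
        show ?case by (rule exI[of _ 1], rule exI[of _ 1])
             (auto simp: subring one_pCons coeff_pCons over_pCons subring_setD[OF subring] split: nat.splits intro: height.intros)
      next
        case minus_one
        show ?case by (rule exI[of _ "[:-1:]"], rule exI[of _ 1])
             (auto simp: subring one_pCons coeff_pCons over_pCons subring_setD[OF subring] split: nat.splits intro: height.intros)
      next
        case (gen g)
        define P :: "nat poly" where "P = (\<Sum>i\<le>degree (q g). monom 1 i)"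
        have cP: "coeff P i = (if i \<le> degree (q g) then 1 else 0)" for i by (simp add: P_def coeff_sum coeff_monom)
        have "height H (coeff (q g) i) 1 (coeff P i)" for i
        proof (cases "i \<le> degree (q g)")
          case True
          hence "coeff (q g) i \<in> H" using k[OF gen] gen by (force simp: H_def)
          thus ?thesis using True by (simp add: cP height.gen[simplified])
        next
          case False
          thus ?thesis using height.mono[OF height.zero, of 1 0] by (simp add: cP coeff_eq_0)
        qed
        moreover have "degree P \<le> k * 1" using k[OF gen] by (intro degree_le) (auto simp: cP)
        moreover have "poly P 1 \<le> (k + 1) ^ 1 * 1" using k[OF gen] by (simp add: P_def poly_sum poly_monom)
        ultimately show ?case using q[OF gen] by blast
      next
        case (add x D L y L')
        then obtain Q P Q' P' where *: "x = poly Q t" "over R Q" "\<And>i. height H (coeff Q i) D (coeff P i)"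
          "degree P \<le> k * D" "poly P 1 \<le> (k + 1) ^ D * L"
          "y = poly Q' t" "over R Q'" "\<And>i. height H (coeff Q' i) D (coeff P' i)"
          "degree P' \<le> k * D" "poly P' 1 \<le> (k + 1) ^ D * L'" by blast
        have "x + y = poly (Q + Q') t" "over R (Q + Q')" "degree (P + P') \<le> k * D"
           "poly (P + P') 1 \<le> (k + 1) ^ D * (L + L')" using * by (auto intro: over_add subring degree_add_le simp: algebra_simps)
        moreover have "height H (coeff (Q + Q') i) D (coeff (P + P') i)" for i using height.add[OF *(3,8)] by simp
        ultimately show ?case by blast
      next
        case (mult x D L y D' L')
        then obtain Q P Q' P' where *: "x = poly Q t" "over R Q" "\<And>i. height H (coeff Q i) D (coeff P i)"
          "degree P \<le> k * D" "poly P 1 \<le> (k + 1) ^ D * L"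
          "y = poly Q' t" "over R Q'" "\<And>i. height H (coeff Q' i) D' (coeff P' i)"
          "degree P' \<le> k * D'" "poly P' 1 \<le> (k + 1) ^ D' * L'" by blast
        have "x * y = poly (Q * Q') t" "over R (Q * Q')" using * by (auto intro: over_mult subring)
        moreover have "degree (P * P') \<le> k * (D + D')" using degree_mult_le[of P P'] *(4,9) by (simp add: algebra_simps)
        moreover have "poly (P * P') 1 \<le> (k + 1) ^ (D + D') * (L * L')" using mult_mono[OF *(5,10)] by (simp add: algebra_simps power_add)
        moreover have "height H (coeff (Q * Q') i) (D + D') (coeff (P * P') i)" for i unfolding coeff_mult by (intro height_sum height.mult *) auto
        ultimately show ?case by blast
      next
        case (mono x D L D' L')
        then obtain Q P where *: "x = poly Q t" "over R Q" "\<And>i. height H (coeff Q i) D (coeff P i)"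
          "degree P \<le> k * D" "poly P 1 \<le> (k + 1) ^ D * L" by blast
        have "degree P \<le> k * D'" using *(4) mono(2) by (meson mult_le_mono2 order_trans)
        moreover have "(k + 1) ^ D * L \<le> (k + 1) ^ D' * L'" using mono by (intro mult_mono power_increasing) auto
        moreover have "\<forall>i. height H (coeff Q i) D' (coeff P i)" using height.mono[OF *(3) mono(2) order_refl] by blast
        ultimately show ?case using *(1,2,5) by (intro exI[of _ Q] exI[of _ P]) auto
      qed
      \<comment> \<open>The factors pay for the depth lost to powers of \<open>t\<close>, for
        separation in \<open>R\<close>, and for the growth of the majorant, in this order.\<close>
      define C' where "C' = 2 ^ k * C * (k + 1) ^ C"
      have C'1: "C \<le> C'" "1 \<le> C'" using C(1) by (auto simp: C'_def)
      have "2 ^ j \<le> C' ^ (D + 1) * L ^ C'" if c: "height G x D L" and x: "x \<noteq> 0" "x \<in> I' j" for x D L j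
      proof -
        obtain Q P where *: "x = poly Q t" "over R Q" "\<And>i. height H (coeff Q i) D (coeff P i)"
          "degree P \<le> k * D" "poly P 1 \<le> (k + 1) ^ D * L" using rep[OF c] by blast
        have L1: "L \<ge> 1" using height_eq_0[OF c] x(1) by (cases L) auto
        have "Q \<noteq> 0" using x(1) *(1) by auto
        then obtain i where i: "coeff Q i \<noteq> 0" by (meson leading_coeff_neq_0)
        hence "coeff P i \<noteq> 0" using height_eq_0[OF *(3)] by blast
        hence ik: "i \<le> k * D" using le_degree *(4) order_trans by blast
        have "coeff P i \<le> poly P 1"
        proof -
          have "coeff P i \<le> (\<Sum>l\<le>degree P. coeff P l)" by (rule member_le_sum) (use \<open>coeff P i \<noteq> 0\<close> le_degree in auto)
          thus ?thesis by (simp add: poly_altdef)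
        qed
        hence Pi: "coeff P i \<le> (k + 1) ^ D * L" using *(5) by linarith
        have "coeff Q i \<in> I (j - i)" using I'D x(2) *(1,2) by blast
        \<comment> \<open>The coefficient of \<open>t ^ i\<close> has depth only
          \<open>j - i\<close>, but \<open>i <= k * D\<close> makes the loss a factor exponential in
          the degree, which the inequality allows.\<close>
        have "(2::nat) ^ j \<le> 2 ^ (i + (j - i))" by (intro power_increasing) auto
        also have "\<dots> = 2 ^ i * 2 ^ (j - i)" by (simp add: power_add)
        also have "\<dots> \<le> 2 ^ (k * D) * (C ^ (D + 1) * coeff P i ^ C)"
          using ik C(2)[OF *(3) i \<open>coeff Q i \<in> I (j - i)\<close>] by (intro mult_mono power_increasing) auto
        also have "\<dots> \<le> 2 ^ (k * D) * (C ^ (D + 1) * ((k + 1) ^ D * L) ^ C)" using Pi by (intro mult_left_mono power_mono) auto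
        also have "\<dots> = (2 ^ k) ^ D * C ^ (D + 1) * ((k + 1) ^ C) ^ D * L ^ C" by (simp add: power_mult_distrib mult.commute flip: power_mult)
        also have "\<dots> \<le> (2 ^ k) ^ (D + 1) * C ^ (D + 1) * ((k + 1) ^ C) ^ (D + 1) * L ^ C'"
          by (intro mult_mono power_increasing) (use C'1 L1 C(1) in auto)
        also have "\<dots> = C' ^ (D + 1) * L ^ C'" unfolding C'_def by (simp only: power_mult_distrib)
        finally show ?thesis .
      qed
      thus ?thesis using C'1(2) by blast
    qed
  qed (use sub prime_p I'_0 I'_ideal I'_mult fin in auto)
  interpret F: filtered_ring "adjoin R t" I' p by (rule F)
  assume Q: "over R Q" and u: "unit_mod (coeff Q 0)"
  have "\<not> (\<exists>b\<ge>1. poly Q t ^ b \<in> I' 1)"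
  proof
    assume "\<exists>b\<ge>1. poly Q t ^ b \<in> I' 1"
    then obtain b where "poly (Q ^ b) t \<in> I' 1" by auto
    from I'D[OF this over_power[OF subring Q], of 0] have "coeff Q 0 ^ b \<in> I 1" by (simp add: coeff_0_power)
    thus False using not_unit_and_nilpotent u by blast
  qed
  thus "F.unit_mod (poly Q t)" using F.unit_or_nilpotent[OF adjoinI[OF Q]] adjoinI[OF Q] unfolding F.unit_mod_def by blast
qed

text \<open>To make \<open>g = Q(t)\<close> a unit its constant coefficient should be one. Since
  \<open>Q\<close> has finitely many roots, some natural number n has \<open>Q(n)\<close> nonzero;
  in terms of \<open>t - n\<close> the constant coefficient is \<open>Q(n)\<close>, and
  \<open>R\<close> has a filtration in which that is a unit.\<close>

lemma filterable_adjoin_transcendental: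
  assumes R: "filterable R" and t: "transcendental_over R t"
  shows "filterable (adjoin R t)" unfolding filterable_def
proof (intro conjI ballI impI)
  have sub: "subring_set R" using R by (simp add: filterable_def)
  thus "subring_set (adjoin R t)" by (rule subring_adjoin)
  fix g assume g: "g \<in> adjoin R t" "g \<noteq> 0"
  then obtain Q where Q: "g = poly Q t" "over R Q" by (auto simp: adjoin_def)
  have "Q \<noteq> 0" using Q g by auto
  hence "finite {a. poly Q a = 0}" by (rule poly_roots_finite)
  moreover have "infinite (range (of_nat :: nat => complex))" by (simp add: range_inj_infinite)
  ultimately have "\<not> range (of_nat :: nat => complex) \<subseteq> {a. poly Q a = 0}" using finite_subset by metis
  then obtain n :: nat where n: "poly Q (of_nat n) \<noteq> 0" by auto
  let ?a = "of_nat n :: complex"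
  have a: "?a \<in> R" by (rule subring_set_of_nat[OF sub])
  define Q' where "Q' = pcompose Q [:?a, 1:]"
  have Q': "over R Q'" unfolding Q'_def by (intro over_pcompose sub Q) (auto simp: over_pCons a sub subring_setD)
  have gQ': "g = poly Q' (t - ?a)" by (simp add: Q'_def poly_pcompose Q)
  have c0: "coeff Q' 0 = poly Q ?a" by (simp add: Q'_def flip: poly_0_coeff_0 add: poly_pcompose)
  have t': "transcendental_over R (t - ?a)" unfolding transcendental_over_def
  proof (intro allI impI)
    fix P assume P: "over R P" "poly P (t - ?a) = 0"
    have "over R (pcompose P [:-?a, 1:])" by (intro over_pcompose sub P) (auto simp: over_pCons a sub subring_setD)
    moreover have "poly (pcompose P [:-?a, 1:]) t = 0" using P by (simp add: poly_pcompose)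
    ultimately have "pcompose P [:-?a, 1:] = 0" using t by (simp add: transcendental_over_def)
    thus "P = 0" by (rule pcompose_eq_0) simp
  qed
  have adj: "adjoin R (t - ?a) = adjoin R t"
  proof (intro equalityI adjoin_minimal subring_adjoin sub subset_adjoin)
    show "t - ?a \<in> adjoin R t" by (intro subring_setD(6) subring_adjoin sub in_adjoin subsetD[OF subset_adjoin a])
    have "(t - ?a) + ?a \<in> adjoin R (t - ?a)" by (intro subring_setD(3) subring_adjoin sub in_adjoin subsetD[OF subset_adjoin a])
    thus "t \<in> adjoin R (t - ?a)" by simp
  qed
  have "coeff Q' 0 \<in> R" "coeff Q' 0 \<noteq> 0" using overD[OF Q', of 0] n c0 by simp_all
  then obtain I p where I: "filtered_ring R I p" "filtered_ring.unit_mod R I (coeff Q' 0)" using R by (auto simp: filterable_def)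
  show "\<exists>I p. filtered_ring (adjoin R t) I p \<and> filtered_ring.unit_mod (adjoin R t) I g"
    using filtered_ring_adjoin_transcendental(1)[OF I(1) t']
      filtered_ring_adjoin_transcendental(2)[OF I(1) t' Q' I(2)] unfolding adj gQ' by (intro exI conjI)
qed

section \<open>Algebraic extensions\<close>

text \<open>Multiplying by the leading coefficient of \<open>Q\<close> instead of dividing by it
  keeps the coefficients in \<open>R\<close>. Each step subtracts a multiple of \<open>Q\<close>
  whose factor is a coefficient of the current dividend, so coefficients in \<open>J\<close> stay in
  \<open>J\<close>.\<close>

lemma pseudo_division:
  assumes R: "subring_set R" and J: "ideal_set R J" and Q: "over R Q"
    and P: "\<And>i. coeff P i \<in> J"
  shows "\<exists>k V B. over R V \<and> (\<forall>i. coeff B i \<in> J) \<and> smult (lead_coeff Q ^ k) P = V * Q + B \<and>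
    (degree Q > 0 --> degree B < degree Q)" using P
proof (induction "degree P" arbitrary: P rule: less_induct)
  case less
  show ?case
  proof (cases "degree Q = 0 \<or> degree P < degree Q")
    case True
    thus ?thesis using less.prems R by (intro exI[of _ 0] exI[of _ P]) auto
  next
    case False
    define T where "T = monom (lead_coeff P) (degree P - degree Q)"
    define P' where "P' = smult (lead_coeff Q) P - T * Q"
    have lcP: "lead_coeff P \<in> J" by (rule less.prems)
    have TJ: "coeff T i \<in> J" for i using lcP ideal_setD(2)[OF J] by (auto simp: T_def coeff_monom)
    have oT: "over R T" using TJ ideal_setD(1)[OF J] by (auto simp: over_def)
    have P'J: "coeff P' i \<in> J" for i
    proof -
      have "coeff (T * Q) i \<in> J" unfolding coeff_mult by (intro ideal_set_sum[OF J] ideal_setD(5)[OF J] overD[OF Q] TJ)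
      moreover have "lead_coeff Q * coeff P i \<in> J" by (intro ideal_setD(4)[OF J] overD[OF Q] less.prems)
      ultimately show ?thesis unfolding P'_def by (simp add: ideal_set_minus[OF R J])
    qed
    have "degree P' < degree P"
    proof -
      have "degree P' \<le> degree P" unfolding P'_def
      proof (rule degree_diff_le)
        show "degree (smult (lead_coeff Q) P) \<le> degree P" by (rule degree_smult_le)
        have "degree T \<le> degree P - degree Q" unfolding T_def by (rule degree_monom_le)
        thus "degree (T * Q) \<le> degree P" using degree_mult_le[of T Q] False by linarith
      qed
      moreover have "coeff P' (degree P) = 0"
      proof -
        have "coeff (T * Q) (degree P) = lead_coeff P * lead_coeff Q" using False by (simp add: T_def coeff_monom_mult)
        thus ?thesis by (simp add: P'_def)
      qed
      moreover have "degree P > 0" using False by simp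
      ultimately show ?thesis by (cases "degree P' = degree P") (metis degree_0 leading_coeff_0_iff less_irrefl, linarith)
    qed
    from less.hyps[OF this P'J] obtain k V B where *: "over R V" "\<And>i. coeff B i \<in> J"
      "smult (lead_coeff Q ^ k) P' = V * Q + B" "degree Q > 0 ==> degree B < degree Q" by metis
    have "smult (lead_coeff Q ^ Suc k) P = smult (lead_coeff Q ^ k) (P' + T * Q)" by (simp add: P'_def mult.commute)
    also have "\<dots> = (V + smult (lead_coeff Q ^ k) T) * Q + B" by (simp add: smult_add_right *(3) algebra_simps)
    finally have "smult (lead_coeff Q ^ Suc k) P = (V + smult (lead_coeff Q ^ k) T) * Q + B" .
    moreover have "over R (V + smult (lead_coeff Q ^ k) T)" by (intro over_add over_smult R * oT subring_power overD[OF Q])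
    ultimately show ?thesis using *(2,4) by (intro exI[of _ "Suc k"] exI[of _ "V + smult (lead_coeff Q ^ k) T"] exI[of _ B]) simp
  qed
qed

section \<open>Determinants over a subring, and adjoining an algebraic element\<close>

lemma det_in_subring:
  assumes "subring_set R" "X \<in> carrier_mat n n" "\<And>i j. i < n ==> j < n ==> X $$ (i, j) \<in> R"
  shows "det X \<in> R" unfolding det_def'[OF assms(2)] using assms by (intro subring_set_sum subring_setD(4) subring_set_prod)
     (auto simp: permutes_in_image sign_def subring_setD)

lemma adj_mat_in_subring:
  assumes R: "subring_set R" and X: "X \<in> carrier_mat n n" "\<And>i j. i < n ==> j < n ==> X $$ (i, j) \<in> R"
    and ij: "i < n" "j < n"
  shows "adj_mat X $$ (i, j) \<in> R"
proof -
  have "det (mat_delete X j i) \<in> R"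
  proof (rule det_in_subring[OF R])
    show "mat_delete X j i \<in> carrier_mat (n - 1) (n - 1)" using X(1) by (intro mat_delete_carrier) 
    fix k l assume "k < n - 1" "l < n - 1"
    thus "mat_delete X j i $$ (k, l) \<in> R" using X by (auto simp: mat_delete_def)
  qed
  moreover have "(- 1) ^ (j + i) \<in> R" using R by (intro subring_power) (auto intro: subring_setD)
  ultimately show ?thesis using X(1) ij R by (auto simp: adj_mat_def cofactor_def intro: subring_setD(4))
qed

text \<open>The Leibniz formula has \<open>fact n\<close> terms, each a product of n entries up to
  sign.\<close>

lemma height_det:
  assumes X: "X \<in> carrier_mat n n" "\<And>i j. i < n ==> j < n ==> height G (X $$ (i, j)) D L"
  shows "height G (det X) (n * D) (fact n * L ^ n)"
proof -
  have "height G (signof q * (\<Prod>i = 0..<n. X $$ (i, q i))) (n * D) (L ^ n)" if q: "q permutes {0..<n}" for q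
  proof -
    have "height G (\<Prod>i = 0..<n. X $$ (i, q i)) (\<Sum>i = 0..<n. D) (\<Prod>i = 0..<n. L)"
      by (rule height_prod) (use X q in "auto simp: permutes_in_image dest: permutes_in_image")
    moreover have "height G (signof q) 0 1" by (auto simp: sign_def intro: height.intros)
    ultimately show ?thesis using height.mult[of G "signof q" 0 1] by fastforce
  qed
  hence "height G (det X) (n * D) (\<Sum>q | q permutes {0..<n}. L ^ n)"
    unfolding det_def'[OF X(1)] by (intro height_sum) (auto simp: finite_permutations)
  thus ?thesis by (simp add: card_permutations)
qed

text \<open>\<open>Q\<close> has least degree among the nonzero polynomials over \<open>R\<close>
  with root \<alpha>, so the powers of \<alpha> below \<open>degree Q\<close> are linearly
  independent over \<open>R\<close>. It need not be monic; its leading coefficient is only a unit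
  modulo \<open>I 1\<close>.\<close>

locale algebraic_extension = filtered_ring +
  fixes \<alpha> :: complex and Q :: "complex poly"
  assumes over_Q: "over R Q" and Q0: "Q \<noteq> 0" and root: "poly Q \<alpha> = 0"
    and minimal: "\<And>P. over R P ==> P \<noteq> 0 ==> degree P < degree Q ==> poly P \<alpha> \<noteq> 0"
    and unit_lead: "unit_mod (lead_coeff Q)"
begin

abbreviation "h \<equiv> lead_coeff Q"
abbreviation "e \<equiv> degree Q"

lemma h: "h \<in> R" "h \<noteq> 0" using overD[OF over_Q] Q0 by auto

lemma e_pos: "e > 0"
proof (rule ccontr)
  assume "\<not> e > 0"
  then obtain c where "Q = [:c:]" by (metis degree_0_id gr_zeroI)
  thus False using root Q0 by auto
qed

lemma independent:
  assumes "over R P" "over R P'" "degree P < e" "degree P' < e" "poly P \<alpha> = poly P' \<alpha>"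
  shows "P = P'" using minimal[of "P - P'"] over_diff[OF subring assms(1,2)] degree_diff_less[OF assms(3,4)] assms(5) by auto

text \<open>The ring generated by \<open>R\<close>, \<alpha> and \<open>1 / h\<close>. Once h is
  inverted, \<open>Q\<close> can be made monic, and the first e powers of \<alpha> span.\<close>

definition E :: "complex set" where "E = {poly P \<alpha> / h ^ k |P k. over R P}"

text \<open>The ideal of \<open>E\<close> generated by \<open>I j\<close>.\<close>

definition J :: "nat => complex set" where "J j = {poly P \<alpha> / h ^ k |P k. \<forall>i. coeff P i \<in> I j}"

lemma EI: "over R P ==> poly P \<alpha> / h ^ k \<in> E" by (auto simp: E_def)
lemma JI: "(\<And>i. coeff P i \<in> I j) ==> poly P \<alpha> / h ^ k \<in> J j" by (auto simp: J_def)

lemma over_I: "(\<And>i. coeff P i \<in> I j) ==> over R P" using I_subset by (auto simp: over_def)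

text \<open>Pseudo-division of the numerator by \<open>Q\<close>. By \<open>independent\<close>,
  comparing reduced numerators after clearing powers of h reduces statements about \<open>E\<close>
  to coefficients in \<open>R\<close>.\<close>

lemma J_reduced:
  assumes "x \<in> J j"
  obtains P k where "x = poly P \<alpha> / h ^ k" "\<And>i. coeff P i \<in> I j" "degree P < e"
proof -
  obtain P k where P: "x = poly P \<alpha> / h ^ k" "\<And>i. coeff P i \<in> I j" using assms by (auto simp: J_def)
  obtain k' V B where B: "\<And>i. coeff B i \<in> I j" "smult (h ^ k') P = V * Q + B" "degree B < e"
    using pseudo_division[OF subring I_ideal over_Q P(2)] e_pos by blast
  have "h ^ k' * poly P \<alpha> = poly B \<alpha>" using arg_cong[OF B(2), of "\<lambda>p. poly p \<alpha>"] root by simp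
  hence "poly P \<alpha> = poly B \<alpha> / h ^ k'" using h(2) by (simp add: field_simps)
  hence "x = poly B \<alpha> / h ^ (k' + k)" using P(1) by (simp add: power_add)
  thus thesis using that B by blast
qed

lemma J_0: "J 0 = E" using I_0 by (auto simp: J_def E_def over_def)

lemma E_reduced:
  assumes "x \<in> E" obtains P k where "x = poly P \<alpha> / h ^ k" "over R P" "degree P < e"
  using J_reduced[of x 0] assms J_0 I_0 by (auto simp: over_def)

lemma J_mult:
  assumes "x \<in> J i" "y \<in> J j" shows "x * y \<in> J (i + j)"
proof -
  obtain P k Q k' where P: "x = poly P \<alpha> / h ^ k" "\<And>l. coeff P l \<in> I i"
    and Q: "y = poly Q \<alpha> / h ^ k'" "\<And>l. coeff Q l \<in> I j" using assms unfolding J_def by blast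
  have "coeff (P * Q) l \<in> I (i + j)" for l unfolding coeff_mult by (intro ideal_set_sum[OF I_ideal] I_mult P Q)
  from JI[OF this, of "k + k'"] show ?thesis using P(1) Q(1) by (simp add: power_add)
qed

lemma J_add:
  assumes "x \<in> J j" "y \<in> J j" shows "x + y \<in> J j"
proof -
  obtain P k Q k' where P: "x = poly P \<alpha> / h ^ k" "\<And>l. coeff P l \<in> I j"
    and Q: "y = poly Q \<alpha> / h ^ k'" "\<And>l. coeff Q l \<in> I j" using assms unfolding J_def by blast
  have "coeff (smult (h ^ k') P + smult (h ^ k) Q) l \<in> I j" for l using P(2) Q(2) subring_power[OF subring h(1)]
    by (auto intro!: ideal_setD(3)[OF I_ideal] ideal_setD(4)[OF I_ideal])
  from JI[OF this, of "k + k'"] have "(poly P \<alpha> * h ^ k' + poly Q \<alpha> * h ^ k) / (h ^ k * h ^ k') \<in> J j"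
    by (simp add: power_add mult.commute)
  thus ?thesis using P(1) Q(1) h(2) by (simp add: add_frac_eq)
qed

lemma subring_E: "subring_set E" unfolding subring_set_def
proof (intro conjI ballI)
  show "0 \<in> E" "1 \<in> E" using EI[of 0 0] EI[of 1 0] subring by auto
  show "x + y \<in> E" "x * y \<in> E" if "x \<in> E" "y \<in> E" for x y using J_add[of x 0 y] J_mult[of x 0 y 0] that J_0 by auto
  show "- x \<in> E" if "x \<in> E" for x using that EI[OF over_minus[OF subring]] by (force simp: E_def)
qed

lemma R_subset_E: "R \<subseteq> E" using EI[of "[:_:]" 0] by (auto simp: over_pCons subring)

lemma adjoin_subset_E: "adjoin R \<alpha> \<subseteq> E" using EI[of _ 0] by (auto simp: adjoin_def)

lemma alpha_in_E: "\<alpha> \<in> E" using in_adjoin[OF subring] adjoin_subset_E by blast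

lemma inverse_h_in_E: "1 / h ^ k \<in> E" using EI[of 1 k] subring by simp

lemma I_subset_J: "x \<in> I j ==> x \<in> J j" using JI[of "[:x:]" j 0] ideal_setD(2)[OF I_ideal] by (auto simp: coeff_pCons split: nat.splits)

lemma J_ideal: "ideal_set E (J j)" unfolding ideal_set_def
proof (intro conjI ballI)
  show "J j \<subseteq> E" using over_I EI by (force simp: J_def)
  show "0 \<in> J j" using I_subset_J ideal_setD(2)[OF I_ideal] by blast
  show "x + y \<in> J j" if "x \<in> J j" "y \<in> J j" for x y using that by (rule J_add)
  show "a * x \<in> J j" if "a \<in> E" "x \<in> J j" for a x using J_mult[of a 0 x j] that J_0 by simp
qed

lemma J_Suc: "J (Suc j) \<subseteq> J j" using I_Suc unfolding J_def by blast

lemma J_finite_quotient: "\<exists>F. finite F \<and> F \<subseteq> E \<and> (\<forall>x\<in>E. \<exists>r\<in>F. x - r \<in> J j)"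
proof -
  obtain F where F: "finite F" "F \<subseteq> R" "\<And>x. x \<in> R ==> \<exists>r\<in>F. x - r \<in> I j" using finite_quotient[of j] by blast
  then obtain f where f: "\<And>x. x \<in> R ==> f x \<in> F \<and> x - f x \<in> I j" by metis
  let ?F = "(\<lambda>c. \<Sum>i<e. c i * \<alpha> ^ i) ` (PiE {..<e} (\<lambda>_. F))"
  have "finite ?F" using F(1) by (intro finite_imageI finite_PiE) auto
  moreover have "?F \<subseteq> E" using F(2) R_subset_E alpha_in_E
    by (auto intro!: subring_set_sum[OF subring_E] subring_setD(4)[OF subring_E] subring_power[OF subring_E])
  moreover have "\<exists>r\<in>?F. x - r \<in> J j" if x: "x \<in> E" for x
  proof -
    obtain B k where B: "x = poly B \<alpha> / h ^ k" "over R B" "degree B < e" using E_reduced[OF x] by blast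
    \<comment> \<open>Since h has finite order modulo \<open>I j\<close>, the inverse of
      \<open>h ^ k\<close> is congruent to the power \<open>(h ^ k) ^ (b - 1)\<close>. Denominators
      thus disappear modulo \<open>J j\<close>, and finitely many coefficient vectors
      suffice.\<close>
    obtain b where b: "b \<ge> 1" "(h ^ k) ^ b - 1 \<in> I j"
    proof -
      have "h ^ b - 1 \<in> I 1 ==> (h ^ k) ^ b - 1 \<in> I 1" for b
      proof (induction k)
        case 0
        thus ?case using ideal_setD(2)[OF I_ideal] by simp
      next
        case (Suc k)
        have "h ^ b * ((h ^ k) ^ b - 1) \<in> I 1" by (intro ideal_setD(4)[OF I_ideal] subring_power[OF subring] h(1) Suc.IH Suc.prems)
        from ideal_setD(3)[OF I_ideal this Suc.prems] show ?case by (simp add: power_mult_distrib algebra_simps)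
      qed
      hence "unit_mod (h ^ k)" using unit_lead subring_power[OF subring h(1)] unfolding unit_mod_def by blast
      from unit_mod_power[OF this] show thesis using that by blast
    qed
    define B' where "B' = smult ((h ^ k) ^ (b - 1)) B"
    have hk: "(h ^ k) ^ (b - 1) * h ^ k = (h ^ k) ^ b" using b(1) by (simp flip: power_Suc2)
    have B': "over R B'" "degree B' < e" unfolding B'_def using B h by (auto intro!: over_smult subring subring_power)
    define c where "c = (\<lambda>i\<in>{..<e}. f (coeff B' i))"
    have c: "c \<in> PiE {..<e} (\<lambda>_. F)" using f overD[OF B'(1)] by (auto simp: c_def)
    define P where "P = (\<Sum>i<e. monom (c i) i)"
    have cP: "coeff P i = (if i < e then c i else 0)" for i by (simp add: P_def coeff_sum coeff_monom)
    have "poly P \<alpha> = (\<Sum>i<e. c i * \<alpha> ^ i)" by (simp add: P_def poly_sum poly_monom)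
    moreover have "poly (B' - P) \<alpha> / h ^ 0 \<in> J j"
    proof (rule JI)
      fix i show "coeff (B' - P) i \<in> I j"
      proof (cases "i < e")
        case True
        thus ?thesis using f[OF overD[OF B'(1)]] by (simp add: cP c_def)
      next
        case False
        hence "coeff B' i = 0" using B'(2) by (intro coeff_eq_0) auto
        thus ?thesis using False ideal_setD(2)[OF I_ideal] by (simp add: cP)
      qed
    qed
    moreover have "x - poly B' \<alpha> \<in> J j"
    proof -
      have "poly (smult (1 - (h ^ k) ^ b) B) \<alpha> / h ^ k \<in> J j"
      proof (rule JI)
        fix i
        have "1 - (h ^ k) ^ b \<in> I j" using ideal_set_uminus[OF subring I_ideal b(2)] by simp
        thus "coeff (smult (1 - (h ^ k) ^ b) B) i \<in> I j" using overD[OF B(2), of i] by (auto intro: ideal_setD(5)[OF I_ideal])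
      qed
      moreover have "poly (smult (1 - (h ^ k) ^ b) B) \<alpha> / h ^ k = x - poly B' \<alpha>"
        using h(2) by (simp add: B(1) B'_def field_simps flip: hk)
      ultimately show ?thesis by simp
    qed
    ultimately have "x - (\<Sum>i<e. c i * \<alpha> ^ i) \<in> J j" using J_add[of "x - poly B' \<alpha>" j "poly (B' - P) \<alpha>"] by simp
    thus ?thesis using c by blast
  qed
  ultimately show ?thesis by (intro exI[of _ ?F] conjI ballI)
qed

text \<open>Reduced numerators may be compared coefficient by coefficient, where p cancels in
  \<open>R\<close>.\<close>

lemma J_p_cancel:
  assumes x: "x \<in> E" and px: "of_nat p * x \<in> J (Suc j)" shows "x \<in> J j"
proof -
  obtain B k where B: "x = poly B \<alpha> / h ^ k" "over R B" "degree B < e" using E_reduced[OF x] by blast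
  obtain B' k' where B': "of_nat p * x = poly B' \<alpha> / h ^ k'" "\<And>i. coeff B' i \<in> I (Suc j)" "degree B' < e"
    using J_reduced[OF px] by blast
  have hR: "h ^ n \<in> R" for n by (rule subring_power[OF subring h(1)])
  have "smult (of_nat p * h ^ k') B = smult (h ^ k) B'"
  proof (rule independent)
    show "over R (smult (of_nat p * h ^ k') B)" "over R (smult (h ^ k) B')"
      using over_I[OF B'(2)] by (auto intro!: over_smult subring B hR subring_setD(4) subring_set_of_nat)
    show "degree (smult (of_nat p * h ^ k') B) < e" "degree (smult (h ^ k) B') < e" using B(3) B'(3) by auto
    show "poly (smult (of_nat p * h ^ k') B) \<alpha> = poly (smult (h ^ k) B') \<alpha>" using B(1) B'(1) h(2) by (simp add: field_simps)
  qed
  hence *: "of_nat p * (h ^ k' * coeff B i) = h ^ k * coeff B' i" for i by (simp add: poly_eq_iff mult.assoc)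
  have "coeff (smult (h ^ k') B) i \<in> I j" for i unfolding coeff_smult
  proof (rule p_cancel)
    show "h ^ k' * coeff B i \<in> R" by (intro subring_setD(4) subring hR overD[OF B(2)])
    show "of_nat p * (h ^ k' * coeff B i) \<in> I (Suc j)" unfolding * by (intro ideal_setD(4)[OF I_ideal] hR B'(2))
  qed
  from JI[OF this, of "k + k'"] show ?thesis using B(1) h(2) by (simp add: power_add)
qed

lemma one_notin_J: "1 \<notin> J 1"
proof
  assume "1 \<in> J 1"
  then obtain B k where B: "1 = poly B \<alpha> / h ^ k" "\<And>i. coeff B i \<in> I 1" "degree B < e" using J_reduced by blast
  have "poly B \<alpha> = poly [:h ^ k:] \<alpha>" using B(1) h(2) by (simp add: field_simps)
  hence "B = [:h ^ k:]" using over_I[OF B(2)] B(3) e_pos subring_power[OF subring h(1)] by (intro independent) (auto simp: over_pCons subring)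
  hence "h ^ k \<in> I 1" using B(2)[of 0] by simp
  thus False using not_unit_and_nilpotent unit_lead by blast
qed

text \<open>A nonzero multiple of \<open>x\<close> of minimal degree is constant: otherwise its division into \<open>Q\<close>
  would yield a smaller multiple or a polynomial of degree less than \<open>e\<close> vanishing at \<open>\<alpha>\<close>.\<close>

lemma exists_multiple_in_R:
  assumes x: "x \<in> E" "x \<noteq> 0"
  obtains y where "y \<in> E" "x * y \<in> R" "x * y \<noteq> 0"
proof -
  define S where "S = {U. over R U \<and> U \<noteq> 0 \<and> degree U < e \<and> (\<exists>y\<in>E. poly U \<alpha> = x * y)}"
  obtain B k where B: "x = poly B \<alpha> / h ^ k" "over R B" "degree B < e" using E_reduced[OF x(1)] by blast
  have "B \<in> S"
  proof -
    have "poly B \<alpha> = x * h ^ k" using B(1) h(2) by simp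
    moreover have "h ^ k \<in> E" using subring_power[OF subring h(1)] R_subset_E by blast
    moreover have "B \<noteq> 0" using B(1) x(2) by auto
    ultimately show ?thesis using B(2,3) unfolding S_def by blast
  qed
  then obtain U where U: "U \<in> S" and least: "\<And>W. W \<in> S ==> degree U \<le> degree W"
    using ex_has_least_nat[of "\<lambda>U. U \<in> S" B degree] by blast
  obtain y where y: "y \<in> E" "poly U \<alpha> = x * y" and U': "over R U" "U \<noteq> 0" "degree U < e" using U by (auto simp: S_def)
  have "degree U = 0"
  proof (rule ccontr)
    assume dU: "degree U \<noteq> 0"
    obtain l V W where W: "over R V" "\<And>i. coeff W i \<in> R" "smult (lead_coeff U ^ l) Q = V * U + W"
      "degree W < degree U" using pseudo_division[OF subring I_ideal[of 0, unfolded I_0] U'(1) overD[OF over_Q]] dU by blast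
    have 0: "poly V \<alpha> * poly U \<alpha> + poly W \<alpha> = 0" using arg_cong[OF W(3), of "\<lambda>p. poly p \<alpha>"] root by simp
    show False
    proof (cases "W = 0")
      case True
      have "poly U \<alpha> \<noteq> 0" using minimal U' by blast
      hence V0: "poly V \<alpha> = 0" using 0 True by simp
      have "degree (smult (lead_coeff U ^ l) Q) = e" using U'(2) by simp
      hence e: "degree (V * U) = e" using W(3) True by simp
      hence "V \<noteq> 0" using e_pos by auto
      hence "degree V < e" using e U'(2) dU by (simp add: degree_mult_eq)
      thus False using minimal[OF W(1) \<open>V \<noteq> 0\<close>] V0 by blast
    next
      case False
      have "poly W \<alpha> = x * (- poly V \<alpha> * y)" using 0 y(2) by (simp add: algebra_simps eq_neg_iff_add_eq_0)
      moreover have "poly V \<alpha> \<in> E" using EI[OF W(1), of 0] by simp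
      hence "- poly V \<alpha> * y \<in> E" using y(1) by (intro subring_setD[OF subring_E])
      moreover have "over R W" "degree W < e" using W(2,4) U'(3) by (auto simp: over_def)
      ultimately have "W \<in> S" using False unfolding S_def by blast
      thus False using least W(4) by fastforce
    qed
  qed
  then obtain c where "U = [:c:]" using degree_0_id by metis
  thus thesis using that[OF y(1)] y(2) U' by (auto simp: over_pCons)
qed

text \<open>Multiplication by \<open>x\<close> in the basis of powers of \<alpha>, with the
  denominators of all rows cleared by one power of h.\<close>

lemma exists_matrix:
  assumes "x \<in> E"
  shows "\<exists>k X. (\<forall>i<e. \<forall>l<e. X i l \<in> R) \<and> (\<forall>i<e. h ^ k * x * \<alpha> ^ i = (\<Sum>l<e. X i l * \<alpha> ^ l))"
proof -
  have "\<exists>k P. h ^ k * (x * \<alpha> ^ i) = poly P \<alpha> \<and> over R P \<and> degree P < e" for i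
  proof -
    have "x * \<alpha> ^ i \<in> E" by (intro subring_setD(4) subring_power subring_E alpha_in_E assms)
    from E_reduced[OF this] obtain P k where "x * \<alpha> ^ i = poly P \<alpha> / h ^ k" "over R P" "degree P < e" .
    thus ?thesis using h(2) by (intro exI[of _ k] exI[of _ P]) (auto simp: field_simps)
  qed
  then obtain k P where kP: "\<And>i. h ^ k i * (x * \<alpha> ^ i) = poly (P i) \<alpha>" "\<And>i. over R (P i)" "\<And>i. degree (P i) < e" by metis
  define K where "K = (\<Sum>i<e. k i)"
  have K: "k i \<le> K" if "i < e" for i unfolding K_def by (rule member_le_sum) (use that in auto)
  define X where "X i l = h ^ (K - k i) * coeff (P i) l" for i l
  have "h ^ K * x * \<alpha> ^ i = (\<Sum>l<e. X i l * \<alpha> ^ l)" if "i < e" for i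
  proof -
    have "h ^ K * x * \<alpha> ^ i = h ^ (K - k i) * (h ^ k i * (x * \<alpha> ^ i))" using K[OF that] by (simp add: mult.assoc flip: power_add)
    also have "\<dots> = h ^ (K - k i) * (\<Sum>l<e. coeff (P i) l * \<alpha> ^ l)" unfolding kP(1) poly_altdef
      by (intro arg_cong2[of _ _ _ _ "(*)"] refl sum.mono_neutral_left) (use kP(3)[of i] in "auto simp: coeff_eq_0")
    finally show ?thesis by (simp add: X_def sum_distrib_left mult.assoc)
  qed
  moreover have "X i l \<in> R" for i l unfolding X_def by (intro subring_setD(4) subring subring_power h overD kP)
  ultimately show ?thesis by blast
qed

text \<open>Sending an element to its multiplication matrix respects sums and products. An
  expression over \<open>G\<close> therefore turns into matrices over a finite subset of
  \<open>R\<close>, with one factor \<open>h ^ \<kappa>\<close> and one factor e of growth for each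
  unit of degree.\<close>

lemma matrix_representation:
  assumes G: "finite G" "G \<subseteq> E"
  obtains H \<kappa> where "finite H" "H \<subseteq> R"
    "\<And>x D L. height G x D L ==> \<exists>X. (\<forall>i<e. \<forall>l<e. X i l \<in> R \<and> height H (X i l) D (e ^ D * L)) \<and>
       (\<forall>i<e. h ^ (\<kappa> * D) * x * \<alpha> ^ i = (\<Sum>l<e. X i l * \<alpha> ^ l))"
proof -
  have "\<forall>g\<in>G. \<exists>k X. (\<forall>i<e. \<forall>l<e. X i l \<in> R) \<and> (\<forall>i<e. h ^ k * g * \<alpha> ^ i = (\<Sum>l<e. X i l * \<alpha> ^ l))"
    using exists_matrix G(2) by blast
  then obtain k where "\<forall>g\<in>G. \<exists>X. (\<forall>i<e. \<forall>l<e. X i l \<in> R) \<and> (\<forall>i<e. h ^ k g * g * \<alpha> ^ i = (\<Sum>l<e. X i l * \<alpha> ^ l))"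
    unfolding bchoice_iff by blast
  then obtain X where X0: "\<forall>g\<in>G. (\<forall>i<e. \<forall>l<e. X g i l \<in> R) \<and> (\<forall>i<e. h ^ k g * g * \<alpha> ^ i = (\<Sum>l<e. X g i l * \<alpha> ^ l))"
    unfolding bchoice_iff by blast
  have X: "X g i l \<in> R" if "g \<in> G" "i < e" "l < e" for g i l using X0 that by simp
  have X': "h ^ k g * g * \<alpha> ^ i = (\<Sum>l<e. X g i l * \<alpha> ^ l)" if "g \<in> G" "i < e" for g i using X0 that by simp
  define \<kappa> where "\<kappa> = (\<Sum>g\<in>G. k g)"
  have k: "k g \<le> \<kappa>" if "g \<in> G" for g unfolding \<kappa>_def by (rule member_le_sum) (use that G(1) in auto)
  define Y where "Y g i l = h ^ (\<kappa> - k g) * X g i l" for g i l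
  have Y: "Y g i l \<in> R" if "g \<in> G" "i < e" "l < e" for g i l unfolding Y_def using that by (intro subring_setD(4) subring_power subring h X)
  have Y': "h ^ \<kappa> * g * \<alpha> ^ i = (\<Sum>l<e. Y g i l * \<alpha> ^ l)" if "g \<in> G" "i < e" for g i
  proof -
    have "h ^ \<kappa> = h ^ (\<kappa> - k g) * h ^ k g" using k[OF that(1)] by (simp flip: power_add)
    hence "h ^ \<kappa> * g * \<alpha> ^ i = h ^ (\<kappa> - k g) * (h ^ k g * g * \<alpha> ^ i)" by (simp only: mult.assoc)
    also have "\<dots> = (\<Sum>l<e. Y g i l * \<alpha> ^ l)" unfolding X'[OF that] by (simp add: Y_def sum_distrib_left mult.assoc)
    finally show ?thesis .
  qed
  \<comment> \<open>\<open>h ^ \<kappa>\<close> itself is included because raising the degree bound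
    forces the matrix to be padded with such factors.\<close>
  define H where "H = insert (h ^ \<kappa>) (\<Union>g\<in>G. \<Union>i<e. Y g i ` {..<e})"
  have H: "finite H" "H \<subseteq> R" using G(1) Y subring_power[OF subring h(1)] by (auto simp: H_def)
  \<comment> \<open>The induction bounds row sums of heights rather than entries, since row sums are
    submultiplicative under matrix products.\<close>
  have rep: "\<exists>X f. (\<forall>i<e. \<forall>l<e. height H (X i l) D (f i l)) \<and> (\<forall>i<e. (\<Sum>l<e. f i l) \<le> e ^ D * L) \<and>
       (\<forall>i<e. h ^ (\<kappa> * D) * x * \<alpha> ^ i = (\<Sum>l<e. X i l * \<alpha> ^ l))" if "height G x D L" for x D L using that
  proof (induction rule: height.induct)
    case zero
    show ?case by (rule exI[of _ "\<lambda>_ _. 0"], rule exI[of _ "\<lambda>_ _. 0"]) (auto intro: height.zero)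
  next
    case one
    show ?case by (rule exI[of _ "\<lambda>i l. if l = i then 1 else 0"], rule exI[of _ "\<lambda>i l. if l = i then 1 else 0"])
        (auto simp: if_distrib[of "\<lambda>x. x * _"] sum.delta cong: if_cong intro: height.intros)
  next
    case minus_one
    show ?case by (rule exI[of _ "\<lambda>i l. if l = i then - 1 else 0"], rule exI[of _ "\<lambda>i l. if l = i then 1 else 0"])
        (auto simp: if_distrib[of "\<lambda>x. x * _"] sum.delta cong: if_cong intro: height.intros)
  next
    case (gen g)
    have "height H (Y g i l) 1 1" if "i < e" "l < e" for i l using gen that by (intro height.gen) (auto simp: H_def)
    thus ?case using Y'[OF gen] by (intro exI[of _ "Y g"] exI[of _ "\<lambda>_ _. 1"]) simp
  next
    case (add x D L y L')
    obtain X f where X: "\<And>i l. i < e ==> l < e ==> height H (X i l) D (f i l)"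
      "\<And>i. i < e ==> (\<Sum>l<e. f i l) \<le> e ^ D * L"
      "\<And>i. i < e ==> h ^ (\<kappa> * D) * x * \<alpha> ^ i = (\<Sum>l<e. X i l * \<alpha> ^ l)" using add.IH(1) by blast
    obtain X' f' where X': "\<And>i l. i < e ==> l < e ==> height H (X' i l) D (f' i l)"
      "\<And>i. i < e ==> (\<Sum>l<e. f' i l) \<le> e ^ D * L'"
      "\<And>i. i < e ==> h ^ (\<kappa> * D) * y * \<alpha> ^ i = (\<Sum>l<e. X' i l * \<alpha> ^ l)" using add.IH(2) by blast
    have "height H (X i l + X' i l) D (f i l + f' i l)" if "i < e" "l < e" for i l using that by (intro height.add X X')
    moreover have "(\<Sum>l<e. f i l + f' i l) \<le> e ^ D * (L + L')" if "i < e" for i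
      using X(2)[OF that] X'(2)[OF that] by (simp add: sum.distrib algebra_simps)
    moreover have "h ^ (\<kappa> * D) * (x + y) * \<alpha> ^ i = (\<Sum>l<e. (X i l + X' i l) * \<alpha> ^ l)" if "i < e" for i
      using X(3)[OF that] X'(3)[OF that] by (simp add: sum.distrib algebra_simps)
    ultimately show ?case by (intro exI[of _ "\<lambda>i l. X i l + X' i l"] exI[of _ "\<lambda>i l. f i l + f' i l"]) simp
  next
    case (mult x D L y D' L')
    obtain X f where X: "\<And>i l. i < e ==> l < e ==> height H (X i l) D (f i l)"
      "\<And>i. i < e ==> (\<Sum>l<e. f i l) \<le> e ^ D * L"
      "\<And>i. i < e ==> h ^ (\<kappa> * D) * x * \<alpha> ^ i = (\<Sum>l<e. X i l * \<alpha> ^ l)" using mult.IH(1) by blast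
    obtain X' f' where X': "\<And>i l. i < e ==> l < e ==> height H (X' i l) D' (f' i l)"
      "\<And>i. i < e ==> (\<Sum>l<e. f' i l) \<le> e ^ D' * L'"
      "\<And>i. i < e ==> h ^ (\<kappa> * D') * y * \<alpha> ^ i = (\<Sum>l<e. X' i l * \<alpha> ^ l)" using mult.IH(2) by blast
    have "height H (\<Sum>k<e. X i k * X' k l) (D + D') (\<Sum>k<e. f i k * f' k l)" if "i < e" "l < e" for i l
      using that by (intro height_sum height.mult X X') auto
    moreover have "(\<Sum>l<e. \<Sum>k<e. f i k * f' k l) \<le> e ^ (D + D') * (L * L')" if "i < e" for i
    proof -
      have "(\<Sum>l<e. \<Sum>k<e. f i k * f' k l) = (\<Sum>k<e. f i k * (\<Sum>l<e. f' k l))" by (subst sum.swap) (simp add: sum_distrib_left)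
      also have "\<dots> \<le> (\<Sum>k<e. f i k * (e ^ D' * L'))" by (intro sum_mono mult_left_mono X'(2)) auto
      also have "\<dots> = (\<Sum>k<e. f i k) * (e ^ D' * L')" by (simp add: sum_distrib_right)
      also have "\<dots> \<le> (e ^ D * L) * (e ^ D' * L')" by (intro mult_right_mono X(2) that) auto
      finally show ?thesis by (simp add: power_add algebra_simps)
    qed
    moreover have "h ^ (\<kappa> * (D + D')) * (x * y) * \<alpha> ^ i = (\<Sum>l<e. (\<Sum>k<e. X i k * X' k l) * \<alpha> ^ l)" if "i < e" for i
    proof -
      have "h ^ (\<kappa> * (D + D')) * (x * y) * \<alpha> ^ i = h ^ (\<kappa> * D') * y * (h ^ (\<kappa> * D) * x * \<alpha> ^ i)"
        by (simp add: algebra_simps power_add)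
      also have "\<dots> = (\<Sum>k<e. X i k * (h ^ (\<kappa> * D') * y * \<alpha> ^ k))"
        unfolding X(3)[OF that] by (simp add: sum_distrib_left algebra_simps)
      also have "\<dots> = (\<Sum>k<e. X i k * (\<Sum>l<e. X' k l * \<alpha> ^ l))" by (intro sum.cong refl) (use X'(3) in auto)
      also have "\<dots> = (\<Sum>l<e. (\<Sum>k<e. X i k * X' k l) * \<alpha> ^ l)"
        unfolding sum_distrib_left sum_distrib_right by (subst sum.swap) (simp add: mult.assoc)
      finally show ?thesis .
    qed
    ultimately show ?case by (intro exI[of _ "\<lambda>i l. \<Sum>k<e. X i k * X' k l"] exI[of _ "\<lambda>i l. \<Sum>k<e. f i k * f' k l"]) simp
  next
    case (mono x D L D' L')
    obtain X f where X: "\<And>i l. i < e ==> l < e ==> height H (X i l) D (f i l)"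
      "\<And>i. i < e ==> (\<Sum>l<e. f i l) \<le> e ^ D * L"
      "\<And>i. i < e ==> h ^ (\<kappa> * D) * x * \<alpha> ^ i = (\<Sum>l<e. X i l * \<alpha> ^ l)" using mono.IH by blast
    define n where "n = D' - D"
    have D': "D' = n + D" using mono.hyps by (simp add: n_def)
    have "height H ((h ^ \<kappa>) ^ n) n 1" using height_power[OF height.gen[of "h ^ \<kappa>" H], of n] by (simp add: H_def)
    from height.mult[OF this X(1)] have "height H ((h ^ \<kappa>) ^ n * X i l) D' (f i l)" if "i < e" "l < e" for i l using that by (simp add: D')
    moreover have "(\<Sum>l<e. f i l) \<le> e ^ D' * L'" if "i < e" for i
    proof -
      have "e ^ D * L \<le> e ^ D' * L'" using mono.hyps e_pos by (intro mult_mono power_increasing) auto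
      thus ?thesis using X(2)[OF that] by linarith
    qed
    moreover have "h ^ (\<kappa> * D') * x * \<alpha> ^ i = (\<Sum>l<e. ((h ^ \<kappa>) ^ n * X i l) * \<alpha> ^ l)" if "i < e" for i
    proof -
      have "h ^ (\<kappa> * D') = (h ^ \<kappa>) ^ n * h ^ (\<kappa> * D)" by (simp add: D' algebra_simps power_add flip: power_mult)
      hence "h ^ (\<kappa> * D') * x * \<alpha> ^ i = (h ^ \<kappa>) ^ n * (h ^ (\<kappa> * D) * x * \<alpha> ^ i)" by (simp only: mult.assoc)
      also have "\<dots> = (\<Sum>l<e. ((h ^ \<kappa>) ^ n * X i l) * \<alpha> ^ l)"
        unfolding X(3)[OF that] by (simp add: sum_distrib_left mult.assoc)
      finally show ?thesis .
    qed
    ultimately show ?case by (intro exI[of _ "\<lambda>i l. (h ^ \<kappa>) ^ n * X i l"] exI[of _ f]) simp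
  qed
  have "\<exists>X. (\<forall>i<e. \<forall>l<e. X i l \<in> R \<and> height H (X i l) D (e ^ D * L)) \<and>
       (\<forall>i<e. h ^ (\<kappa> * D) * x * \<alpha> ^ i = (\<Sum>l<e. X i l * \<alpha> ^ l))" if cx: "height G x D L" for x D L
  proof -
    obtain X f where X: "\<And>i l. i < e ==> l < e ==> height H (X i l) D (f i l)"
      "\<And>i. i < e ==> (\<Sum>l<e. f i l) \<le> e ^ D * L"
      "\<And>i. i < e ==> h ^ (\<kappa> * D) * x * \<alpha> ^ i = (\<Sum>l<e. X i l * \<alpha> ^ l)" using rep[OF cx] by blast
    have "X i l \<in> R \<and> height H (X i l) D (e ^ D * L)" if "i < e" "l < e" for i l
    proof -
      have "f i l \<le> (\<Sum>l<e. f i l)" by (rule member_le_sum) (use that in auto)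
      hence "f i l \<le> e ^ D * L" using X(2)[OF that(1)] by linarith
      thus ?thesis using height.mono[OF X(1)[OF that] order_refl] height_in_subring[OF X(1)[OF that] subring H(2)] by blast
    qed
    thus ?thesis using X(3) by (intro exI[of _ X]) simp
  qed
  thus thesis using that H by blast
qed

end

context algebraic_extension
begin

text \<open>The determinant of the multiplication matrix is the norm of \<open>h ^ m * x\<close>.
  The vector of powers of \<alpha> is an eigenvector with eigenvalue \<open>h ^ m * x\<close>;
  applying the adjugate and reading off coordinate 0, where the power of \<alpha> is 1, shows that
  the norm is a multiple of \<open>x\<close> in \<open>E\<close>.\<close>

lemma norm_multiple:
  assumes x: "x \<in> E" "x \<noteq> 0"
    and X: "\<And>i l. i < e ==> l < e ==> X i l \<in> R"
    and mult: "\<And>i. i < e ==> h ^ m * x * \<alpha> ^ i = (\<Sum>l<e. X i l * \<alpha> ^ l)"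
  defines "b \<equiv> det (mat e e (\<lambda>(i, l). X i l))"
  shows "b \<in> R" "b \<noteq> 0" "\<exists>y\<in>E. b = x * y"
proof -
  let ?X = "mat e e (\<lambda>(i, l). X i l)"
  let ?v = "vec e (\<lambda>i. \<alpha> ^ i)"
  have Xc: "?X \<in> carrier_mat e e" by simp
  show "b \<in> R" unfolding b_def by (rule det_in_subring[OF subring]) (use X in auto)
  have Xv: "?X *\<^sub>v ?v = (h ^ m * x) \<cdot>\<^sub>v ?v" by (intro eq_vecI) (auto simp: scalar_prod_def mult atLeast0LessThan)
  show "b \<noteq> 0"
  proof -
    \<comment> \<open>Multiplication by an element of \<open>R\<close> is a scalar matrix. The
      product of the matrices of \<open>y\<close> and \<open>x\<close> is such a nonzero scalar
      matrix, so neither determinant vanishes.\<close>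
    obtain y where y: "y \<in> E" "x * y \<in> R" "x * y \<noteq> 0" using exists_multiple_in_R[OF x] .
    obtain k Y where Y: "\<And>i l. i < e ==> l < e ==> Y i l \<in> R"
      "\<And>i. i < e ==> h ^ k * y * \<alpha> ^ i = (\<Sum>l<e. Y i l * \<alpha> ^ l)" using exists_matrix[OF y(1)] by blast
    define \<beta> where "\<beta> = h ^ (k + m) * (x * y)"
    have \<beta>: "\<beta> \<in> R" "\<beta> \<noteq> 0"
      using y h subring_power[OF subring h(1)] by (auto simp: \<beta>_def intro: subring_setD(4) subring)
    define Z where "Z i l = (\<Sum>k<e. Y i k * X k l)" for i l
    have ZR: "Z i l \<in> R" if "i < e" "l < e" for i l unfolding Z_def using that by (intro subring_set_sum subring_setD(4) subring X Y) auto
    have Z: "(\<Sum>l<e. Z i l * \<alpha> ^ l) = \<beta> * \<alpha> ^ i" if "i < e" for i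
    proof -
      have "\<beta> * \<alpha> ^ i = h ^ m * x * (h ^ k * y * \<alpha> ^ i)" by (simp add: \<beta>_def power_add algebra_simps)
      also have "\<dots> = (\<Sum>k<e. Y i k * (h ^ m * x * \<alpha> ^ k))" unfolding Y(2)[OF that] by (simp add: sum_distrib_left algebra_simps)
      also have "\<dots> = (\<Sum>k<e. Y i k * (\<Sum>l<e. X k l * \<alpha> ^ l))" by (intro sum.cong refl) (use mult in auto)
      also have "\<dots> = (\<Sum>l<e. Z i l * \<alpha> ^ l)"
        unfolding Z_def sum_distrib_left sum_distrib_right by (subst sum.swap) (simp add: mult.assoc)
      finally show ?thesis by simp
    qed
    have "Z i l = (if l = i then \<beta> else 0)" if i: "i < e" and l: "l < e" for i l
    proof -
      define P where "P = (\<Sum>l<e. monom (Z i l) l)"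
      have "P = monom \<beta> i"
      proof (rule independent)
        show "over R P" unfolding P_def using i by (intro over_sum over_monom subring ZR) auto
        show "over R (monom \<beta> i)" by (intro over_monom subring \<beta>)
        show "degree (monom \<beta> i) < e" using degree_monom_le[of \<beta> i] i by linarith
        have "degree P \<le> e - 1" unfolding P_def by (intro degree_sum_le order_trans[OF degree_monom_le]) auto
        thus "degree P < e" using e_pos by linarith
        show "poly P \<alpha> = poly (monom \<beta> i) \<alpha>" by (simp add: P_def poly_sum poly_monom Z[OF i])
      qed
      moreover have "coeff P l = Z i l" using l by (simp add: P_def coeff_sum coeff_monom)
      ultimately show ?thesis by (auto simp: coeff_monom)
    qed
    hence "mat e e (\<lambda>(i, l). Y i l) * ?X = \<beta> \<cdot>\<^sub>m 1\<^sub>m e"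
      by (intro eq_matI) (auto simp: scalar_prod_def Z_def atLeast0LessThan)
    hence "det (mat e e (\<lambda>(i, l). Y i l)) * b = det (\<beta> \<cdot>\<^sub>m 1\<^sub>m e)"
      unfolding b_def by (subst det_mult[symmetric, of _ e]) auto
    thus "b \<noteq> 0" using \<beta>(2) by (auto simp: det_smult)
  qed
  have adj: "adj_mat ?X \<in> carrier_mat e e" "adj_mat ?X * ?X = b \<cdot>\<^sub>m 1\<^sub>m e" using adj_mat[OF Xc] by (auto simp: b_def)
  have "b \<cdot>\<^sub>v ?v = (adj_mat ?X * ?X) *\<^sub>v ?v" unfolding adj(2) by (intro eq_vecI) auto
  also have "\<dots> = (h ^ m * x) \<cdot>\<^sub>v (adj_mat ?X *\<^sub>v ?v)"
    using adj(1) Xv by (simp add: assoc_mult_mat_vec[of _ e e _ e] mult_mat_vec[of _ e e])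
  finally have "(b \<cdot>\<^sub>v ?v) $ 0 = ((h ^ m * x) \<cdot>\<^sub>v (adj_mat ?X *\<^sub>v ?v)) $ 0" by simp
  hence "b = h ^ m * x * (\<Sum>l<e. adj_mat ?X $$ (0, l) * \<alpha> ^ l)" using e_pos adj(1) by (simp add: scalar_prod_def atLeast0LessThan)
  moreover have "h ^ m * (\<Sum>l<e. adj_mat ?X $$ (0, l) * \<alpha> ^ l) \<in> E"
  proof (intro subring_setD(4) subring_set_sum subring_power subring_E alpha_in_E)
    show "h \<in> E" using h R_subset_E by blast
    show "adj_mat ?X $$ (0, l) \<in> E" if "l \<in> {..<e}" for l
      by (rule subsetD[OF R_subset_E adj_mat_in_subring[OF subring Xc]]) (use that e_pos X in auto)
  qed
  ultimately show "\<exists>y\<in>E. b = x * y" by (intro bexI) (auto simp: mult_ac)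
qed

end

section \<open>Localisation at a prime above \<open>J 1\<close>\<close>

context algebraic_extension
begin

text \<open>\<open>J\<close> itself may fail \<open>unit_or_nilpotent\<close>, because several
  primes can lie above p. Localising at one prime \<open>N\<close> above \<open>J 1\<close>, that
  is, allowing multiplication by an \<open>s\<close> outside \<open>N\<close>, makes the quotient
  local again.\<close>

lemma filtered_ring_E:
  obtains I' where "filtered_ring E I' p"
    "\<And>c. unit_mod c ==> filtered_ring.unit_mod E I' c"
proof -
  obtain N where N: "ideal_set E N" "J 1 \<subseteq> N" "\<And>k. (1::complex) ^ k \<notin> N"
    "\<And>a b. a \<in> E ==> b \<in> E ==> a * b \<in> N ==> a \<in> N \<or> b \<in> N"
    by (rule prime_ideal_avoiding_powers[OF subring_E J_ideal[of 1] subring_setD(2)[OF subring_E]])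
       (use one_notin_J in auto)
  have N1: "1 \<notin> N" using N(3)[of 0] by simp
  have Npow: "a \<in> N" if "a ^ k \<in> N" "a \<in> E" for a k using that
  proof (induction k)
    case 0
    thus ?case using N1 by simp
  next
    case (Suc k)
    thus ?case using N(4)[of a "a ^ k"] subring_power[OF subring_E] by auto
  qed
  define I' where "I' j = {x \<in> E. \<exists>s\<in>E. s \<notin> N \<and> s * x \<in> J j}" for j
  have JI': "J j \<subseteq> I' j" for j using ideal_setD(1)[OF J_ideal[of j]] N1 subring_setD(2)[OF subring_E] by (force simp: I'_def)
  have ideal: "ideal_set E (I' j)" for j unfolding ideal_set_def
  proof (intro conjI ballI)
    show "I' j \<subseteq> E" by (auto simp: I'_def)
    show "0 \<in> I' j" using JI' ideal_setD(2)[OF J_ideal] by blast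
    fix x y assume "x \<in> I' j" "y \<in> I' j"
    then obtain s s' where s: "x \<in> E" "y \<in> E" "s \<in> E" "s' \<in> E" "s \<notin> N" "s' \<notin> N" "s * x \<in> J j" "s' * y \<in> J j"
      by (auto simp: I'_def)
    have "s' * (s * x) + s * (s' * y) \<in> J j" by (rule ideal_setD(3)[OF J_ideal ideal_setD(4)[OF J_ideal s(4,7)] ideal_setD(4)[OF J_ideal s(3,8)]])
    hence "(s * s') * (x + y) \<in> J j" by (simp add: algebra_simps)
    moreover have "s * s' \<notin> N" using N(4) s by blast
    ultimately show "x + y \<in> I' j" using s subring_setD(3,4)[OF subring_E] unfolding I'_def by blast
  next
    fix a x assume a: "a \<in> E" and "x \<in> I' j"
    then obtain s where s: "x \<in> E" "s \<in> E" "s \<notin> N" "s * x \<in> J j" by (auto simp: I'_def)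
    have "a * (s * x) \<in> J j" by (rule ideal_setD(4)[OF J_ideal a s(4)])
    hence "s * (a * x) \<in> J j" by (simp add: algebra_simps)
    thus "a * x \<in> I' j" using a s subring_setD(4)[OF subring_E] unfolding I'_def by blast
  qed
  have F: "filtered_ring E I' p"
  proof
    show "subring_set E" by (rule subring_E)
    show "prime p" by (rule prime_p)
    show "I' 0 = E" using JI'[of 0] J_0 ideal_setD(1)[OF ideal[of 0]] by auto
    show "I' (Suc j) \<subseteq> I' j" for j using J_Suc by (auto simp: I'_def)
    show "ideal_set E (I' j)" for j by (rule ideal)
    show "x * y \<in> I' (i + j)" if "x \<in> I' i" "y \<in> I' j" for x y i j
    proof -
      have "\<exists>s\<in>E. s \<notin> N \<and> s * x \<in> J i" "\<exists>s\<in>E. s \<notin> N \<and> s * y \<in> J j" "x \<in> E" "y \<in> E"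
        using that by (auto simp: I'_def)
      then obtain s s' where s: "x \<in> E" "y \<in> E" "s \<in> E" "s' \<in> E" "s \<notin> N" "s' \<notin> N" "s * x \<in> J i" "s' * y \<in> J j"
        by blast
      have "(s * s') * (x * y) \<in> J (i + j)" using J_mult[OF s(7,8)] by (simp add: algebra_simps)
      moreover have "s * s' \<notin> N" using N(4) s by blast
      ultimately show ?thesis using s subring_setD(4)[OF subring_E] unfolding I'_def by blast
    qed
    show "\<exists>F. finite F \<and> F \<subseteq> E \<and> (\<forall>x\<in>E. \<exists>r\<in>F. x - r \<in> I' j)" for j
    proof -
      obtain F where "finite F" "F \<subseteq> E" "\<And>x. x \<in> E ==> \<exists>r\<in>F. x - r \<in> J j" using J_finite_quotient[of j] by blast
      thus ?thesis using JI'[of j] by (intro exI[of _ F] conjI ballI) (simp, simp, meson subsetD)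
    qed
    show "of_nat p \<in> I' 1" using I_subset_J[OF p_in_I] JI' by blast
    show "x \<in> I' j" if x: "x \<in> E" and px: "of_nat p * x \<in> I' (Suc j)" for x j
    proof -
      obtain s where s: "s \<in> E" "s \<notin> N" "s * (of_nat p * x) \<in> J (Suc j)" using px by (auto simp: I'_def)
      have "of_nat p * (s * x) \<in> J (Suc j)" using s(3) by (simp add: algebra_simps)
      hence "s * x \<in> J j" by (rule J_p_cancel[rotated]) (rule subring_setD(4)[OF subring_E s(1) x])
      thus ?thesis using s x by (auto simp: I'_def)
    qed
    show "1 \<notin> I' 1" using N(2) by (auto simp: I'_def)
    show "(\<exists>b\<ge>1. x ^ b - 1 \<in> I' 1) \<or> (\<exists>b\<ge>1. x ^ b \<in> I' 1)" if x: "x \<in> E" for x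
    proof -
      \<comment> \<open>Of the factors \<open>x ^ a\<close> and \<open>x ^ b - 1\<close>, at least
        one lies outside \<open>N\<close>; it may be cancelled in \<open>I' 1\<close>, leaving a
        unit or a nilpotent.\<close>
      obtain a b where ab: "b \<ge> 1" "x ^ a * (x ^ b - 1) \<in> J 1" using power_periodic_mod[OF subring_E J_ideal J_finite_quotient x] by blast
      have xE: "x ^ n \<in> E" "x ^ n - 1 \<in> E" for n by (intro subring_setD(2,6)[OF subring_E] subring_power[OF subring_E] x)+
      show ?thesis
      proof (cases "x \<in> N")
        case False
        hence "x ^ a \<notin> N" using Npow x by blast
        hence "x ^ b - 1 \<in> I' 1" unfolding I'_def using ab(2) xE[of a] xE[of b] by blast
        thus ?thesis using ab(1) by blast
      next
        case True
        have "x ^ b \<in> N" by (rule ideal_set_power[OF subring_E N(1) _ x ab(1)]) (use True in simp)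
        hence "x ^ b - 1 \<notin> N" using ideal_set_minus[OF subring_E N(1), of "x ^ b" "x ^ b - 1"] N1 by auto
        moreover have "(x ^ b - 1) * x ^ a \<in> J 1" using ab(2) by (simp add: mult.commute)
        ultimately have "x ^ a \<in> I' 1" unfolding I'_def using xE[of a] xE[of b] by blast
        hence "x ^ Suc a \<in> I' 1" by (rule ideal_set_power[OF subring_E ideal _ x]) simp
        thus ?thesis by (intro disjI2 exI[of _ "Suc a"]) simp
      qed
    qed
    show "\<exists>C::nat. C \<ge> 1 \<and> (\<forall>x D L j. height G x D L --> x \<noteq> 0 --> x \<in> I' j --> 2 ^ j \<le> C ^ (D + 1) * L ^ C)"
      if G: "finite G" "G \<subseteq> E" for G
    proof -
      obtain H \<kappa> where H: "finite H" "H \<subseteq> R" and rep: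
        "\<And>x D L. height G x D L ==> \<exists>X. (\<forall>i<e. \<forall>l<e. X i l \<in> R \<and> height H (X i l) D (e ^ D * L)) \<and>
           (\<forall>i<e. h ^ (\<kappa> * D) * x * \<alpha> ^ i = (\<Sum>l<e. X i l * \<alpha> ^ l))" using matrix_representation[OF G] by blast
      obtain C :: nat where C: "C \<ge> 1"
        "\<And>x D L j. height H x D L ==> x \<noteq> 0 ==> x \<in> I j ==> 2 ^ j \<le> C ^ (D + 1) * L ^ C" using separation[OF H] by blast
      \<comment> \<open>The product collects the constants of separation applied to the norm, whose
        height is \<open>e * D\<close> and \<open>fact e * (e ^ D * L) ^ e\<close>; the summand
        \<open>e * C\<close> makes the exponent of \<open>L\<close> large enough.\<close>
      define C' where "C' = C ^ e * C * (fact e) ^ C * e ^ (e * C) + e * C"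
      have C'1: "C' \<ge> C ^ e * C * (fact e) ^ C * e ^ (e * C)" "e * C \<le> C'" by (auto simp: C'_def)
      have C'2: "C' \<ge> 1" using e_pos C(1) C'1(2) by (cases "e * C") auto
      have "2 ^ j \<le> C' ^ (D + 1) * L ^ C'" if c: "height G x D L" and x: "x \<noteq> 0" "x \<in> I' j" for x D L j
      proof -
        have L1: "L \<ge> 1" using height_eq_0[OF c] x(1) by (cases L) auto
        obtain X where X: "\<And>i l. i < e ==> l < e ==> X i l \<in> R"
          "\<And>i l. i < e ==> l < e ==> height H (X i l) D (e ^ D * L)"
          "\<And>i. i < e ==> h ^ (\<kappa> * D) * x * \<alpha> ^ i = (\<Sum>l<e. X i l * \<alpha> ^ l)" using rep[OF c] by blast
        define b where "b = det (mat e e (\<lambda>(i, l). X i l))"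
        have xE: "x \<in> E" using x(2) by (simp add: I'_def)
        note nm = norm_multiple[OF xE x(1) X(1,3), folded b_def]
        have cb: "height H b (e * D) (fact e * (e ^ D * L) ^ e)" unfolding b_def by (rule height_det) (use X(2) in auto)
        obtain y where y: "y \<in> E" "b = x * y" using nm(3) by blast
        obtain s where s: "s \<in> E" "s \<notin> N" "s * x \<in> J j" using x(2) by (auto simp: I'_def)
        have sb: "s * b \<in> J j" using ideal_setD(5)[OF J_ideal y(1) s(3)] by (simp add: y(2) mult.assoc)
        \<comment> \<open>\<open>b\<close> lies in \<open>R\<close> while \<open>s * b\<close> lies
          in \<open>J j\<close>. Comparing reduced numerators puts every coefficient of
          \<open>s\<close>, times \<open>b\<close> and a power of h, into \<open>I j\<close>, so one
          unit coefficient of \<open>s\<close> suffices.\<close>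
        have "b \<in> I j"
        proof -
          obtain B k where B: "s = poly B \<alpha> / h ^ k" "over R B" "degree B < e" using E_reduced[OF s(1)] .
          obtain B' k' where B': "s * b = poly B' \<alpha> / h ^ k'" "\<And>i. coeff B' i \<in> I j" "degree B' < e" using J_reduced[OF sb] by metis
          have hR: "h ^ n \<in> R" for n by (rule subring_power[OF subring h(1)])
          have "smult (h ^ k' * b) B = smult (h ^ k) B'"
          proof (rule independent)
            show "over R (smult (h ^ k' * b) B)" "over R (smult (h ^ k) B')"
              using over_I[OF B'(2)] nm(1) by (auto intro!: over_smult subring B hR subring_setD(4))
            show "degree (smult (h ^ k' * b) B) < e" "degree (smult (h ^ k) B') < e"
              using B(3) B'(3) by (auto intro: le_less_trans[OF degree_smult_le])
            show "poly (smult (h ^ k' * b) B) \<alpha> = poly (smult (h ^ k) B') \<alpha>" using B(1) B'(1) h(2) by (simp add: field_simps)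
          qed
          hence *: "coeff B i * (h ^ k' * b) = h ^ k * coeff B' i" for i by (simp add: poly_eq_iff mult_ac)
          \<comment> \<open>If all coefficients of \<open>s\<close> were nilpotent modulo
            \<open>I 1\<close>, they would lie in the prime \<open>N\<close>, and so would
            \<open>s\<close>.\<close>
          have "\<exists>i. unit_mod (coeff B i)"
          proof (rule ccontr)
            assume "\<not> ?thesis"
            hence nil: "\<exists>n\<ge>1. coeff B i ^ n \<in> I 1" for i
              using unit_or_nilpotent[OF overD[OF B(2)], of i] overD[OF B(2), of i] by (auto simp: unit_mod_def)
            have "coeff B i \<in> N" for i
            proof -
              obtain n where "coeff B i ^ n \<in> I 1" using nil by blast
              hence "coeff B i ^ n \<in> N" using I_subset_J[of _ 1] N(2) by blast
              thus ?thesis by (rule Npow) (use overD[OF B(2)] R_subset_E in blast)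
            qed
            hence "poly B \<alpha> \<in> N" unfolding poly_altdef
              by (intro ideal_set_sum[OF N(1)] ideal_setD(5)[OF N(1)] subring_power subring_E alpha_in_E)
            hence "1 / h ^ k * poly B \<alpha> \<in> N" using inverse_h_in_E by (intro ideal_setD(4)[OF N(1)])
            thus False using s(2) B(1) by simp
          qed
          then obtain i where i: "unit_mod (coeff B i)" by blast
          have "coeff B i * (h ^ k' * b) \<in> I j" unfolding * by (intro ideal_setD(4)[OF I_ideal] hR B')
          hence "h ^ k' * b \<in> I j" by (rule unit_mod_cancel[OF i, rotated]) (intro subring_setD(4) subring hR nm)
          thus "b \<in> I j"
          proof (induction k')
            case (Suc k')
            have "h * (h ^ k' * b) \<in> I j" using Suc.prems by (simp add: mult.assoc)
            hence "h ^ k' * b \<in> I j" by (rule unit_mod_cancel[OF unit_lead, rotated]) (intro subring_setD(4) subring hR nm)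
            thus ?case by (rule Suc.IH)
          qed simp
        qed
        hence "2 ^ j \<le> C ^ (e * D + 1) * (fact e * (e ^ D * L) ^ e) ^ C" using C(2)[OF cb nm(2)] by blast
        also have "\<dots> = (C ^ e) ^ D * C * (fact e) ^ C * (e ^ (e * C)) ^ D * L ^ (e * C)"
          by (simp add: power_mult_distrib mult_ac flip: power_mult)
        also have "\<dots> \<le> (C ^ e) ^ (D + 1) * C ^ (D + 1) * ((fact e) ^ C) ^ (D + 1) * (e ^ (e * C)) ^ (D + 1) * L ^ C'"
          using C(1) e_pos L1 C'1(2) self_le_power[of C "D + 1"] self_le_power[of "(fact e) ^ C" "D + 1"] by (intro mult_mono power_increasing) auto
        also have "\<dots> = (C ^ e * C * (fact e) ^ C * e ^ (e * C)) ^ (D + 1) * L ^ C'" by (simp only: power_mult_distrib)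
        also have "\<dots> \<le> C' ^ (D + 1) * L ^ C'" using C'1(1) by (intro mult_right_mono power_mono) auto
        finally show ?thesis .
      qed
      thus ?thesis using C'2 by (intro exI[of _ C']) simp
    qed
  qed
  interpret F: filtered_ring E I' p by (rule F)
  show thesis
  proof (rule that[OF F])
    fix c assume c: "unit_mod c"
    then obtain b where b: "b \<ge> 1" "c ^ b - 1 \<in> I 1" "c \<in> R" by (auto simp: unit_mod_def)
    hence "c ^ b - 1 \<in> I' 1" using I_subset_J[OF b(2)] JI'[of 1] by blast
    thus "F.unit_mod c" using b R_subset_E unfolding F.unit_mod_def by blast
  qed
qed

end

section \<open>Existence of filtrations on finitely generated rings\<close>

lemma (in filtered_ring) unit_mod_factor:
  assumes "unit_mod (x * y)" "x \<in> R" "y \<in> R" shows "unit_mod x"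
proof (rule ccontr)
  assume "\<not> unit_mod x"
  then obtain b where "x ^ b \<in> I 1" using unit_or_nilpotent[OF assms(2)] assms(2) by (auto simp: unit_mod_def)
  hence "(x * y) ^ b \<in> I 1" using assms(3) by (auto simp: power_mult_distrib intro: ideal_setD(5)[OF I_ideal] subring_power[OF subring])
  thus False using not_unit_and_nilpotent assms(1) by blast
qed

text \<open>Both the leading coefficient and \<open>g\<close> must be units. \<open>g\<close> has a
  nonzero multiple in \<open>R\<close> with cofactor in \<open>E\<close>, so a single element of
  \<open>R\<close>, the product of that multiple with the leading coefficient, is made a
  unit.\<close>

lemma filterable_adjoin_algebraic:
  assumes R: "filterable R" and t: "\<not> transcendental_over R t"
  shows "filterable (adjoin R t)" unfolding filterable_def
proof (intro conjI ballI impI)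
  have sub: "subring_set R" using R by (simp add: filterable_def)
  thus subt: "subring_set (adjoin R t)" by (rule subring_adjoin)
  define S where "S = {Q. over R Q \<and> Q \<noteq> 0 \<and> poly Q t = 0}"
  have "\<exists>Q. Q \<in> S" using t by (auto simp: S_def transcendental_over_def)
  then obtain Q where Q: "Q \<in> S" and least: "\<And>P. P \<in> S ==> degree Q \<le> degree P"
    using ex_has_least_nat[of "\<lambda>U. U \<in> S" _ degree] by blast
  have Q': "over R Q" "Q \<noteq> 0" "poly Q t = 0" using Q by (auto simp: S_def)
  have minimal: "poly P t \<noteq> 0" if "over R P" "P \<noteq> 0" "degree P < degree Q" for P using least[of P] that by (auto simp: S_def)
  have h: "lead_coeff Q \<in> R" "lead_coeff Q \<noteq> 0" using Q' by (auto dest: overD)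
  fix g assume g: "g \<in> adjoin R t" "g \<noteq> 0"
  \<comment> \<open>This preliminary filtration only gives access to the algebra of
    \<open>E\<close>, which does not depend on the filtration; the one finally used is
    \<open>I\<close>.\<close>
  obtain I0 p0 where "filtered_ring R I0 p0" "filtered_ring.unit_mod R I0 (lead_coeff Q)" using R h unfolding filterable_def by blast
  then interpret X: algebraic_extension R I0 p0 t Q using Q' minimal by (simp add: algebraic_extension_def algebraic_extension_axioms_def)
  have "g \<in> X.E" using g(1) X.adjoin_subset_E by blast
  then obtain y where y: "y \<in> X.E" "g * y \<in> R" "g * y \<noteq> 0" using X.exists_multiple_in_R g(2) by metis
  have hg: "lead_coeff Q * (g * y) \<in> R" "lead_coeff Q * (g * y) \<noteq> 0" using h y sub by (auto intro: subring_setD(4))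
  obtain I p where I: "filtered_ring R I p" "filtered_ring.unit_mod R I (lead_coeff Q * (g * y))" using R hg unfolding filterable_def by blast
  interpret Y: filtered_ring R I p by (rule I(1))
  have u: "Y.unit_mod (lead_coeff Q)" "Y.unit_mod (g * y)"
    using Y.unit_mod_factor[of "lead_coeff Q" "g * y"] Y.unit_mod_factor[of "g * y" "lead_coeff Q"] I(2) h(1) y(2) by (simp_all add: mult.commute)
  interpret Z: algebraic_extension R I p t Q using Q' minimal u(1) by unfold_locales auto
  have E: "Z.E = X.E" by (simp add: X.E_def Z.E_def)
  obtain I' where I': "filtered_ring Z.E I' p" "filtered_ring.unit_mod Z.E I' (g * y)" using Z.filtered_ring_E u(2) by metis
  interpret W: filtered_ring Z.E I' p by (rule I'(1))
  have "W.unit_mod g" by (rule W.unit_mod_factor[OF I'(2)]) (use y(1) \<open>g \<in> X.E\<close> E in auto)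
  thus "\<exists>I p. filtered_ring (adjoin R t) I p \<and> filtered_ring.unit_mod (adjoin R t) I g"
    using filtered_ring_restrict[OF I'(1) subt Z.adjoin_subset_E]
      unit_mod_restrict[OF I'(1) subt Z.adjoin_subset_E g(1)] by (intro exI conjI)
qed

lemma filterable_adjoin: "filterable R ==> filterable (adjoin R t)" using filterable_adjoin_algebraic filterable_adjoin_transcendental by blast

theorem exists_filtered_ring:
  assumes "finite G"
  obtains R I p where "filtered_ring R I p" "G \<subseteq> R"
proof -
  have "\<exists>R. filterable R \<and> G \<subseteq> R" using assms
  proof (induction G rule: finite_induct)
    case empty
    thus ?case using filterable_Ints by blast
  next
    case (insert t G)
    then obtain R where R: "filterable R" "G \<subseteq> R" by blast
    hence "subring_set R" by (simp add: filterable_def)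
    thus ?case using filterable_adjoin[OF R(1), of t] subset_adjoin[of R t] in_adjoin[of R t] R(2) by blast
  qed
  then obtain R where R: "filterable R" "G \<subseteq> R" by blast
  hence "1 \<in> R" by (auto simp: filterable_def intro: subring_setD(2))
  hence "\<exists>I p. filtered_ring R I p" using R(1) one_neq_zero unfolding filterable_def by blast
  thus thesis using that R(2) by blast
qed

section \<open>Newton series\<close>

text \<open>The recursion behind Legendre's formula. The coarse bound n holds for p = 2 as well and
  is what the doubled index in \<open>I (2 * k)\<close> pays for.\<close>

lemma multiplicity_fact_le:
  assumes p: "prime (p::nat)" shows "multiplicity p (fact n) \<le> n"
proof -
  have p2: "p \<ge> 2" using p by (rule prime_ge_2_nat)
  have step: "multiplicity p (fact (Suc n)) = multiplicity p (Suc n) + multiplicity p (fact n)" for n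
    using p unfolding fact_Suc of_nat_id by (intro prime_elem_multiplicity_mult_distrib) auto
  \<comment> \<open>Only the multiples of p up to n contribute; dividing each of them by p leaves
    the factorial of \<open>n div p\<close>.\<close>
  have eq: "multiplicity p (fact n) = n div p + multiplicity p (fact (n div p))" for n
  proof (induction n)
    case (Suc n)
    show ?case
    proof (cases "p dvd Suc n")
      case True
      then obtain q where q: "Suc n = p * q" by blast
      have "q > 0" using q by (cases q) auto
      have "n div p = q - 1"
      proof -
        obtain k where k: "q = Suc k" using \<open>q > 0\<close> by (cases q) auto
        show ?thesis using q p2 unfolding k by (intro div_nat_eqI) auto
      qed
      then obtain k where k: "q = Suc k" "n div p = k" using \<open>q > 0\<close> by (cases q) auto
      have "multiplicity p (Suc n) = 1 + multiplicity p q"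
        using p \<open>q > 0\<close> unfolding q by (subst prime_elem_multiplicity_mult_distrib) auto
      moreover have "Suc n div p = q" using q p2 by simp
      ultimately show ?thesis using step[of n] step[of k] Suc k by simp
    next
      case False
      hence "multiplicity p (Suc n) = 0" by (simp add: not_dvd_imp_multiplicity_0)
      moreover have "Suc n div p = n div p" using False by (simp add: div_Suc dvd_eq_mod_eq_0)
      ultimately show ?thesis using step[of n] Suc by simp
    qed
  qed simp
  show ?thesis
  proof (induction n rule: less_induct)
    case (less n)
    show ?case
    proof (cases "n = 0")
      case False
      hence "n div p < n" using p2 by simp
      hence "multiplicity p (fact n) \<le> 2 * (n div p)" using eq[of n] less by force
      also have "\<dots> \<le> n" using p2 by (metis div_times_less_eq_dividend mult.commute mult_le_mono1 order_trans)
      finally show ?thesis .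
    qed simp
  qed
qed

section \<open>Depth of fractions with integer denominators\<close>

context filtered_ring
begin

lemma p_power_in_I: "of_nat (p ^ k) \<in> I k"
proof (induction k)
  case 0
  thus ?case using I_0 subring_setD(2)[OF subring] by simp
next
  case (Suc j)
  thus ?case using I_mult[OF p_in_I Suc] by simp
qed

lemma of_nat_in_I: "of_nat m \<in> I (multiplicity p m)"
proof -
  define v where "v = multiplicity p m"
  obtain k where k: "m = p ^ v * k" using multiplicity_dvd[of p m] unfolding v_def by blast
  have "of_nat k * of_nat (p ^ v) \<in> I v" by (intro ideal_setD(4)[OF I_ideal] subring_set_of_nat[OF subring] p_power_in_I)
  hence "of_nat m \<in> I v" by (simp add: k mult.commute)
  thus ?thesis by (simp add: v_def)
qed

lemma nat_cancel:
  assumes x: "x \<in> R" and m: "m \<ge> 1" and mx: "of_nat m * x \<in> I (j + multiplicity p m)"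
  shows "x \<in> I j"
proof -
  have m0: "m \<noteq> 0" "\<not> is_unit p" using m prime_p by auto
  obtain q where q: "m = p ^ multiplicity p m * q" "\<not> p dvd q" using multiplicity_decompose'[OF m0] by blast
  define v where "v = multiplicity p m"
  have xp: "of_nat (p ^ n) * x \<in> R" for n by (intro subring_setD(4) subring subring_set_of_nat x)
  have mq: "m = p ^ v * q" using q(1) unfolding v_def .
  have "coprime q p" using prime_imp_coprime[OF prime_p q(2)] by (simp add: coprime_commute)
  moreover have "of_nat q * (of_nat (p ^ v) * x) \<in> I (j + v)" using mx unfolding v_def[symmetric] by (simp add: mq mult_ac)
  ultimately have "of_nat (p ^ v) * x \<in> I (j + v)" using coprime_cancel[OF xp] by blast
  thus ?thesis
  proof (induction v)
    case (Suc v)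
    have "of_nat p * (of_nat (p ^ v) * x) \<in> I (Suc (j + v))" using Suc.prems by (simp add: mult.assoc)
    from p_cancel[OF xp this] show ?case by (rule Suc.IH)
  qed simp
qed

text \<open>Extends \<open>I j\<close> to rational multiples of elements of \<open>R\<close>:
  dividing by m lowers the depth by the exponent of p in m. On \<open>R\<close> itself nothing new
  arises, by \<open>hat_I\<close>.\<close>

definition hat :: "nat => complex set" where
  "hat j = {x. \<exists>m\<ge>1. of_nat m * x \<in> I (j + multiplicity p m)}"

lemma hat_I: "x \<in> R ==> x \<in> hat j ==> x \<in> I j" using nat_cancel unfolding hat_def by blast

lemma hat_antimono: "i \<le> j ==> hat j \<subseteq> hat i" unfolding hat_def using I_antimono[OF add_le_mono1] by blast

lemma hat_0: "0 \<in> hat j" unfolding hat_def by (auto intro!: exI[of _ 1] ideal_setD(2)[OF I_ideal])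

lemma hat_add:
  assumes "x \<in> hat j" "y \<in> hat j" shows "x + y \<in> hat j"
proof -
  obtain m n where m: "m \<ge> 1" "of_nat m * x \<in> I (j + multiplicity p m)"
    and n: "n \<ge> 1" "of_nat n * y \<in> I (j + multiplicity p n)" using assms by (auto simp: hat_def)
  have v: "multiplicity p (m * n) = multiplicity p m + multiplicity p n" using m(1) n(1) prime_p by (intro prime_elem_multiplicity_mult_distrib) auto
  have "(of_nat m * x) * of_nat n \<in> I (j + multiplicity p m + multiplicity p n)" by (rule I_mult[OF m(2) of_nat_in_I])
  moreover have "(of_nat n * y) * of_nat m \<in> I (j + multiplicity p n + multiplicity p m)" by (rule I_mult[OF n(2) of_nat_in_I])
  ultimately have "(of_nat m * x) * of_nat n + (of_nat n * y) * of_nat m \<in> I (j + multiplicity p (m * n))"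
    by (intro ideal_setD(3)[OF I_ideal]) (simp_all add: v add_ac)
  hence "of_nat (m * n) * (x + y) \<in> I (j + multiplicity p (m * n))" by (simp add: algebra_simps)
  thus ?thesis using m(1) n(1) unfolding hat_def by (auto intro!: exI[of _ "m * n"])
qed

lemma hat_mult:
  assumes "c \<in> R" "x \<in> hat j" shows "c * x \<in> hat j"
proof -
  obtain m where m: "m \<ge> 1" "of_nat m * x \<in> I (j + multiplicity p m)" using assms by (auto simp: hat_def)
  hence "c * (of_nat m * x) \<in> I (j + multiplicity p m)" by (intro ideal_setD(4)[OF I_ideal assms(1)])
  thus ?thesis using m unfolding hat_def by (auto intro!: exI[of _ m] simp: mult_ac)
qed

lemma hat_sum: "(\<And>i. i \<in> A ==> f i \<in> hat j) ==> sum f A \<in> hat j"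
  by (induction A rule: infinite_finite_induct) (auto intro: hat_add hat_0)

text \<open>Horner's recursion gives coefficient l of the quotient as coefficient l + 1 of
  \<open>f\<close> plus \<open>t\<close> times coefficient l + 1 of the quotient. Downward induction
  on l turns this index shift into one more unit of depth.\<close>

lemma divide_linear_factor:
  assumes f: "\<And>l. coeff f l \<in> hat (l + j)" and t: "t \<in> R" "poly f t = 0"
  shows "\<exists>q. f = [:- t, 1:] * q \<and> (\<forall>l. coeff q l \<in> hat (l + Suc j))"
proof -
  obtain q where q: "f = [:- t, 1:] * q" using t(2) by (metis dvdE poly_eq_0_iff_dvd)
  have rec: "coeff q l = coeff f (Suc l) + t * coeff q (Suc l)" for l unfolding q by (simp add: coeff_pCons)
  have "coeff q l \<in> hat (l + Suc j)" for l
  proof (induction "Suc (degree q) - l" arbitrary: l)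
    case 0
    thus ?case using hat_0 by (simp add: coeff_eq_0)
  next
    case (Suc n)
    have "coeff q (Suc l) \<in> hat (Suc l + Suc j)" using Suc.hyps(1)[of "Suc l"] Suc.hyps(2) by simp
    hence "coeff q (Suc l) \<in> hat (l + Suc j)" using hat_antimono[of "l + Suc j" "Suc l + Suc j"] by auto
    moreover have "coeff f (Suc l) \<in> hat (l + Suc j)" using f[of "Suc l"] by simp
    ultimately show ?case unfolding rec[of l] by (intro hat_add hat_mult t)
  qed
  thus ?thesis using q by blast
qed

lemma divide_linear_factors:
  assumes "finite T" "\<And>l. coeff f l \<in> hat l" "\<And>t. t \<in> T ==> poly f (of_nat t) = 0"
  shows "\<exists>q. f = (\<Prod>t\<in>T. [:- of_nat t, 1:]) * q \<and> (\<forall>l. coeff q l \<in> hat (l + card T))" using assms(1,3)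
proof (induction T rule: finite_induct)
  case empty
  thus ?case using assms(2) by auto
next
  case (insert t T)
  then obtain q where q: "f = (\<Prod>t\<in>T. [:- of_nat t, 1:]) * q" "\<And>l. coeff q l \<in> hat (l + card T)" by auto
  have "poly (\<Prod>t\<in>T. [:- of_nat t, 1:]) (of_nat t :: complex) \<noteq> 0" using insert.hyps by (auto simp: poly_prod)
  moreover have "poly f (of_nat t) = 0" using insert.prems by simp
  ultimately have "poly q (of_nat t) = 0" using q(1) by (metis mult_eq_0_iff poly_mult)
  from divide_linear_factor[OF q(2) subring_set_of_nat[OF subring] this] obtain q' where
    "q = [:- of_nat t, 1:] * q'" "\<forall>l. coeff q' l \<in> hat (l + Suc (card T))" by blast
  moreover from this have "f = (\<Prod>t\<in>insert t T. [:- of_nat t, 1:]) * q'" using q(1) by (simp only: prod.insert[OF insert.hyps] mult_ac)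
  ultimately show ?case using insert.hyps by (intro exI[of _ q']) simp
qed

text \<open>The Newton series of \<open>b\<close> has coefficients \<open>c k / k!\<close> that still tend to zero.  A polynomial truncation
  that agrees with \<open>b\<close> at \<open>j\<close> of its zeros and at \<open>n\<close> may be divided by the \<open>j\<close> linear factors, and each
  division improves the divisibility of the coefficients by one.\<close>

theorem newton_series_zero:
  assumes b: "\<And>n. b n = (\<Sum>k\<le>n. of_nat (n choose k) * c k)" and c: "\<And>k. c k \<in> I (2 * k)"
    and inf: "infinite {n. b n = 0}"
  shows "b n = 0"
proof (rule I_separated)
  have cR: "c k \<in> R" for k using c[of k] I_subset by blast
  show bR: "b n \<in> R" unfolding b by (intro subring_set_sum subring_setD(4) subring subring_set_of_nat cR)
  \<comment> \<open>Coefficient of the k-th falling factorial: of the depth \<open>2 * k\<close> at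
    most k is lost to the factorial.\<close>
  define \<beta> where "\<beta> k = c k / fact k" for k
  have \<beta>: "\<beta> k \<in> hat k" for k
  proof -
    have "of_nat (fact k) * \<beta> k = c k" by (simp add: \<beta>_def)
    moreover have "c k \<in> I (k + multiplicity p (fact k))"
      using c[of k] I_antimono[of "k + multiplicity p (fact k)" "2 * k"] multiplicity_fact_le[OF prime_p, of k] by auto
    ultimately show ?thesis unfolding hat_def by (auto intro!: exI[of _ "fact k"])
  qed
  \<comment> \<open>Falling factorials: k! times the k-th binomial coefficient as an honest
    polynomial with integer coefficients.\<close>
  define ff :: "nat => complex poly" where "ff k = (\<Prod>i<k. [:- of_nat i, 1:])" for k
  have ff_over: "over R (ff k)" for k unfolding ff_def
  proof (induction k)
    case (Suc k)
    show ?case unfolding prod.lessThan_Suc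
      by (intro over_mult subring Suc) (auto simp: over_pCons subring subring_setD[OF subring] subring_set_of_nat[OF subring])
  qed (simp add: subring)
  have ff_degree: "degree (ff k) = k" for k unfolding ff_def by (subst degree_prod_eq_sum_degree) auto
  have ff_poly: "poly (ff k) (of_nat n) = fact k * of_nat (n choose k)" for k n
    by (simp add: binomial_gbinomial gbinomial_prod_rev ff_def poly_prod atLeast0LessThan)
  fix j
  obtain T where T: "T \<subseteq> {n. b n = 0}" "finite T" "card T = j" using infinite_arbitrarily_large[OF inf] by blast
  \<comment> \<open>Binomial coefficients vanish beyond the argument, so truncation at
    \<open>N\<close> is exact at \<open>n\<close> and at the chosen zeros.\<close>
  define N where "N = Max (insert n T)"
  have N: "m \<le> N" if "m \<in> insert n T" for m unfolding N_def using T(2) that by (intro Max_ge) auto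
  define f where "f = (\<Sum>k\<le>N. smult (\<beta> k) (ff k))"
  have f: "poly f (of_nat m) = b m" if "m \<le> N" for m
  proof -
    have "poly f (of_nat m) = (\<Sum>k\<le>N. of_nat (m choose k) * c k)" by (simp add: f_def poly_sum ff_poly \<beta>_def mult.commute)
    also have "\<dots> = b m" unfolding b by (rule sum.mono_neutral_right) (use that in auto)
    finally show ?thesis .
  qed
  have "coeff f l \<in> hat l" for l unfolding f_def coeff_sum coeff_smult
  proof (rule hat_sum)
    fix k
    show "\<beta> k * coeff (ff k) l \<in> hat l"
    proof (cases "l \<le> k")
      case True
      hence "\<beta> k \<in> hat l" using \<beta>[of k] hat_antimono by blast
      from hat_mult[OF overD[OF ff_over] this] show ?thesis by (simp add: mult.commute)
    next
      case False
      thus ?thesis using hat_0 by (simp add: coeff_eq_0 ff_degree)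
    qed
  qed
  moreover have "poly f (of_nat t) = 0" if "t \<in> T" for t using f[OF N, of t] T(1) that by auto
  ultimately obtain q where q: "f = (\<Prod>t\<in>T. [:- of_nat t, 1:]) * q" "\<And>l. coeff q l \<in> hat (l + j)"
    using divide_linear_factors[OF T(2)] T(3) by blast
  \<comment> \<open>After division by j linear factors all coefficients have depth at least j, so
    \<open>b n\<close> has depth at least j, for arbitrary j.\<close>
  have "poly q (of_nat n) \<in> hat j" unfolding poly_altdef
  proof (rule hat_sum)
    fix l
    have "coeff q l \<in> hat j" using q(2)[of l] hat_antimono[of j "l + j"] by auto
    hence "of_nat (n ^ l) * coeff q l \<in> hat j" by (intro hat_mult subring_set_of_nat subring)
    thus "coeff q l * of_nat n ^ l \<in> hat j" by (simp add: mult.commute)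
  qed
  moreover have "b n = of_int (\<Prod>t\<in>T. int n - int t) * poly q (of_nat n)" using f[OF N, of n] q(1) by (simp add: poly_prod)
  ultimately have "b n \<in> hat j" using hat_mult[OF subring_set_of_int[OF subring]] by metis
  thus "b n \<in> I j" using hat_I bR by blast
qed

end

section \<open>Polynomial expressions and the Nullstellensatz\<close>

text \<open>Syntax trees instead of coefficient functions: the constants, which have to lie in
  \<open>R\<close>, and a degree bound are read off the tree, and derivatives, weights and heights
  follow by structural induction.\<close>

datatype 'v pexp = PConst complex | PVar 'v | PAdd "'v pexp" "'v pexp" | PMul "'v pexp" "'v pexp"

fun peval :: "('v => complex) => 'v pexp => complex" where
  "peval x (PConst c) = c"
| "peval x (PVar v) = x v"
| "peval x (PAdd a b) = peval x a + peval x b"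
| "peval x (PMul a b) = peval x a * peval x b"

fun pvars :: "'v pexp => 'v set" where
  "pvars (PConst c) = {}"
| "pvars (PVar v) = {v}"
| "pvars (PAdd a b) = pvars a \<union> pvars b"
| "pvars (PMul a b) = pvars a \<union> pvars b"

fun pconsts :: "'v pexp => complex set" where
  "pconsts (PConst c) = {c}"
| "pconsts (PVar v) = {}"
| "pconsts (PAdd a b) = pconsts a \<union> pconsts b"
| "pconsts (PMul a b) = pconsts a \<union> pconsts b"

fun pdeg :: "'v pexp => nat" where
  "pdeg (PConst c) = 0"
| "pdeg (PVar v) = 1"
| "pdeg (PAdd a b) = max (pdeg a) (pdeg b)"
| "pdeg (PMul a b) = pdeg a + pdeg b"

fun pdiff :: "('v => complex) => ('v => complex) => 'v pexp => complex" where
  "pdiff x t (PConst c) = 0"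
| "pdiff x t (PVar v) = t v"
| "pdiff x t (PAdd a b) = pdiff x t a + pdiff x t b"
| "pdiff x t (PMul a b) = pdiff x t a * peval x b + peval x a * pdiff x t b"

fun psubst :: "('v => 'w pexp) => 'v pexp => 'w pexp" where
  "psubst s (PConst c) = PConst c"
| "psubst s (PVar v) = s v"
| "psubst s (PAdd a b) = PAdd (psubst s a) (psubst s b)"
| "psubst s (PMul a b) = PMul (psubst s a) (psubst s b)"

lemma finite_pconsts: "finite (pconsts e)" by (induction e) auto

lemma peval_cong: "(\<And>v. v \<in> pvars e ==> x v = y v) ==> peval x e = peval y e" by (induction e) auto

lemma pdiff_cong:
  "(\<And>v. v \<in> pvars e ==> x v = y v \<and> s v = t v) ==> pdiff x s e = pdiff y t e" by (induction e) (auto simp: peval_cong[of _ x y])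

lemma peval_psubst: "peval x (psubst s e) = peval (\<lambda>v. peval x (s v)) e" by (induction e) auto

lemma pdiff_psubst: "pdiff x t (psubst s e) = pdiff (\<lambda>v. peval x (s v)) (\<lambda>v. pdiff x t (s v)) e"
  by (induction e) (auto simp: peval_psubst)

lemma pvars_psubst: "pvars (psubst s e) = (\<Union>v\<in>pvars e. pvars (s v))" by (induction e) auto

lemma pconsts_psubst: "pconsts (psubst s e) \<subseteq> pconsts e \<union> (\<Union>v\<in>pvars e. pconsts (s v))" by (induction e) auto

lemma peval_in_subring: "subring_set R ==> pconsts e \<subseteq> R ==> (\<And>v. v \<in> pvars e ==> x v \<in> R) ==> peval x e \<in> R"
  by (induction e) (auto intro: subring_setD)

text \<open>With \<open>K = UNIV\<close> this is the polynomial ring over the complex numbers,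
  realised by functions, so that no normal form of expressions is needed.\<close>

definition polyfuns :: "'v set => complex set => (('v => complex) => complex) set" where
  "polyfuns V K = {\<lambda>x. peval x e |e. pvars e \<subseteq> V \<and> pconsts e \<subseteq> K}"

lemma polyfunsI: "pvars e \<subseteq> V ==> pconsts e \<subseteq> K ==> (\<lambda>x. peval x e) \<in> polyfuns V K" by (auto simp: polyfuns_def)

lemma polyfuns_const: "c \<in> K ==> (\<lambda>x. c) \<in> polyfuns V K" using polyfunsI[of "PConst c" V K] by simp

lemma polyfuns_var: "v \<in> V ==> (\<lambda>x. x v) \<in> polyfuns V K" using polyfunsI[of "PVar v" V K] by simp

lemma
  assumes "f \<in> polyfuns V K" "g \<in> polyfuns V K"
  shows polyfuns_add: "(\<lambda>x. f x + g x) \<in> polyfuns V K" and polyfuns_mult: "(\<lambda>x. f x * g x) \<in> polyfuns V K"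
proof -
  obtain a b where "f = (\<lambda>x. peval x a)" "g = (\<lambda>x. peval x b)" "pvars a \<subseteq> V" "pconsts a \<subseteq> K"
    "pvars b \<subseteq> V" "pconsts b \<subseteq> K" using assms by (auto simp: polyfuns_def)
  thus "(\<lambda>x. f x + g x) \<in> polyfuns V K" "(\<lambda>x. f x * g x) \<in> polyfuns V K"
    using polyfunsI[of "PAdd a b" V K] polyfunsI[of "PMul a b" V K] by simp_all
qed

lemma polyfuns_sum:
  "0 \<in> K ==> (\<And>i. i \<in> A ==> f i \<in> polyfuns V K) ==> (\<lambda>x. \<Sum>i\<in>A. f i x) \<in> polyfuns V K"
  by (induction A rule: infinite_finite_induct) (auto intro: polyfuns_const polyfuns_add)

lemma polyfuns_prod:
  "1 \<in> K ==> (\<And>i. i \<in> A ==> f i \<in> polyfuns V K) ==> (\<lambda>x. \<Prod>i\<in>A. f i x) \<in> polyfuns V K"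
  by (induction A rule: infinite_finite_induct) (auto intro: polyfuns_const polyfuns_mult)

lemma polyfuns_power: "1 \<in> K ==> f \<in> polyfuns V K ==> (\<lambda>x. f x ^ n) \<in> polyfuns V K"
  by (induction n) (auto intro: polyfuns_const polyfuns_mult)

lemma subring_polyfuns: "subring_set (polyfuns V UNIV)" unfolding subring_set_def
proof (intro conjI ballI)
  show "0 \<in> polyfuns V UNIV" "1 \<in> polyfuns V UNIV" by (auto simp: zero_fun_def one_fun_def intro: polyfuns_const)
  show "f + g \<in> polyfuns V UNIV" "f * g \<in> polyfuns V UNIV" if "f \<in> polyfuns V UNIV" "g \<in> polyfuns V UNIV" for f g
    using polyfuns_add[OF that] polyfuns_mult[OF that] by (simp_all add: plus_fun_def times_fun_def)
  show "- f \<in> polyfuns V UNIV" if "f \<in> polyfuns V UNIV" for f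
    using polyfuns_mult[OF polyfuns_const[of "- 1"] that] by (simp add: fun_Compl_def)
qed

section \<open>The Nullstellensatz for one equation\<close>

lemma power_fun_apply: "((f :: 'a => complex) ^ n) x = f x ^ n" by (induction n) auto

text \<open>Monomials are indexed by lists of variables. For countably many variables there are only
  countably many finite sets of such lists, which is the countability set against the size of the
  complex numbers.\<close>

lemma peval_in_span:
  fixes e :: "'v pexp"
  shows "\<exists>S. finite S \<and> (\<lambda>x. peval x e) \<in> module.span (\<lambda>c f x. c * f x) ((\<lambda>l x. \<Prod>v\<leftarrow>l. x v) ` (S :: 'v list set))"
proof -
  interpret vs: vector_space "\<lambda>c (f :: ('v => complex) => complex) x. c * f x" by unfold_locales (auto simp: algebra_simps)
  define m where "m l = (\<lambda>x :: 'v => complex. \<Prod>v\<leftarrow>l. x v)" for l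
  have mult: "f * g \<in> vs.span (m ` ((\<lambda>(k, l). k @ l) ` (S \<times> T)))" if f: "f \<in> vs.span (m ` S)" and g: "g \<in> vs.span (m ` T)" for f g S T
  proof -
    let ?W = "vs.span (m ` ((\<lambda>(k, l). k @ l) ` (S \<times> T)))"
    have *: "m k * g \<in> ?W" if "k \<in> S" for k using g
    proof (induction rule: vs.span_induct_alt)
      case base
      thus ?case using vs.span_zero by (simp add: func_times zero_fun_def)
    next
      case (step c b y)
      then obtain l where l: "l \<in> T" "b = m l" by auto
      have "m k * m l = m (k @ l)" by (auto simp: m_def)
      moreover have "m (k @ l) \<in> ?W" by (rule vs.span_base) (use l that in force)
      ultimately have "(\<lambda>x. c * (m k * m l) x) + m k * y \<in> ?W" using step by (intro vs.span_add vs.span_scale) (simp_all add: func_times)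
      moreover have "m k * ((\<lambda>x. c * b x) + y) = (\<lambda>x. c * (m k * m l) x) + m k * y" by (auto simp: l algebra_simps)
      ultimately show ?case by (simp add: func_times func_plus)
    qed
    show ?thesis using f
    proof (induction rule: vs.span_induct_alt)
      case base
      thus ?case using vs.span_zero by (simp add: func_times zero_fun_def)
    next
      case (step c b y)
      then obtain k where k: "k \<in> S" "b = m k" by auto
      have "(\<lambda>x. c * (m k * g) x) + y * g \<in> ?W" using step *[OF k(1)] by (intro vs.span_add vs.span_scale)
      moreover have "((\<lambda>x. c * b x) + y) * g = (\<lambda>x. c * (m k * g) x) + y * g" by (auto simp: k algebra_simps)
      ultimately show ?case by (simp add: func_times func_plus)
    qed
  qed
  have "\<exists>S. finite S \<and> (\<lambda>x. peval x e) \<in> vs.span (m ` S)"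
  proof (induction e)
    case (PConst c)
    have "(\<lambda>x. c * m [] x) \<in> vs.span (m ` {[]})" by (intro vs.span_scale vs.span_base) simp
    thus ?case by (intro exI[of _ "{[]}"]) (simp add: m_def)
  next
    case (PVar v)
    have "m [v] \<in> vs.span (m ` {[v]})" by (intro vs.span_base) simp
    thus ?case by (intro exI[of _ "{[v]}"]) (simp add: m_def)
  next
    case (PAdd a b)
    then obtain S T where S: "finite S" "(\<lambda>x. peval x a) \<in> vs.span (m ` S)" "finite T" "(\<lambda>x. peval x b) \<in> vs.span (m ` T)" by blast
    have "(\<lambda>x. peval x a) + (\<lambda>x. peval x b) \<in> vs.span (m ` (S \<union> T))"
      by (rule vs.span_add) (use S vs.span_mono[of "m ` S" "m ` (S \<union> T)"] vs.span_mono[of "m ` T" "m ` (S \<union> T)"] in blast)+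
    thus ?case using S by (intro exI[of _ "S \<union> T"]) (simp add: plus_fun_def)
  next
    case (PMul a b)
    then obtain S T where S: "finite S" "(\<lambda>x. peval x a) \<in> vs.span (m ` S)" "finite T" "(\<lambda>x. peval x b) \<in> vs.span (m ` T)" by blast
    from mult[OF S(2,4)] show ?case using S by (intro exI[of _ "(\<lambda>(k, l). k @ l) ` (S \<times> T)"]) (simp add: times_fun_def)
  qed
  thus ?thesis by (simp add: m_def[abs_def])
qed

text \<open>This is where the uncountability of the complex numbers enters: the inverses \<open>h c\<close> of the
  functions \<open>x v - c\<close> modulo \<open>N\<close> lie in a space of countable dimension, so they are linearly dependent.\<close>

lemma exists_root_mod_prime_ideal:
  fixes v :: "'v::countable" and g :: "('v => complex) => complex"
  defines "P \<equiv> polyfuns (UNIV :: 'v set) UNIV"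
  assumes N: "ideal_set P N" and g: "g \<in> P" "\<And>k. g ^ k \<notin> N"
    and prime: "\<And>a b. a \<in> P ==> b \<in> P ==> a * b \<in> N ==> a \<in> N \<or> b \<in> N"
    and inv: "\<And>a. a \<in> P ==> a \<notin> N ==> \<exists>h\<in>P. \<exists>k. h * a - g ^ k \<in> N"
  shows "\<exists>c. (\<lambda>x. x v - c) \<in> N"
proof (rule ccontr)
  assume no: "\<not> (\<exists>c. (\<lambda>x. x v - c) \<in> N)"
  interpret vs: vector_space "\<lambda>c (f :: ('v => complex) => complex) x. c * f x" by unfold_locales (auto simp: algebra_simps)
  have sub: "subring_set P" unfolding P_def by (rule subring_polyfuns)
  define X where "X c = (\<lambda>x :: 'v => complex. x v - c)" for c
  have constP: "(\<lambda>x. c) \<in> P" for c unfolding P_def by (rule polyfuns_const) simp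
  have XP: "X c \<in> P" for c unfolding P_def X_def diff_conv_add_uminus by (intro polyfuns_add polyfuns_var polyfuns_const) auto
  have gP: "g ^ k \<in> P" for k by (rule subring_power[OF sub g(1)])
  have "\<forall>c. \<exists>h k. h \<in> P \<and> h * X c - g ^ k \<in> N"   proof
    fix c
    have "X c \<notin> N" using no by (auto simp: X_def)
    from inv[OF XP this] show "\<exists>h k. h \<in> P \<and> h * X c - g ^ k \<in> N" by blast
  qed
  then obtain h k where h: "\<And>c. h c \<in> P" "\<And>c. h c * X c - g ^ k c \<in> N" by metis
  define m where "m l = (\<lambda>x :: 'v => complex. \<Prod>v\<leftarrow>l. x v)" for l
  have "\<forall>c. \<exists>S. finite S \<and> h c \<in> vs.span (m ` S)"
  proof
    fix c
    obtain e where "h c = (\<lambda>x. peval x e)" using h(1)[of c] by (auto simp: P_def polyfuns_def)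
    thus "\<exists>S. finite S \<and> h c \<in> vs.span (m ` S)" using peval_in_span[of e] by (simp add: m_def[abs_def])
  qed
  then obtain S where S: "\<And>c. finite (S c)" "\<And>c. h c \<in> vs.span (m ` S c)" by metis
  \<comment> \<open>Uncountably many c but countably many pairs of an exponent and a finite set of
    monomials: infinitely many c share both, so their \<open>h c\<close> lie in one
    finite-dimensional space.\<close>
  obtain K T where KT: "infinite {c. k c = K \<and> S c = T}"
  proof (rule ccontr)
    assume "\<not> thesis"
    hence fin: "finite {c. k c = K \<and> S c = T}" for K T using that by blast
    have "UNIV = (\<Union>z\<in>UNIV \<times> {T. finite T}. {c. k c = fst z \<and> S c = snd z})" using S(1) by auto
    moreover have "countable (\<Union>z\<in>UNIV \<times> {T. finite T}. {c. k c = fst z \<and> S c = snd z})"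
      using fin by (intro countable_UN countable_SIGMA countable_Collect_finite) (auto intro: countable_finite)
    ultimately show False using uncountable_UNIV_complex by metis
  qed
  define C where "C = {c. k c = K \<and> S c = T}"
  have hX: "h c * X c - g ^ K \<in> N" if "c \<in> C" for c using h(2)[of c] that by (simp add: C_def)
  \<comment> \<open>If \<open>h c = h c'\<close>, subtracting the two congruences puts
    \<open>(c' - c) * h c\<close> into \<open>N\<close>, hence \<open>h c\<close> and then a power
    of \<open>g\<close>.\<close>
  have inj: "inj_on h C"
  proof (rule inj_onI, rule ccontr)
    fix c c' assume c: "c \<in> C" "c' \<in> C" "h c = h c'" "c \<noteq> c'"
    have "(h c * X c - g ^ K) - (h c' * X c' - g ^ K) \<in> N" by (intro ideal_set_minus[OF sub N] hX c)
    moreover have "(h c * X c - g ^ K) - (h c' * X c' - g ^ K) = (\<lambda>x. c' - c) * h c"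
      unfolding c(3) by (rule ext) (simp add: X_def algebra_simps)
    ultimately have "(\<lambda>x. c' - c) * h c \<in> N" by simp
    hence "(\<lambda>x. inverse (c' - c)) * ((\<lambda>x. c' - c) * h c) \<in> N" by (rule ideal_setD(4)[OF N constP])
    also have "(\<lambda>x. inverse (c' - c)) * ((\<lambda>x. c' - c) * h c) = h c" using c(4) by (auto simp: fun_eq_iff)
    finally have "h c \<in> N" .
    hence "h c * X c \<in> N" by (rule ideal_setD(5)[OF N XP])
    from ideal_set_minus[OF sub N this hX[OF c(1)]] show False using g(2)[of K] by simp
  qed
  have "h ` C \<subseteq> vs.span (m ` T)" using S(2) by (auto simp: C_def)
  moreover have "infinite (h ` C)" using KT inj by (simp add: finite_image_iff C_def)
  moreover have "finite (m ` T)"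
  proof -
    obtain c where "k c = K \<and> S c = T" using infinite_imp_nonempty[OF KT] by blast
    hence "finite T" using S(1)[of c] by simp
    thus ?thesis by simp
  qed
  ultimately have "vs.dependent (h ` C)" using vs.independent_span_bound by blast
  then obtain t u where t: "finite t" "t \<subseteq> h ` C" "(\<Sum>f\<in>t. (\<lambda>x. u f * f x)) = 0" "\<exists>f\<in>t. u f \<noteq> 0"
    unfolding vs.dependent_explicit by blast
  obtain D where D: "D \<subseteq> C" "t = h ` D" using t(2) by (auto simp: subset_image_iff)
  have injD: "inj_on h D" using inj D(1) by (rule inj_on_subset)
  have finD: "finite D" using t(1) D(2) injD by (simp add: finite_image_iff)
  define w where "w c = u (h c)" for c
  have sum0: "(\<Sum>c\<in>D. w c * h c x) = 0" for x
  proof -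
    have "(\<Sum>f\<in>t. (\<lambda>x. u f * f x)) x = 0" using t(3) by simp
    moreover have "(\<Sum>f\<in>t. (\<lambda>x. u f * f x)) x = (\<Sum>f\<in>t. u f * f x)" by (induction t rule: infinite_finite_induct) auto
    ultimately show ?thesis unfolding D(2) w_def by (subst (asm) sum.reindex[OF injD]) (simp add: sum.reindex[OF injD])
  qed
  define W where "W c = (\<lambda>x. \<Prod>c'\<in>D - {c}. X c' x)" for c
  have WP: "W c \<in> P" for c unfolding W_def P_def by (intro polyfuns_prod) (use XP in "auto simp: P_def")
  \<comment> \<open>Modulo \<open>N\<close>, \<open>h c\<close> behaves like
    \<open>g ^ K / (x v - c)\<close>. \<open>U\<close> is the numerator of the linear relation after
    clearing these denominators, and it is nonzero because it does not vanish at a c with nonzero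
    weight.\<close>
  define U where "U = (\<Sum>c\<in>D. smult (w c) (\<Prod>c'\<in>D - {c}. [:- c', 1:]))"
  have Ux: "poly U (x v) = (\<Sum>c\<in>D. w c * W c x)" for x by (simp add: U_def poly_sum poly_prod W_def X_def)
  have "U \<noteq> 0"
  proof -
    obtain c where c: "c \<in> D" "w c \<noteq> 0" using t(4) D(2) by (auto simp: w_def)
    have "poly U c = (\<Sum>c0\<in>D. if c0 = c then w c * (\<Prod>c'\<in>D - {c}. c - c') else 0)" unfolding U_def poly_sum
    proof (rule sum.cong[OF refl])
      fix c0 assume "c0 \<in> D"
      show "poly (smult (w c0) (\<Prod>c'\<in>D - {c0}. [:- c', 1:])) c = (if c0 = c then w c * (\<Prod>c'\<in>D - {c}. c - c') else 0)"
        using finD c(1) by (auto simp: poly_prod)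
    qed
    also have "\<dots> = w c * (\<Prod>c'\<in>D - {c}. c - c')" using c(1) finD by simp
    finally show ?thesis using c(2) finD by auto
  qed
  have "g ^ K * (\<lambda>x. poly U (x v)) \<in> N"
  proof -
    have "(\<lambda>x. w c) * (W c * (h c * X c - g ^ K)) \<in> N" if "c \<in> D" for c
      using that D(1) by (intro ideal_setD(4)[OF N] constP WP hX) auto
    hence "(\<Sum>c\<in>D. (\<lambda>x. w c) * (W c * (h c * X c - g ^ K))) \<in> N" by (rule ideal_set_sum[OF N])
    moreover have "(\<Sum>c\<in>D. (\<lambda>x. w c) * (W c * (h c * X c - g ^ K))) = - (g ^ K * (\<lambda>x. poly U (x v)))"
    proof
      fix x
      have "(\<Sum>c\<in>D. (\<lambda>x. w c) * (W c * (h c * X c - g ^ K))) x = (\<Sum>c\<in>D. w c * (W c x * (h c x * X c x - (g ^ K) x)))"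
        by (induction D rule: infinite_finite_induct) auto
      also have "\<dots> = (\<Sum>c\<in>D. (\<Prod>c'\<in>D. X c' x) * (w c * h c x) - (g ^ K) x * (w c * W c x))"
        by (rule sum.cong) (auto simp: W_def prod.remove[OF finD, of _ "\<lambda>c. X c x"] algebra_simps)
      also have "\<dots> = (\<Prod>c'\<in>D. X c' x) * (\<Sum>c\<in>D. w c * h c x) - (g ^ K) x * (\<Sum>c\<in>D. w c * W c x)"
        by (simp add: sum_subtractf sum_distrib_left)
      finally show "(\<Sum>c\<in>D. (\<lambda>x. w c) * (W c * (h c * X c - g ^ K))) x = (- (g ^ K * (\<lambda>x. poly U (x v)))) x"
        by (simp add: sum0 Ux)
    qed
    ultimately show ?thesis using ideal_set_uminus[OF sub N] by fastforce
  qed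
  have Upoly: "(\<lambda>x. poly Q (x v)) \<in> P" for Q
  proof (induction Q)
    case 0
    thus ?case using constP by simp
  next
    case (pCons a Q)
    have "(\<lambda>x. a) + (\<lambda>x. x v) * (\<lambda>x. poly Q (x v)) \<in> P"
      using XP[of 0] by (intro subring_setD(3,4)[OF sub] constP pCons) (simp add: X_def)
    thus ?case by (simp add: plus_fun_def times_fun_def)
  qed
  hence "(\<lambda>x. poly U (x v)) \<in> N" using prime[OF gP Upoly] g(2) \<open>g ^ K * (\<lambda>x. poly U (x v)) \<in> N\<close> by blast
  \<comment> \<open>\<open>U\<close> splits into linear factors over the complex numbers, so the
    prime \<open>N\<close> would contain one of the excluded functions
    \<open>x v - a\<close>.\<close>
  thus False using \<open>U \<noteq> 0\<close>
  proof (induction "degree U" arbitrary: U)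
    case 0
    then obtain c where c: "U = [:c:]" using degree_0_id by metis
    hence "(\<lambda>x. inverse c) * (\<lambda>x. poly U (x v)) \<in> N" using 0 by (intro ideal_setD(4)[OF N] constP)
    moreover have "(\<lambda>x :: 'v => complex. inverse c) * (\<lambda>x. poly U (x v)) = g ^ 0" using c 0 by (auto simp: fun_eq_iff)
    ultimately show False using g(2)[of 0] by simp
  next
    case (Suc n)
    have "\<not> constant (poly U)" using Suc.hyps(2) by (simp add: constant_degree)
    then obtain a where "poly U a = 0" using fundamental_theorem_of_algebra by blast
    then obtain Q where Q: "U = [:- a, 1:] * Q" by (metis dvdE poly_eq_0_iff_dvd)
    hence "Q \<noteq> 0" using Suc.prems by auto
    hence "degree Q = n" using Suc.hyps(2) Q by (simp add: degree_mult_eq del: mult_pCons_left)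
    have "X a * (\<lambda>x. poly Q (x v)) \<in> N" using Suc.prems(1) unfolding Q by (simp add: X_def times_fun_def algebra_simps)
    hence "(\<lambda>x. poly Q (x v)) \<in> N" using prime[OF XP Upoly] no by (auto simp: X_def)
    thus False using Suc.hyps(1)[of Q] \<open>degree Q = n\<close> \<open>Q \<noteq> 0\<close> by blast
  qed
qed

text \<open>Otherwise some prime \<open>N\<close> contains \<open>f\<close> but no power of
  \<open>g\<close>. The roots modulo \<open>N\<close> of the single variables form a point
  \<open>c\<close> at which \<open>f\<close> vanishes; then \<open>g\<close> vanishes at
  \<open>c\<close>, which puts \<open>g\<close> into \<open>N\<close>.\<close>

theorem nullstellensatz_principal:
  fixes f g :: "('v::countable => complex) => complex"
  assumes f: "f \<in> polyfuns UNIV UNIV" and g: "g \<in> polyfuns UNIV UNIV"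
    and fg: "\<And>x. f x = 0 ==> g x = 0"
  obtains k a where "a \<in> polyfuns UNIV UNIV" "\<And>x. g x ^ k = a x * f x"
proof (rule ccontr)
  assume *: "\<not> thesis"
  let ?P = "polyfuns (UNIV :: 'v set) UNIV"
  define J where "J = {a * f |a. a \<in> ?P}"
  have sub: "subring_set ?P" by (rule subring_polyfuns)
  have J: "ideal_set ?P J" unfolding ideal_set_def
  proof (intro conjI ballI)
    show "J \<subseteq> ?P" using f subring_setD(4)[OF sub] by (auto simp: J_def)
    show "0 \<in> J" using subring_setD(1)[OF sub] unfolding J_def by (intro CollectI exI[of _ 0]) simp
    show "x + y \<in> J" if xy: "x \<in> J" "y \<in> J" for x y
    proof -
      obtain a b where "x = a * f" "y = b * f" "a \<in> ?P" "b \<in> ?P" using xy by (auto simp: J_def)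
      thus ?thesis using subring_setD(3)[OF sub, of a b] by (auto simp: J_def distrib_right intro!: exI[of _ "a + b"])
    qed
    show "c * x \<in> J" if cx: "c \<in> ?P" "x \<in> J" for c x
    proof -
      obtain a where "x = a * f" "a \<in> ?P" using cx by (auto simp: J_def)
      thus ?thesis using subring_setD(4)[OF sub, of c a] cx by (auto simp: J_def mult.assoc intro!: exI[of _ "c * a"])
    qed
  qed
  have "g ^ k \<notin> J" for k
  proof
    assume "g ^ k \<in> J"
    then obtain a where a: "a \<in> ?P" "g ^ k = a * f" by (auto simp: J_def)
    have "g x ^ k = a x * f x" for x using fun_cong[OF a(2), of x] by (simp add: power_fun_apply)
    thus False using * that a(1) by blast
  qed
  from prime_ideal_avoiding_powers[OF sub J g this] obtain N where N: "ideal_set ?P N" "J \<subseteq> N" "\<And>k. g ^ k \<notin> N"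
    "\<And>a b. a \<in> ?P ==> b \<in> ?P ==> a * b \<in> N ==> a \<in> N \<or> b \<in> N"
    "\<And>a. a \<in> ?P ==> a \<notin> N ==> \<exists>h\<in>?P. \<exists>k. h * a - g ^ k \<in> N" by metis
  have "\<forall>v. \<exists>c. (\<lambda>x. x v - c) \<in> N" using exists_root_mod_prime_ideal[OF N(1) g N(3,4,5)] by blast
  then obtain c where c: "\<And>v. (\<lambda>x. x v - c v) \<in> N" by metis
  have constP: "(\<lambda>x. b) \<in> ?P" for b by (rule polyfuns_const) simp
  have eP: "(\<lambda>x. peval x e) \<in> ?P" for e by (rule polyfunsI) auto
  \<comment> \<open>Evaluation at \<open>c\<close> is reduction modulo \<open>N\<close>.\<close>
  have e: "(\<lambda>x. peval x e) - (\<lambda>x. peval c e) \<in> N" for e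
  proof (induction e)
    case (PConst b)
    thus ?case using ideal_setD(2)[OF N(1)] by (simp add: fun_diff_def zero_fun_def)
  next
    case (PVar v)
    thus ?case using c[of v] by (simp add: fun_diff_def)
  next
    case (PAdd a b)
    from ideal_setD(3)[OF N(1) PAdd.IH] show ?case by (simp add: fun_diff_def plus_fun_def algebra_simps)
  next
    case (PMul a b)
    have "(\<lambda>x. peval x a) * ((\<lambda>x. peval x b) - (\<lambda>x. peval c b)) + (\<lambda>x. peval c b) * ((\<lambda>x. peval x a) - (\<lambda>x. peval c a)) \<in> N"
      by (intro ideal_setD(3)[OF N(1)] ideal_setD(4)[OF N(1)] PMul.IH eP constP)
    thus ?case by (simp add: fun_diff_def plus_fun_def times_fun_def algebra_simps)
  qed
  have const: "b = 0" if "(\<lambda>x. b) \<in> N" for b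
  proof (rule ccontr)
    assume "b \<noteq> 0"
    have "(\<lambda>x. inverse b) * (\<lambda>x. b) \<in> N" by (intro ideal_setD(4)[OF N(1)] constP that)
    moreover have "(\<lambda>x :: 'v => complex. inverse b) * (\<lambda>x. b) = g ^ 0" using \<open>b \<noteq> 0\<close> by auto
    ultimately show False using N(3)[of 0] by simp
  qed
  obtain ef eg where ef: "f = (\<lambda>x. peval x ef)" "g = (\<lambda>x. peval x eg)" using f g by (auto simp: polyfuns_def)
  have "1 * f \<in> J" using subring_setD(2)[OF sub] unfolding J_def by blast
  hence "f \<in> N" using N(2) by auto
  from ideal_set_minus[OF sub N(1) this e[of ef]] have "(\<lambda>x. peval c ef) \<in> N" by (simp add: ef)
  hence "peval c ef = 0" by (rule const)
  hence "peval c eg = 0" using fg[of c] by (simp add: ef)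
  hence "g \<in> N" using e[of eg] by (simp add: ef fun_diff_def)
  thus False using N(3)[of 1] by simp
qed

section \<open>Etale orbits\<close>

lemma pdiff_add: "pdiff x (\<lambda>v. s v + t v) e = pdiff x s e + pdiff x t e" by (induction e) (auto simp: algebra_simps)

lemma pdiff_scale: "pdiff x (\<lambda>v. c * t v) e = c * pdiff x t e" by (induction e) (auto simp: algebra_simps)

lemma pdiff_zero: "pdiff x (\<lambda>v. 0) e = 0" using pdiff_scale[of x 0 "\<lambda>v. 0" e] by simp

lemma pdiff_diff: "pdiff x (\<lambda>v. s v - t v) e = pdiff x s e - pdiff x t e" using pdiff_add[of x "\<lambda>v. s v - t v" t e] by simp

lemma pdiff_sum: "pdiff x (\<lambda>v. \<Sum>i\<in>A. t i v) e = (\<Sum>i\<in>A. pdiff x (t i) e)"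
  by (induction A rule: infinite_finite_induct) (auto simp: pdiff_zero pdiff_add)

section \<open>Weights of polynomial functions around an orbit point\<close>

context filtered_ring
begin

lemma pdiff_in_I:
  assumes "pconsts e \<subseteq> R" "\<And>v. v \<in> pvars e ==> x v \<in> R" "\<And>v. v \<in> pvars e ==> t v \<in> I j"
  shows "pdiff x t e \<in> I j" using assms
proof (induction e)
  case (PMul a b)
  have "peval x a \<in> R" "peval x b \<in> R" using PMul.prems by (auto intro!: peval_in_subring subring)
  moreover have "pdiff x t a \<in> I j" "pdiff x t b \<in> I j" using PMul by auto
  ultimately show ?case using ideal_setD(3)[OF I_ideal ideal_setD(5)[OF I_ideal] ideal_setD(4)[OF I_ideal]] by simp
qed (auto intro: ideal_setD(2,3)[OF I_ideal])

lemma pdiff_in_R: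
  assumes "pconsts e \<subseteq> R" "\<And>v. v \<in> pvars e ==> x v \<in> R" "\<And>v. v \<in> pvars e ==> t v \<in> R"
  shows "pdiff x t e \<in> R" using pdiff_in_I[of e x t 0] assms I_0 by auto

text \<open>Polynomial functions with coefficients in \<open>R\<close>, filtered by the order of the coefficients, where each
  \<open>x v - y v\<close> counts twice.\<close>

inductive weight :: "'v set => ('v => complex) => (('v => complex) => complex) => nat => bool" for V y where
  const: "c \<in> I j ==> weight V y (\<lambda>x. c) j"
| var: "v \<in> V ==> weight V y (\<lambda>x. x v - y v) 2"
| add: "weight V y f j ==> weight V y g j ==> weight V y (\<lambda>x. f x + g x) j"
| mult: "weight V y f i ==> weight V y g j ==> weight V y (\<lambda>x. f x * g x) (i + j)"
| mono: "weight V y f j ==> i \<le> j ==> weight V y f i"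

lemma weight_at: "weight V y f j ==> f y \<in> I j"
proof (induction rule: weight.induct)
  case (mono f j i)
  thus ?case using I_antimono by blast
qed (auto intro: ideal_setD(2,3)[OF I_ideal] I_mult)

lemma weight_scale: "c \<in> R ==> weight V y f j ==> weight V y (\<lambda>x. c * f x) j"
  using weight.mult[OF weight.const[of c 0] , of V y f j] I_0 by simp

lemma weight_zero: "weight V y (\<lambda>x. 0) j" by (intro weight.const ideal_setD(2)[OF I_ideal])

lemma weight_sum: "(\<And>i. i \<in> A ==> weight V y (f i) j) ==> weight V y (\<lambda>x. \<Sum>i\<in>A. f i x) j"
  by (induction A rule: infinite_finite_induct) (auto intro: weight_zero weight.add)

lemma weight_compose:
  assumes "weight V y f j" and g: "\<And>v. v \<in> V ==> weight V z (\<lambda>x. g x v - y v) 2"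
  shows "weight V z (\<lambda>x. f (g x)) j" using assms(1) by (induction rule: weight.induct) (auto intro: weight.intros g)

text \<open>A discrete Leibniz rule. If \<open>g\<close> moves each coordinate by weight 4, two more
  than the weight of a coordinate, then the difference of \<open>f\<close> along \<open>g\<close>
  gains weight 2.\<close>

lemma weight_difference:
  assumes "weight V y f j" and g: "\<And>v. v \<in> V ==> weight V y (\<lambda>x. g x v - x v) 4"
  shows "weight V y (\<lambda>x. f (g x) - f x) (j + 2)"
proof -
  have g2: "weight V y (\<lambda>x. g x v - y v) 2" if "v \<in> V" for v
    using weight.add[OF weight.mono[OF g[OF that], of 2] weight.var[OF that]] by simp
  show ?thesis using assms(1)
  proof (induction rule: weight.induct)
    case (const c j)
    thus ?case using weight_zero by simp
  next
    case (var v)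
    thus ?case using g[OF var] by simp
  next
    case (add f j f')
    from weight.add[OF add.IH] show ?case by (simp add: algebra_simps)
  next
    case (mult f i f' j)
    have 1: "weight V y (\<lambda>x. (f (g x) - f x) * f' (g x)) (i + 2 + j)" by (rule weight.mult[OF mult.IH(1) weight_compose[OF mult.hyps(2) g2]])
    have 2: "weight V y (\<lambda>x. f x * (f' (g x) - f' x)) (i + (j + 2))" by (rule weight.mult[OF mult.hyps(1) mult.IH(2)])
    have "weight V y (\<lambda>x. (f (g x) - f x) * f' (g x) + f x * (f' (g x) - f' x)) (i + j + 2)"
      using 1 2 by (intro weight.add) (simp_all add: add_ac)
    thus ?case by (simp add: algebra_simps)
  next
    case (mono f j i)
    thus ?case by (meson add_le_mono1 weight.mono)
  qed
qed

lemma weight_peval: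
  assumes "pvars e \<subseteq> V" "pconsts e \<subseteq> R" "\<And>v. v \<in> V ==> y v \<in> R"
  shows "weight V y (\<lambda>x. peval x e) 0" using assms
proof (induction e)
  case (PConst c)
  thus ?case using I_0 by (auto intro: weight.const)
next
  case (PVar v)
  hence "weight V y (\<lambda>x. (x v - y v) + y v) 0" using I_0 by (intro weight.add weight.const weight.mono[OF weight.var]) auto
  thus ?case by simp
next
  case (PAdd a b)
  thus ?case by (auto intro: weight.add)
next
  case (PMul a b)
  thus ?case using weight.mult[of V y "\<lambda>x. peval x a" 0 "\<lambda>x. peval x b" 0] by auto
qed

lemma weight_pdiff:
  assumes "pvars e \<subseteq> V" "pconsts e \<subseteq> R" "\<And>v. v \<in> V ==> z v \<in> R"
    "\<And>v. v \<in> V ==> weight V y (\<lambda>x. t x v) j"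
  shows "weight V y (\<lambda>x. pdiff z (t x) e) j" using assms
proof (induction e)
  case (PMul a b)
  have "peval z a \<in> R" "peval z b \<in> R" by (rule peval_in_subring[OF subring]; use PMul.prems in auto)+
  hence "weight V y (\<lambda>x. peval z b * pdiff z (t x) a + peval z a * pdiff z (t x) b) j" using PMul by (intro weight.add weight_scale) auto
  thus ?case by (simp add: mult.commute)
qed (auto intro: weight_zero weight.add)

text \<open>Taylor expansion to first order: the remainder consists of products of at least two
  increments, each of weight 2.\<close>

lemma weight_linear:
  assumes "pvars e \<subseteq> V" "pconsts e \<subseteq> R" "\<And>v. v \<in> V ==> y v \<in> R"
  shows "weight V y (\<lambda>x. peval x e - peval y e) 2 \<and>
    weight V y (\<lambda>x. peval x e - peval y e - pdiff y (\<lambda>v. x v - y v) e) 4" using assms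
proof (induction e)
  case (PConst c)
  thus ?case by (simp add: weight_zero)
next
  case (PVar v)
  thus ?case by (simp add: weight_zero weight.var)
next
  case (PAdd a b)
  hence IH: "weight V y (\<lambda>x. peval x a - peval y a) 2" "weight V y (\<lambda>x. peval x b - peval y b) 2"
    "weight V y (\<lambda>x. peval x a - peval y a - pdiff y (\<lambda>v. x v - y v) a) 4"
    "weight V y (\<lambda>x. peval x b - peval y b - pdiff y (\<lambda>v. x v - y v) b) 4" by auto
  from weight.add[OF IH(1,2)] weight.add[OF IH(3,4)] show ?case by (simp add: algebra_simps)
next
  case (PMul a b)
  hence IH: "weight V y (\<lambda>x. peval x a - peval y a) 2" "weight V y (\<lambda>x. peval x b - peval y b) 2"
    "weight V y (\<lambda>x. peval x a - peval y a - pdiff y (\<lambda>v. x v - y v) a) 4"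
    "weight V y (\<lambda>x. peval x b - peval y b - pdiff y (\<lambda>v. x v - y v) b) 4" by auto
  have R: "peval y a \<in> R" "peval y b \<in> R" by (rule peval_in_subring[OF subring]; use PMul.prems in auto)+
  have 4: "weight V y (\<lambda>x. (peval x a - peval y a) * (peval x b - peval y b)) 4" using weight.mult[OF IH(1,2)] by simp
  have "weight V y (\<lambda>x. (peval x a - peval y a) * (peval x b - peval y b) +
      (peval y a * (peval x b - peval y b) + peval y b * (peval x a - peval y a))) 2" by (intro weight.add weight_scale R IH weight.mono[OF 4]) simp
  moreover have "weight V y (\<lambda>x. (peval x a - peval y a) * (peval x b - peval y b) +
      (peval y a * (peval x b - peval y b - pdiff y (\<lambda>v. x v - y v) b) +
       peval y b * (peval x a - peval y a - pdiff y (\<lambda>v. x v - y v) a))) 4" by (intro weight.add weight_scale R IH 4)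
  ultimately show ?case by (simp add: algebra_simps)
qed

text \<open>The inner choice fixes a finite set of representatives, and the outer one depends only
  on the congruence class of \<open>x\<close>. Hence congruence becomes equality of
  residues.\<close>

definition residue :: "nat => complex => complex" where
  "residue j x = (SOME r. r \<in> (SOME F. finite F \<and> F \<subseteq> R \<and> (\<forall>x\<in>R. \<exists>r\<in>F. x - r \<in> I j)) \<and> x - r \<in> I j)"

lemma residue:
  shows "finite (residue j ` R)" "x \<in> R ==> residue j x \<in> R" "x \<in> R ==> x - residue j x \<in> I j"
    "x \<in> R ==> y \<in> R ==> residue j x = residue j y \<longleftrightarrow> x - y \<in> I j"
proof -
  define F where "F = (SOME F. finite F \<and> F \<subseteq> R \<and> (\<forall>x\<in>R. \<exists>r\<in>F. x - r \<in> I j))"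
  have F: "finite F \<and> F \<subseteq> R \<and> (\<forall>x\<in>R. \<exists>r\<in>F. x - r \<in> I j)"
    unfolding F_def by (rule someI_ex[OF finite_quotient])
  have r: "residue j x \<in> F \<and> x - residue j x \<in> I j" if "x \<in> R" for x
    unfolding residue_def F_def[symmetric] by (rule someI_ex) (use F that in blast)
  show "finite (residue j ` R)" using F r by (meson finite_subset image_subsetI)
  show "x \<in> R ==> residue j x \<in> R" "x \<in> R ==> x - residue j x \<in> I j" using F r by blast+
  assume xy: "x \<in> R" "y \<in> R"
  show "residue j x = residue j y \<longleftrightarrow> x - y \<in> I j"
  proof
    assume eq: "residue j x = residue j y"
    have "(x - residue j x) - (y - residue j y) \<in> I j" by (rule ideal_set_minus[OF subring I_ideal]) (use r xy in blast)+
    thus "x - y \<in> I j" by (simp add: eq)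
  next
    assume d: "x - y \<in> I j"
    have "x - r \<in> I j \<longleftrightarrow> y - r \<in> I j" for r
      using ideal_set_minus[OF subring I_ideal _ d, of "x - r"] ideal_setD(3)[OF I_ideal _ d, of "y - r"] by auto
    thus "residue j x = residue j y" unfolding residue_def by simp
  qed
qed

text \<open>Modulo \<open>I j\<close> this is an injective self-map of a finite group.\<close>

lemma surjective_mod:
  fixes f :: "('v => complex) => 'v => complex"
  assumes V: "finite V"
    and fR: "\<And>t v. (\<And>v. v \<in> V ==> t v \<in> R) ==> v \<in> V ==> f t v \<in> R"
    and fdiff: "\<And>s t v. v \<in> V ==> f (\<lambda>v. s v - t v) v = f s v - f t v"
    and inj: "\<And>t. (\<And>v. v \<in> V ==> t v \<in> R) ==> (\<And>v. v \<in> V ==> f t v \<in> I j) ==> (\<And>v. v \<in> V ==> t v \<in> I j)"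
    and t: "\<And>v. v \<in> V ==> t v \<in> R"
  shows "\<exists>s. (\<forall>v\<in>V. s v \<in> R) \<and> (\<forall>v\<in>V. f s v - t v \<in> I j)"
proof -
  let ?A = "PiE V (\<lambda>_. residue j ` R)"
  define \<Phi> where "\<Phi> s = (\<lambda>v\<in>V. residue j (f s v))" for s
  have mem: "\<exists>x\<in>R. s v = residue j x" if "s \<in> ?A" "v \<in> V" for s v using PiE_mem[OF that] by (simp add: image_iff)
  have AR: "s v \<in> R" if "s \<in> ?A" "v \<in> V" for s v using mem[OF that] by (auto simp: residue(2))
  have idem: "residue j (s v) = s v" if "s \<in> ?A" "v \<in> V" for s v
  proof -
    obtain x where x: "x \<in> R" "s v = residue j x" using mem[OF \<open>s \<in> ?A\<close> \<open>v \<in> V\<close>] by blast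
    have "residue j x - x \<in> I j" using ideal_set_uminus[OF subring I_ideal residue(3)[OF x(1)]] by simp
    thus ?thesis unfolding x(2) using residue(4)[OF residue(2)[OF x(1)] x(1)] by blast
  qed
  have "finite ?A" using V residue(1) by (intro finite_PiE) auto
  moreover have "\<Phi> ` ?A \<subseteq> ?A" using fR AR by (auto simp: \<Phi>_def)
  moreover have "inj_on \<Phi> ?A"
  proof (rule inj_onI)
    fix s s' assume s: "s \<in> ?A" "s' \<in> ?A" "\<Phi> s = \<Phi> s'"
    have "f (\<lambda>v. s v - s' v) v \<in> I j" if v: "v \<in> V" for v
    proof -
      have "residue j (f s v) = residue j (f s' v)" using fun_cong[OF s(3), of v] v by (simp add: \<Phi>_def)
      moreover have "f s v \<in> R" "f s' v \<in> R" by (rule fR[OF AR v]; use s in blast)+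
      ultimately have "f s v - f s' v \<in> I j" using residue(4) by blast
      thus ?thesis by (simp add: fdiff v)
    qed
    hence d: "s v - s' v \<in> I j" if "v \<in> V" for v using inj[of "\<lambda>v. s v - s' v"] subring_setD(6)[OF subring] AR s that by blast
    show "s = s'"
    proof (rule PiE_ext[OF s(1,2)])
      fix v assume v: "v \<in> V"
      have "residue j (s v) = residue j (s' v)" using residue(4)[OF AR[OF s(1) v] AR[OF s(2) v]] d[OF v] by blast
      thus "s v = s' v" using idem s v by simp
    qed
  qed
  ultimately have surj: "\<Phi> ` ?A = ?A" by (rule endo_inj_surj)
  have "(\<lambda>v\<in>V. residue j (t v)) \<in> ?A" using t by auto
  hence "(\<lambda>v\<in>V. residue j (t v)) \<in> \<Phi> ` ?A" by (simp only: surj)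
  then obtain s where s': "(\<lambda>v\<in>V. residue j (t v)) = \<Phi> s" and s: "s \<in> ?A" by (rule imageE)
  have "f s v - t v \<in> I j" if v: "v \<in> V" for v
  proof -
    have "residue j (f s v) = residue j (t v)" using fun_cong[OF s', of v] v by (simp add: \<Phi>_def)
    moreover have "f s v \<in> R" by (rule fR[OF AR[OF s] v])
    ultimately show ?thesis using residue(4) t[OF v] by blast
  qed
  thus ?thesis using AR[OF s] by (intro exI[of _ s] conjI ballI)
qed

end

text \<open>Modulo \<open>I 2\<close>, where finite quotients make injectivity and invertibility the
  same, the derivative is required to be injective at the orbit points only, not everywhere.\<close>

locale etale_orbit = filtered_ring +
  fixes V :: "'v set" and G :: "'v => 'v pexp" and y :: "nat => 'v => complex"
  assumes finite_V: "finite V"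
    and G_vars: "v \<in> V ==> pvars (G v) \<subseteq> V"
    and G_consts: "v \<in> V ==> pconsts (G v) \<subseteq> R"
    and y_0: "v \<in> V ==> y 0 v \<in> R"
    and y_Suc: "v \<in> V ==> y (Suc n) v = peval (y n) (G v)"
    and derivative_injective: "(\<And>v. v \<in> V ==> t v \<in> R) ==>
      (\<And>v. v \<in> V ==> pdiff (y n) t (G v) \<in> I 2) ==> v \<in> V ==> t v \<in> I 2"
begin

lemma y_in_R: "v \<in> V ==> y n v \<in> R"
proof (induction n arbitrary: v)
  case (Suc n)
  thus ?case unfolding y_Suc[OF Suc.prems] by (intro peval_in_subring subring) (use G_vars G_consts in blast)+
qed (rule y_0)

definition step :: "('v => complex) => 'v => complex" where "step x = (\<lambda>v. peval x (G v))"

lemma y_add: "v \<in> V ==> y (n + k) v = (step ^^ k) (y n) v"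
proof (induction k arbitrary: v)
  case (Suc k)
  have "peval (y (n + k)) (G v) = peval ((step ^^ k) (y n)) (G v)" by (rule peval_cong) (use G_vars Suc in blast)
  thus ?case using Suc.prems by (simp add: y_Suc step_def[of "(step ^^ k) (y n)"])
qed simp

text \<open>Derivative of the k-th iterate of \<open>step\<close> at \<open>y n\<close> in direction
  \<open>t\<close>, by the chain rule along the orbit.\<close>

fun D :: "nat => nat => ('v => complex) => 'v => complex" where
  "D n 0 t = t"
| "D n (Suc k) t = (\<lambda>v. pdiff (y (n + k)) (D n k t) (G v))"

lemma D_in_I:
  assumes "\<And>v. v \<in> V ==> t v \<in> I j" shows "v \<in> V ==> D n k t v \<in> I j"
proof (induction k arbitrary: v)
  case (Suc k)
  show ?case unfolding D.simps by (rule pdiff_in_I) (use Suc G_vars G_consts y_in_R in blast)+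
qed (use assms in simp)

lemma D_in_R: "(\<And>v. v \<in> V ==> t v \<in> R) ==> v \<in> V ==> D n k t v \<in> R" using D_in_I[of t 0 v n k] I_0 by simp

lemma D_cong: "(\<And>v. v \<in> V ==> s v = t v) ==> v \<in> V ==> D n k s v = D n k t v"
proof (induction k arbitrary: v)
  case (Suc k)
  show ?case unfolding D.simps by (rule pdiff_cong) (use Suc G_vars in blast)
qed simp

lemma D_diff: "D n k (\<lambda>v. s v - t v) = (\<lambda>v. D n k s v - D n k t v)" by (induction k) (auto simp: pdiff_diff)

lemma D_scale: "D n k (\<lambda>v. c * t v) = (\<lambda>v. c * D n k t v)" by (induction k) (auto simp: pdiff_scale)

lemma D_sum: "D n k (\<lambda>v. \<Sum>i\<in>A. t i v) = (\<lambda>v. \<Sum>i\<in>A. D n k (t i) v)" by (induction k) (auto simp: pdiff_sum)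

lemma D_add: "D n (k + l) t = D (n + k) l (D n k t)" by (induction l) (auto simp: add.assoc)

abbreviation unit_vector :: "'v => 'v => complex" where "unit_vector w \<equiv> (\<lambda>v. if v = w then 1 else 0)"

lemma D_expand: "v \<in> V ==> D n k t v = (\<Sum>w\<in>V. t w * D n k (unit_vector w) v)"
proof -
  assume v: "v \<in> V"
  have "D n k t v = D n k (\<lambda>v. \<Sum>w\<in>V. t w * unit_vector w v) v"
    by (rule D_cong[OF _ v]) (use finite_V in \<open>simp add: if_distrib[of "\<lambda>x. _ * x"] cong: if_cong\<close>)
  thus ?thesis by (simp only: D_sum D_scale)
qed

lemma D_injective:
  assumes "\<And>v. v \<in> V ==> t v \<in> R" "\<And>v. v \<in> V ==> D n k t v \<in> I 2"
  shows "v \<in> V ==> t v \<in> I 2" using assms(2)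
proof (induction k arbitrary: v)
  case (Suc k)
  have "D n k t w \<in> I 2" if "w \<in> V" for w by (rule derivative_injective[of "D n k t" "n + k"]) (use Suc.prems D_in_R assms(1) that in auto)
  thus ?case using Suc by blast
qed simp

text \<open>The chain rule for increments: near \<open>y n\<close> an iterate equals its value there
  plus its derivative, up to weight 4. The weights do not deteriorate with the number of
  steps.\<close>

lemma step_linear:
  "\<forall>v\<in>V. weight V (y n) (\<lambda>x. (step ^^ k) x v - y (n + k) v - D n k (\<lambda>v. x v - y n v) v) 4 \<and>
    weight V (y n) (\<lambda>x. D n k (\<lambda>v. x v - y n v) v) 2"
proof (induction k)
  case 0
  thus ?case by (simp add: weight_zero weight.var)
next
  case (Suc k)
  have IH: "weight V (y n) (\<lambda>x. (step ^^ k) x v - y (n + k) v - D n k (\<lambda>v. x v - y n v) v) 4"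
    "weight V (y n) (\<lambda>x. D n k (\<lambda>v. x v - y n v) v) 2" if "v \<in> V" for v using Suc that by auto
  have IH2: "weight V (y n) (\<lambda>x. (step ^^ k) x v - y (n + k) v) 2" if "v \<in> V" for v
    using weight.add[OF weight.mono[OF IH(1)[OF that], of 2] IH(2)[OF that]] by simp
  show ?case
  proof (intro ballI conjI)
    fix v assume v: "v \<in> V"
    let ?P = "\<lambda>t. pdiff (y (n + k)) t (G v)"
    have "weight V (y (n + k)) (\<lambda>x. peval x (G v) - peval (y (n + k)) (G v) - ?P (\<lambda>w. x w - y (n + k) w)) 4"
      by (rule conjunct2[OF weight_linear[OF G_vars[OF v] G_consts[OF v]]]) (rule y_in_R)
    from weight_compose[OF this IH2]
    have lin: "weight V (y n) (\<lambda>x. (step ^^ Suc k) x v - y (n + Suc k) v - ?P (\<lambda>w. (step ^^ k) x w - y (n + k) w)) 4"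
      by (simp add: y_Suc[OF v] step_def[of "(step ^^ k) _"])
    have "weight V (y n) (\<lambda>x. ?P (\<lambda>w. (step ^^ k) x w - y (n + k) w - D n k (\<lambda>v. x v - y n v) w)) 4"
      by (rule weight_pdiff[OF G_vars[OF v] G_consts[OF v] y_in_R IH(1)])
    moreover have "?P (\<lambda>w. (step ^^ k) x w - y (n + k) w - D n k (\<lambda>v. x v - y n v) w) =
        ?P (\<lambda>w. (step ^^ k) x w - y (n + k) w) - ?P (D n k (\<lambda>v. x v - y n v))" for x by (rule pdiff_diff)
    ultimately have der: "weight V (y n) (\<lambda>x. ?P (\<lambda>w. (step ^^ k) x w - y (n + k) w) - ?P (D n k (\<lambda>v. x v - y n v))) 4"
      by simp
    from weight.add[OF lin der]
    show "weight V (y n) (\<lambda>x. (step ^^ Suc k) x v - y (n + Suc k) v - D n (Suc k) (\<lambda>v. x v - y n v) v) 4"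
      by (simp add: algebra_simps del: funpow.simps)
    show "weight V (y n) (\<lambda>x. D n (Suc k) (\<lambda>v. x v - y n v) v) 2"
      unfolding D.simps by (rule weight_pdiff[OF G_vars[OF v] G_consts[OF v] y_in_R IH(2)])
  qed
qed

text \<open>Two times k < l agree in the orbit point modulo \<open>I 4\<close> and in the derivative
  from time 0 modulo \<open>I 2\<close>. The change of \<open>x\<close> under \<open>l - k\<close>
  steps is the displacement of the orbit point, plus the derivative minus the identity applied to
  the increment, plus a second-order remainder; each has weight 4.\<close>

lemma exists_period:
  obtains q k where "q \<ge> 1" "\<And>v. v \<in> V ==> weight V (y k) (\<lambda>x. (step ^^ q) x v - x v) 4"
proof -
  \<comment> \<open>Finite information about time n: the point modulo \<open>I 4\<close> and the
    matrix of the derivative of the n-th iterate modulo \<open>I 2\<close>.\<close>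
  define st where "st n = ((\<lambda>v\<in>V. residue 4 (y n v)), (\<lambda>(w, v)\<in>V \<times> V. residue 2 (D 0 n (unit_vector w) v)))" for n
  have UR: "unit_vector w v \<in> R" for w v using subring_setD(1,2)[OF subring] by auto
  have DR: "D 0 n (unit_vector w) v \<in> R" if "v \<in> V" for w v n by (rule D_in_R[OF UR that])
  have "range st \<subseteq> PiE V (\<lambda>_. residue 4 ` R) \<times> PiE (V \<times> V) (\<lambda>_. residue 2 ` R)"
  proof (rule image_subsetI)
    fix n
    show "st n \<in> PiE V (\<lambda>_. residue 4 ` R) \<times> PiE (V \<times> V) (\<lambda>_. residue 2 ` R)"
      unfolding st_def mem_Times_iff fst_conv snd_conv restrict_PiE_iff using y_in_R DR by auto
  qed
  moreover have "finite (PiE V (\<lambda>_. residue 4 ` R) \<times> PiE (V \<times> V) (\<lambda>_. residue 2 ` R))"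
    using finite_V residue(1) by (intro finite_cartesian_product finite_PiE) auto
  ultimately have "finite (range st)" by (rule finite_subset)
  hence "\<not> inj st" using finite_imageD infinite_UNIV_nat by blast
  then obtain k l where kl: "k < l" "st k = st l" by (metis injI nat_neq_iff)
  have y: "y l v - y k v \<in> I 4" if "v \<in> V" for v
  proof -
    have "residue 4 (y l v) = residue 4 (y k v)" using fun_cong[OF arg_cong[OF kl(2), of fst], of v] that by (simp add: st_def)
    thus ?thesis using residue(4) y_in_R that by blast
  qed
  have Dkl: "D 0 l (unit_vector w) v - D 0 k (unit_vector w) v \<in> I 2" if "w \<in> V" "v \<in> V" for w v
  proof -
    have "residue 2 (D 0 l (unit_vector w) v) = residue 2 (D 0 k (unit_vector w) v)"
      using fun_cong[OF arg_cong[OF kl(2), of snd], of "(w, v)"] that by (simp add: st_def)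
    thus ?thesis using residue(4) DR that by blast
  qed
  define q where "q = l - k"
  have lp: "l = k + q" "q \<ge> 1" using kl(1) by (auto simp: q_def)
  \<comment> \<open>\<open>D 0 l\<close> is \<open>D k q\<close> after \<open>D 0 k\<close> and
    agrees with \<open>D 0 k\<close> modulo \<open>I 2\<close>. Since \<open>D 0 k\<close> is
    injective it is also surjective modulo \<open>I 2\<close>, so it cancels.\<close>
  have id: "D k q t v - t v \<in> I 2" if t: "\<And>v. v \<in> V ==> t v \<in> R" and v: "v \<in> V" for t v
  proof -
    have "\<exists>s. (\<forall>v\<in>V. s v \<in> R) \<and> (\<forall>v\<in>V. D 0 k s v - t v \<in> I 2)"
      by (rule surjective_mod[OF finite_V, of "D 0 k"])
         (use D_in_R D_injective[of _ 0 k] t in "auto simp: D_diff")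
    then obtain s where s: "\<And>v. v \<in> V ==> s v \<in> R" "\<And>v. v \<in> V ==> D 0 k s v - t v \<in> I 2" by blast
    have "D k q (\<lambda>v. D 0 k s v - t v) v \<in> I 2" by (rule D_in_I[OF s(2) v])
    hence 1: "D 0 l s v - D k q t v \<in> I 2" by (simp add: D_diff lp D_add)
    have "(\<Sum>w\<in>V. s w * (D 0 l (unit_vector w) v - D 0 k (unit_vector w) v)) \<in> I 2"
      by (intro ideal_set_sum[OF I_ideal] ideal_setD(4)[OF I_ideal] s Dkl v)
    hence 2: "D 0 l s v - D 0 k s v \<in> I 2" by (simp add: D_expand[OF v, of _ _ s] right_diff_distrib sum_subtractf)
    have "(D 0 l s v - D 0 k s v) + (D 0 k s v - t v) - (D 0 l s v - D k q t v) \<in> I 2"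
      by (rule ideal_set_minus[OF subring I_ideal ideal_setD(3)[OF I_ideal 2 s(2)[OF v]] 1])
    thus ?thesis by simp
  qed
  have "weight V (y k) (\<lambda>x. (step ^^ q) x v - x v) 4" if v: "v \<in> V" for v
  proof -
    have "weight V (y k) (\<lambda>x. \<Sum>w\<in>V. (D k q (unit_vector w) v - unit_vector w v) * (x w - y k w)) 4"
    proof (rule weight_sum)
      fix w assume w: "w \<in> V"
      show "weight V (y k) (\<lambda>x. (D k q (unit_vector w) v - unit_vector w v) * (x w - y k w)) 4"
      proof -
        have 4: "4 = (2 + 2 :: nat)" by simp
        show ?thesis unfolding 4 by (rule weight.mult[OF weight.const[OF id[OF UR v]] weight.var[OF w]])
      qed
    qed
    moreover have "(\<Sum>w\<in>V. (D k q (unit_vector w) v - unit_vector w v) * (x w - y k w)) =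
        D k q (\<lambda>v. x v - y k v) v - (x v - y k v)" for x
    proof -
      have \<delta>: "(\<Sum>w\<in>V. unit_vector w v * z w) = z v" for z
        using v finite_V by (simp add: if_distrib[of "\<lambda>u. u * _"] cong: if_cong)
      show ?thesis
        unfolding D_expand[OF v, of k q "\<lambda>v. x v - y k v"] left_diff_distrib[of "D k q _ v"] sum_subtractf \<delta>[of "\<lambda>w. x w - y k w"]
        by (simp only: mult.commute)
    qed
    ultimately have 1: "weight V (y k) (\<lambda>x. D k q (\<lambda>v. x v - y k v) v - (x v - y k v)) 4" by simp
    have 2: "weight V (y k) (\<lambda>x. y l v - y k v) 4" by (rule weight.const[OF y[OF v]])
    from weight.add[OF weight.add[OF 1 2] conjunct1[OF bspec[OF step_linear[of k q] v]]] show ?thesis by (simp add: lp)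
  qed
  thus thesis using that lp(2) by blast
qed

text \<open>Along the period the values form a Newton series whose k-th coefficient is the k-th
  difference at the starting point, of depth \<open>2 * k\<close>. \<open>q\<close> and
  \<open>k\<close> are fixed before the polynomial is, which is what makes the period
  uniform.\<close>

theorem zeros_in_progressions:
  "\<exists>q k. q \<ge> 1 \<and> (\<forall>e i. pvars e \<subseteq> V --> pconsts e \<subseteq> R -->
     infinite {n. peval (y (k + i + q * n)) e = 0} --> (\<forall>n. peval (y (k + i + q * n)) e = 0))"
proof -
  obtain q k where q: "q \<ge> 1" and w: "\<And>v. v \<in> V ==> weight V (y k) (\<lambda>x. (step ^^ q) x v - x v) 4" using exists_period by blast
  define g where "g = step ^^ q"
  define \<Delta> where "\<Delta> f = (\<lambda>x. f (g x) - f x :: complex)" for f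
  \<comment> \<open>Gregory-Newton formula: composition with \<open>g\<close> is 1 plus the
    difference operator.\<close>
  have newton: "f ((g ^^ n) x) = (\<Sum>j\<le>n. of_nat (n choose j) * (\<Delta> ^^ j) f x)" for f n x
  proof (induction n arbitrary: f)
    case 0
    thus ?case by simp
  next
    case (Suc n)
    have comm: "(\<Delta> ^^ j) (\<Delta> f) = (\<Delta> ^^ Suc j) f" for j by (simp only: funpow_Suc_right o_apply)
    have add: "(\<Delta> ^^ j) (\<lambda>x. f1 x + f2 x) x = (\<Delta> ^^ j) f1 x + (\<Delta> ^^ j) f2 x" for j f1 f2 x
    proof (induction j arbitrary: x)
      case (Suc j)
      thus ?case by (simp add: \<Delta>_def[of "(\<Delta> ^^ j) _"])
    qed simp
    have "f ((g ^^ Suc n) x) = (\<lambda>x. f x + \<Delta> f x) ((g ^^ n) x)" by (simp add: \<Delta>_def)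
    also have "\<dots> = (\<Sum>j\<le>n. of_nat (n choose j) * (\<Delta> ^^ j) f x) + (\<Sum>j\<le>n. of_nat (n choose j) * (\<Delta> ^^ Suc j) f x)"
      unfolding Suc.IH[of "\<lambda>x. f x + \<Delta> f x"] add comm by (simp add: algebra_simps sum.distrib)
    also have "(\<Sum>j\<le>n. of_nat (n choose j) * (\<Delta> ^^ j) f x) =
        (\<Delta> ^^ 0) f x + (\<Sum>j\<le>n. of_nat (n choose Suc j) * (\<Delta> ^^ Suc j) f x)"
    proof -
      have "(\<Sum>j\<le>n. of_nat (n choose j) * (\<Delta> ^^ j) f x) = (\<Sum>j\<le>Suc n. of_nat (n choose j) * (\<Delta> ^^ j) f x)" by simp
      thus ?thesis unfolding sum.atMost_Suc_shift by simp
    qed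
    also have "(\<Delta> ^^ 0) f x + (\<Sum>j\<le>n. of_nat (n choose Suc j) * (\<Delta> ^^ Suc j) f x) +
        (\<Sum>j\<le>n. of_nat (n choose j) * (\<Delta> ^^ Suc j) f x) = (\<Sum>j\<le>Suc n. of_nat (Suc n choose j) * (\<Delta> ^^ j) f x)"
      unfolding sum.atMost_Suc_shift by (simp add: algebra_simps sum.distrib del: funpow.simps)
    finally show ?case .
  qed
  have zero: "peval (y (k + q * n)) e = 0"
    if e: "pvars e \<subseteq> V" "pconsts e \<subseteq> R" and inf: "infinite {n. peval (y (k + q * n)) e = 0}" for e n
  proof -
    have yg: "peval (y (k + q * n)) e = peval ((g ^^ n) (y k)) e" for n
      unfolding g_def by (rule peval_cong) (use y_add e in "auto simp: funpow_mult subset_iff")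
    define f where "f = (\<lambda>x. peval x e)"
    have "weight V (y k) ((\<Delta> ^^ j) f) (2 * j)" for j
    proof (induction j)
      case 0
      thus ?case unfolding f_def using weight_peval[OF e y_in_R] by simp
    next
      case (Suc j)
      from weight_difference[OF Suc, of g] w show ?case by (simp add: \<Delta>_def[of "(\<Delta> ^^ j) f"] g_def add.commute)
    qed
    hence "(\<Delta> ^^ j) f (y k) \<in> I (2 * j)" for j by (rule weight_at)
    from newton_series_zero[OF newton[of f _ "y k"] this, of n] inf
    show ?thesis by (simp add: yg f_def)
  qed
  \<comment> \<open>The offset i is absorbed into the polynomial: a polynomial of the state i steps
    ahead is a polynomial of the present state.\<close>
  have subst: "\<exists>e'. pvars e' \<subseteq> V \<and> pconsts e' \<subseteq> R \<and> (\<forall>n. peval (y (n + i)) e = peval (y n) e')"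
    if e: "pvars e \<subseteq> V" "pconsts e \<subseteq> R" for e i using e
  proof (induction i arbitrary: e)
    case 0
    thus ?case by auto
  next
    case (Suc i)
    have "pvars (psubst G e) \<subseteq> V" using Suc.prems G_vars by (auto simp: pvars_psubst)
    moreover have "pconsts (psubst G e) \<subseteq> R" using pconsts_psubst[of G e] Suc.prems G_consts by blast
    ultimately obtain e' where e': "pvars e' \<subseteq> V" "pconsts e' \<subseteq> R"
      "\<And>n. peval (y (n + i)) (psubst G e) = peval (y n) e'" using Suc.IH by blast
    have "peval (y (n + Suc i)) e = peval (y (n + i)) (psubst G e)" for n unfolding peval_psubst by (rule peval_cong) (use Suc.prems y_Suc in auto)
    thus ?case using e' by auto
  qed
  show ?thesis
  proof (intro exI conjI allI impI)
    show "q \<ge> 1" by (rule q)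
    fix e i n assume e: "pvars e \<subseteq> V" "pconsts e \<subseteq> R" and inf: "infinite {n. peval (y (k + i + q * n)) e = 0}"
    obtain e' where e': "pvars e' \<subseteq> V" "pconsts e' \<subseteq> R" "\<And>n. peval (y (n + i)) e = peval (y n) e'" using subst[OF e] by blast
    have eq: "peval (y (k + i + q * n)) e = peval (y (k + q * n)) e'" for n using e'(3)[of "k + q * n"] by (simp add: add_ac)
    show "peval (y (k + i + q * n)) e = 0" using zero[OF e'(1,2)] inf unfolding eq .
  qed
qed

end

section \<open>Finite sums of expressions\<close>

fun psum :: "'v pexp list => 'v pexp" where
  "psum [] = PConst 0"
| "psum (e # es) = PAdd e (psum es)"

lemma peval_psum: "peval x (psum es) = (\<Sum>e\<leftarrow>es. peval x e)" by (induction es) auto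

lemma pdiff_psum: "pdiff x t (psum es) = (\<Sum>e\<leftarrow>es. pdiff x t e)" by (induction es) auto

lemma pvars_psum: "pvars (psum es) = (\<Union>e\<in>set es. pvars e)" by (induction es) auto

lemma pconsts_psum: "pconsts (psum es) = insert 0 (\<Union>e\<in>set es. pconsts e)" by (induction es) auto

lemma pdeg_psum_le: "(\<And>e. e \<in> set es ==> pdeg e \<le> n) ==> pdeg (psum es) \<le> n" by (induction es) auto

lemma sum_list_upt: "(\<Sum>i\<leftarrow>[0..<n]. f i) = (\<Sum>i<n. f i)" by (simp add: sum_list_distinct_conv_sum_set atLeast0LessThan)

section \<open>Growth of heights along orbits\<close>

text \<open>A logarithmic height: one real number bounds both the degree and the binary logarithm of
  the coefficient sum.\<close>

definition small :: "complex set => complex => real => bool" where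
  "small G x r \<longleftrightarrow> (\<exists>N. real N \<le> r \<and> height G x N (2 ^ N))"

lemma small_mono: "small G x r ==> r \<le> s ==> small G x s" unfolding small_def by (meson order_trans)

lemma small_gen: "g \<in> G ==> 1 \<le> r ==> small G g r" unfolding small_def by (intro exI[of _ 1] conjI height.mono[OF height.gen]) auto

lemma small_0: "0 \<le> r ==> small G 0 r" unfolding small_def by (intro exI[of _ 0] conjI height.mono[OF height.zero]) auto

lemma small_add:
  assumes "small G x r" "small G y r" shows "small G (x + y) (r + 1)"
proof -
  obtain M N where MN: "real M \<le> r" "height G x M (2 ^ M)" "real N \<le> r" "height G y N (2 ^ N)" using assms by (auto simp: small_def)
  define K where "K = max M N"
  have "height G x K (2 ^ K)" "height G y K (2 ^ K)" by (rule height.mono[OF MN(2)] height.mono[OF MN(4)]; simp add: K_def)+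
  from height.add[OF this] have "height G (x + y) (Suc K) (2 ^ Suc K)" by (rule height.mono) auto
  thus ?thesis unfolding small_def using MN by (intro exI[of _ "Suc K"]) (auto simp: K_def)
qed

lemma small_mult:
  assumes "small G x r" "small G y s" shows "small G (x * y) (r + s)"
proof -
  obtain M N where MN: "real M \<le> r" "height G x M (2 ^ M)" "real N \<le> s" "height G y N (2 ^ N)" using assms by (auto simp: small_def)
  from height.mult[OF MN(2,4)] have "height G (x * y) (M + N) (2 ^ (M + N))" by (simp add: power_add)
  thus ?thesis unfolding small_def using MN by (intro exI[of _ "M + N"]) auto
qed

lemma small_sum_lessThan:
  fixes n :: nat
  assumes "\<And>i. i < n ==> small G (f i) r" "0 \<le> r" shows "small G (\<Sum>i<n. f i) (r + n)" using assms
proof (induction n)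
  case (Suc n)
  have "small G (f n) (r + n)" by (rule small_mono[OF Suc.prems(1)]) auto
  from small_add[OF Suc.IH this] Suc.prems show ?case by (simp add: add_ac)
qed (simp add: small_0)

lemma small_of_nat: "small G (of_nat n) (real n)"
proof -
  have "height G (of_nat n) 0 n"
  proof (induction n)
    case (Suc n)
    from height.add[OF height.one Suc] show ?case by simp
  qed (simp add: height.zero)
  hence "height G (of_nat n) n (2 ^ n)" by (rule height.mono) (auto simp: less_imp_le[OF less_exp])
  thus ?thesis unfolding small_def by blast
qed

text \<open>A polynomial map multiplies logarithmic heights by its degree, up to an additive
  constant that does not depend on the point.\<close>

lemma small_peval:
  assumes "pconsts e \<subseteq> G"
  shows "\<exists>C::nat. \<forall>x (r::real). 0 \<le> r --> (\<forall>v\<in>pvars e. small G (x v) r) --> small G (peval x e) (pdeg e * r + C)"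
  using assms
proof (induction e)
  case (PConst c)
  thus ?case by (intro exI[of _ 1]) (auto intro: small_gen)
next
  case (PVar v)
  thus ?case by (intro exI[of _ 0]) auto
next
  case (PAdd a b)
  then obtain C C' :: nat where C: "\<And>x (r::real). 0 \<le> r ==> (\<forall>v\<in>pvars a. small G (x v) r) ==> small G (peval x a) (pdeg a * r + C)"
    "\<And>x (r::real). 0 \<le> r ==> (\<forall>v\<in>pvars b. small G (x v) r) ==> small G (peval x b) (pdeg b * r + C')" by auto
  show ?case
  proof (intro exI[of _ "max C C' + 1"] allI impI)
    fix x and r :: real assume r: "0 \<le> r" "\<forall>v\<in>pvars (PAdd a b). small G (x v) r"
    let ?s = "max (pdeg a) (pdeg b) * r + max C C'"
    have "real (pdeg a) * r \<le> max (pdeg a) (pdeg b) * r" "real (pdeg b) * r \<le> max (pdeg a) (pdeg b) * r"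
      using r(1) by (auto intro!: mult_right_mono)
    moreover have "real C \<le> real (max C C')" "real C' \<le> real (max C C')" by auto
    ultimately have le: "real (pdeg a) * r + C \<le> ?s" "real (pdeg b) * r + C' \<le> ?s" by linarith+
    have "small G (peval x a) ?s" "small G (peval x b) ?s"
      using small_mono[OF C(1)[OF r(1)] le(1)] small_mono[OF C(2)[OF r(1)] le(2)] r(2) by simp_all
    from small_add[OF this] show "small G (peval x (PAdd a b)) (pdeg (PAdd a b) * r + real (max C C' + 1))" by (simp add: add_ac)
  qed
next
  case (PMul a b)
  then obtain C C' :: nat where C: "\<And>x (r::real). 0 \<le> r ==> (\<forall>v\<in>pvars a. small G (x v) r) ==> small G (peval x a) (pdeg a * r + C)"
    "\<And>x (r::real). 0 \<le> r ==> (\<forall>v\<in>pvars b. small G (x v) r) ==> small G (peval x b) (pdeg b * r + C')" by auto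
  show ?case
  proof (intro exI[of _ "C + C'"] allI impI)
    fix x and r :: real assume r: "0 \<le> r" "\<forall>v\<in>pvars (PMul a b). small G (x v) r"
    have "small G (peval x a * peval x b) ((pdeg a * r + C) + (pdeg b * r + C'))" by (rule small_mult[OF C(1) C(2)]) (use r in auto)
    thus "small G (peval x (PMul a b)) (pdeg (PMul a b) * r + real (C + C'))" by (simp add: algebra_simps)
  qed
qed

text \<open>Separation in logarithmic form.\<close>

lemma (in filtered_ring) small_not_in_I:
  assumes "finite G" "G \<subseteq> R"
  obtains C :: real where "C > 0" "\<And>x r j. small G x r ==> x \<noteq> 0 ==> x \<in> I j ==> real j \<le> C * (r + 1)"
proof -
  obtain C :: nat where C: "C \<ge> 1"
    "\<And>x D L j. height G x D L ==> x \<noteq> 0 ==> x \<in> I j ==> 2 ^ j \<le> C ^ (D + 1) * L ^ C" using separation[OF assms] by blast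
  have "real j \<le> real (2 * C) * (r + 1)" if x: "small G x r" "x \<noteq> 0" "x \<in> I j" for x r j
  proof -
    obtain N where N: "real N \<le> r" "height G x N (2 ^ N)" using x(1) by (auto simp: small_def)
    have "(2::nat) ^ j \<le> C ^ (N + 1) * (2 ^ N) ^ C" by (rule C(2)[OF N(2) x(2,3)])
    also have "\<dots> \<le> (2 ^ C) ^ (N + 1) * (2 ^ N) ^ C" by (intro mult_right_mono power_mono) (auto simp: less_imp_le[OF less_exp])
    also have "\<dots> = 2 ^ (C * (N + 1) + N * C)" by (simp only: power_add power_mult)
    finally have "j \<le> C * (N + 1) + N * C" by simp
    also have "\<dots> \<le> 2 * C * (N + 1)" by simp
    finally have "real j \<le> real (2 * C * (N + 1))" by (simp only: of_nat_le_iff)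
    also have "\<dots> = real (2 * C) * (real N + 1)" by (simp add: algebra_simps)
    also have "\<dots> \<le> real (2 * C) * (r + 1)" by (intro mult_left_mono) (use N in auto)
    finally show ?thesis .
  qed
  moreover have "real (2 * C) > 0" using C(1) by simp
  ultimately show thesis using that by blast
qed

lemma tame_peval:
  assumes e: "pconsts e \<subseteq> G" "pvars e \<subseteq> V" and y: "\<And>n v. v \<in> V ==> small G (y n v) (A * \<theta> ^ n)"
    and "\<theta> \<ge> 1" "A \<ge> 0"
  shows "\<exists>A'. \<forall>n. small G (peval (y n) e) (A' * \<theta> ^ n)"
proof -
  obtain C :: nat where C: "\<And>x (r::real). 0 \<le> r ==> (\<forall>v\<in>pvars e. small G (x v) r) ==> small G (peval x e) (pdeg e * r + C)"
    using small_peval[OF e(1)] by blast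
  have "small G (peval (y n) e) ((pdeg e * A + C) * \<theta> ^ n)" for n
  proof (rule small_mono[OF C])
    show "0 \<le> A * \<theta> ^ n" using assms by simp
    show "\<forall>v\<in>pvars e. small G (y n v) (A * \<theta> ^ n)" using y e(2) by blast
    have "real C * 1 \<le> real C * \<theta> ^ n" using \<open>\<theta> \<ge> 1\<close> by (intro mult_left_mono) auto
    thus "real (pdeg e) * (A * \<theta> ^ n) + real C \<le> (real (pdeg e) * A + real C) * \<theta> ^ n" by (simp add: algebra_simps)
  qed
  thus ?thesis by blast
qed

text \<open>Over q steps the height is multiplied by at most \<delta> and increased by a constant,
  so any \<theta> with \<delta> < \<theta>^q bounds its exponential growth rate.\<close>

lemma tame_base:
  fixes m q \<delta> :: nat and f :: "nat => nat => complex"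
  assumes q: "q \<ge> 1" and \<theta>: "\<theta> > 1" "real \<delta> < \<theta> ^ q"
    and e: "\<And>i. i < m ==> pvars (e i) \<subseteq> {..<m} \<and> pconsts (e i) \<subseteq> G \<and> pdeg (e i) \<le> \<delta>"
    and rec: "\<And>n i. i < m ==> f (n + q) i = peval (f n) (e i)"
    and init: "\<And>n i. n < q ==> i < m ==> f n i \<in> G"
  shows "\<exists>A\<ge>0. \<forall>n. \<forall>i<m. small G (f n i) (A * \<theta> ^ n)"
proof -
  have "\<forall>i<m. \<exists>C::nat. \<forall>x (r::real). 0 \<le> r --> (\<forall>v\<in>pvars (e i). small G (x v) r) --> small G (peval x (e i)) (pdeg (e i) * r + C)"
    using small_peval e by blast
  then obtain C :: "nat => nat" where C: "\<And>i x (r::real). i < m ==> 0 \<le> r ==> (\<forall>v\<in>pvars (e i). small G (x v) r) ==>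
      small G (peval x (e i)) (pdeg (e i) * r + C i)" by metis
  define K where "K = (\<Sum>i<m. C i)"
  have K: "C i \<le> K" if "i < m" for i unfolding K_def by (rule member_le_sum) (use that in auto)
  \<comment> \<open>Chosen so that \<delta> A \<theta>^n + K <= A \<theta>^(n+q); the summand 1
    leaves room for the initial values, which are generators.\<close>
  define A where "A = 1 + real K / (\<theta> ^ q - \<delta>)"
  have A: "A \<ge> 1" "A * (\<theta> ^ q - \<delta>) \<ge> K" using \<theta>(2) by (auto simp: A_def distrib_right)
  have "\<forall>i<m. small G (f n i) (A * \<theta> ^ n)" for n
  proof (induction n rule: less_induct)
    case (less n)
    show ?case
    proof (cases "n < q")
      case True
      have "1 * 1 \<le> A * \<theta> ^ n" using A(1) \<theta>(1) by (intro mult_mono one_le_power) auto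
      thus ?thesis using True init by (auto intro: small_gen)
    next
      case False
      define k where "k = n - q"
      have n: "n = k + q" "k < n" using False q by (auto simp: k_def)
      show ?thesis
      proof (intro allI impI)
        fix i assume i: "i < m"
        have nn: "0 \<le> A * \<theta> ^ k" using A(1) \<theta>(1) by simp
        have "\<forall>v\<in>pvars (e i). small G (f k v) (A * \<theta> ^ k)" using less[OF n(2)] e[OF i] by blast
        from C[OF i nn this] have "small G (f n i) (pdeg (e i) * (A * \<theta> ^ k) + C i)" unfolding n(1) rec[OF i] .
        thus "small G (f n i) (A * \<theta> ^ n)"
        proof (rule small_mono)
          have "real (pdeg (e i)) * (A * \<theta> ^ k) \<le> \<delta> * (A * \<theta> ^ k)" using e[OF i] nn by (intro mult_right_mono) auto
          moreover have "real (C i) \<le> A * (\<theta> ^ q - \<delta>) * \<theta> ^ k"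
          proof -
            have "real (C i) \<le> A * (\<theta> ^ q - \<delta>)" using K[OF i] A(2) by linarith
            also have "\<dots> * 1 \<le> A * (\<theta> ^ q - \<delta>) * \<theta> ^ k" using A(1) \<theta> by (intro mult_left_mono one_le_power) auto
            finally show ?thesis by simp
          qed
          ultimately show "real (pdeg (e i)) * (A * \<theta> ^ k) + real (C i) \<le> A * \<theta> ^ n" by (simp add: n(1) power_add algebra_simps)
        qed
      qed
    qed
  qed
  thus ?thesis using A(1) by (intro exI[of _ A]) auto
qed

text \<open>A linear step only adds the height of a matrix entry to that of the vector, so matrix
  heights growing like \<theta>^n accumulate to a geometric sum of the same order.\<close>

lemma tame_cocycle:
  fixes r :: nat
  assumes \<theta>: "\<theta> > 1" and B: "B \<ge> 0" "\<And>n i k. i < r ==> k < r ==> small G (c n i k) (B * \<theta> ^ n)"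
    and rec: "\<And>n i. i < r ==> w (Suc n) i = (\<Sum>k<r. c n i k * w n k)"
    and init: "\<And>i. i < r ==> w 0 i \<in> G"
  shows "\<exists>A\<ge>0. \<forall>n. \<forall>i<r. small G (w n i) (A * \<theta> ^ n)"
proof -
  define A where "A = 1 + (B + r) / (\<theta> - 1)"
  have A: "A \<ge> 1" "A * (\<theta> - 1) \<ge> B + r" 
  proof -
    define c where "c = \<theta> - 1"
    have "c > 0" using \<theta> by (simp add: c_def)
    thus "A \<ge> 1" "A * (\<theta> - 1) \<ge> B + r" using B(1) unfolding A_def c_def[symmetric] by (auto simp: field_simps)
  qed
  have "\<forall>i<r. small G (w n i) (A * \<theta> ^ n)" for n
  proof (induction n)
    case 0
    thus ?case using init A(1) by (auto intro: small_gen)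
  next
    case (Suc n)
    show ?case
    proof (intro allI impI)
      fix i assume i: "i < r"
      have "small G (w (Suc n) i) (B * \<theta> ^ n + A * \<theta> ^ n + r)" unfolding rec[OF i]
        by (intro small_sum_lessThan small_mult B(2) i) (use Suc A(1) B(1) \<theta> in auto)
      thus "small G (w (Suc n) i) (A * \<theta> ^ Suc n)"
      proof (rule small_mono)
        have "(B + r) * \<theta> ^ n \<le> A * (\<theta> - 1) * \<theta> ^ n" using A(2) \<theta> by (intro mult_right_mono) auto
        moreover have "real r * 1 \<le> r * \<theta> ^ n" using \<theta> by (intro mult_left_mono one_le_power) auto
        ultimately show "B * \<theta> ^ n + A * \<theta> ^ n + real r \<le> A * \<theta> ^ Suc n" by (simp add: algebra_simps)
      qed
    qed
  qed
  thus ?thesis using A(1) by (intro exI[of _ A]) auto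
qed

lemma tame_time:
  fixes \<theta> :: real
  assumes "\<theta> > 1" shows "\<exists>A\<ge>0. \<forall>n. small G (of_nat (n0 + n)) (A * \<theta> ^ n)"
proof -
  define A where "A = real n0 + 1 / (\<theta> - 1)"
  have "small G (of_nat (n0 + n)) (A * \<theta> ^ n)" for n
  proof (rule small_mono[OF small_of_nat])
    have "1 + real n * (\<theta> - 1) \<le> (1 + (\<theta> - 1)) ^ n" using assms by (intro Bernoulli_inequality) auto
    hence "1 + real n * (\<theta> - 1) \<le> \<theta> ^ n" by simp
    hence "real n \<le> 1 / (\<theta> - 1) * \<theta> ^ n" using assms by (simp add: field_simps)
    moreover have "real n0 * 1 \<le> n0 * \<theta> ^ n" using assms by (intro mult_left_mono one_le_power) auto
    ultimately show "real (n0 + n) \<le> A * \<theta> ^ n" by (simp add: A_def algebra_simps)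
  qed
  thus ?thesis using assms by (intro exI[of _ A]) (auto simp: A_def)
qed

text \<open>Induction on the number of terms. A nontrivial relation over \<open>R\<close> among the
  coefficients \<open>c i\<close> eliminates one term. If there is none, a zero of the combination
  at n forces every \<open>f i n\<close> to be zero, as these values lie in
  \<open>R\<close>.\<close>

lemma zeros_of_combinations:
  fixes S :: "(nat => complex) set"
  assumes R: "subring_set R" and S: "\<And>s n. s \<in> S ==> s n \<in> R"
    and lin: "\<And>a b s t. a \<in> R ==> b \<in> R ==> s \<in> S ==> t \<in> S ==> (\<lambda>n. a * s n - b * t n) \<in> S"
    and zero: "\<And>s. s \<in> S ==> infinite {n. s n = 0} ==> ev (\<lambda>n. s n = 0)"
    and A: "finite A" "\<And>i. i \<in> A ==> f i \<in> S"
    and inf: "infinite {n. (\<Sum>i\<in>A. c i * f i n) = 0}"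
  shows "ev (\<lambda>n. (\<Sum>i\<in>A. c i * f i n) = 0)" using A inf
proof (induction "card A" arbitrary: A f)
  case 0
  thus ?case by simp
next
  case (Suc k)
  show ?case
  proof (cases "\<exists>a. (\<forall>i\<in>A. a i \<in> R) \<and> (\<exists>i\<in>A. a i \<noteq> 0) \<and> (\<Sum>i\<in>A. a i * c i) = 0")
    case True
    then obtain a j where a: "\<And>i. i \<in> A ==> a i \<in> R" "j \<in> A" "a j \<noteq> 0" "(\<Sum>i\<in>A. a i * c i) = 0" by blast
    define g where "g i = (\<lambda>n. a j * f i n - a i * f j n)" for i
    have eq: "a j * (\<Sum>i\<in>A. c i * f i n) = (\<Sum>i\<in>A - {j}. c i * g i n)" for n
    proof -
      have "(\<Sum>i\<in>A - {j}. c i * g i n) = (\<Sum>i\<in>A. c i * g i n)"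
        by (rule sum.mono_neutral_left) (use Suc.prems in "auto simp: g_def")
      also have "\<dots> = a j * (\<Sum>i\<in>A. c i * f i n) - (\<Sum>i\<in>A. a i * c i) * f j n"
        by (simp add: g_def algebra_simps sum_subtractf sum_distrib_left)
      finally show ?thesis using a(4) by simp
    qed
    have eq0: "(\<Sum>i\<in>A - {j}. c i * g i n) = 0 \<longleftrightarrow> (\<Sum>i\<in>A. c i * f i n) = 0" for n
      unfolding eq[symmetric] using a(3) by simp
    have "k = card (A - {j})" using Suc.hyps(2) a(2) Suc.prems(1) by simp
    moreover have "g i \<in> S" if "i \<in> A - {j}" for i unfolding g_def using that a Suc.prems(2) by (intro lin) auto
    ultimately have "ev (\<lambda>n. (\<Sum>i\<in>A - {j}. c i * g i n) = 0)"
      using Suc.hyps(1)[of "A - {j}" g] Suc.prems(1,3) by (simp add: eq0)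
    thus ?thesis by (simp add: eq0)
  next
    case False
    have all0: "f i n = 0" if "(\<Sum>i\<in>A. c i * f i n) = 0" "i \<in> A" for i n
    proof (rule ccontr)
      assume "f i n \<noteq> 0"
      hence "\<exists>a. (\<forall>i\<in>A. a i \<in> R) \<and> (\<exists>i\<in>A. a i \<noteq> 0) \<and> (\<Sum>i\<in>A. a i * c i) = 0"
        using that S Suc.prems(2) by (intro exI[of _ "\<lambda>i. f i n"]) (auto simp: mult.commute)
      thus False using False by blast
    qed
    have "ev (\<lambda>n. f i n = 0)" if "i \<in> A" for i
    proof (rule zero)
      show "f i \<in> S" using Suc.prems(2) that .
      show "infinite {n. f i n = 0}" by (rule infinite_super[OF _ Suc.prems(3)]) (use all0 that in auto)
    qed
    hence "ev (\<lambda>n. \<forall>i\<in>A. f i n = 0)" using Suc.prems(1) by (simp add: eventually_ball_finite)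
    thus ?thesis by eventually_elim simp
  qed
qed

text \<open>Separates the arbitrary constants from expressions whose only constant is 1 and which
  therefore live over every subring.\<close>

lemma pexp_as_combination:
  "\<exists>L. (\<forall>z\<in>set L. pvars (snd z) \<subseteq> pvars e \<and> pconsts (snd z) \<subseteq> {1}) \<and>
     (\<forall>x. peval x e = (\<Sum>z\<leftarrow>L. fst z * peval x (snd z)))"
proof (induction e)
  case (PConst c)
  show ?case by (intro exI[of _ "[(c, PConst 1)]"]) simp
next
  case (PVar v)
  show ?case by (intro exI[of _ "[(1, PVar v)]"]) simp
next
  case (PAdd a b)
  obtain L where "\<forall>z\<in>set L. pvars (snd z) \<subseteq> pvars a \<and> pconsts (snd z) \<subseteq> {1}"
    "\<forall>x. peval x a = (\<Sum>z\<leftarrow>L. fst z * peval x (snd z))" using PAdd.IH(1) by (elim exE conjE)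
  moreover obtain M where "\<forall>z\<in>set M. pvars (snd z) \<subseteq> pvars b \<and> pconsts (snd z) \<subseteq> {1}"
    "\<forall>x. peval x b = (\<Sum>z\<leftarrow>M. fst z * peval x (snd z))" using PAdd.IH(2) by (elim exE conjE)
  ultimately show ?case by (intro exI[of _ "L @ M"]) auto
next
  case (PMul a b)
  obtain L where L: "\<forall>z\<in>set L. pvars (snd z) \<subseteq> pvars a \<and> pconsts (snd z) \<subseteq> {1}"
    "\<forall>x. peval x a = (\<Sum>z\<leftarrow>L. fst z * peval x (snd z))" using PMul.IH(1) by (elim exE conjE)
  obtain M where M: "\<forall>z\<in>set M. pvars (snd z) \<subseteq> pvars b \<and> pconsts (snd z) \<subseteq> {1}"
    "\<forall>x. peval x b = (\<Sum>z\<leftarrow>M. fst z * peval x (snd z))" using PMul.IH(2) by (elim exE conjE)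
  define P where "P L = concat (map (\<lambda>z. map (\<lambda>w. (fst z * fst w, PMul (snd z) (snd w))) M) L)" for L
  have "(\<Sum>z\<leftarrow>L. fst z * peval x (snd z)) * (\<Sum>w\<leftarrow>M. fst w * peval x (snd w)) = (\<Sum>z\<leftarrow>P L. fst z * peval x (snd z))" for x
  proof (induction L)
    case (Cons z L)
    have "(\<Sum>w\<leftarrow>map (\<lambda>w. (fst z * fst w, PMul (snd z) (snd w))) M. fst w * peval x (snd w)) =
        fst z * peval x (snd z) * (\<Sum>w\<leftarrow>M. fst w * peval x (snd w))" by (induction M) (auto simp: algebra_simps)
    thus ?case using Cons by (simp add: P_def algebra_simps)
  qed (simp add: P_def)
  moreover have "\<forall>z\<in>set (P L). pvars (snd z) \<subseteq> pvars (PMul a b) \<and> pconsts (snd z) \<subseteq> {1}"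
  proof
    fix u assume "u \<in> set (P L)"
    then obtain z w where zw: "z \<in> set L" "w \<in> set M" "u = (fst z * fst w, PMul (snd z) (snd w))" by (auto simp: P_def)
    show "pvars (snd u) \<subseteq> pvars (PMul a b) \<and> pconsts (snd u) \<subseteq> {1}"
      using bspec[OF L(1) zw(1)] bspec[OF M(1) zw(2)] unfolding zw(3) by auto
  qed
  ultimately show ?case using L(2) M(2) by (intro exI[of _ "P L"]) simp
qed

definition progression_zeros :: "'v set => complex set => (nat => 'v => complex) => nat => bool" where
  "progression_zeros V K x p \<longleftrightarrow> (\<forall>e i. pvars e \<subseteq> V --> pconsts e \<subseteq> K -->
     infinite {n. peval (x (i + p * n)) e = 0} --> ev (\<lambda>n. peval (x (i + p * n)) e = 0))"

text \<open>The period found for coefficients in the orbit ring works unchanged for all complex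
  coefficients.\<close>

lemma progression_zeros_UNIV:
  assumes R: "subring_set R" and x: "\<And>n v. v \<in> V ==> x n v \<in> R" and P: "progression_zeros V R x p"
  shows "progression_zeros V UNIV x p" unfolding progression_zeros_def
proof (intro allI impI)
  fix e i assume e: "pvars e \<subseteq> V" and inf: "infinite {n. peval (x (i + p * n)) e = 0}"
  obtain L where L: "\<forall>z\<in>set L. pvars (snd z) \<subseteq> pvars e \<and> pconsts (snd z) \<subseteq> {1}"
     "\<forall>x. peval x e = (\<Sum>z\<leftarrow>L. fst z * peval x (snd z))" using pexp_as_combination[of e] by blast
  define S where "S = {\<lambda>n. peval (x (i + p * n)) e |e. pvars e \<subseteq> V \<and> pconsts e \<subseteq> R}"
  have eq: "peval x e = (\<Sum>j<length L. fst (L ! j) * peval x (snd (L ! j)))" for x using L(2) by (simp add: sum_list_sum_nth atLeast0LessThan)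
  have "ev (\<lambda>n. (\<Sum>j<length L. fst (L ! j) * (\<lambda>n. peval (x (i + p * n)) (snd (L ! j))) n) = 0)"
  proof (rule zeros_of_combinations[OF R])
    show "s n \<in> R" if "s \<in> S" for s n using that x by (auto simp: S_def intro!: peval_in_subring R)
    show "(\<lambda>n. a * s n - b * t n) \<in> S" if ab: "a \<in> R" "b \<in> R" and st: "s \<in> S" "t \<in> S" for a b s t
    proof -
      obtain e1 e2 where e12: "s = (\<lambda>n. peval (x (i + p * n)) e1)" "t = (\<lambda>n. peval (x (i + p * n)) e2)"
        "pvars e1 \<subseteq> V" "pconsts e1 \<subseteq> R" "pvars e2 \<subseteq> V" "pconsts e2 \<subseteq> R" using st by (auto simp: S_def)
      let ?e = "PAdd (PMul (PConst a) e1) (PMul (PConst (- b)) e2)"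
      have "pvars ?e \<subseteq> V" "pconsts ?e \<subseteq> R" using e12 ab subring_setD(5)[OF R] by auto
      moreover have "(\<lambda>n. a * s n - b * t n) = (\<lambda>n. peval (x (i + p * n)) ?e)" by (simp add: e12)
      ultimately show ?thesis unfolding S_def by blast
    qed
    show "ev (\<lambda>n. s n = 0)" if "s \<in> S" "infinite {n. s n = 0}" for s
      using that P by (auto simp: S_def progression_zeros_def)
    show "(\<lambda>n. peval (x (i + p * n)) (snd (L ! j))) \<in> S" if "j \<in> {..<length L}" for j
    proof -
      have "snd (L ! j) \<in> snd ` set L" using that by auto
      hence "pvars (snd (L ! j)) \<subseteq> V" "pconsts (snd (L ! j)) \<subseteq> R"
        using L(1) e subring_setD(2)[OF R] that by (meson nth_mem lessThan_iff order_trans, meson nth_mem lessThan_iff order_trans empty_subsetI insert_subset)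
      thus ?thesis unfolding S_def by blast
    qed
  qed (use inf in "auto simp: eq")
  thus "ev (\<lambda>n. peval (x (i + p * n)) e = 0)" by (simp add: eq)
qed

section \<open>Skew products\<close>

context filtered_ring
begin

lemma left_inverse_injective:
  fixes n :: nat
  assumes Y: "\<And>i k. i < n ==> k < n ==> Y i k \<in> R"
    and YX: "\<And>i l. i < n ==> l < n ==> (\<Sum>k<n. Y i k * X k l) = (if i = l then c else 0)"
    and c: "unit_mod c" and t: "\<And>l. l < n ==> t l \<in> R"
    and Xt: "\<And>k. k < n ==> (\<Sum>l<n. X k l * t l) \<in> I j" and i: "i < n"
  shows "t i \<in> I j"
proof (rule unit_mod_cancel[OF c])
  show "t i \<in> R" using t i .
  have "(\<Sum>k<n. Y i k * (\<Sum>l<n. X k l * t l)) \<in> I j"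
    by (rule ideal_set_sum[OF I_ideal], rule ideal_setD(4)[OF I_ideal]) (use Y Xt i in auto)
  also have "(\<Sum>k<n. Y i k * (\<Sum>l<n. X k l * t l)) = (\<Sum>l<n. (\<Sum>k<n. Y i k * X k l) * t l)"
    unfolding sum_distrib_left sum_distrib_right by (subst sum.swap) (simp add: mult.assoc)
  also have "\<dots> = (\<Sum>l<n. (if i = l then c else 0) * t l)" by (intro sum.cong refl) (simp add: YX i)
  also have "\<dots> = c * t i" using i by (simp add: if_distrib[of "\<lambda>u. u * _"] cong: if_cong)
  finally show "c * t i \<in> I j" .
qed

lemma det_unit_injective:
  assumes X: "\<And>i k. i < n ==> k < n ==> X i k \<in> R"
    and d: "unit_mod (det (mat n n (\<lambda>(i, k). X i k)))"
    and t: "\<And>l. l < n ==> t l \<in> R"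
    and Xt: "\<And>k. k < n ==> (\<Sum>l<n. X k l * t l) \<in> I j" and i: "i < n"
  shows "t i \<in> I j"
proof -
  let ?X = "mat n n (\<lambda>(i, k). X i k)"
  let ?Y = "adj_mat ?X"
  have adj: "?Y \<in> carrier_mat n n" "?Y * ?X = det ?X \<cdot>\<^sub>m 1\<^sub>m n" using adj_mat[of ?X n] by auto
  show ?thesis
  proof (rule left_inverse_injective[where Y = "\<lambda>i k. ?Y $$ (i, k)", OF _ _ d t Xt i])
  show "?Y $$ (i, k) \<in> R" if "i < n" "k < n" for i k by (rule adj_mat_in_subring[OF subring, of _ n]) (use X that in auto)
  fix i l assume il: "i < n" "l < n"
  have "(?Y * ?X) $$ (i, l) = (\<Sum>k<n. ?Y $$ (i, k) * X k l)" using il adj(1) by (simp add: scalar_prod_def atLeast0LessThan)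
  moreover have "(?Y * ?X) $$ (i, l) = (if i = l then det ?X else 0)" unfolding adj(2) using il by simp
  ultimately show "(\<Sum>k<n. ?Y $$ (i, k) * X k l) = (if i = l then det ?X else 0)" by (rule trans[OF sym])
  qed
qed

lemma peval_diff_in_ideal:
  assumes J: "ideal_set R J" and "pconsts e \<subseteq> R"
    and "\<And>v. v \<in> pvars e ==> x v \<in> R \<and> y v \<in> R \<and> x v - y v \<in> J"
  shows "peval x e - peval y e \<in> J" using assms(2,3)
proof (induction e)
  case (PConst c)
  thus ?case using ideal_setD(2)[OF J] by simp
next
  case (PAdd a b)
  hence "(peval x a - peval y a) + (peval x b - peval y b) \<in> J" by (intro ideal_setD(3)[OF J]) auto
  thus ?case by (simp add: algebra_simps)
next
  case (PMul a b)
  have "peval x a \<in> R" "peval y b \<in> R" by (rule peval_in_subring[OF subring]; use PMul.prems in auto)+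
  moreover have "peval x a - peval y a \<in> J" "peval x b - peval y b \<in> J" using PMul by auto
  ultimately have "(peval x a - peval y a) * peval y b + peval x a * (peval x b - peval y b) \<in> J"
    by (intro ideal_setD(3)[OF J ideal_setD(5)[OF J] ideal_setD(4)[OF J]])
  thus ?case by (simp add: algebra_simps)
qed auto

text \<open>The radical of \<open>I 1\<close>, hence an ideal.\<close>

definition nilpotents :: "complex set" where
  "nilpotents = {x \<in> R. \<exists>b\<ge>1. x ^ b \<in> I 1}"

lemma nilpotents_ideal: "ideal_set R nilpotents" unfolding ideal_set_def
proof (intro conjI ballI)
  show "nilpotents \<subseteq> R" by (auto simp: nilpotents_def)
  show "0 \<in> nilpotents" using subring_setD(1)[OF subring] ideal_setD(2)[OF I_ideal] by (auto simp: nilpotents_def intro!: exI[of _ 1])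
  show "c * x \<in> nilpotents" if c: "c \<in> R" and x: "x \<in> nilpotents" for c x
  proof -
    obtain b where b: "x \<in> R" "b \<ge> 1" "x ^ b \<in> I 1" using x by (auto simp: nilpotents_def)
    have "(c * x) ^ b \<in> I 1" unfolding power_mult_distrib by (rule ideal_setD(4)[OF I_ideal subring_power[OF subring c] b(3)])
    thus ?thesis using b c subring_setD(4)[OF subring] by (auto simp: nilpotents_def)
  qed
  fix x y assume xy: "x \<in> nilpotents" "y \<in> nilpotents"
  obtain a where a: "x \<in> R" "a \<ge> 1" "x ^ a \<in> I 1" using xy(1) by (auto simp: nilpotents_def)
  obtain b where b: "y \<in> R" "b \<ge> 1" "y ^ b \<in> I 1" using xy(2) by (auto simp: nilpotents_def)
  have "(x + y) ^ (a + b) \<in> I 1" unfolding binomial_ring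
  proof (rule ideal_set_sum[OF I_ideal])
    fix k assume "k \<in> {..a + b}"
    have "x ^ k * y ^ (a + b - k) \<in> I 1"
    proof (cases "a \<le> k")
      case True
      thus ?thesis by (intro ideal_setD(5)[OF I_ideal subring_power[OF subring b(1)]] ideal_set_power[OF subring I_ideal a(3,1)])
    next
      case False
      thus ?thesis by (intro ideal_setD(4)[OF I_ideal subring_power[OF subring a(1)]] ideal_set_power[OF subring I_ideal b(3,1)]) simp
    qed
    thus "of_nat (a + b choose k) * x ^ k * y ^ (a + b - k) \<in> I 1"
      using ideal_setD(4)[OF I_ideal subring_set_of_nat[OF subring]] by (simp add: mult.assoc)
  qed
  thus "x + y \<in> nilpotents" using a b subring_setD(3)[OF subring] by (auto simp: nilpotents_def intro!: exI[of _ "a + b"])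
qed

end

section \<open>Scaling the fiber coordinates\<close>

definition rescale :: "complex => (coord => complex) => coord => complex" where
  "rescale s y c = (case c of Fiber j => s * y (Fiber j) | _ => y c)"

lemma rescale_simps [simp]:
  "rescale s y Time = y Time" "rescale s y (Base i) = y (Base i)" "rescale s y (Fiber j) = s * y (Fiber j)"
  "rescale s y (Entry i k) = y (Entry i k)" by (auto simp: rescale_def)

text \<open>Expansion in powers of the scaling factor, with coefficients that are again expressions
  over \<open>R\<close> in the unscaled coordinates and a degree bound independent of the
  point.\<close>

lemma peval_rescale:
  fixes e :: "coord pexp"
  assumes "pvars e \<subseteq> V" "pconsts e \<subseteq> R" and R: "subring_set R"
  shows "\<exists>C K. (\<forall>i. pvars (C i) \<subseteq> V \<and> pconsts (C i) \<subseteq> R) \<and>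
    (\<forall>y. \<exists>P. (\<forall>i. coeff P i = peval y (C i)) \<and> degree P \<le> K \<and> (\<forall>s. poly P s = peval (rescale s y) e))"
  using assms(1,2)
proof (induction e)
  case (PConst c)
  show ?case
  proof (intro exI[of _ "\<lambda>i::nat. if i = 0 then PConst c else PConst 0"] exI[of _ "0::nat"] conjI allI)
    fix y show "\<exists>P. (\<forall>i. coeff P i = peval y (if i = 0 then PConst c else PConst 0)) \<and> degree P \<le> 0 \<and>
        (\<forall>s. poly P s = peval (rescale s y) (PConst c))" by (intro exI[of _ "[:c:]"]) (auto simp: coeff_pCons split: nat.splits)
  qed (use PConst subring_setD[OF R] in auto)
next
  case (PVar v)
  define n :: nat where "n = (case v of Fiber j => 1 | _ => 0)"
  show ?case
  proof (intro exI[of _ "\<lambda>i::nat. if i = n then PVar v else PConst 0"] exI[of _ "1::nat"] conjI allI)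
    fix y show "\<exists>P. (\<forall>i. coeff P i = peval y (if i = n then PVar v else PConst 0)) \<and> degree P \<le> 1 \<and>
        (\<forall>s. poly P s = peval (rescale s y) (PVar v))" by (rule exI[of _ "monom (y v) n"])
         (auto simp: n_def coeff_monom poly_monom split: coord.splits intro: order_trans[OF degree_monom_le])
  qed (use PVar subring_setD[OF R] in auto)
next
  case (PAdd a b)
  obtain C K where a: "\<And>i. pvars (C i) \<subseteq> V \<and> pconsts (C i) \<subseteq> R"
    "\<And>y. \<exists>P. (\<forall>i. coeff P i = peval y (C i)) \<and> degree P \<le> K \<and> (\<forall>s. poly P s = peval (rescale s y) a)"
    using PAdd.IH(1) PAdd.prems by auto
  obtain C' K' where b: "\<And>i. pvars (C' i) \<subseteq> V \<and> pconsts (C' i) \<subseteq> R"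
    "\<And>y. \<exists>P. (\<forall>i. coeff P i = peval y (C' i)) \<and> degree P \<le> K' \<and> (\<forall>s. poly P s = peval (rescale s y) b)"
    using PAdd.IH(2) PAdd.prems by auto
  show ?case
  proof (intro exI[of _ "\<lambda>i. PAdd (C i) (C' i)"] exI[of _ "max K K'"] conjI allI)
    fix y
    obtain P where P: "\<And>i. coeff P i = peval y (C i)" "degree P \<le> K" "\<And>s. poly P s = peval (rescale s y) a" using a(2)[of y] by blast
    obtain P' where P': "\<And>i. coeff P' i = peval y (C' i)" "degree P' \<le> K'" "\<And>s. poly P' s = peval (rescale s y) b"
      using b(2)[of y] by blast
    have "degree (P + P') \<le> max K K'" using degree_add_le_max[of P P'] P(2) P'(2) by linarith
    thus "\<exists>P. (\<forall>i. coeff P i = peval y (PAdd (C i) (C' i))) \<and> degree P \<le> max K K' \<and>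
        (\<forall>s. poly P s = peval (rescale s y) (PAdd a b))" by (intro exI[of _ "P + P'"]) (simp add: P P')
  qed (use a b in auto)
next
  case (PMul a b)
  obtain C K where a: "\<And>i. pvars (C i) \<subseteq> V \<and> pconsts (C i) \<subseteq> R"
    "\<And>y. \<exists>P. (\<forall>i. coeff P i = peval y (C i)) \<and> degree P \<le> K \<and> (\<forall>s. poly P s = peval (rescale s y) a)"
    using PMul.IH(1) PMul.prems by auto
  obtain C' K' where b: "\<And>i. pvars (C' i) \<subseteq> V \<and> pconsts (C' i) \<subseteq> R"
    "\<And>y. \<exists>P. (\<forall>i. coeff P i = peval y (C' i)) \<and> degree P \<le> K' \<and> (\<forall>s. poly P s = peval (rescale s y) b)"
    using PMul.IH(2) PMul.prems by auto
  define E where "E i = psum (map (\<lambda>j. PMul (C j) (C' (i - j))) [0..<Suc i])" for i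
  show ?case
  proof (intro exI[of _ E] exI[of _ "K + K'"] conjI allI)
    fix y
    obtain P where P: "\<And>i. coeff P i = peval y (C i)" "degree P \<le> K" "\<And>s. poly P s = peval (rescale s y) a" using a(2)[of y] by blast
    obtain P' where P': "\<And>i. coeff P' i = peval y (C' i)" "degree P' \<le> K'" "\<And>s. poly P' s = peval (rescale s y) b"
      using b(2)[of y] by blast
    have "degree (P * P') \<le> K + K'" using degree_mult_le[of P P'] P(2) P'(2) by linarith
    moreover have "coeff (P * P') i = peval y (E i)" for i
      by (simp add: coeff_mult P P' E_def peval_psum o_def sum_list_upt lessThan_Suc_atMost del: upt_Suc)
    ultimately show "\<exists>P. (\<forall>i. coeff P i = peval y (E i)) \<and> degree P \<le> K + K' \<and>
        (\<forall>s. poly P s = peval (rescale s y) (PMul a b))" by (intro exI[of _ "P * P'"]) (simp add: P P')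
  next
    fix i
    have ab: "pvars (PMul (C j) (C' k)) \<subseteq> V \<and> pconsts (PMul (C j) (C' k)) \<subseteq> R" for j k using a(1)[of j] b(1)[of k] by simp
    show "pvars (E i) \<subseteq> V" unfolding E_def pvars_psum set_map using ab by (simp add: UN_subset_iff del: pvars.simps upt_Suc)
    show "pconsts (E i) \<subseteq> R" unfolding E_def pconsts_psum set_map using ab subring_setD(1)[OF R]
      by (simp add: UN_subset_iff del: pconsts.simps upt_Suc)
  qed
qed

text \<open>The left side is the depth that a height of order \<theta>^n permits, the right side the
  depth gained after n steps of d-th powers.\<close>

lemma exponential_gap:
  fixes \<theta> C A :: real and d b :: nat
  assumes "1 < \<theta>" "\<theta> < d" "C > 0" "A \<ge> 0" "b \<ge> 1"
  shows "\<exists>N. \<forall>n\<ge>N. C * (A * \<theta> ^ Suc n + 1) < real (d ^ n div b)"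
proof -
  have d: "real d > 1" "real d > 0" using assms by auto
  define K where "K = (C * A * \<theta> + C + 1) * b"
  have K: "K > 0" using assms by (auto simp: K_def intro!: mult_pos_pos add_nonneg_pos)
  have "(\<lambda>n. (\<theta> / d) ^ n) \<longlonglongrightarrow> 0" using assms d by (intro LIMSEQ_power_zero) auto
  hence "ev (\<lambda>n. (\<theta> / d) ^ n < 1 / K)" by (rule order_tendstoD) (use K in simp)
  then obtain N where N: "\<And>n. n \<ge> N ==> (\<theta> / d) ^ n < 1 / K" by (auto simp: eventually_sequentially)
  have "C * (A * \<theta> ^ Suc n + 1) < real (d ^ n div b)" if "n \<ge> N" for n
  proof -
    have "\<theta> ^ n * K < real d ^ n" using N[OF that] K d by (simp add: power_divide field_simps)
    hence "(C * A * \<theta> + C + 1) * \<theta> ^ n < real d ^ n / b" using assms(5) by (simp add: K_def field_simps)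
    moreover have "1 \<le> \<theta> ^ n" using assms(1) by (intro one_le_power) auto
    hence "C * 1 \<le> C * \<theta> ^ n" "1 \<le> \<theta> ^ n" using assms(3) by auto
    moreover have "real d ^ n / b < real (d ^ n div b) + 1"
    proof -
      have "d ^ n < (d ^ n div b + 1) * b" using assms(5) by (simp add: dividend_less_div_times)
      hence "real (d ^ n) < real ((d ^ n div b + 1) * b)" by (simp only: of_nat_less_iff)
      hence "real d ^ n < (real (d ^ n div b) + 1) * real b" by (simp add: algebra_simps)
      thus ?thesis using assms(5) by (simp add: pos_divide_less_eq)
    qed
    ultimately show ?thesis by (simp add: algebra_simps)
  qed
  thus ?thesis by blast
qed

text \<open>The orbit in terms of expressions, over a base that may already be an auxiliary system.
  \<open>Mi\<close> and \<open>Ai\<close> invert \<open>M\<close> and \<open>A\<close>,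
  \<open>g\<close> is the fiber map, and \<open>e\<close> describes q steps of the base with degree
  \<delta> < d^q. In \<open>rho_order\<close> the variable \<open>None\<close> stands for the
  scaling factor. \<open>K\<close> holds constants, such as Nullstellensatz cofactors, that
  \<open>R\<close> must contain for \<open>base_etale\<close> and \<open>critical\<close> to
  apply.\<close>

locale skew_orbit =
  fixes m r a d n0 :: nat and B :: "nat => nat pexp" and \<rho> :: "coord pexp" and M Mi :: "nat => nat => coord pexp"
    and g :: "nat => coord pexp" and A Ai :: "nat => nat => coord pexp"
    and x :: "nat => coord => complex" and q \<delta> :: nat and e :: "nat => nat pexp"
    and K :: "complex set" and l :: nat
  assumes B: "i < m ==> pvars (B i) \<subseteq> {..<m}"
    and \<rho>: "pvars \<rho> \<subseteq> Base ` {..<m} \<union> Fiber ` {..<r}"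
    and M: "i < r ==> k < r ==> pvars (M i k) \<subseteq> Base ` {..<m}"
    and Mi: "i < r ==> k < r ==> pvars (Mi i k) \<subseteq> Base ` {..<m}"
    and g: "i < r ==> pvars (g i) \<subseteq> Base ` {..<m} \<union> Fiber ` {..<r}"
    and A: "i < a ==> k < a ==> pvars (A i k) \<subseteq> {Time}"
    and Ai: "i < a ==> k < a ==> pvars (Ai i k) \<subseteq> {Time}"
    and x_Time: "x n Time = of_nat (n0 + n)"
    and x_Base: "i < m ==> x (Suc n) (Base i) = peval (\<lambda>i. x n (Base i)) (B i)"
    and x_Fiber: "j < r ==> x (Suc n) (Fiber j) = peval (x n) (g j)"
    and x_Entry: "i < a ==> j < a ==> x (Suc n) (Entry i j) = (\<Sum>k<a. peval (x n) (A i k) * x n (Entry k j))"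
    and g_eq: "j < r ==> peval y (g j) = peval y \<rho> * (\<Sum>k<r. peval y (M j k) * y (Fiber k))"
    and M_inv: "i < r ==> k < r ==> (\<Sum>j<r. peval (x n) (Mi i j) * peval (x n) (M j k)) = (if i = k then 1 else 0)"
    and A_inv: "i < a ==> k < a ==> (\<Sum>j<a. peval (x n) (Ai i j) * peval (x n) (A j k)) = (if i = k then 1 else 0)"
    and rho_order: "\<exists>\<rho>'. pvars \<rho>' \<subseteq> insert None (Some ` (Base ` {..<m} \<union> Fiber ` {..<r})) \<and> pconsts \<rho>' \<subseteq> K \<and>
      (\<forall>s y. peval (rescale s y) \<rho> = s ^ (d - 1) * peval (case_option s y) \<rho>')"
    and d2: "d \<ge> 2"
    and q: "q \<ge> 1" and \<delta>: "\<delta> < d ^ q"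
    and e: "i < m ==> pvars (e i) \<subseteq> {..<m} \<and> pdeg (e i) \<le> \<delta>"
    and x_e: "i < m ==> x (n + q) (Base i) = peval (\<lambda>i. x n (Base i)) (e i)"
    and K: "finite K"
    and base_etale: "filtered_ring R I p ==> K \<subseteq> R ==> (\<And>n i. i < m ==> x n (Base i) \<in> R) ==>
      (\<And>i. i < m ==> t i \<in> R) ==> (\<And>i. i < m ==> pdiff (\<lambda>i. x n (Base i)) t (B i) \<in> I 2) ==>
      i < m ==> t i \<in> I 2"
    and critical: "subring_set R ==> K \<subseteq> R ==> (\<And>n c. c \<in> state_coords m r a ==> x n c \<in> R) ==> j < r ==>
      \<exists>k. \<exists>b\<in>R. x (n + l) (Fiber j) ^ k =
        b * det (mat r r (\<lambda>(i, k). pdiff (x n) (\<lambda>c. if c = Fiber k then 1 else 0) (g i)))"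
begin

abbreviation "V \<equiv> state_coords m r a"

text \<open>The fiber rule is a parameter: it is \<open>g\<close> for the orbit itself and the
  linear map given by \<open>M\<close> for the orbit with its scalar factor removed.\<close>

definition system :: "(nat => coord pexp) => coord => coord pexp" where
  "system f c = (case c of Time => PAdd (PVar Time) (PConst 1)
     | Base i => psubst (\<lambda>i. PVar (Base i)) (B i)
     | Fiber j => f j
     | Entry i j => psum (map (\<lambda>k. PMul (A i k) (PVar (Entry k j))) [0..<a]))"

lemma finite_V: "finite V"
proof -
  have "{Entry i j |i j. i < a \<and> j < a} = (\<lambda>(i, j). Entry i j) ` ({..<a} \<times> {..<a})" by auto
  thus ?thesis by (simp add: state_coords_def)
qed

lemma in_V: "Time \<in> V" "i < m ==> Base i \<in> V" "j < r ==> Fiber j \<in> V" "i < a ==> j < a ==> Entry i j \<in> V"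
  by (auto simp: state_coords_def)

lemma V_cases:
  assumes "c \<in> V"
  obtains "c = Time" | i where "c = Base i" "i < m" | j where "c = Fiber j" "j < r" | i j where "c = Entry i j" "i < a" "j < a"
  using assms by (auto simp: state_coords_def)

definition coefficients :: "complex set" where
  "coefficients = insert 0 (insert 1 (K \<union> (\<Union>i<m. pconsts (B i) \<union> pconsts (e i)) \<union> pconsts \<rho> \<union>
     (\<Union>i<r. pconsts (g i) \<union> (\<Union>k<r. pconsts (M i k) \<union> pconsts (Mi i k))) \<union>
     (\<Union>i<a. \<Union>k<a. pconsts (A i k) \<union> pconsts (Ai i k))))"

lemma coefficients:
  "K \<subseteq> coefficients" "i < m ==> pconsts (B i) \<subseteq> coefficients" "i < m ==> pconsts (e i) \<subseteq> coefficients"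
  "pconsts \<rho> \<subseteq> coefficients" "i < r ==> pconsts (g i) \<subseteq> coefficients"
  "i < r ==> k < r ==> pconsts (M i k) \<subseteq> coefficients" "i < r ==> k < r ==> pconsts (Mi i k) \<subseteq> coefficients"
  "i < a ==> k < a ==> pconsts (A i k) \<subseteq> coefficients" "i < a ==> k < a ==> pconsts (Ai i k) \<subseteq> coefficients"
  by (auto simp: coefficients_def)

lemma finite_coefficients: "finite coefficients" unfolding coefficients_def using K by (simp add: finite_pconsts)

text \<open>The Jacobian is block triangular in the order time, base, fiber, entries of the cocycle.
  Time is a translation, the base block is \<open>base_etale\<close>, the block of the entries has
  the inverse \<open>Ai\<close>, and the fiber block is left to the hypothesis
  \<open>inj\<close>.\<close>

lemma system_etale_orbit:
  assumes F: "filtered_ring R I p" and KR: "coefficients \<subseteq> R"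
    and xR: "\<And>n c. c \<in> V ==> x n c \<in> R"
    and f: "\<And>j. j < r ==> pvars (f j) \<subseteq> Base ` {..<m} \<union> Fiber ` {..<r} \<and> pconsts (f j) \<subseteq> R"
    and yx: "\<And>n c. (\<And>j. c \<noteq> Fiber j) ==> y n c = x (N + n) c"
    and y0: "\<And>j. j < r ==> y 0 (Fiber j) \<in> R"
    and ySuc: "\<And>n j. j < r ==> y (Suc n) (Fiber j) = peval (y n) (f j)"
    and inj: "\<And>n t j. (\<And>j. j < r ==> t j \<in> R) ==>
      (\<And>j. j < r ==> (\<Sum>k<r. pdiff (y n) (\<lambda>c. if c = Fiber k then 1 else 0) (f j) * t k) \<in> I 2) ==> j < r ==> t j \<in> I 2"
  shows "etale_orbit R I p V (system f) y"
proof -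
  interpret filtered_ring R I p by (rule F)
  have R01: "0 \<in> R" "1 \<in> R" using subring_setD[OF subring] by auto
  have base_fiber: "Base ` {..<m} \<union> Fiber ` {..<r} \<subseteq> V" by (auto simp: in_V)
  have system_vars: "pvars (system f c) \<subseteq> V" if "c \<in> V" for c using that
  proof (cases rule: V_cases)
    case (2 i)
    thus ?thesis using B[of i] by (auto simp: system_def pvars_psubst in_V)
  next
    case (3 j)
    hence "pvars (f j) \<subseteq> V" using f[OF 3(2)] base_fiber by (meson order_trans)
    thus ?thesis using 3 by (simp add: system_def)
  next
    case (4 i j)
    have "pvars (PMul (A i k) (PVar (Entry k j))) \<subseteq> V" if "k < a" for k using A[OF 4(2) that] in_V(1) in_V(4)[OF that 4(3)] by auto
    thus ?thesis using 4 by (simp add: system_def pvars_psum UN_subset_iff)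
  qed (auto simp: system_def in_V)
  have system_consts: "pconsts (system f c) \<subseteq> R" if "c \<in> V" for c using that
  proof (cases rule: V_cases)
    case (2 i)
    have "pconsts (B i) \<subseteq> R" by (rule order_trans[OF coefficients(2)[OF 2(2)] KR])
    thus ?thesis using 2 pconsts_psubst[of "\<lambda>i. PVar (Base i)" "B i"] by (auto simp: system_def)
  next
    case (3 j)
    thus ?thesis using f[of j] by (simp add: system_def)
  next
    case (4 i j)
    have "pconsts (A i k) \<subseteq> R" if "k < a" for k by (rule order_trans[OF coefficients(8)[OF 4(2) that] KR])
    thus ?thesis using 4 R01 by (simp add: system_def pconsts_psum UN_subset_iff)
  qed (auto simp: system_def R01)
  have y_Suc: "y (Suc n) c = peval (y n) (system f c)" if "c \<in> V" for n c using that
  proof (cases rule: V_cases)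
    case 1
    thus ?thesis by (simp add: system_def yx x_Time)
  next
    case (2 i)
    thus ?thesis using x_Base[of i "N + n"] by (simp add: system_def yx peval_psubst)
  next
    case (3 j)
    thus ?thesis using ySuc by (simp add: system_def)
  next
    case (4 i j)
    have "peval (y n) (A i k) = peval (x (N + n)) (A i k)" if "k < a" for k by (rule peval_cong) (use A[of i k] 4 that yx in auto)
    thus ?thesis using 4 x_Entry[of i j "N + n"] by (simp add: system_def yx peval_psum o_def sum_list_upt)
  qed
  have y0R: "y 0 c \<in> R" if "c \<in> V" for c using that by (cases rule: V_cases) (use y0 yx xR that in auto)
  have yR: "y n c \<in> R" if "c \<in> V" for n c using that
  proof (induction n arbitrary: c)
    case (Suc n)
    show ?case unfolding y_Suc[OF Suc.prems]
      by (rule peval_in_subring[OF subring system_consts[OF Suc.prems]]) (use system_vars[OF Suc.prems] Suc.IH in blast)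
  qed (rule y0R)
  show ?thesis
  proof
    fix t n c
    assume tR: "\<And>c. c \<in> V ==> t c \<in> R" and dt: "\<And>c. c \<in> V ==> pdiff (y n) t (system f c) \<in> I 2" and c: "c \<in> V"
    have time: "t Time \<in> I 2" using dt[OF in_V(1)] by (simp add: system_def)
    have base: "t (Base i) \<in> I 2" if "i < m" for i
    proof (rule base_etale[OF F, of "\<lambda>i. t (Base i)" "N + n"])
      show "K \<subseteq> R" by (rule order_trans[OF coefficients(1) KR])
      show "x n (Base i) \<in> R" if "i < m" for n i by (rule xR[OF in_V(2)[OF that]])
      show "t (Base i) \<in> R" if "i < m" for i by (rule tR[OF in_V(2)[OF that]])
      show "pdiff (\<lambda>i. x (N + n) (Base i)) (\<lambda>i. t (Base i)) (B i) \<in> I 2" if "i < m" for i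
        using dt[OF in_V(2)[OF that]] by (simp add: system_def pdiff_psubst yx)
    qed (rule that)
    have fiber: "t (Fiber j) \<in> I 2" if "j < r" for j
    proof (rule inj[of "\<lambda>j. t (Fiber j)" n])
      show "t (Fiber j) \<in> R" if "j < r" for j by (rule tR[OF in_V(3)[OF that]])
      fix j assume j: "j < r"
      \<comment> \<open>The fiber part of the tangent vector; what remains has base components in
        \<open>I 2\<close> and does not matter modulo \<open>I 2\<close>.\<close>
      define tf where "tf c = (\<Sum>k<r. t (Fiber k) * (if c = Fiber k then 1 else 0))" for c
      have tf_Base: "tf (Base i) = 0" for i by (simp add: tf_def)
      have tf_Fiber: "tf (Fiber k) = t (Fiber k)" if "k < r" for k using that by (simp add: tf_def if_distrib[of "\<lambda>u. _ * u"] cong: if_cong)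
      have fj: "v \<in> Base ` {..<m} \<union> Fiber ` {..<r}" if "v \<in> pvars (f j)" for v using f[OF j] that by blast
      have "pdiff (y n) (\<lambda>c. t c - tf c) (f j) \<in> I 2"
      proof (rule pdiff_in_I)
        show "pconsts (f j) \<subseteq> R" using f[OF j] by blast
        show "y n v \<in> R" if "v \<in> pvars (f j)" for v using fj[OF that] yR in_V by blast
        show "t v - tf v \<in> I 2" if "v \<in> pvars (f j)" for v using fj[OF that] base tf_Base tf_Fiber ideal_setD(2)[OF I_ideal] by auto
      qed
      hence "pdiff (y n) t (f j) - pdiff (y n) tf (f j) \<in> I 2" by (simp only: pdiff_diff)
      moreover have "pdiff (y n) t (f j) \<in> I 2" using dt[OF in_V(3)[OF j]] by (simp add: system_def)
      ultimately have "pdiff (y n) t (f j) - (pdiff (y n) t (f j) - pdiff (y n) tf (f j)) \<in> I 2"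
        by (rule ideal_set_minus[OF subring I_ideal, rotated])
      hence "pdiff (y n) tf (f j) \<in> I 2" by simp
      thus "(\<Sum>k<r. pdiff (y n) (\<lambda>c. if c = Fiber k then 1 else 0) (f j) * t (Fiber k)) \<in> I 2"
        unfolding tf_def[abs_def] by (simp only: pdiff_sum pdiff_scale mult.commute)
    qed (rule that)
    have entry: "t (Entry i j) \<in> I 2" if ij: "i < a" "j < a" for i j
    proof (rule left_inverse_injective[of a "\<lambda>i k. peval (y n) (Ai i k)" "\<lambda>i k. peval (y n) (A i k)" 1 "\<lambda>k. t (Entry k j)"])
      have A_R: "peval (y n) (A i k) \<in> R" "peval (y n) (Ai i k) \<in> R" if "i < a" "k < a" for i k
      proof -
        have "pconsts (A i k) \<subseteq> R" "pconsts (Ai i k) \<subseteq> R"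
          by (rule order_trans[OF coefficients(8)[OF that] KR], rule order_trans[OF coefficients(9)[OF that] KR])
        thus "peval (y n) (A i k) \<in> R" "peval (y n) (Ai i k) \<in> R"
          using A[OF that] Ai[OF that] yR[OF in_V(1), of n] by (auto intro!: peval_in_subring subring)
      qed
      show "peval (y n) (Ai i k) \<in> R" if "i < a" "k < a" for i k using A_R that by blast
      show "(\<Sum>k<a. peval (y n) (Ai i k) * peval (y n) (A k j)) = (if i = j then 1 else 0)" if "i < a" "j < a" for i j
      proof -
        have "peval (y n) (A k j) = peval (x (N + n)) (A k j)" "peval (y n) (Ai i k) = peval (x (N + n)) (Ai i k)" if "k < a" for k
          by (rule peval_cong; use A[of k j] Ai[of i k] that \<open>i < a\<close> \<open>j < a\<close> yx in auto)+
        thus ?thesis using A_inv[OF that, of "N + n"] by simp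
      qed
      show "unit_mod 1" using R01 ideal_setD(2)[OF I_ideal] by (auto simp: unit_mod_def intro!: exI[of _ 1])
      show "t (Entry k j) \<in> R" if "k < a" for k by (rule tR[OF in_V(4)[OF that ij(2)]])
      show "i < a" by (rule ij)
      fix i assume i: "i < a"
      have pa: "pdiff (y n) t (A i k) \<in> I 2" if "k < a" for k
      proof (rule pdiff_in_I)
        show "pconsts (A i k) \<subseteq> R" by (rule order_trans[OF coefficients(8)[OF i that] KR])
        show "y n v \<in> R" "t v \<in> I 2" if "v \<in> pvars (A i k)" for v using A[OF i \<open>k < a\<close>] that yR[OF in_V(1)] time by auto
      qed
      have "(\<Sum>k<a. pdiff (y n) t (A i k) * y n (Entry k j)) \<in> I 2"
        by (intro ideal_set_sum[OF I_ideal] ideal_setD(5)[OF I_ideal] yR in_V pa) (use ij in auto)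
      moreover have "(\<Sum>k<a. pdiff (y n) t (A i k) * y n (Entry k j) + peval (y n) (A i k) * t (Entry k j)) \<in> I 2"
        using dt[OF in_V(4)[OF i ij(2)]] by (simp add: system_def pdiff_psum o_def sum_list_upt)
      ultimately have "(\<Sum>k<a. pdiff (y n) t (A i k) * y n (Entry k j) + peval (y n) (A i k) * t (Entry k j)) -
          (\<Sum>k<a. pdiff (y n) t (A i k) * y n (Entry k j)) \<in> I 2" by (intro ideal_set_minus[OF subring I_ideal])
      thus "(\<Sum>k<a. peval (y n) (A i k) * t (Entry k j)) \<in> I 2" by (simp add: sum.distrib)
    qed
    show "t c \<in> I 2" using c by (cases rule: V_cases) (use time base fiber entry in auto)
  qed (fact finite_V y0R y_Suc system_vars system_consts)+
qed

end

section \<open>Orbits avoiding and orbits meeting the critical locus\<close>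

lemma infinite_shift: "infinite {n. P n} ==> infinite {n. P (n + k :: nat)}" using eventually_sequentially_seg[of "\<lambda>n. \<not> P n" k]
  by (simp add: eventually_cofinite flip: cofinite_eq_sequentially)

lemma progression_zerosI:
  assumes p: "p \<ge> 1"
    and key: "\<And>e i. pvars e \<subseteq> V ==> pconsts e \<subseteq> K ==> infinite {n. peval (x (N + i + p * n)) e = 0} ==>
      ev (\<lambda>n. peval (x (N + i + p * n)) e = 0)"
  shows "progression_zeros V K x p" unfolding progression_zeros_def
proof (intro allI impI)
  fix e i assume e: "pvars e \<subseteq> V" "pconsts e \<subseteq> K" and inf: "infinite {n. peval (x (i + p * n)) e = 0}"
  \<comment> \<open>Advancing \<open>N\<close> periods from i passes the preperiod and lands at
    \<open>N + i'\<close> in the same progression.\<close>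
  define i' where "i' = i + (p - 1) * N"
  have eq: "i + p * (n + N) = N + i' + p * n" for n using p by (cases p) (auto simp: i'_def algebra_simps)
  have "infinite {n. peval (x (N + i' + p * n)) e = 0}" using infinite_shift[OF inf, of N] unfolding eq .
  from key[OF e this] have "ev (\<lambda>n. peval (x (i + p * (n + N))) e = 0)" by (simp only: eq)
  thus "ev (\<lambda>n. peval (x (i + p * n)) e = 0)"
    by (simp only: eventually_sequentially_seg[of "\<lambda>n. peval (x (i + p * n)) e = 0"])
qed

lemma small_subset: "small G x r ==> G \<subseteq> H ==> small H x r" unfolding small_def using height_subset by blast

context skew_orbit
begin

lemma orbit_in_R:
  assumes R: "subring_set R" "coefficients \<subseteq> R" and x0: "\<And>c. c \<in> V ==> x 0 c \<in> R" and c: "c \<in> V"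
  shows "x n c \<in> R" using c
proof (induction n arbitrary: c)
  case (Suc n)
  show ?case using Suc.prems
  proof (cases rule: V_cases)
    case 1
    thus ?thesis unfolding 1 x_Time by (intro subring_set_of_nat R)
  next
    case (2 i)
    show ?thesis unfolding 2(1) x_Base[OF 2(2)]
    proof (rule peval_in_subring[OF R(1) order_trans[OF coefficients(2)[OF 2(2)] R(2)]])
      fix v assume "v \<in> pvars (B i)"
      hence "v < m" using B[OF 2(2)] by blast
      thus "x n (Base v) \<in> R" by (intro Suc.IH in_V)
    qed
  next
    case (3 j)
    show ?thesis unfolding 3(1) x_Fiber[OF 3(2)]
    proof (rule peval_in_subring[OF R(1) order_trans[OF coefficients(5)[OF 3(2)] R(2)]])
      fix v assume "v \<in> pvars (g j)"
      hence "v \<in> V" using g[OF 3(2)] by (auto simp: in_V dest!: subsetD)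
      thus "x n v \<in> R" by (rule Suc.IH)
    qed
  next
    case (4 i j)
    show ?thesis unfolding 4(1) x_Entry[OF 4(2,3)]
    proof (rule subring_set_sum[OF R(1)], rule subring_setD(4)[OF R(1)])
      fix k assume "k \<in> {..<a}"
      hence k: "k < a" by simp
      show "x n (Entry k j) \<in> R" by (rule Suc.IH[OF in_V(4)[OF k 4(3)]])
      show "peval (x n) (A i k) \<in> R"
      proof (rule peval_in_subring[OF R(1) order_trans[OF coefficients(8)[OF 4(2) k] R(2)]])
        fix v assume "v \<in> pvars (A i k)"
        hence "v = Time" using A[OF 4(2) k] by blast
        thus "x n v \<in> R" using Suc.IH in_V(1) by blast
      qed
    qed
  qed
qed (rule x0)

definition jacobian :: "nat => complex mat" where
  "jacobian n = mat r r (\<lambda>(i, k). pdiff (x n) (\<lambda>c. if c = Fiber k then 1 else 0) (g i))"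

text \<open>In this case \<open>x\<close> is itself an etale orbit.\<close>

lemma noncritical_orbit:
  assumes F: "filtered_ring R I p" and KR: "coefficients \<subseteq> R" and x0: "\<And>c. c \<in> V ==> x 0 c \<in> R"
    and unit: "\<And>n. filtered_ring.unit_mod R I (det (jacobian n))"
  shows "\<exists>p\<ge>1. progression_zeros V R x p"
proof -
  interpret filtered_ring R I p by (rule F)
  have xR: "x n c \<in> R" if "c \<in> V" for n c by (rule orbit_in_R[OF subring KR x0 that])
  have gR: "pconsts (g j) \<subseteq> R" if "j < r" for j by (rule order_trans[OF coefficients(5)[OF that] KR])
  have gV: "v \<in> V" if "j < r" "v \<in> pvars (g j)" for v j using g[OF that(1)] that(2) by (auto simp: in_V dest!: subsetD)
  interpret E: etale_orbit R I p V "system g" x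
  proof (rule system_etale_orbit[OF F KR xR, of g x 0])
    show "pvars (g j) \<subseteq> Base ` {..<m} \<union> Fiber ` {..<r} \<and> pconsts (g j) \<subseteq> R" if "j < r" for j
      using g[OF that] gR[OF that] by blast
    show "x 0 (Fiber j) \<in> R" if "j < r" for j by (rule x0[OF in_V(3)[OF that]])
    show "x (Suc n) (Fiber j) = peval (x n) (g j)" if "j < r" for n j by (rule x_Fiber[OF that])
    fix n t j
    assume t: "\<And>j. j < r ==> t j \<in> R"
      and dt: "\<And>j. j < r ==> (\<Sum>k<r. pdiff (x n) (\<lambda>c. if c = Fiber k then 1 else 0) (g j) * t k) \<in> I 2"
      and j: "j < r"
    show "t j \<in> I 2"
    proof (rule det_unit_injective[OF _ _ t dt j])
      show "unit_mod (det (mat r r (\<lambda>(i, k). pdiff (x n) (\<lambda>c. if c = Fiber k then 1 else 0) (g i))))"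
        using unit[of n] by (simp add: jacobian_def)
      show "pdiff (x n) (\<lambda>c. if c = Fiber k then 1 else 0) (g i) \<in> R" if "i < r" "k < r" for i k
        by (rule pdiff_in_R[OF gR[OF that(1)]]) (use gV[OF that(1)] xR subring_setD[OF subring] in auto)
    qed
  qed auto
  obtain q k where q: "q \<ge> 1" and z: "\<forall>e i. pvars e \<subseteq> V --> pconsts e \<subseteq> R -->
      infinite {n. peval (x (k + i + q * n)) e = 0} --> (\<forall>n. peval (x (k + i + q * n)) e = 0)"
    using E.zeros_in_progressions by (elim exE conjE)
  have "progression_zeros V R x q" by (rule progression_zerosI[OF q, of _ _ _ k]) (use z in auto)
  thus ?thesis using q by blast
qed

text \<open>If the orbit meets the critical locus modulo \<open>I 1\<close>, then the fiber coordinates become nilpotent modulo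
  \<open>I 1\<close> and from then on tend to zero superexponentially: they are multiples \<open>s n * w n\<close> where \<open>w\<close> is a linear
  cocycle over the base and \<open>s (n + 1)\<close> is divisible by \<open>s n ^ d\<close>.  In \<open>\<Sum>i. s n ^ i * c i n = 0\<close> the lowest
  nonzero coefficient \<open>c i n\<close> would be divisible by \<open>s n\<close>, which its height does not allow.\<close>

lemma critical_orbit:
  assumes F: "filtered_ring R I p" and KR: "coefficients \<subseteq> R" and x0: "\<And>c. c \<in> V ==> x 0 c \<in> R"
    and nonunit: "\<not> filtered_ring.unit_mod R I (det (jacobian n1))"
  shows "\<exists>p\<ge>1. progression_zeros V R x p"
proof -
  interpret filtered_ring R I p by (rule F)
  have xR: "x n c \<in> R" if "c \<in> V" for n c by (rule orbit_in_R[OF subring KR x0 that])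
  have KK: "K \<subseteq> R" by (rule order_trans[OF coefficients(1) KR])
  have R01: "0 \<in> R" "1 \<in> R" using subring_setD[OF subring] by auto
  have gR: "pconsts (g j) \<subseteq> R" if "j < r" for j by (rule order_trans[OF coefficients(5)[OF that] KR])
  have gV: "v \<in> V" if "j < r" "v \<in> pvars (g j)" for v j using g[OF that(1)] that(2) by (auto simp: in_V dest!: subsetD)
  have baseV: "Base ` {..<m} \<subseteq> V" "Base ` {..<m} \<union> Fiber ` {..<r} \<subseteq> V" by (auto simp: in_V)
  have rhoR: "peval y \<rho> \<in> R" if "\<And>c. c \<in> V ==> y c \<in> R" for y
    by (rule peval_in_subring[OF subring order_trans[OF coefficients(4) KR]])
       (use \<rho> baseV that in blast)
  have jR: "det (jacobian n) \<in> R" for n unfolding jacobian_def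
  proof (rule det_in_subring[OF subring, of _ r])
    fix i k assume ik: "i < r" "k < r"
    have "pdiff (x n) (\<lambda>c. if c = Fiber k then 1 else 0) (g i) \<in> R"
      by (rule pdiff_in_R[OF gR[OF ik(1)]]) (use gV[OF ik(1)] xR R01 in auto)
    thus "mat r r (\<lambda>(i, k). pdiff (x n) (\<lambda>c. if c = Fiber k then 1 else 0) (g i)) $$ (i, k) \<in> R" using ik by simp
  qed simp
  have jnil: "det (jacobian n1) \<in> nilpotents" using unit_or_nilpotent[OF jR[of n1]] nonunit jR[of n1] by (auto simp: unit_mod_def nilpotents_def)
  \<comment> \<open>After l further steps a power of each fiber coordinate is a multiple of the
    nilpotent Jacobian determinant.\<close>
  define n2 where "n2 = n1 + l"
  have znil: "x n2 (Fiber j) \<in> nilpotents" if j: "j < r" for j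
  proof -
    obtain k b where b: "b \<in> R" "x n2 (Fiber j) ^ k = b * det (jacobian n1)"
      using critical[OF subring KK xR j, of n1] unfolding n2_def jacobian_def by blast
    have "x n2 (Fiber j) ^ k \<in> nilpotents" unfolding b(2) by (rule ideal_setD(4)[OF nilpotents_ideal b(1) jnil])
    then obtain c where c: "c \<ge> 1" "(x n2 (Fiber j) ^ k) ^ c \<in> I 1" by (auto simp: nilpotents_def)
    hence "x n2 (Fiber j) ^ (k * c) \<in> I 1" by (simp add: power_mult)
    hence "x n2 (Fiber j) ^ (Suc (k * c)) \<in> I 1" by (rule ideal_set_power[OF subring I_ideal _ xR[OF in_V(3)[OF j]]]) simp
    thus ?thesis using xR[OF in_V(3)[OF j]] unfolding nilpotents_def by (intro CollectI conjI exI[of _ "Suc (k * c)"]) auto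
  qed
  obtain \<rho>' where \<rho>': "pvars \<rho>' \<subseteq> insert None (Some ` (Base ` {..<m} \<union> Fiber ` {..<r}))" "pconsts \<rho>' \<subseteq> K"
    "\<And>s y. peval (rescale s y) \<rho> = s ^ (d - 1) * peval (case_option s y) \<rho>'" using rho_order by blast
  \<comment> \<open>The fiber vector with all scalar factors from \<rho> stripped off;
    \<open>s\<close> below collects them.\<close>
  define w where "w = rec_nat (\<lambda>j. x n2 (Fiber j)) (\<lambda>n w j. \<Sum>k<r. peval (x (n2 + n)) (M j k) * w k)"
  have w0: "w 0 j = x n2 (Fiber j)" and wSuc: "w (Suc n) j = (\<Sum>k<r. peval (x (n2 + n)) (M j k) * w n k)" for n j by (auto simp: w_def)
  define y where "y n c = (case c of Fiber j => w n j | _ => x (n2 + n) c)" for n c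
  have y_other: "y n c = x (n2 + n) c" if "\<And>j. c \<noteq> Fiber j" for n c using that by (auto simp: y_def split: coord.splits)
  have y_Fiber: "y n (Fiber j) = w n j" for n j by (simp add: y_def)
  have MB: "peval (y n) (M j k) = peval (x (n2 + n)) (M j k)" if "j < r" "k < r" for n j k by (rule peval_cong) (use M[OF that] y_other in auto)
  define f where "f j = psum (map (\<lambda>k. PMul (M j k) (PVar (Fiber k))) [0..<r])" for j
  have f_eq: "peval z (f j) = (\<Sum>k<r. peval z (M j k) * z (Fiber k))" for z j by (simp add: f_def peval_psum o_def sum_list_upt)
  have y_Suc: "y (Suc n) (Fiber j) = peval (y n) (f j)" if "j < r" for n j unfolding f_eq y_Fiber wSuc using MB that by simp
  interpret E: etale_orbit R I p V "system f" y
  proof (rule system_etale_orbit[OF F KR xR, of f y n2])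
    show "pvars (f j) \<subseteq> Base ` {..<m} \<union> Fiber ` {..<r} \<and> pconsts (f j) \<subseteq> R" if j: "j < r" for j
    proof
      have "pvars (PMul (M j k) (PVar (Fiber k))) \<subseteq> Base ` {..<m} \<union> Fiber ` {..<r}" if "k < r" for k using M[OF j that] that by auto
      thus "pvars (f j) \<subseteq> Base ` {..<m} \<union> Fiber ` {..<r}" by (simp add: f_def pvars_psum UN_subset_iff)
      have "pconsts (M j k) \<subseteq> R" if "k < r" for k by (rule order_trans[OF coefficients(6)[OF j that] KR])
      thus "pconsts (f j) \<subseteq> R" using R01 by (simp add: f_def pconsts_psum UN_subset_iff)
    qed
    show "y n c = x (n2 + n) c" if "\<And>j. c \<noteq> Fiber j" for n c by (rule y_other[OF that])
    show "y 0 (Fiber j) \<in> R" if "j < r" for j using xR[OF in_V(3)[OF that]] by (simp add: y_Fiber w0)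
    show "y (Suc n) (Fiber j) = peval (y n) (f j)" if "j < r" for n j by (rule y_Suc[OF that])
    fix n t j
    assume t: "\<And>j. j < r ==> t j \<in> R"
      and dt: "\<And>j. j < r ==> (\<Sum>k<r. pdiff (y n) (\<lambda>c. if c = Fiber k then 1 else 0) (f j) * t k) \<in> I 2"
      and j: "j < r"
    have der: "pdiff (y n) (\<lambda>c. if c = Fiber k then 1 else 0) (f j) = peval (x (n2 + n)) (M j k)" if jk: "j < r" "k < r" for j k
    proof -
      have "pdiff (y n) (\<lambda>c. if c = Fiber k then 1 else 0) (M j k') = 0" if "k' < r" for k'
      proof -
        have "pdiff (y n) (\<lambda>c. if c = Fiber k then 1 else 0) (M j k') = pdiff (y n) (\<lambda>c. 0) (M j k')"
          by (rule pdiff_cong) (use M[OF jk(1) that] in auto)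
        thus ?thesis by (simp add: pdiff_zero)
      qed
      thus ?thesis using jk by (simp add: f_def pdiff_psum o_def sum_list_upt MB if_distrib[of "\<lambda>u. _ * u"] cong: if_cong)
    qed
    show "t j \<in> I 2"
    proof (rule left_inverse_injective[of r "\<lambda>i k. peval (x (n2 + n)) (Mi i k)" "\<lambda>i k. peval (x (n2 + n)) (M i k)" 1, OF _ M_inv _ t _ j])
      show "peval (x (n2 + n)) (Mi i k) \<in> R" if "i < r" "k < r" for i k
        by (rule peval_in_subring[OF subring order_trans[OF coefficients(7)[OF that] KR]])
           (use Mi[OF that] baseV(1) xR in blast)
      show "unit_mod 1" using R01 ideal_setD(2)[OF I_ideal] by (auto simp: unit_mod_def intro!: exI[of _ 1])
      show "(\<Sum>l<r. peval (x (n2 + n)) (M k l) * t l) \<in> I 2" if "k < r" for k using dt[OF that] der[OF that] by simp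
    qed
  qed
  have yR: "y n c \<in> R" if "c \<in> V" for n c by (rule E.y_in_R[OF that])
  define s where "s = rec_nat 1 (\<lambda>n s. peval (x (n2 + n)) \<rho> * s)"
  have s0: "s 0 = 1" and sSuc: "s (Suc n) = peval (x (n2 + n)) \<rho> * s n" for n by (auto simp: s_def)
  have x_rescale: "x (n2 + n) c = rescale (s n) (y n) c" if "c \<in> V" for n c using that
  proof (induction n arbitrary: c)
    case 0
    thus ?case by (cases c) (auto simp: y_def w0 s0)
  next
    case (Suc n)
    show ?case
    proof (cases c)
      case (Fiber j)
      hence j: "j < r" using Suc.prems by (auto simp: state_coords_def)
      have "x (n2 + Suc n) (Fiber j) = peval (x (n2 + n)) \<rho> * (\<Sum>k<r. peval (x (n2 + n)) (M j k) * x (n2 + n) (Fiber k))"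
        using x_Fiber[OF j, of "n2 + n"] g_eq[OF j] by simp
      also have "(\<Sum>k<r. peval (x (n2 + n)) (M j k) * x (n2 + n) (Fiber k)) = s n * w (Suc n) j" unfolding wSuc sum_distrib_left
        by (intro sum.cong refl) (use Suc.IH in_V(3) in "auto simp: y_Fiber")
      finally show ?thesis unfolding Fiber rescale_simps y_Fiber sSuc by (simp only: mult.assoc)
    qed (auto simp: y_def)
  qed
  \<comment> \<open>\<rho> has fiber order at least d - 1, so it releases
    \<open>s n ^ (d - 1)\<close>; with the factor \<open>s n\<close> already present this makes
    \<open>s (Suc n)\<close> divisible by \<open>s n ^ d\<close>.\<close>
  have rho_y: "peval (x (n2 + n)) \<rho> = s n ^ (d - 1) * peval (case_option (s n) (y n)) \<rho>'" for n
  proof -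
    have "peval (x (n2 + n)) \<rho> = peval (rescale (s n) (y n)) \<rho>" by (rule peval_cong) (use \<rho> baseV x_rescale in blast)
    thus ?thesis by (simp add: \<rho>'(3))
  qed
  have sR: "s n \<in> R" for n by (induction n) (use s0 sSuc R01 rhoR xR in "auto intro!: subring_setD(4)[OF subring]")
  have s_dvd: "\<exists>c\<in>R. s (Suc n) = s n ^ d * c" for n
  proof -
    have "peval (case_option (s n) (y n)) \<rho>' \<in> R"
    proof (rule peval_in_subring[OF subring order_trans[OF \<rho>'(2) KK]])
      fix v assume "v \<in> pvars \<rho>'"
      hence "v = None \<or> (\<exists>c\<in>V. v = Some c)" using \<rho>'(1) baseV(2) by blast
      thus "case_option (s n) (y n) v \<in> R" using sR yR by auto
    qed
    moreover have "s (Suc n) = s n ^ d * peval (case_option (s n) (y n)) \<rho>'" unfolding sSuc rho_y using d2 by (simp add: power_eq_if[of "s n" d])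
    ultimately show ?thesis by blast
  qed
  \<comment> \<open>\<open>s 1\<close> is \<rho> at time n2. There the fiber coordinates are
    nilpotent, and \<rho> vanishes at fiber zero because d - 1 is positive.\<close>
  have "s 1 \<in> nilpotents"
  proof -
    define z where "z c = (case c of Fiber j => 0 | _ => x n2 c)" for c
    have "peval (x n2) \<rho> - peval z \<rho> \<in> nilpotents"
    proof (rule peval_diff_in_ideal[OF nilpotents_ideal order_trans[OF coefficients(4) KR]])
      fix v assume v: "v \<in> pvars \<rho>"
      hence "v \<in> Base ` {..<m} \<union> Fiber ` {..<r}" using \<rho> by blast
      thus "x n2 v \<in> R \<and> z v \<in> R \<and> x n2 v - z v \<in> nilpotents"
        using xR in_V znil R01 ideal_setD(2)[OF nilpotents_ideal] by (auto simp: z_def)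
    qed
    moreover have "peval z \<rho> = 0"
    proof -
      have "z = rescale 0 (x n2)" by (rule ext) (simp add: z_def rescale_def split: coord.splits)
      thus ?thesis using d2 by (simp add: \<rho>'(3) power_0_left)
    qed
    ultimately show ?thesis using sSuc[of 0] s0 by simp
  qed
  then obtain b where b: "b \<ge> 1" "s 1 ^ b \<in> I 1" by (auto simp: nilpotents_def)
  have s_power: "\<exists>c\<in>R. s (Suc n) = s 1 ^ (d ^ n) * c" for n
  proof (induction n)
    case 0
    thus ?case using R01 by auto
  next
    case (Suc n)
    then obtain c where c: "c \<in> R" "s (Suc n) = s 1 ^ (d ^ n) * c" by blast
    obtain c' where c': "c' \<in> R" "s (Suc (Suc n)) = s (Suc n) ^ d * c'" using s_dvd by blast
    have "s (Suc (Suc n)) = s 1 ^ (d ^ Suc n) * (c ^ d * c')"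
      unfolding c'(2) c(2) by (simp add: power_mult_distrib mult.assoc mult.commute[of d] flip: power_mult)
    thus ?case using c c' by (auto intro!: bexI[of _ "c ^ d * c'"] subring_setD(4)[OF subring] subring_power[OF subring])
  qed
  \<comment> \<open>Every b factors \<open>s 1\<close> contribute one unit of depth, and
    \<open>s (Suc n)\<close> contains \<open>d ^ n\<close> of them.\<close>
  have sI: "s (Suc n) \<in> I (d ^ n div b)" for n
  proof -
    have "(s 1 ^ b) ^ k \<in> I k" for k
    proof (induction k)
      case 0
      thus ?case using I_0 R01 by simp
    next
      case (Suc k)
      thus ?case using I_mult[OF b(2) Suc] by simp
    qed
    hence "s 1 ^ (b * (d ^ n div b)) \<in> I (d ^ n div b)" by (simp add: power_mult)
    hence 1: "s 1 ^ (d ^ n) \<in> I (d ^ n div b)" by (rule ideal_set_power[OF subring I_ideal _ sR]) simp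
    obtain c where "c \<in> R" "s (Suc n) = s 1 ^ (d ^ n) * c" using s_power by blast
    thus ?thesis using ideal_setD(5)[OF I_ideal _ 1] by simp
  qed
  \<comment> \<open>The q-th root of the midpoint between max(1, \<delta>) and d^q: above the growth
    rate of base heights, below that of the depth of \<open>s\<close>.\<close>
  obtain \<theta> :: real where \<theta>: "1 < \<theta>" "\<theta> < d" "real \<delta> < \<theta> ^ q"
  proof -
    define D where "D = (max 1 (real \<delta>) + real d ^ q) / 2"
    have dq: "1 < real d ^ q" using d2 q by (intro one_less_power) auto
    have "real \<delta> < real d ^ q" using \<delta> by (metis of_nat_less_iff of_nat_power)
    hence D: "max 1 (real \<delta>) < D" "D < real d ^ q" using dq by (auto simp: D_def max_def)
    define \<theta> where "\<theta> = root q D"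
    have \<theta>q: "\<theta> ^ q = D" using D q by (simp add: \<theta>_def)
    have "\<theta> > 0" using D q by (simp add: \<theta>_def)
    have "\<theta> > 1"
    proof (rule ccontr)
      assume "\<not> \<theta> > 1"
      hence "\<theta> ^ q \<le> 1" using \<open>\<theta> > 0\<close> by (intro power_le_one) auto
      thus False using \<theta>q D by simp
    qed
    moreover have "\<theta> < d" by (rule power_less_imp_less_base[of _ q]) (use \<theta>q D in auto)
    ultimately show thesis using that \<theta>q D(1) by simp
  qed
  \<comment> \<open>The base heights obey a q-step recursion, so the first q base points have to be
    generators.\<close>
  define G where "G = coefficients \<union> y 0 ` V \<union> (\<lambda>(n, i). x (n2 + n) (Base i)) ` ({..<q} \<times> {..<m})"
  have G: "finite G" "G \<subseteq> R" unfolding G_def using finite_coefficients finite_V KR yR xR in_V by auto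
  have Gc: "coefficients \<subseteq> G" by (auto simp: G_def)
  obtain A1 where A1: "A1 \<ge> 0" "\<And>n. small G (of_nat (n0 + n2 + n)) (A1 * \<theta> ^ n)" using tame_time[OF \<theta>(1)] by blast
  obtain A2 where A2: "A2 \<ge> 0" "\<And>n i. i < m ==> small G (x (n2 + n) (Base i)) (A2 * \<theta> ^ n)"
  proof -
    have "\<exists>A\<ge>0. \<forall>n. \<forall>i<m. small G (x (n2 + n) (Base i)) (A * \<theta> ^ n)"
    proof (rule tame_base[OF q \<theta>(1,3), of m e])
      show "pvars (e i) \<subseteq> {..<m} \<and> pconsts (e i) \<subseteq> G \<and> pdeg (e i) \<le> \<delta>" if "i < m" for i
        using e[OF that] order_trans[OF coefficients(3)[OF that] Gc] by blast
      show "x (n2 + (n + q)) (Base i) = peval (\<lambda>i. x (n2 + n) (Base i)) (e i)" if "i < m" for n i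
        using x_e[OF that, of "n2 + n"] by (simp add: add.assoc)
      show "x (n2 + n) (Base i) \<in> G" if "n < q" "i < m" for n i using that by (auto simp: G_def)
    qed
    thus thesis using that by blast
  qed
  have tame_coeff: "\<exists>A'. \<forall>n. small G (peval (y n) u) (A' * \<theta> ^ n)"
    if "pconsts u \<subseteq> coefficients" "pvars u \<subseteq> insert Time (Base ` {..<m})" for u
  proof (rule tame_peval[of u G "insert Time (Base ` {..<m})" y "max A1 A2"])
    show "pconsts u \<subseteq> G" using that(1) Gc by blast
    show "small G (y n v) (max A1 A2 * \<theta> ^ n)" if v: "v \<in> insert Time (Base ` {..<m})" for n v
    proof -
      have "A1 * \<theta> ^ n \<le> max A1 A2 * \<theta> ^ n" "A2 * \<theta> ^ n \<le> max A1 A2 * \<theta> ^ n"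
        using \<theta>(1) by (auto intro!: mult_right_mono)
      thus ?thesis using v small_mono[OF A1(2)[of n]] small_mono[OF A2(2), of _ n] by (auto simp: y_other x_Time add.assoc)
    qed
  qed (use that \<theta>(1) A1(1) in auto)
  have tame_matrix: "\<exists>B\<ge>0. \<forall>n. \<forall>i<k. \<forall>j<k. small G (peval (y n) (X i j)) (B * \<theta> ^ n)"
    if X: "\<And>i j. i < k ==> j < k ==> pconsts (X i j) \<subseteq> coefficients \<and> pvars (X i j) \<subseteq> insert Time (Base ` {..<m})" for k and X :: "nat => nat => coord pexp"
  proof -
    have "\<forall>i<k. \<forall>j<k. \<exists>A'. \<forall>n. small G (peval (y n) (X i j)) (A' * \<theta> ^ n)" using tame_coeff X by blast
    then obtain A' where A': "\<And>i j n. i < k ==> j < k ==> small G (peval (y n) (X i j)) (A' i j * \<theta> ^ n)" by metis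
    define B where "B = (\<Sum>i<k. \<Sum>j<k. \<bar>A' i j\<bar>)"
    have AB: "A' i j \<le> B" if "i < k" "j < k" for i j
    proof -
      have "\<bar>A' i j\<bar> \<le> (\<Sum>j<k. \<bar>A' i j\<bar>)" by (rule member_le_sum) (use that in auto)
      also have "\<dots> \<le> B" unfolding B_def
        by (rule member_le_sum[of i "{..<k}" "\<lambda>i. \<Sum>j<k. \<bar>A' i j\<bar>"]) (use that in "auto intro: sum_nonneg")
      finally show ?thesis by simp
    qed
    have "small G (peval (y n) (X i j)) (B * \<theta> ^ n)" if "i < k" "j < k" for i j n
      by (rule small_mono[OF A'[OF that]]) (use AB[OF that] \<theta>(1) in "auto intro!: mult_right_mono")
    moreover have "B \<ge> 0" by (auto simp: B_def intro!: sum_nonneg)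
    ultimately show ?thesis by blast
  qed
  obtain A3 where A3: "A3 \<ge> 0" "\<And>n j. j < r ==> small G (w n j) (A3 * \<theta> ^ n)"
  proof -
    have "pvars (M i k) \<subseteq> insert Time (Base ` {..<m})" if "i < r" "k < r" for i k using M[OF that] by blast
    hence "\<exists>B\<ge>0. \<forall>n. \<forall>i<r. \<forall>k<r. small G (peval (y n) (M i k)) (B * \<theta> ^ n)"
      by (intro tame_matrix) (simp add: coefficients(6))
    then obtain BM where BM: "BM \<ge> 0" "\<And>n i k. i < r ==> k < r ==> small G (peval (y n) (M i k)) (BM * \<theta> ^ n)" by blast
    have "\<exists>A\<ge>0. \<forall>n. \<forall>i<r. small G (w n i) (A * \<theta> ^ n)"
    proof (rule tame_cocycle[OF \<theta>(1) BM])
      show "w (Suc n) i = (\<Sum>k<r. peval (y n) (M i k) * w n k)" if "i < r" for n i unfolding wSuc using MB that by simp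
      show "w 0 i \<in> G" if "i < r" for i using in_V(3)[OF that] y_Fiber[of 0 i] unfolding G_def by (metis UnCI imageI)
    qed
    thus thesis using that by blast
  qed
  have entry_tame: "\<exists>A4\<ge>0. \<forall>n. \<forall>i<a. small G (y n (Entry i j)) (A4 * \<theta> ^ n)" if j: "j < a" for j
  proof -
    have "pvars (A i k) \<subseteq> insert Time (Base ` {..<m})" if "i < a" "k < a" for i k using A[OF that] by blast
    hence "\<exists>B\<ge>0. \<forall>n. \<forall>i<a. \<forall>k<a. small G (peval (y n) (A i k)) (B * \<theta> ^ n)"
      by (intro tame_matrix) (simp add: coefficients(8))
    then obtain BA where BA: "BA \<ge> 0" "\<And>n i k. i < a ==> k < a ==> small G (peval (y n) (A i k)) (BA * \<theta> ^ n)" by blast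
    show ?thesis
    proof (rule tame_cocycle[OF \<theta>(1) BA])
      show "y (Suc n) (Entry i j) = (\<Sum>k<a. peval (y n) (A i k) * y n (Entry k j))" if "i < a" for n i
      proof -
        have "peval (y n) (A i k) = peval (x (n2 + n)) (A i k)" if "k < a" for k
          by (rule peval_cong) (use A[OF \<open>i < a\<close> that] y_other in auto)
        thus ?thesis using x_Entry[OF that j, of "n2 + n"] by (simp add: y_other)
      qed
      show "y 0 (Entry i j) \<in> G" if "i < a" for i using in_V(4)[OF that j] unfolding G_def by blast
    qed
  qed
  then obtain A4 where A4: "\<And>j. j < a ==> A4 j \<ge> 0" "\<And>j n i. j < a ==> i < a ==> small G (y n (Entry i j)) (A4 j * \<theta> ^ n)"
    by metis
  define AA where "AA = A1 + A2 + A3 + (\<Sum>j<a. A4 j)"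
  have A4s: "0 \<le> (\<Sum>j<a. A4 j)" using A4(1) by (auto intro!: sum_nonneg)
  have AA: "A1 \<le> AA" "A2 \<le> AA" "A3 \<le> AA" "0 \<le> AA" using A1(1) A2(1) A3(1) A4s unfolding AA_def by linarith+
  have AA4: "A4 j \<le> AA" if "j < a" for j
  proof -
    have "A4 j \<le> (\<Sum>j<a. A4 j)" by (rule member_le_sum) (use that A4(1) in auto)
    thus ?thesis using A1(1) A2(1) A3(1) unfolding AA_def by linarith
  qed
  have y_tame: "small G (y n c) (AA * \<theta> ^ n)" if "c \<in> V" for n c
  proof -
    have mono: "small G z (AA * \<theta> ^ n)" if "small G z (A' * \<theta> ^ n)" "A' \<le> AA" for z A'
      by (rule small_mono[OF that(1)]) (use that(2) \<theta>(1) in "auto intro!: mult_right_mono")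
    show ?thesis using that
    proof (cases rule: V_cases)
      case 1
      thus ?thesis using mono[OF A1(2) AA(1)] by (simp add: y_other x_Time add.assoc)
    next
      case (2 i)
      thus ?thesis using mono[OF A2(2) AA(2)] by (simp add: y_other)
    next
      case (3 j)
      thus ?thesis using mono[OF A3(2) AA(3)] by (simp add: y_Fiber)
    next
      case (4 i j)
      thus ?thesis using mono[OF A4(2) AA4] by blast
    qed
  qed
  obtain q' k where q': "q' \<ge> 1" and zeros: "\<forall>e i. pvars e \<subseteq> V --> pconsts e \<subseteq> R -->
      infinite {n. peval (y (k + i + q' * n)) e = 0} --> (\<forall>n. peval (y (k + i + q' * n)) e = 0)"
    using E.zeros_in_progressions by (elim exE conjE)
  have "progression_zeros V R x q'"
  proof (rule progression_zerosI[OF q', of _ _ _ "n2 + k"])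
    fix u i
    assume u: "pvars u \<subseteq> V" "pconsts u \<subseteq> R" and inf: "infinite {n. peval (x (n2 + k + i + q' * n)) u = 0}"
    define \<tau> where "\<tau> n = k + i + q' * n" for n
    have \<tau>: "n2 + k + i + q' * n = n2 + \<tau> n" "n \<le> \<tau> n" for n using q' by (auto simp: \<tau>_def trans_le_add2)
    obtain C L where C: "\<And>j. pvars (C j) \<subseteq> V" "\<And>j. pconsts (C j) \<subseteq> R"
      "\<And>y. \<exists>P. (\<forall>j. coeff P j = peval y (C j)) \<and> degree P \<le> L \<and> (\<forall>s. poly P s = peval (rescale s y) u)"
      using peval_rescale[OF u subring] by blast
    define c where "c j n = peval (y (\<tau> n)) (C j)" for j n
    have cR: "c j n \<in> R" for j n unfolding c_def by (rule peval_in_subring[OF subring C(2)]) (use C(1) yR in blast)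
    have u_eq: "peval (x (n2 + \<tau> n)) u = (\<Sum>j\<le>L. c j n * s (\<tau> n) ^ j)" for n
    proof -
      obtain P where P: "\<And>j. coeff P j = peval (y (\<tau> n)) (C j)" "degree P \<le> L"
        "\<And>s. poly P s = peval (rescale s (y (\<tau> n))) u" using C(3)[of "y (\<tau> n)"] by blast
      have "peval (x (n2 + \<tau> n)) u = poly P (s (\<tau> n))" unfolding P(3) by (rule peval_cong) (use u(1) x_rescale in blast)
      also have "\<dots> = (\<Sum>j\<le>degree P. coeff P j * s (\<tau> n) ^ j)" by (rule poly_altdef)
      also have "\<dots> = (\<Sum>j\<le>L. coeff P j * s (\<tau> n) ^ j)"
        by (rule sum.mono_neutral_left) (use P(2) in "auto simp: coeff_eq_0")
      finally show ?thesis by (simp add: P(1) c_def)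
    qed
    have c_zeros: "\<forall>n. c j n = 0" if "infinite {n. c j n = 0}" for j
      using zeros[rule_format, OF C(1,2), of i j] that by (simp add: c_def \<tau>_def)
    have Z: "infinite {n. (\<Sum>j\<le>L. c j n * s (\<tau> n) ^ j) = 0}" using inf unfolding \<tau>(1) u_eq .
    have "ev (\<lambda>n. (\<Sum>j\<le>L. c j n * s (\<tau> n) ^ j) = 0)"
    proof (cases "\<exists>n. s n = 0")
      case True
      then obtain N where N: "s N = 0" by blast
      \<comment> \<open>Once \<open>s\<close> vanishes it stays zero, and only the coefficient of
        its zeroth power is left.\<close>
      have sN: "s n = 0" if "N \<le> n" for n using that N by (induction n rule: dec_induct) (auto simp: sSuc)
      have ev: "(\<Sum>j\<le>L. c j n * s (\<tau> n) ^ j) = c 0 n" if "N \<le> n" for n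
        using sN[OF order_trans[OF that \<tau>(2)]] by (simp add: power_0_left if_distrib[of "\<lambda>u. _ * u"] cong: if_cong)
      have "infinite {n. (\<Sum>j\<le>L. c j (n + N) * s (\<tau> (n + N)) ^ j) = 0}" by (rule infinite_shift[OF Z])
      moreover have "(\<Sum>j\<le>L. c j (n + N) * s (\<tau> (n + N)) ^ j) = c 0 (n + N)" for n by (rule ev) simp
      ultimately have "infinite {n. c 0 (n + N) = 0}" by simp
      hence "infinite ((\<lambda>n. n + N) ` {n. c 0 (n + N) = 0})" by (subst finite_image_iff) (auto intro: inj_onI)
      moreover have "(\<lambda>n. n + N) ` {n. c 0 (n + N) = 0} \<subseteq> {n. c 0 n = 0}" by auto
      ultimately have "infinite {n. c 0 n = 0}" using finite_subset by blast
      hence "\<forall>n. c 0 n = 0" by (rule c_zeros)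
      thus ?thesis using ev by (auto simp: eventually_sequentially intro!: exI[of _ N])
    next
      case False
      hence s_nz: "s n \<noteq> 0" for n by blast
      have "\<forall>n. c j n = 0" if "j \<le> L" for j using that
      proof (induction j rule: less_induct)
        case (less j)
        show ?case
        proof (rule c_zeros, rule ccontr)
          assume fin: "\<not> infinite {n. c j n = 0}"
          \<comment> \<open>The constants of \<open>C j\<close> come from the given polynomial and
            need not lie in \<open>G\<close>. They affect the separation constant and the threshold
            \<open>N\<close>, not the period.\<close>
          define H where "H = G \<union> pconsts (C j)"
          have H: "finite H" "H \<subseteq> R" using G C(2)[of j] finite_pconsts by (auto simp: H_def)
          have "\<exists>A'. \<forall>n. small H (peval (y n) (C j)) (A' * \<theta> ^ n)"
          proof (rule tame_peval[of "C j" H V y AA])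
            show "pconsts (C j) \<subseteq> H" by (simp add: H_def)
            show "small H (y n v) (AA * \<theta> ^ n)" if "v \<in> V" for n v by (rule small_subset[OF y_tame[OF that]]) (simp add: H_def)
          qed (use C(1) \<theta>(1) AA(4) in auto)
          then obtain A' where A': "\<And>n. small H (peval (y n) (C j)) (A' * \<theta> ^ n)" by blast
          obtain D :: real where D: "D > 0" "\<And>x r i. small H x r ==> x \<noteq> 0 ==> x \<in> I i ==> real i \<le> D * (r + 1)"
            using small_not_in_I[OF H] by metis
          obtain N where N: "\<And>n. n \<ge> N ==> D * (max 0 A' * \<theta> ^ Suc n + 1) < real (d ^ n div b)"
            using exponential_gap[OF \<theta>(1,2) D(1), of "max 0 A'" b] b(1) by auto
          \<comment> \<open>If \<open>c j\<close> had only finitely many zeros, the relation would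
            still hold at some late index where \<open>c j\<close> is nonzero.\<close>
          have "infinite ({n. (\<Sum>j\<le>L. c j n * s (\<tau> n) ^ j) = 0} - ({n. c j n = 0} \<union> {..N}))"
            using Z fin by (intro Diff_infinite_finite) auto
          from infinite_imp_nonempty[OF this]
          obtain n where "n \<in> {n. (\<Sum>j\<le>L. c j n * s (\<tau> n) ^ j) = 0} - ({n. c j n = 0} \<union> {..N})" by blast
          hence n: "(\<Sum>j\<le>L. c j n * s (\<tau> n) ^ j) = 0" "c j n \<noteq> 0" "N < n" by auto
          then obtain t where t: "\<tau> n = Suc t" "N \<le> t" using \<tau>(2)[of n] by (cases "\<tau> n") auto
          have low: "c i n = 0" if "i < j" for i using less that by auto
          have "(\<Sum>i\<le>L. c i n * s (\<tau> n) ^ i) = (\<Sum>i=j..L. c i n * s (\<tau> n) ^ i)"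
            by (rule sum.mono_neutral_right) (use low in auto)
          also have "\<dots> = s (\<tau> n) ^ j * (\<Sum>i=j..L. c i n * s (\<tau> n) ^ (i - j))" unfolding sum_distrib_left
            by (rule sum.cong) (auto simp: mult.left_commute simp flip: power_add)
          finally have "(\<Sum>i=j..L. c i n * s (\<tau> n) ^ (i - j)) = 0" using n(1) s_nz by simp
          moreover have "(\<Sum>i=j..L. c i n * s (\<tau> n) ^ (i - j)) = c j n + (\<Sum>i=Suc j..L. c i n * s (\<tau> n) ^ (i - j))"
            using less.prems by (simp add: sum.atLeast_Suc_atMost)
          ultimately have "c j n = - (\<Sum>i=Suc j..L. c i n * s (\<tau> n) ^ (i - j))" by (simp add: eq_neg_iff_add_eq_0)
          also have "\<dots> \<in> I (d ^ t div b)"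
          proof (rule ideal_set_uminus[OF subring I_ideal], rule ideal_set_sum[OF I_ideal], rule ideal_setD(4)[OF I_ideal cR])
            fix i assume "i \<in> {Suc j..L}"
            hence "1 \<le> i - j" by auto
            have "s (\<tau> n) ^ 1 \<in> I (d ^ t div b)" using sI[of t] t(1) by simp
            from ideal_set_power[OF subring I_ideal this sR \<open>1 \<le> i - j\<close>]
            show "s (\<tau> n) ^ (i - j) \<in> I (d ^ t div b)" .
          qed
          finally have cI: "c j n \<in> I (d ^ t div b)" .
          have "small H (c j n) (max 0 A' * \<theta> ^ Suc t)"
            unfolding c_def t(1) by (rule small_mono[OF A']) (use \<theta>(1) in "auto intro!: mult_right_mono")
          from D(2)[OF this n(2) cI] N[OF t(2)] show False by linarith
        qed
      qed
      thus ?thesis by simp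
    qed
    thus "ev (\<lambda>n. peval (x (n2 + k + i + q' * n)) u = 0)" unfolding \<tau>(1) u_eq .
  qed
  thus ?thesis using q' by blast
qed

theorem exists_progression_zeros: "\<exists>p\<ge>1. progression_zeros V UNIV x p"
proof -
  have "finite (coefficients \<union> x 0 ` V)" using finite_coefficients finite_V by simp
  then obtain R I p where F: "filtered_ring R I p" and sub: "coefficients \<union> x 0 ` V \<subseteq> R" using exists_filtered_ring by metis
  interpret filtered_ring R I p by (rule F)
  have cR: "coefficients \<subseteq> R" using sub by simp
  have x0: "x 0 c \<in> R" if "c \<in> V" for c using sub that by blast
  have "\<exists>p\<ge>1. progression_zeros V R x p"
  proof (cases "\<forall>n. unit_mod (det (jacobian n))")
    case True
    thus ?thesis by (intro noncritical_orbit[OF F cR x0]) simp_all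
  next
    case False
    then obtain n where "\<not> unit_mod (det (jacobian n))" by blast
    from critical_orbit[OF F cR x0 this] show ?thesis by simp
  qed
  then obtain q where q: "q \<ge> 1" "progression_zeros V R x q" by (elim exE conjE)
  have "progression_zeros V UNIV x q" by (rule progression_zeros_UNIV[OF subring orbit_in_R[OF subring cR x0] q(2)])
  thus ?thesis using q(1) by (intro exI[of _ q] conjI)
qed

end

section \<open>Polynomials as expressions\<close>

abbreviation (input) "keys \<equiv> Poly_Mapping.keys"
abbreviation (input) "lookup \<equiv> Poly_Mapping.lookup"
abbreviation (input) "single \<equiv> Poly_Mapping.single"

definition monomial_value :: "('v => 'b) => ('v \<Rightarrow>\<^sub>0 nat) => 'b::comm_ring_1" where
  "monomial_value s \<mu> = (\<Prod>v\<in>keys \<mu>. s v ^ lookup \<mu> v)"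

lemma monomial_value_superset:
  "finite W ==> keys \<mu> \<subseteq> W ==> monomial_value s \<mu> = (\<Prod>v\<in>W. s v ^ lookup \<mu> v)"
  unfolding monomial_value_def by (rule prod.mono_neutral_left) (auto simp: in_keys_iff)

lemma monomial_value_0 [simp]: "monomial_value s 0 = 1" by (simp add: monomial_value_def)

lemma monomial_value_single [simp]: "monomial_value s (single v n) = s v ^ n" by (simp add: monomial_value_def)

lemma monomial_value_add: "monomial_value s (\<mu> + \<nu>) = monomial_value s \<mu> * monomial_value s \<nu>"
proof -
  let ?W = "keys \<mu> \<union> keys \<nu>"
  have "monomial_value s (\<mu> + \<nu>) = (\<Prod>v\<in>?W. s v ^ lookup (\<mu> + \<nu>) v)"
    using Poly_Mapping.keys_add[of \<mu> \<nu>] by (intro monomial_value_superset) auto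
  also have "\<dots> = (\<Prod>v\<in>?W. s v ^ lookup \<mu> v) * (\<Prod>v\<in>?W. s v ^ lookup \<nu> v)"
    by (simp add: lookup_add power_add prod.distrib)
  finally show ?thesis by (simp add: monomial_value_superset[of ?W])
qed

lemma mp_eval_altdef: "mp_eval x f = (\<Sum>\<mu>\<in>keys f. lookup f \<mu> * monomial_value x \<mu>)"
  by (simp add: mp_eval_def mp_insertion_def monomial_value_def)

lemma poly_mapping_expansion:
  "f = (\<Sum>\<mu>\<in>keys f. single \<mu> (lookup f \<mu>))" by (rule poly_mapping_eqI)
     (auto simp: lookup_sum lookup_single when_def in_keys_iff sum.delta)

lemma mp_eval_single: "mp_eval x (single \<mu> c) = c * monomial_value x \<mu>" by (simp add: mp_eval_altdef)

interpretation mp_eval: comm_ring_hom "mp_eval x" for x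
proof -
  have add: "mp_eval x (f + g) = mp_eval x f + mp_eval x g" for f g
  proof -
    let ?W = "keys f \<union> keys g"
    have "mp_eval x h = (\<Sum>\<mu>\<in>?W. lookup h \<mu> * monomial_value x \<mu>)" if "keys h \<subseteq> ?W" for h
      unfolding mp_eval_altdef by (rule sum.mono_neutral_left) (use that in "auto simp: in_keys_iff")
    thus ?thesis using Poly_Mapping.keys_add[of f g] by (simp add: lookup_add distrib_right sum.distrib)
  qed
  have zero: "mp_eval x 0 = 0" by (simp add: mp_eval_altdef)
  have sum: "mp_eval x (\<Sum>i\<in>I. f i) = (\<Sum>i\<in>I. mp_eval x (f i))" for f and I :: "('a \<Rightarrow>\<^sub>0 nat) set"
    by (induction I rule: infinite_finite_induct) (simp_all add: add zero)
  have "mp_eval x (f * g) = mp_eval x f * mp_eval x g" for f g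
  proof -
    have "f * g = (\<Sum>\<mu>\<in>keys f. \<Sum>\<nu>\<in>keys g.
        single (\<mu> + \<nu>) (lookup f \<mu> * lookup g \<nu>))"
      by (subst (1) poly_mapping_expansion[of f], subst (1) poly_mapping_expansion[of g])
         (simp add: sum_product mult_single)
    hence "mp_eval x (f * g) = (\<Sum>\<mu>\<in>keys f. \<Sum>\<nu>\<in>keys g.
        (lookup f \<mu> * monomial_value x \<mu>) * (lookup g \<nu> * monomial_value x \<nu>))"
      by (simp add: sum mp_eval_single monomial_value_add algebra_simps)
    thus ?thesis by (simp add: mp_eval_altdef sum_product)
  qed
  thus "comm_ring_hom (mp_eval x)" by unfold_locales (simp_all add: add zero mp_eval_single flip: single_one)
qed

lemma mp_eval_var [simp]: "mp_eval x (mp_var v) = x v" by (simp add: mp_var_def mp_eval_single)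

lemma mp_eval_cong:
  assumes "\<And>v. v \<in> mp_vars f ==> x v = y v"
  shows "mp_eval x f = mp_eval y f" unfolding mp_eval_altdef monomial_value_def
proof (intro sum.cong refl arg_cong[of _ _ "(*) _"] prod.cong)
  fix \<mu> v assume "\<mu> \<in> keys f" "v \<in> keys \<mu>"
  hence "v \<in> mp_vars f" by (auto simp: mp_vars_def)
  thus "x v ^ lookup \<mu> v = y v ^ lookup \<mu> v" by (simp add: assms)
qed

lemma mp_eval_subst: "mp_eval x (mp_subst s f) = mp_eval (\<lambda>v. mp_eval x (s v)) f"
proof -
  have "mp_eval x (monomial_value s \<mu>) = monomial_value (\<lambda>v. mp_eval x (s v)) \<mu>" for \<mu>
    by (simp add: monomial_value_def mp_eval.hom_prod mp_eval.hom_power)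
  thus ?thesis unfolding mp_subst_def mp_insertion_def monomial_value_def[symmetric] mp_eval.hom_sum mp_eval.hom_mult
    by (simp add: mp_eval_altdef[of _ f] mp_const_def mp_eval_single)
qed

lemma finite_mp_vars: "finite (mp_vars f)" by (simp add: mp_vars_def)

section \<open>Monomials as lists of variables\<close>

fun list_monomial :: "'v list => 'v \<Rightarrow>\<^sub>0 nat" where
  "list_monomial [] = 0"
| "list_monomial (v # l) = single v 1 + list_monomial l"

lemma list_monomial_append: "list_monomial (k @ l) = list_monomial k + list_monomial l" by (induction k) (simp_all add: add.assoc)

lemma list_monomial_replicate: "list_monomial (replicate n v) = single v n" by (induction n) (simp_all flip: single_add)

lemma list_monomial_concat: "distinct vs ==>
    list_monomial (concat (map (\<lambda>v. replicate (n v) v) vs)) = (\<Sum>v\<in>set vs. single v (n v))"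
  by (induction vs) (simp_all add: list_monomial_append list_monomial_replicate)

lemma monomial_as_list: "\<exists>l. list_monomial l = \<mu>"
proof -
  obtain vs where "set vs = keys \<mu>" "distinct vs" using finite_distinct_list[OF finite_keys] by metis
  hence "list_monomial (concat (map (\<lambda>v. replicate (lookup \<mu> v) v) vs)) = \<mu>"
    by (simp add: list_monomial_concat flip: poly_mapping_expansion)
  thus ?thesis by (rule exI)
qed

fun pprod :: "'v list => 'v pexp" where
  "pprod [] = PConst 1"
| "pprod (v # l) = PMul (PVar v) (pprod l)"

lemma peval_pprod: "peval x (pprod l) = monomial_value x (list_monomial l)" by (induction l) (simp_all add: monomial_value_add)

lemma pvars_pprod: "pvars (pprod l) = set l" by (induction l) auto

lemma pdeg_pprod: "pdeg (pprod l) = length l" by (induction l) auto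

lemma lookup_list_monomial: "lookup (list_monomial l) v = count_list l v" by (induction l) (auto simp: lookup_add lookup_single when_def)

lemma keys_list_monomial: "keys (list_monomial l) = set l" by (auto simp: in_keys_iff lookup_list_monomial count_list_0_iff)

lemma degree_list_monomial: "mp_monom_degree (list_monomial l) = length l"
  unfolding mp_monom_degree_def keys_list_monomial lookup_list_monomial by (rule sum_count_set) auto

text \<open>Where w does not occur the exponent difference is truncated, but then the term carries
  the factor zero.\<close>

lemma pdiff_pprod:
  "finite W ==> set l \<subseteq> W ==> pdiff x t (pprod l) =
    (\<Sum>w\<in>W. t w * (of_nat (count_list l w) * monomial_value x (list_monomial l - single w 1)))"
proof (induction l)
  case (Cons v l)
  let ?\<mu> = "list_monomial l"
  have *: "of_nat (count_list (v # l) w) * monomial_value x (single v 1 + ?\<mu> - single w 1) =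
      (if w = v then monomial_value x ?\<mu> else 0) +
      x v * (of_nat (count_list l w) * monomial_value x (?\<mu> - single w 1))" for w
  proof (cases "count_list l w = 0")
    case True
    thus ?thesis by auto
  next
    case False
    hence "single v 1 + ?\<mu> - single w 1 = single v 1 + (?\<mu> - single w 1)"
      by (intro poly_mapping_eqI) (auto simp: lookup_add lookup_minus lookup_single when_def lookup_list_monomial)
    hence eq: "monomial_value x (single v 1 + ?\<mu> - single w 1) =
        x v * monomial_value x (?\<mu> - single w 1)" by (simp add: monomial_value_add)
    show ?thesis
    proof (cases "w = v")
      case True
      have "single v 1 + ?\<mu> - single w 1 = ?\<mu>" using True by simp
      hence "monomial_value x ?\<mu> = x v * monomial_value x (?\<mu> - single w 1)" using eq by simp
      thus ?thesis using True eq by (simp add: algebra_simps)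
    qed (use eq in "auto simp: algebra_simps")
  qed
  have "pdiff x t (pprod (v # l)) = t v * monomial_value x ?\<mu> +
      x v * (\<Sum>w\<in>W. t w * (of_nat (count_list l w) * monomial_value x (?\<mu> - single w 1)))"
    using Cons by (simp add: peval_pprod)
  also have "t v * monomial_value x ?\<mu> = (\<Sum>w\<in>W. t w * (if w = v then monomial_value x ?\<mu> else 0))"
    using Cons.prems by (simp add: if_distrib[of "\<lambda>u. _ * u"] cong: if_cong)
  finally show ?case unfolding sum_distrib_left sum.distrib[symmetric] list_monomial.simps * by (simp add: algebra_simps)
qed simp

lemma cpoly_as_pexp:
  fixes f :: "'v cpoly"
  assumes "finite W" "mp_vars f \<subseteq> W"
  shows "\<exists>e. pvars e \<subseteq> mp_vars f \<and> pdeg e \<le> mp_total_degree f \<and> (\<forall>x. peval x e = mp_eval x f) \<and>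
    (\<forall>x t. pdiff x t e = (\<Sum>v\<in>W. t v * mp_eval x (mp_deriv v f)))"
proof -
  obtain ks where ks: "set ks = keys f" "distinct ks" using finite_distinct_list[OF finite_keys] by metis
  obtain l :: "('v \<Rightarrow>\<^sub>0 nat) => 'v list" where l: "\<And>\<mu>. list_monomial (l \<mu>) = \<mu>" using monomial_as_list by metis
  define e where "e = psum (map (\<lambda>\<mu>. PMul (PConst (lookup f \<mu>)) (pprod (l \<mu>))) ks)"
  have set_l: "set (l \<mu>) = keys \<mu>" for \<mu> using keys_list_monomial[of "l \<mu>"] by (simp add: l)
  show ?thesis
  proof (intro exI[of _ e] conjI allI)
    show "pvars e \<subseteq> mp_vars f" by (auto simp: e_def pvars_psum pvars_pprod set_l mp_vars_def ks)
    have "pdeg (pprod (l \<mu>)) \<le> mp_total_degree f" if "\<mu> \<in> keys f" for \<mu>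
    proof -
      have "pdeg (pprod (l \<mu>)) = mp_monom_degree \<mu>" using degree_list_monomial[of "l \<mu>"] by (simp add: pdeg_pprod l)
      thus ?thesis using that by (simp add: mp_total_degree_def)
    qed
    thus "pdeg e \<le> mp_total_degree f" unfolding e_def by (intro pdeg_psum_le) (auto simp: ks)
    show "peval x e = mp_eval x f" for x
      by (simp add: e_def peval_psum o_def peval_pprod mp_eval_altdef sum_list_distinct_conv_sum_set[OF ks(2)] ks(1) l)
    fix x t
    have D: "pdiff x t (pprod (l \<mu>)) = (\<Sum>w\<in>W. t w * (of_nat (lookup \<mu> w) * monomial_value x (\<mu> - single w 1)))"
      if "\<mu> \<in> keys f" for \<mu>
    proof -
      have "set (l \<mu>) \<subseteq> W" using that assms(2) by (auto simp: set_l mp_vars_def)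
      from pdiff_pprod[OF assms(1) this, of x t] show ?thesis unfolding lookup_list_monomial[symmetric] l .
    qed
    have "pdiff x t e = (\<Sum>\<mu>\<in>keys f. lookup f \<mu> * pdiff x t (pprod (l \<mu>)))"
      by (simp add: e_def pdiff_psum o_def sum_list_distinct_conv_sum_set[OF ks(2)] ks(1))
    also have "\<dots> = (\<Sum>\<mu>\<in>keys f. \<Sum>w\<in>W. lookup f \<mu> *
        (t w * (of_nat (lookup \<mu> w) * monomial_value x (\<mu> - single w 1))))" by (simp add: D sum_distrib_left)
    also have "\<dots> = (\<Sum>w\<in>W. \<Sum>\<mu>\<in>keys f. lookup f \<mu> *
        (t w * (of_nat (lookup \<mu> w) * monomial_value x (\<mu> - single w 1))))" by (rule sum.swap)
    also have "\<dots> = (\<Sum>v\<in>W. t v * mp_eval x (mp_deriv v f))" unfolding mp_deriv_def mp_eval.hom_sum mp_eval_single sum_distrib_left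
      by (intro sum.cong refl) (simp only: mult_ac)
    finally show "pdiff x t e = (\<Sum>v\<in>W. t v * mp_eval x (mp_deriv v f))" .
  qed
qed

lemma poly_as_pexp: "\<exists>e. pvars e \<subseteq> {v} \<and> (\<forall>y. peval y e = poly f (y v))"
proof (induction f)
  case 0
  show ?case by (rule exI[of _ "PConst 0"]) simp
next
  case (pCons c f)
  then obtain e where "pvars e \<subseteq> {v}" "\<forall>y. peval y e = poly f (y v)" by blast
  thus ?case by (intro exI[of _ "PAdd (PConst c) (PMul (PVar v) e)"]) simp
qed

lemma has_derivative_peval:
  "((\<lambda>s. peval (\<lambda>v. x v + s * t v) e) has_field_derivative pdiff (\<lambda>v. x v + s * t v) t e) (at s)"
  by (induction e) (auto intro!: derivative_eq_intros)

text \<open>\<open>pdiff\<close> is defined on syntax. It is nevertheless the analytic derivative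
  along a line, which depends only on the function.\<close>

lemma pdiff_ext:
  assumes "\<And>x. peval x e = peval x e'"
  shows "pdiff x t e = pdiff x t e'" using has_derivative_peval[of x t e 0] has_derivative_peval[of x t e' 0] DERIV_unique by (simp add: assms)

section \<open>Base systems\<close>

lemma cpoly_as_pexp_renamed:
  "\<exists>e. pvars e \<subseteq> \<kappa> ` mp_vars f \<and> (\<forall>y. peval y e = mp_eval (\<lambda>v. y (\<kappa> v)) f)"
proof -
  obtain e where e: "pvars e \<subseteq> mp_vars f" "\<forall>x. peval x e = mp_eval x f"
    using cpoly_as_pexp[OF finite_mp_vars[of f] order_refl] by blast
  have "pvars (psubst (\<lambda>v. PVar (\<kappa> v)) e) \<subseteq> \<kappa> ` mp_vars f" using e(1) by (auto simp: pvars_psubst)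
  moreover have "peval y (psubst (\<lambda>v. PVar (\<kappa> v)) e) = mp_eval (\<lambda>v. y (\<kappa> v)) f" for y by (simp add: peval_psubst e(2))
  ultimately show ?thesis by blast
qed

lemma polyfuns_mp_eval:
  assumes "\<And>v. h v \<in> polyfuns UNIV UNIV"
  shows "(\<lambda>y. mp_eval (\<lambda>v. h v y) f) \<in> polyfuns UNIV UNIV" unfolding mp_eval_altdef monomial_value_def
  by (intro polyfuns_sum polyfuns_mult polyfuns_const polyfuns_prod polyfuns_power assms) simp_all

text \<open>Evaluation indexes vectors by arbitrary variables; an entry out of range is one
  unspecified value that depends only on the dimension and index.\<close>

lemma vec_index_outside:
  "v \<in> carrier_vec n ==> w \<in> carrier_vec n ==> n \<le> i ==> v $ i = w $ i"
  unfolding carrier_vec_def mem_Collect_eq by transfer (auto simp: mk_vec_def)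

definition poly_vec :: "nat => (('v => complex) => complex vec) => bool" where
  "poly_vec n U \<longleftrightarrow> (\<forall>y. U y \<in> carrier_vec n) \<and> (\<forall>i<n. (\<lambda>y. U y $ i) \<in> polyfuns UNIV UNIV)"

lemma poly_vec_index: "poly_vec n U ==> (\<lambda>y. U y $ i) \<in> polyfuns UNIV UNIV"
proof (cases "i < n")
  case False
  assume U: "poly_vec n U"
  have "(\<lambda>y. U y $ i) = (\<lambda>y. 0\<^sub>v n $ i)"
    by (rule ext, rule vec_index_outside) (use U False in "auto simp: poly_vec_def")
  thus ?thesis by (simp add: polyfuns_const)
qed (auto simp: poly_vec_def)

lemma peval_pprod_map: "peval x (pprod (map f l)) = peval (\<lambda>v. x (f v)) (pprod l)" by (induction l) auto

text \<open>Every monomial of \<rho> has fiber order at least k, so \<open>s ^ k\<close> splits off;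
  surplus factors \<open>s\<close> become the variable \<open>None\<close>, which avoids division
  when s is zero.\<close>

lemma fiber_order_rescale:
  assumes vars: "mp_vars \<rho> \<subseteq> Inl ` {..<m} \<union> Inr ` {..<r}" and k: "fiber_order_ge r k \<rho>"
  shows "\<exists>\<rho>'. pvars \<rho>' \<subseteq> insert None (Some ` (Base ` {..<m} \<union> Fiber ` {..<r})) \<and>
    (\<forall>s y. mp_eval (\<lambda>v. rescale s y (case_sum Base Fiber v)) \<rho> = s ^ k * peval (case_option s y) \<rho>')"
proof -
  obtain ks where ks: "set ks = keys \<rho>" "distinct ks" using finite_distinct_list[OF finite_keys] by metis
  obtain l :: "(nat + nat \<Rightarrow>\<^sub>0 nat) => (nat + nat) list" where l: "\<And>\<mu>. list_monomial (l \<mu>) = \<mu>"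
    using monomial_as_list by metis
  define ord where "ord \<mu> = (\<Sum>j<r. lookup \<mu> (Inr j))" for \<mu> :: "nat + nat \<Rightarrow>\<^sub>0 nat"
  let ?\<kappa> = "case_sum Base Fiber"
  define e where "e \<mu> = PMul (PConst (lookup \<rho> \<mu>))
    (PMul (pprod (replicate (ord \<mu> - k) None)) (pprod (map (\<lambda>v. Some (?\<kappa> v)) (l \<mu>))))" for \<mu>
  have set_l: "set (l \<mu>) = keys \<mu>" for \<mu> using keys_list_monomial[of "l \<mu>"] by (simp add: l)
  have keys: "keys \<mu> \<subseteq> Inl ` {..<m} \<union> Inr ` {..<r}" if "\<mu> \<in> keys \<rho>" for \<mu>
    using vars that by (auto simp: mp_vars_def)
  have "pvars (e \<mu>) \<subseteq> insert None (Some ` (Base ` {..<m} \<union> Fiber ` {..<r}))" if "\<mu> \<in> keys \<rho>" for \<mu>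
  proof -
    have "?\<kappa> v \<in> Base ` {..<m} \<union> Fiber ` {..<r}" if "v \<in> keys \<mu>" for v
      using keys[OF \<open>\<mu> \<in> _\<close>] that by auto
    thus ?thesis by (auto simp: e_def pvars_pprod set_l)
  qed
  hence 1: "pvars (psum (map e ks)) \<subseteq> insert None (Some ` (Base ` {..<m} \<union> Fiber ` {..<r}))"
    unfolding pvars_psum by (simp add: UN_subset_iff ks)
  have "mp_eval (\<lambda>v. rescale s y (?\<kappa> v)) \<rho> = s ^ k * peval (case_option s y) (psum (map e ks))" for s y
  proof -
    have mv: "monomial_value (\<lambda>v. rescale s y (?\<kappa> v)) \<mu> = s ^ ord \<mu> * monomial_value (\<lambda>v. y (?\<kappa> v)) \<mu>"
      if "\<mu> \<in> keys \<rho>" for \<mu>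
    proof -
      have eq: "monomial_value f \<mu> = (\<Prod>i<m. f (Inl i) ^ lookup \<mu> (Inl i)) *
          (\<Prod>j<r. f (Inr j) ^ lookup \<mu> (Inr j))" for f :: "nat + nat => complex"
        unfolding monomial_value_superset[OF _ keys[OF that], of f, simplified] by (subst prod.union_disjoint) (auto simp: prod.reindex)
      show ?thesis unfolding eq ord_def by (simp add: power_mult_distrib prod.distrib power_sum)
    qed
    have "peval (case_option s y) (e \<mu>) = lookup \<rho> \<mu> * (s ^ (ord \<mu> - k) * monomial_value (\<lambda>v. y (?\<kappa> v)) \<mu>)" for \<mu>
      unfolding e_def peval.simps peval_pprod_map by (simp add: peval_pprod list_monomial_replicate l)
    hence "s ^ k * peval (case_option s y) (e \<mu>) = lookup \<rho> \<mu> * monomial_value (\<lambda>v. rescale s y (?\<kappa> v)) \<mu>"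
      if "\<mu> \<in> keys \<rho>" for \<mu>
    proof -
      assume *: "\<And>\<mu>. peval (case_option s y) (e \<mu>) = lookup \<rho> \<mu> * (s ^ (ord \<mu> - k) * monomial_value (\<lambda>v. y (?\<kappa> v)) \<mu>)"
      have "k \<le> ord \<mu>" using k that by (simp add: fiber_order_ge_def ord_def)
      hence "s ^ ord \<mu> = s ^ k * s ^ (ord \<mu> - k)" by (simp flip: power_add)
      thus ?thesis unfolding * mv[OF that] by simp
    qed
    thus ?thesis by (simp add: mp_eval_altdef peval_psum o_def sum_list_distinct_conv_sum_set[OF ks(2)] ks(1) sum_distrib_left)
  qed
  with 1 show ?thesis by blast
qed

lemma mp_eval_fiber_map:
  assumes "M \<in> carrier_mat r r" "j < r"
  shows "mp_eval y (fiber_map r \<rho> M $ j) = mp_eval y \<rho> * (\<Sum>k<r. mp_eval (\<lambda>i. y (Inl i)) (M $$ (j, k)) * y (Inr k))" using assms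
  by (simp add: fiber_map_def scalar_prod_def mp_eval.hom_mult mp_eval.hom_sum mp_eval_subst atLeast0LessThan)

locale skew_system =
  fixes m r d a :: nat and T :: "nat cpoly vec" and M :: "nat cpoly mat" and \<rho> :: "(nat + nat) cpoly"
    and A :: "complex poly mat" and u\<^sub>0 z\<^sub>0 :: "complex vec"
  assumes d2: "d \<ge> 2" and T: "polynomial_map m T" and M: "M \<in> GL r {f. mp_vars f \<subseteq> {..<m}}"
    and vars_rho: "mp_vars \<rho> \<subseteq> Inl ` {..<m} \<union> Inr ` {..<r}" and rho_order: "fiber_order_ge r (d - 1) \<rho>"
    and u0: "u\<^sub>0 \<in> carrier_vec m" and z0: "z\<^sub>0 \<in> carrier_vec r" and A: "A \<in> GL a UNIV"
begin

definition "F = skew_product r T \<rho> M"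
definition "x = state F (u\<^sub>0, z\<^sub>0) A"
definition "u n = fst ((F ^^ n) (u\<^sub>0, z\<^sub>0))"
definition "z n = snd ((F ^^ n) (u\<^sub>0, z\<^sub>0))"

lemma carriers: "M \<in> carrier_mat r r" "A \<in> carrier_mat a a" "dim_vec T = m" "dim_row A = a"
  using M A T by (auto simp: GL_def polynomial_map_def)

lemma F_eq: "F (v, w) = (pm_eval T v, map_vec (total_eval v w) (fiber_map r \<rho> M))" by (simp add: F_def skew_product_def)

lemma F_carrier: "fst (F y) \<in> carrier_vec m" "snd (F y) \<in> carrier_vec r"
proof -
  obtain v w where "y = (v, w)" by (cases y)
  hence "F y = (pm_eval T v, map_vec (total_eval v w) (fiber_map r \<rho> M))" by (simp only: F_eq)
  moreover have "dim_vec (fiber_map r \<rho> M) = r" using carriers(1) by (simp add: fiber_map_def)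
  ultimately show "fst (F y) \<in> carrier_vec m" "snd (F y) \<in> carrier_vec r"
    by (simp_all only: fst_conv snd_conv) (simp_all only: pm_eval_def carriers(3) carrier_vec_def mem_Collect_eq index_map_vec)
qed

lemma u_carrier: "u n \<in> carrier_vec m" and z_carrier: "z n \<in> carrier_vec r" by (cases n; simp add: u_def z_def u0 z0 F_carrier)+

lemma pm_eval_index: "i < m ==> pm_eval T v $ i = mp_eval (($) v) (T $ i)" by (simp add: pm_eval_def carriers)

lemma u_Suc: "u (Suc n) = pm_eval T (u n)" using F_eq[of "u n" "z n"] by (simp add: u_def z_def)

lemma z_Suc: "j < r ==> z (Suc n) $ j = total_eval (u n) (z n) (fiber_map r \<rho> M $ j)"
  using F_eq[of "u n" "z n"] carriers by (simp add: u_def z_def fiber_map_def)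

lemma u_add: "u (k + n) = (pm_eval T ^^ k) (u n)" by (induction k) (simp_all add: u_Suc)

lemma F_iterate: "(F ^^ k) (u n, z n) = (u (n + k), z (n + k))" by (simp add: u_def z_def funpow_add add.commute[of n k])

lemma cocycle_carrier: "cocycle A n \<in> carrier_mat a a" by (induction n) (use carriers in "auto intro!: mult_carrier_mat[of _ a a]")

lemma x_simps:
  "x n Time = of_nat n" "x n (Base i) = u n $ i" "x n (Fiber j) = z n $ j" "x n (Entry i j) = cocycle A n $$ (i, j)"
  by (simp_all add: x_def u_def z_def)

lemma cocycle_Suc: "i < a ==> j < a ==>
    cocycle A (Suc n) $$ (i, j) = (\<Sum>k<a. poly (A $$ (i, k)) (of_nat n) * cocycle A n $$ (k, j))"
  using carriers cocycle_carrier[of n] by (simp add: scalar_prod_def atLeast0LessThan)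

lemma inverse_matrix:
  assumes "X \<in> GL n P"
  shows "\<exists>Y. (\<forall>i<n. \<forall>k<n. Y $$ (i, k) \<in> P) \<and>
    (\<forall>i<n. \<forall>k<n. (\<Sum>j<n. Y $$ (i, j) * X $$ (j, k)) = (if i = k then 1 else 0))"
proof -
  obtain Y where Y: "X \<in> carrier_mat n n" "Y \<in> carrier_mat n n" "elements_mat Y \<subseteq> P" "inverts_mat Y X"
    using assms by (auto simp: GL_def)
  show ?thesis
  proof (intro exI[of _ Y] conjI allI impI)
    fix i k assume ik: "i < n" "k < n"
    show "Y $$ (i, k) \<in> P" using Y(2,3) ik by (force simp: elements_mat_def)
    have "(\<Sum>j<n. Y $$ (i, j) * X $$ (j, k)) = (Y * X) $$ (i, k)" using Y(1,2) ik by (simp add: scalar_prod_def atLeast0LessThan)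
    also have "Y * X = 1\<^sub>m n" using Y(2,4) by (simp add: inverts_mat_def)
    finally show "(\<Sum>j<n. Y $$ (i, j) * X $$ (j, k)) = (if i = k then 1 else 0)" using ik by simp
  qed
qed

lemma vars_M: "i < r ==> k < r ==> mp_vars (M $$ (i, k)) \<subseteq> {..<m}"
proof -
  assume "i < r" "k < r"
  hence "M $$ (i, k) \<in> elements_mat M" using carriers(1) by (force simp: elements_mat_def)
  moreover have "elements_mat M \<subseteq> {f. mp_vars f \<subseteq> {..<m}}" using M by (simp add: GL_def)
  ultimately show ?thesis by blast
qed

lemma poly_vec_pm_eval:
  assumes "poly_vec m U"
  shows "poly_vec m (\<lambda>y. pm_eval T (U y))" unfolding poly_vec_def
proof (intro conjI allI impI)
  fix i assume "i < m"
  thus "(\<lambda>y. pm_eval T (U y) $ i) \<in> polyfuns UNIV UNIV" by (simp add: pm_eval_index polyfuns_mp_eval poly_vec_index[OF assms])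
qed (rule carrier_vecI, simp add: pm_eval_def carriers(3))

lemma polyfuns_total_eval:
  assumes "poly_vec m U" "poly_vec r Z"
  shows "(\<lambda>y. total_eval (U y) (Z y) f) \<in> polyfuns UNIV UNIV"
proof -
  have "(\<lambda>y. case_sum (($) (U y)) (($) (Z y)) v) \<in> polyfuns UNIV UNIV" for v
    using poly_vec_index[OF assms(1)] poly_vec_index[OF assms(2)] by (cases v) simp_all
  thus ?thesis unfolding total_eval_def by (rule polyfuns_mp_eval)
qed

lemma poly_vec_F:
  assumes "poly_vec m U" "poly_vec r Z"
  shows "poly_vec m (\<lambda>y. fst ((F ^^ k) (U y, Z y))) \<and> poly_vec r (\<lambda>y. snd ((F ^^ k) (U y, Z y)))"
proof (induction k)
  case (Suc k)
  let ?U = "\<lambda>y. fst ((F ^^ k) (U y, Z y))" and ?Z = "\<lambda>y. snd ((F ^^ k) (U y, Z y))"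
  have eq: "(F ^^ Suc k) (U y, Z y) = (pm_eval T (?U y), map_vec (total_eval (?U y) (?Z y)) (fiber_map r \<rho> M))" for y
    using F_eq[of "?U y" "?Z y"] by simp
  have "poly_vec r (\<lambda>y. map_vec (total_eval (?U y) (?Z y)) (fiber_map r \<rho> M))" unfolding poly_vec_def
  proof (intro conjI allI impI)
    fix i assume "i < r"
    hence "(\<lambda>y. map_vec (total_eval (?U y) (?Z y)) (fiber_map r \<rho> M) $ i) =
        (\<lambda>y. total_eval (?U y) (?Z y) (fiber_map r \<rho> M $ i))" using carriers by (auto simp: fiber_map_def)
    thus "(\<lambda>y. map_vec (total_eval (?U y) (?Z y)) (fiber_map r \<rho> M) $ i) \<in> polyfuns UNIV UNIV"
      using polyfuns_total_eval[OF conjunct1[OF Suc] conjunct2[OF Suc]] by simp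
  qed (rule carrier_vecI, use carriers(1) in "simp add: fiber_map_def")
  thus ?case using poly_vec_pm_eval[OF conjunct1[OF Suc]] unfolding eq by simp
qed (use assms in simp)

lemma poly_vec_iterate: "poly_vec m U ==> poly_vec m (\<lambda>y. (pm_eval T ^^ k) (U y))" by (induction k) (simp_all add: poly_vec_pm_eval)

lemma poly_vec_coordinates: "poly_vec n (\<lambda>y. vec n (\<lambda>i. y (\<kappa> i)))" by (auto simp: poly_vec_def intro: polyfuns_var)

abbreviation "J \<equiv> det (fiber_jacobian r (fiber_map r \<rho> M))"

text \<open>The image of the N-th iterate is parametrised by affine space, so the Nullstellensatz on
  affine space applies to the pulled-back polynomials. N is 0 in the etale case.\<close>

lemma critical_nullstellensatz:
  assumes crit: "\<And>v w. v \<in> (pm_eval T ^^ N) ` carrier_vec m ==> w \<in> carrier_vec r ==>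
      total_eval v w J = 0 ==> snd ((F ^^ l) (v, w)) = 0\<^sub>v r"
    and j: "j < r"
  shows "\<exists>k e. \<forall>v\<in>carrier_vec m. \<forall>w\<in>carrier_vec r.
    snd ((F ^^ l) ((pm_eval T ^^ N) v, w)) $ j ^ k =
      peval (case_sum (\<lambda>i. if i < m then v $ i else 0) (\<lambda>i. if i < r then w $ i else 0)) e * total_eval ((pm_eval T ^^ N) v) w J"
proof -
  define U where "U y = (pm_eval T ^^ N) (vec m (\<lambda>i. y (Inl i)))" for y :: "nat + nat => complex"
  define Z where "Z y = vec r (\<lambda>i. y (Inr i))" for y :: "nat + nat => complex"
  have UZ: "poly_vec m U" "poly_vec r Z" unfolding U_def Z_def by (intro poly_vec_iterate poly_vec_coordinates)+
  have f: "(\<lambda>y. total_eval (U y) (Z y) J) \<in> polyfuns UNIV UNIV" by (rule polyfuns_total_eval[OF UZ])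
  have g: "(\<lambda>y. snd ((F ^^ l) (U y, Z y)) $ j) \<in> polyfuns UNIV UNIV" by (rule poly_vec_index[OF conjunct2[OF poly_vec_F[OF UZ]]])
  have fg: "snd ((F ^^ l) (U y, Z y)) $ j = 0" if "total_eval (U y) (Z y) J = 0" for y
  proof -
    have "snd ((F ^^ l) (U y, Z y)) = 0\<^sub>v r" by (rule crit[OF _ _ that]) (auto simp: U_def Z_def)
    thus ?thesis using j by simp
  qed
  obtain k e where e: "e \<in> polyfuns UNIV UNIV" "\<And>y. snd ((F ^^ l) (U y, Z y)) $ j ^ k = e y * total_eval (U y) (Z y) J"
    using nullstellensatz_principal[OF f g fg] by metis
  obtain e' where e': "e = (\<lambda>y. peval y e')" using e(1) by (auto simp: polyfuns_def)
  show ?thesis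
  proof (intro exI[of _ k] exI[of _ e'] ballI)
    fix v w :: "complex vec" assume v: "v \<in> carrier_vec m" "w \<in> carrier_vec r"
    let ?y = "case_sum (\<lambda>i. if i < m then v $ i else 0) (\<lambda>i. if i < r then w $ i else 0)"
    have "U ?y = (pm_eval T ^^ N) v" unfolding U_def by (rule arg_cong[of _ _ "pm_eval T ^^ N"]) (use v in auto)
    moreover have "Z ?y = w" unfolding Z_def using v by auto
    ultimately show "snd ((F ^^ l) ((pm_eval T ^^ N) v, w)) $ j ^ k = peval ?y e' * total_eval ((pm_eval T ^^ N) v) w J"
      using e(2)[of ?y] by (simp add: e')
  qed
qed

end

context skew_system
begin

text \<open>The base coordinates are the first \<open>m\<close> coordinates of an auxiliary system \<open>y (Suc n) = B (y n)\<close> on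
  affine \<open>b\<close>-space which is etale along the orbit.\<close>

lemma progression_zeros_base_system:
  fixes y :: "nat => nat => complex"
  assumes mb: "m \<le> b" and N: "N \<le> n0"
    and y_u: "\<And>n i. i < m ==> y n i = u (n0 + n) $ i"
    and B: "\<And>i. i < b ==> pvars (B i) \<subseteq> {..<b}" and y_Suc: "\<And>n i. i < b ==> y (Suc n) i = peval (y n) (B i)"
    and e: "\<And>i. i < b ==> pvars (e i) \<subseteq> {..<b} \<and> pdeg (e i) \<le> \<delta>"
    and y_e: "\<And>n i. i < b ==> y (n + q) i = peval (y n) (e i)"
    and q: "q \<ge> 1" "\<delta> < d ^ q" and K: "finite K"
    and etale: "\<And>R I p n t i. filtered_ring R I p ==> K \<subseteq> R ==> (\<And>n i. i < b ==> y n i \<in> R) ==>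
      (\<And>i. i < b ==> t i \<in> R) ==> (\<And>i. i < b ==> pdiff (y n) t (B i) \<in> I 2) ==> i < b ==> t i \<in> I 2"
    and crit: "\<And>v w. v \<in> (pm_eval T ^^ N) ` carrier_vec m ==> w \<in> carrier_vec r ==>
      total_eval v w J = 0 ==> snd ((F ^^ l) (v, w)) = 0\<^sub>v r"
  shows "\<exists>p\<ge>1. progression_zeros (state_coords m r a) UNIV x p"
proof -
  obtain \<rho>e where \<rho>e: "pvars \<rho>e \<subseteq> case_sum Base Fiber ` mp_vars \<rho>"
    "\<forall>y. peval y \<rho>e = mp_eval (\<lambda>v. y (case_sum Base Fiber v)) \<rho>"
    using cpoly_as_pexp_renamed[of "case_sum Base Fiber" \<rho>] by (elim exE conjE)
  define represents where "represents e f \<longleftrightarrow> pvars e \<subseteq> Base ` {..<m} \<and> (\<forall>y. peval y e = mp_eval (\<lambda>v. y (Base v)) f)" for e f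
  have represented: "\<exists>e. represents e f" if "mp_vars f \<subseteq> {..<m}" for f
    using cpoly_as_pexp_renamed[of Base f] image_mono[OF that, of Base] unfolding represents_def by blast
  have "\<exists>e. represents e (M $$ (i, k))" if "i < r" "k < r" for i k by (rule represented[OF vars_M[OF that]])
  then obtain Me where "\<And>i k. i < r ==> k < r ==> represents (Me i k) (M $$ (i, k))" by metis
  hence Me: "\<And>i k. i < r ==> k < r ==> pvars (Me i k) \<subseteq> Base ` {..<m}"
    "\<And>i k y. i < r ==> k < r ==> peval y (Me i k) = mp_eval (\<lambda>v. y (Base v)) (M $$ (i, k))" by (simp_all add: represents_def)
  obtain Mi where Mi: "\<forall>i<r. \<forall>k<r. Mi $$ (i, k) \<in> {f. mp_vars f \<subseteq> {..<m}}"
    "\<forall>i<r. \<forall>k<r. (\<Sum>j<r. Mi $$ (i, j) * M $$ (j, k)) = (if i = k then 1 else 0)" using inverse_matrix[OF M] by (elim exE conjE)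
  have "\<exists>e. represents e (Mi $$ (i, k))" if "i < r" "k < r" for i k using represented Mi(1) that by simp
  then obtain Mie where "\<And>i k. i < r ==> k < r ==> represents (Mie i k) (Mi $$ (i, k))" by metis
  hence Mie: "\<And>i k. i < r ==> k < r ==> pvars (Mie i k) \<subseteq> Base ` {..<m}"
    "\<And>i k y. i < r ==> k < r ==> peval y (Mie i k) = mp_eval (\<lambda>v. y (Base v)) (Mi $$ (i, k))" by (simp_all add: represents_def)
  obtain Ai where Ai: "\<forall>i<a. \<forall>k<a. (\<Sum>j<a. Ai $$ (i, j) * A $$ (j, k)) = (if i = k then 1 else 0)"
    using inverse_matrix[OF A] by (elim exE conjE)
  define rep_poly where "rep_poly e f \<longleftrightarrow> pvars e \<subseteq> {Time} \<and> (\<forall>y. peval y e = poly f (y Time))" for e f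
  have "\<exists>e. rep_poly e f" for f using poly_as_pexp[of Time f] by (simp add: rep_poly_def)
  then obtain P where "\<And>f. rep_poly (P f) f" by metis
  hence P: "\<And>f. pvars (P f) \<subseteq> {Time}" "\<And>f y. peval y (P f) = poly f (y Time)" by (simp_all add: rep_poly_def)
  obtain \<rho>' where \<rho>': "pvars \<rho>' \<subseteq> insert None (Some ` (Base ` {..<m} \<union> Fiber ` {..<r}))"
    "\<forall>s y. mp_eval (\<lambda>v. rescale s y (case_sum Base Fiber v)) \<rho> = s ^ (d - 1) * peval (case_option s y) \<rho>'"
    using fiber_order_rescale[OF vars_rho rho_order] by (elim exE conjE)
  define cofactor where "cofactor j k e \<longleftrightarrow> (\<forall>v\<in>carrier_vec m. \<forall>w\<in>carrier_vec r. snd ((F ^^ l) ((pm_eval T ^^ N) v, w)) $ j ^ k =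
      peval (case_sum (\<lambda>i. if i < m then v $ i else 0) (\<lambda>i. if i < r then w $ i else 0)) e * total_eval ((pm_eval T ^^ N) v) w J)" for j k e
  have "\<exists>k e. cofactor j k e" if "j < r" for j unfolding cofactor_def by (rule critical_nullstellensatz[OF crit that])
  then obtain kc ec where crit': "\<And>j. j < r ==> cofactor j (kc j) (ec j)" by metis
  \<comment> \<open>The cofactors are evaluated at base points N steps back, which may precede time
    n0; the first n0 base points are therefore included. The 0 fills the coordinates out of
    range.\<close>
  define K' where "K' = {0} \<union> K \<union> pconsts \<rho>' \<union> (\<Union>j<r. pconsts (ec j)) \<union> (\<Union>n<n0. \<Union>i<m. {u n $ i})"
  define g where "g j = PMul \<rho>e (psum (map (\<lambda>k. PMul (Me j k) (PVar (Fiber k))) [0..<r]))" for j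
  \<comment> \<open>The orbit from time n0 on, with the auxiliary system in place of the
    base.\<close>
  define X where "X n c = (case c of Base i => y n i | _ => x (n0 + n) c)" for n c
  have X: "X n Time = of_nat (n0 + n)" "X n (Base i) = y n i" "X n (Fiber j) = z (n0 + n) $ j"
    "X n (Entry i j) = cocycle A (n0 + n) $$ (i, j)" for n i j by (simp_all add: X_def x_simps)
  have g_eq: "peval w (g j) = peval w \<rho>e * (\<Sum>k<r. peval w (Me j k) * w (Fiber k))" for w j
    by (simp add: g_def peval_psum o_def sum_list_upt)
  have \<rho>V: "pvars \<rho>e \<subseteq> Base ` {..<m} \<union> Fiber ` {..<r}"
  proof -
    have "case_sum Base Fiber ` (Inl ` {..<m} \<union> Inr ` {..<r}) \<subseteq> Base ` {..<m} \<union> Fiber ` {..<r}" by auto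
    thus ?thesis by (rule order_trans[OF order_trans[OF \<rho>e(1) image_mono[OF vars_rho]]])
  qed
  have gV: "pvars (g j) \<subseteq> Base ` {..<m} \<union> Fiber ` {..<r}" if j: "j < r" for j
  proof -
    have "pvars (PMul (Me j k) (PVar (Fiber k))) \<subseteq> Base ` {..<m} \<union> Fiber ` {..<r}" if "k < r" for k
      using Me(1)[OF j that] that by auto
    thus ?thesis using \<rho>V by (simp add: g_def pvars_psum UN_subset_iff)
  qed
  have g_eval: "peval w (g j) = mp_eval (\<lambda>v. w (case_sum Base Fiber v)) (fiber_map r \<rho> M $ j)" if j: "j < r" for w j
    unfolding g_eq mp_eval_fiber_map[OF carriers(1) j] using \<rho>e(2) Me(2)[OF j] by simp
  \<comment> \<open>The variant with u itself as base turns expressions back into polynomials on the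
    total space. It agrees with \<open>X\<close> on all coordinates that occur in the fiber
    map.\<close>
  define X' where "X' n c = (case c of Base i => u (n0 + n) $ i | _ => x (n0 + n) c)" for n c
  have XX': "X n c = X' n c" if "c \<in> Base ` {..<m} \<union> Fiber ` {..<r}" for n c using that by (auto simp: X_def X'_def y_u)
  have X'_eq: "(\<lambda>v. X' n (case_sum Base Fiber v)) = case_sum (($) (u (n0 + n))) (($) (z (n0 + n)))" for n
    by (rule ext) (simp add: X'_def x_simps split: sum.splits)
  have jac: "det (mat r r (\<lambda>(i, k). pdiff (X n) (\<lambda>c. if c = Fiber k then 1 else 0) (g i))) =
      total_eval (u (n0 + n)) (z (n0 + n)) J" for n
  proof -
    let ?ev = "total_eval (u (n0 + n)) (z (n0 + n))"
    have "pdiff (X n) (\<lambda>c. if c = Fiber k then 1 else 0) (g i) = ?ev (mp_deriv (Inr k) (fiber_map r \<rho> M $ i))"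
      if ik: "i < r" "k < r" for i k
    proof -
      let ?t = "\<lambda>c. if c = Fiber k then 1 else 0 :: complex" and ?h = "fiber_map r \<rho> M $ i"
      let ?W = "insert (Inr k) (mp_vars ?h)"
      have W: "finite ?W" "mp_vars ?h \<subseteq> ?W" using finite_mp_vars[of ?h] by auto
      obtain e0 where e0: "\<forall>x. peval x e0 = mp_eval x ?h"
        "\<forall>x t. pdiff x t e0 = (\<Sum>v\<in>?W. t v * mp_eval x (mp_deriv v ?h))" using cpoly_as_pexp[OF W] by (elim exE conjE)
      let ?s = "\<lambda>v. PVar (case_sum Base Fiber v)"
      have "pdiff (X n) ?t (g i) = pdiff (X' n) ?t (g i)" by (rule pdiff_cong) (use gV[OF ik(1)] XX' in blast)
      also have "\<dots> = pdiff (X' n) ?t (psubst ?s e0)" by (rule pdiff_ext) (simp add: g_eval[OF ik(1)] peval_psubst e0(1))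
      also have "\<dots> = (\<Sum>v\<in>?W. (if v = Inr k then 1 else 0) * ?ev (mp_deriv v ?h))"
        unfolding pdiff_psubst peval.simps pdiff.simps X'_eq total_eval_def e0(2)[rule_format]
        by (intro sum.cong refl arg_cong2[of _ _ _ _ "(*)"]) (auto split: sum.splits)
      also have "\<dots> = ?ev (mp_deriv (Inr k) ?h)" using finite_mp_vars[of ?h] by (simp add: if_distrib[of "\<lambda>u. u * _"] cong: if_cong)
      finally show ?thesis .
    qed
    hence "mat r r (\<lambda>(i, k). pdiff (X n) (\<lambda>c. if c = Fiber k then 1 else 0) (g i)) =
        map_mat ?ev (fiber_jacobian r (fiber_map r \<rho> M))" by (intro eq_matI) (auto simp: fiber_jacobian_def)
    thus ?thesis by (simp add: total_eval_def)
  qed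
  have sys: "skew_orbit b r a d n0 B \<rho>e Me Mie g (\<lambda>i k. P (A $$ (i, k))) (\<lambda>i k. P (Ai $$ (i, k))) X q \<delta> e K' l"
  proof
    show "pvars \<rho>e \<subseteq> Base ` {..<b} \<union> Fiber ` {..<r}" using \<rho>V mb by fastforce
    show "pvars (Me i k) \<subseteq> Base ` {..<b}" if "i < r" "k < r" for i k using Me(1)[OF that] mb by fastforce
    show "pvars (Mie i k) \<subseteq> Base ` {..<b}" if "i < r" "k < r" for i k using Mie(1)[OF that] mb by fastforce
    show "pvars (g i) \<subseteq> Base ` {..<b} \<union> Fiber ` {..<r}" if "i < r" for i using gV[OF that] mb by fastforce
    show "X (Suc n) (Base i) = peval (\<lambda>i. X n (Base i)) (B i)" if "i < b" for n i using y_Suc[OF that] by (simp add: X)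
    show "X (Suc n) (Fiber j) = peval (X n) (g j)" if "j < r" for n j
    proof -
      have "peval (X n) (g j) = peval (X' n) (g j)" by (rule peval_cong) (use gV[OF that] XX' in blast)
      thus ?thesis using z_Suc[OF that, of "n0 + n"] by (simp add: X g_eval[OF that] X'_eq total_eval_def)
    qed
    show "X (Suc n) (Entry i j) = (\<Sum>k<a. peval (X n) (P (A $$ (i, k))) * X n (Entry k j))" if "i < a" "j < a" for n i j
      using cocycle_Suc[OF that, of "n0 + n"] by (simp add: X P(2))
    show "(\<Sum>j<r. peval (X n) (Mie i j) * peval (X n) (Me j k)) = (if i = k then 1 else 0)" if "i < r" "k < r" for n i k
    proof -
      have "(\<Sum>j<r. peval (X n) (Mie i j) * peval (X n) (Me j k)) =
          mp_eval (\<lambda>v. X n (Base v)) (\<Sum>j<r. Mi $$ (i, j) * M $$ (j, k))"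
        using that by (simp add: Mie(2) Me(2) mp_eval.hom_sum mp_eval.hom_mult)
      also have "(\<Sum>j<r. Mi $$ (i, j) * M $$ (j, k)) = (if i = k then 1 else 0)" using Mi(2) that by blast
      finally show ?thesis by (cases "i = k") simp_all
    qed
    show "(\<Sum>j<a. peval (X n) (P (Ai $$ (i, j))) * peval (X n) (P (A $$ (j, k)))) = (if i = k then 1 else 0)"
      if "i < a" "k < a" for n i k
    proof -
      have "(\<Sum>j<a. peval (X n) (P (Ai $$ (i, j))) * peval (X n) (P (A $$ (j, k)))) =
          poly (\<Sum>j<a. Ai $$ (i, j) * A $$ (j, k)) (X n Time)" by (simp add: P(2) poly_sum)
      also have "(\<Sum>j<a. Ai $$ (i, j) * A $$ (j, k)) = (if i = k then 1 else 0)" using Ai that by blast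
      finally show ?thesis by (cases "i = k") simp_all
    qed
    show "\<exists>\<rho>'. pvars \<rho>' \<subseteq> insert None (Some ` (Base ` {..<b} \<union> Fiber ` {..<r})) \<and> pconsts \<rho>' \<subseteq> K' \<and>
        (\<forall>s y. peval (rescale s y) \<rho>e = s ^ (d - 1) * peval (case_option s y) \<rho>')"
    proof (intro exI[of _ \<rho>'] conjI allI)
      have "Base ` {..<m} \<subseteq> Base ` {..<b}" using mb by auto
      hence "insert None (Some ` (Base ` {..<m} \<union> Fiber ` {..<r})) \<subseteq> insert None (Some ` (Base ` {..<b} \<union> Fiber ` {..<r}))"
        by (intro insert_mono image_mono[of _ _ Some] Un_mono order_refl)
      thus "pvars \<rho>' \<subseteq> insert None (Some ` (Base ` {..<b} \<union> Fiber ` {..<r}))" by (rule order_trans[OF \<rho>'(1)])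
      show "pconsts \<rho>' \<subseteq> K'" by (auto simp: K'_def)
      show "peval (rescale s y) \<rho>e = s ^ (d - 1) * peval (case_option s y) \<rho>'" for s y using \<rho>'(2) \<rho>e(2) by simp
    qed
    show "X (n + q) (Base i) = peval (\<lambda>i. X n (Base i)) (e i)" if "i < b" for n i using y_e[OF that] by (simp add: X)
    show "finite K'" using K by (simp add: K'_def finite_pconsts)
    show "t i \<in> I 2" if "filtered_ring R I p" "K' \<subseteq> R" "\<And>n i. i < b ==> X n (Base i) \<in> R"
      "\<And>i. i < b ==> t i \<in> R" "\<And>i. i < b ==> pdiff (\<lambda>i. X n (Base i)) t (B i) \<in> I 2" "i < b" for R I p n t i
    proof (rule etale[OF that(1)])
      show "K \<subseteq> R" using that(2) by (simp add: K'_def)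
      show "y n i \<in> R" if "i < b" for n i using \<open>\<And>n i. i < b ==> X n (Base i) \<in> R\<close>[OF that, of n] by (simp add: X)
      show "t i \<in> R" if "i < b" for i by (rule \<open>\<And>i. i < b ==> t i \<in> R\<close>[OF that])
      show "pdiff (y n) t (B i) \<in> I 2" if "i < b" for i
        using \<open>\<And>i. i < b ==> pdiff (\<lambda>i. X n (Base i)) t (B i) \<in> I 2\<close>[OF that] by (simp add: X)
    qed (rule that(6))
    show "\<exists>k. \<exists>b\<in>R. X (n + l) (Fiber j) ^ k =
        b * det (mat r r (\<lambda>(i, k). pdiff (X n) (\<lambda>c. if c = Fiber k then 1 else 0) (g i)))"
      if R: "subring_set R" "K' \<subseteq> R" and XR: "\<And>n c. c \<in> state_coords b r a ==> X n c \<in> R" and j: "j < r" for R n j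
    proof -
      have uR: "u i $ k \<in> R" if "k < m" for i k
      proof (cases "i < n0")
        case True
        thus ?thesis using R(2) that by (auto simp: K'_def UN_subset_iff)
      next
        case False
        hence "u i $ k = X (i - n0) (Base k)" using y_u[OF that, of "i - n0"] by (simp add: X)
        thus ?thesis using XR[of "Base k" "i - n0"] that mb by (simp add: state_coords_def)
      qed
      have zR: "z (n0 + n) $ k \<in> R" if "k < r" for k using XR[of "Fiber k" n] that by (simp add: X state_coords_def)
      let ?v = "u (n0 + n - N)" and ?w = "z (n0 + n)"
      let ?y = "case_sum (\<lambda>i. if i < m then ?v $ i else 0) (\<lambda>i. if i < r then ?w $ i else 0)"
      have u_eq: "(pm_eval T ^^ N) ?v = u (n0 + n)" using u_add[of N "n0 + n - N"] N by simp
      have "X (n + l) (Fiber j) = snd ((F ^^ l) (u (n0 + n), ?w)) $ j" by (simp add: X F_iterate add.assoc)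
      hence "X (n + l) (Fiber j) ^ kc j = peval ?y (ec j) * total_eval (u (n0 + n)) ?w J"
        using crit'[OF j, unfolded cofactor_def, rule_format, OF u_carrier[of "n0 + n - N"] z_carrier[of "n0 + n"]] unfolding u_eq by simp
      moreover have "peval ?y (ec j) \<in> R"
      proof (rule peval_in_subring[OF R(1)])
        show "pconsts (ec j) \<subseteq> R" using R(2) j by (auto simp: K'_def UN_subset_iff)
        show "?y v \<in> R" for v using R(2) uR zR by (cases v) (auto simp: K'_def)
      qed
      ultimately show ?thesis unfolding jac by blast
    qed
  qed (rule P(1) X(1) g_eq d2 q | (rule B e; assumption))+
  interpret S: skew_orbit b r a d n0 B \<rho>e Me Mie g "\<lambda>i k. P (A $$ (i, k))" "\<lambda>i k. P (Ai $$ (i, k))" X q \<delta> e K' l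
    by (rule sys)
  obtain p where p: "p \<ge> 1" "progression_zeros (state_coords b r a) UNIV X p" using S.exists_progression_zeros by (elim exE conjE)
  have sub: "state_coords m r a \<subseteq> state_coords b r a" using mb by (auto simp: state_coords_def)
  have X_x: "X n c = x (n0 + n) c" if "c \<in> state_coords m r a" for n c using that by (auto simp: X_def state_coords_def x_simps y_u)
  have "progression_zeros (state_coords m r a) UNIV x p"
  proof (rule progression_zerosI[OF p(1), of _ _ _ n0])
    fix e i assume e: "pvars e \<subseteq> state_coords m r a" and inf: "infinite {n. peval (x (n0 + i + p * n)) e = 0}"
    have eq: "peval (x (n0 + i + p * n)) e = peval (X (i + p * n)) e" for n unfolding add.assoc by (rule peval_cong) (use e X_x in auto)
    show "ev (\<lambda>n. peval (x (n0 + i + p * n)) e = 0)"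
      using p(2) inf order_trans[OF e sub] unfolding eq progression_zeros_def by blast
  qed
  thus ?thesis using p(1) by blast
qed

end

section \<open>The etale base\<close>

lemma (in filtered_ring) unit_mod_inverse:
  assumes "x \<in> R" "y \<in> R" "y * x = 1"
  shows "unit_mod x"
proof (rule ccontr)
  assume "\<not> unit_mod x"
  then obtain b where b: "b \<ge> 1" "x ^ b \<in> I 1" using unit_or_nilpotent[OF assms(1)] assms(1) unfolding unit_mod_def by blast
  have "y ^ b * x ^ b \<in> I 1" by (rule ideal_setD(4)[OF I_ideal subring_power[OF subring assms(2)] b(2)])
  hence "(y * x) ^ b \<in> I 1" by (simp add: power_mult_distrib)
  thus False using one_notin assms(3) by simp
qed

lemma invertible_mat_det_nonzero:
  fixes X :: "complex mat"
  assumes X: "invertible_mat X" "X \<in> carrier_mat n n"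
  shows "det X \<noteq> 0"
proof -
  obtain Y where Y: "X * Y = 1\<^sub>m (dim_row X)" "Y * X = 1\<^sub>m (dim_row Y)" using X(1) by (auto simp: invertible_mat_def inverts_mat_def)
  have "dim_col (X * Y) = n" "dim_col (Y * X) = n" using X(2) unfolding Y(1) by auto
  hence "Y \<in> carrier_mat n n" unfolding Y(2) by auto
  hence "det X * det Y = det (1\<^sub>m n :: complex mat)" using det_mult[OF X(2), of Y] Y(1) X(2) by simp
  hence "det X * det Y = 1" by simp
  thus ?thesis by auto
qed

lemma pdeg_psubst: "(\<And>v. pdeg (s v) \<le> 1) ==> pdeg (psubst s e) \<le> pdeg e"
  by (induction e) (auto simp: max_def intro: add_mono order_trans)

context skew_system
begin

lemma vars_T: "i < m ==> mp_vars (T $ i) \<subseteq> {..<m}" using T by (simp add: polynomial_map_def)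

lemma T_as_pexp:
  "\<exists>B. \<forall>i<m. pvars (B i) \<subseteq> {..<m} \<and> pdeg (B i) \<le> mp_total_degree (T $ i) \<and> (\<forall>y. peval y (B i) = mp_eval y (T $ i)) \<and>
    (\<forall>y t. pdiff y t (B i) = (\<Sum>v<m. t v * mp_eval y (mp_deriv v (T $ i))))"
proof -
  define rep where "rep i e \<longleftrightarrow> pvars e \<subseteq> {..<m} \<and> pdeg e \<le> mp_total_degree (T $ i) \<and> (\<forall>y. peval y e = mp_eval y (T $ i)) \<and>
    (\<forall>y t. pdiff y t e = (\<Sum>v<m. t v * mp_eval y (mp_deriv v (T $ i))))" for i e
  have "\<exists>e. rep i e" if i: "i < m" for i
  proof -
    obtain e where "pvars e \<subseteq> mp_vars (T $ i)" "pdeg e \<le> mp_total_degree (T $ i)" "\<forall>y. peval y e = mp_eval y (T $ i)"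
      "\<forall>y t. pdiff y t e = (\<Sum>v<m. t v * mp_eval y (mp_deriv v (T $ i)))"
      using cpoly_as_pexp[OF finite_lessThan vars_T[OF i]] by (elim exE conjE)
    hence "rep i e" using order_trans[OF _ vars_T[OF i]] unfolding rep_def by simp
    thus ?thesis by (rule exI)
  qed
  then obtain B where "\<And>i. i < m ==> rep i (B i)" by metis
  thus ?thesis unfolding rep_def by (intro exI[of _ B]) simp
qed

lemma iterate_dim: "dim_vec (pm_iterate T k) = m" by (induction k) (simp_all add: pm_iterate_def pm_comp_def carriers(3))

lemma mp_eval_iterate: "i < m ==> mp_eval y (pm_iterate T k $ i) = (pm_eval T ^^ k) (vec m y) $ i"
proof (induction k arbitrary: i)
  case 0
  thus ?case by (simp add: pm_iterate_def carriers(3))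
next
  case (Suc k)
  have "pm_iterate T (Suc k) $ i = mp_subst (($) (pm_iterate T k)) (T $ i)" using Suc.prems by (simp add: pm_iterate_def pm_comp_def carriers(3))
  hence "mp_eval y (pm_iterate T (Suc k) $ i) = mp_eval (\<lambda>v. mp_eval y (pm_iterate T k $ v)) (T $ i)" by (simp add: mp_eval_subst)
  also have "\<dots> = mp_eval (($) ((pm_eval T ^^ k) (vec m y))) (T $ i)" by (rule mp_eval_cong) (use vars_T[OF Suc.prems] Suc.IH in auto)
  finally show ?case using Suc.prems by (simp add: pm_eval_index)
qed

lemma iterate_as_pexp:
  assumes i: "i < m"
  shows "\<exists>e. pvars e \<subseteq> {..<m} \<and> pdeg e \<le> pm_degree (pm_iterate T k) \<and> (\<forall>n. u (n + k) $ i = peval (($) (u n)) e)"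
proof -
  let ?f = "pm_iterate T k $ i"
  obtain e where e: "pdeg e \<le> mp_total_degree ?f" "\<forall>y. peval y e = mp_eval y ?f"
    using cpoly_as_pexp[OF finite_mp_vars[of ?f] order_refl] by (elim exE conjE)
  \<comment> \<open>Variables from m on are replaced by 0: the iterated polynomials are only known
    to have values independent of them.\<close>
  define s :: "nat => nat pexp" where "s v = (if v < m then PVar v else PConst 0)" for v
  have "mp_total_degree ?f \<le> pm_degree (pm_iterate T k)"
  proof (cases "?f = 0")
    case False
    have eq: "{mp_total_degree (pm_iterate T k $ i) |i. i < dim_vec (pm_iterate T k) \<and> pm_iterate T k $ i \<noteq> 0} =
        (\<lambda>i. mp_total_degree (pm_iterate T k $ i)) ` {i. i < m \<and> pm_iterate T k $ i \<noteq> 0}" by (auto simp: iterate_dim)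
    show ?thesis unfolding pm_degree_def eq by (rule Max_ge) (use False i in auto)
  qed (simp add: mp_total_degree_def)
  moreover have "pdeg (psubst s e) \<le> pdeg e" by (rule pdeg_psubst) (simp add: s_def)
  ultimately have "pdeg (psubst s e) \<le> pm_degree (pm_iterate T k)" using e(1) by linarith
  moreover have "pvars (psubst s e) \<subseteq> {..<m}" by (auto simp: pvars_psubst s_def split: if_splits)
  moreover have "u (n + k) $ i = peval (($) (u n)) (psubst s e)" for n
  proof -
    have "peval (($) (u n)) (psubst s e) = (pm_eval T ^^ k) (vec m (\<lambda>v. peval (($) (u n)) (s v))) $ i"
      by (simp add: peval_psubst e(2) mp_eval_iterate[OF i])
    also have "vec m (\<lambda>v. peval (($) (u n)) (s v)) = u n" using u_carrier[of n] by (auto simp: s_def)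
    finally show ?thesis using u_add[of k n] by (simp add: add.commute)
  qed
  ultimately show ?thesis by blast
qed

text \<open>The Nullstellensatz with \<open>g = 1\<close>: a Jacobian determinant without zeros has
  a polynomial inverse. A filtered ring containing the constants of this inverse and the orbit
  contains the inverse of the determinant along the orbit.\<close>

lemma etale_inverse:
  assumes "pm_etale T"
  shows "\<exists>e. \<forall>v\<in>carrier_vec m. peval (\<lambda>i. if i < m then v $ i else 0) e * det (pm_differential T v) = 1"
proof -
  let ?D = "det (mat m m (\<lambda>(i, j). mp_deriv j (T $ i)))"
  have det: "det (pm_differential T v) = mp_eval (($) v) ?D" for v
  proof -
    have "pm_differential T v = map_mat (mp_eval (($) v)) (mat m m (\<lambda>(i, j). mp_deriv j (T $ i)))"
      by (rule eq_matI) (auto simp: pm_differential_def carriers(3))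
    thus ?thesis by simp
  qed
  have f: "(\<lambda>y. mp_eval (($) (vec m y)) ?D) \<in> polyfuns UNIV UNIV"
    by (rule polyfuns_mp_eval, rule poly_vec_index[OF poly_vec_coordinates[of m "\<lambda>i. i"]])
  have g: "(\<lambda>y. 1) \<in> polyfuns (UNIV :: nat set) UNIV" by (rule polyfuns_const) simp
  have fg: "(1::complex) = 0" if "mp_eval (($) (vec m y)) ?D = 0" for y
  proof -
    have "invertible_mat (pm_differential T (vec m y))" using assms by (simp add: pm_etale_def carriers(3))
    hence "det (pm_differential T (vec m y)) \<noteq> 0" by (rule invertible_mat_det_nonzero[of _ m]) (simp add: pm_differential_def carriers(3))
    thus ?thesis using that by (simp add: det)
  qed
  show ?thesis
  proof (rule nullstellensatz_principal[OF f g fg])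
    fix k e
    assume e: "e \<in> polyfuns UNIV UNIV" "\<And>y. 1 ^ k = e y * mp_eval (($) (vec m y)) ?D"
    obtain e' where e': "e = (\<lambda>y. peval y e')" using e(1) by (auto simp: polyfuns_def)
    have "peval (\<lambda>i. if i < m then v $ i else 0) e' * det (pm_differential T v) = 1" if v: "v \<in> carrier_vec m" for v
    proof -
      have "vec m (\<lambda>i. if i < m then v $ i else 0) = v" using v by auto
      thus ?thesis using e(2)[of "\<lambda>i. if i < m then v $ i else 0"] by (simp add: e' det)
    qed
    thus ?thesis by (intro exI[of _ e'] ballI)
  qed
qed

lemma progression_zeros_etale:
  assumes et: "pm_etale T" and q: "q \<ge> 1" "pm_degree (pm_iterate T q) < d ^ q"
    and crit: "(F ^^ l) ` critical_locus r \<rho> M (carrier_vec m) \<subseteq> carrier_vec m \<times> {0\<^sub>v r}"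
  shows "\<exists>p\<ge>1. progression_zeros (state_coords m r a) UNIV x p"
proof -
  obtain B where B: "\<forall>i<m. pvars (B i) \<subseteq> {..<m} \<and> pdeg (B i) \<le> mp_total_degree (T $ i) \<and> (\<forall>y. peval y (B i) = mp_eval y (T $ i)) \<and>
    (\<forall>y t. pdiff y t (B i) = (\<Sum>v<m. t v * mp_eval y (mp_deriv v (T $ i))))" using T_as_pexp by (elim exE)
  define rep where "rep i e \<longleftrightarrow> pvars e \<subseteq> {..<m} \<and> pdeg e \<le> pm_degree (pm_iterate T q) \<and> (\<forall>n. u (n + q) $ i = peval (($) (u n)) e)" for i e
  have "\<exists>e. rep i e" if "i < m" for i unfolding rep_def by (rule iterate_as_pexp[OF that])
  then obtain e where e: "\<And>i. i < m ==> rep i (e i)" by metis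
  obtain dinv where dinv: "\<forall>v\<in>carrier_vec m. peval (\<lambda>i. if i < m then v $ i else 0) dinv * det (pm_differential T v) = 1"
    using etale_inverse[OF et] by (elim exE)
  show ?thesis
  proof (rule progression_zeros_base_system[where y = "\<lambda>n. ($) (u n)" and b = m and N = 0 and ?n0.0 = 0 and B = B and e = e
        and q = q and \<delta> = "pm_degree (pm_iterate T q)" and K = "pconsts dinv \<union> (\<Union>i<m. pconsts (B i))" and l = l])
    show "pvars (B i) \<subseteq> {..<m}" if "i < m" for i using B that by simp
    show "u (Suc n) $ i = peval (($) (u n)) (B i)" if "i < m" for n i using B that by (simp add: u_Suc pm_eval_index)
    show "pvars (e i) \<subseteq> {..<m} \<and> pdeg (e i) \<le> pm_degree (pm_iterate T q)" if "i < m" for i using e[OF that] by (simp add: rep_def)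
    show "u (n + q) $ i = peval (($) (u n)) (e i)" if "i < m" for n i using e[OF that] by (simp add: rep_def)
    show "snd ((F ^^ l) (v, w)) = 0\<^sub>v r"
      if "v \<in> (pm_eval T ^^ 0) ` carrier_vec m" "w \<in> carrier_vec r" "total_eval v w J = 0" for v w
    proof -
      have "(v, w) \<in> critical_locus r \<rho> M (carrier_vec m)" using that by (simp add: critical_locus_def)
      hence "(F ^^ l) (v, w) \<in> carrier_vec m \<times> {0\<^sub>v r}" using crit by blast
      thus ?thesis by (auto simp: mem_Times_iff)
    qed
    fix R I p n t i
    assume F: "filtered_ring R I p" and K: "pconsts dinv \<union> (\<Union>i<m. pconsts (B i)) \<subseteq> R" and uR: "\<And>n i. i < m ==> u n $ i \<in> R"
      and t: "\<And>i. i < m ==> t i \<in> R" and dt: "\<And>i. i < m ==> pdiff (($) (u n)) t (B i) \<in> I 2" and i: "i < m"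
    interpret filtered_ring R I p by (rule F)
    define D where "D i k = mp_eval (($) (u n)) (mp_deriv k (T $ i))" for i k
    have D_B: "D i k = pdiff (($) (u n)) (\<lambda>v. if v = k then 1 else 0) (B i)" if "i < m" "k < m" for i k
      using B that by (simp add: D_def if_distrib[of "\<lambda>u. u * _"] cong: if_cong)
    have D_eq: "mat m m (\<lambda>(i, k). D i k) = pm_differential T (u n)" by (rule eq_matI) (auto simp: pm_differential_def carriers(3) D_def)
    have D_R: "D i k \<in> R" if "i < m" "k < m" for i k unfolding D_B[OF that]
    proof (rule pdiff_in_R)
      show "pconsts (B i) \<subseteq> R" using K that by auto
      have "pvars (B i) \<subseteq> {..<m}" using B \<open>i < m\<close> by simp
      thus "u n $ v \<in> R" if "v \<in> pvars (B i)" for v using uR[of v] that by auto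
    qed (use subring_setD[OF subring] in auto)
    show "t i \<in> I 2"
    proof (rule det_unit_injective[of m D t 2 i, OF D_R _ t _ i])
      have "pm_differential T (u n) \<in> carrier_mat m m" by (simp add: pm_differential_def carriers(3))
      hence det_R: "det (pm_differential T (u n)) \<in> R" unfolding D_eq[symmetric] by (intro det_in_subring[OF subring, of _ m]) (simp_all add: D_R)
      have inv_R: "peval (\<lambda>i. if i < m then u n $ i else 0) dinv \<in> R"
        by (rule peval_in_subring[OF subring]) (use K uR subring_setD(1)[OF subring] in auto)
      show "unit_mod (det (mat m m (\<lambda>(i, k). D i k)))" unfolding D_eq by (rule unit_mod_inverse[OF det_R inv_R]) (use dinv u_carrier in simp)
      show "(\<Sum>l<m. D k l * t l) \<in> I 2" if "k < m" for k using dt[OF that] B that by (simp add: D_def mult.commute)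
    qed
  qed (use q in "auto simp: finite_pconsts")
qed

end

text \<open>Polynomials of degree at most one preserve affine dependences; the condition that the
  weights sum to zero takes care of the constant term.\<close>

lemma affine_combination:
  assumes f: "mp_total_degree f \<le> 1" and c: "(\<Sum>i\<in>S. c i) = 0" "\<And>v. v \<in> mp_vars f ==> (\<Sum>i\<in>S. c i * y i v) = 0"
  shows "(\<Sum>i\<in>S. c i * mp_eval (y i) f) = 0"
proof -
  have mono: "(\<Sum>i\<in>S. c i * monomial_value (y i) \<mu>) = 0" if \<mu>: "\<mu> \<in> keys f" for \<mu>
  proof -
    obtain l where l: "list_monomial l = \<mu>" using monomial_as_list by metis
    have "length l = mp_monom_degree \<mu>" using degree_list_monomial[of l] by (simp add: l)
    also have "\<dots> \<le> mp_total_degree f" unfolding mp_total_degree_def by (rule Max_ge) (use \<mu> in auto)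
    finally have "length l \<le> 1" using f by simp
    then consider "l = []" | v where "l = [v]" by (cases l) auto
    thus ?thesis
    proof cases
      case 1
      thus ?thesis using c(1) l by auto
    next
      case 2
      hence eq: "\<mu> = single v 1" using l by simp
      have "v \<in> mp_vars f" unfolding mp_vars_def by (rule UN_I[OF \<mu>]) (simp add: eq)
      thus ?thesis using c(2) eq by simp
    qed
  qed
  have "(\<Sum>i\<in>S. c i * mp_eval (y i) f) =
      (\<Sum>\<mu>\<in>keys f. lookup f \<mu> * (\<Sum>i\<in>S. c i * monomial_value (y i) \<mu>))"
    unfolding mp_eval_altdef sum_distrib_left by (subst sum.swap) (simp add: mult_ac)
  thus ?thesis by (simp add: mono)
qed

section \<open>The affine base: a linear recurrence and its companion system\<close>

context skew_system
begin

text \<open>The m + 2 points u_0, ..., u_(m+1) of m-space are affinely dependent, and applying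
  \<open>T\<close> carries the dependence along the orbit. Starting it at its first nonzero weight
  gives a recurrence with nonzero lowest coefficient, even if \<open>T\<close> is not
  injective.\<close>

lemma affine_recurrence:
  assumes "pm_affine_linear T"
  shows "\<exists>i0 k \<gamma>. k \<ge> 1 \<and> \<gamma> 0 \<noteq> 0 \<and> (\<forall>n\<ge>i0. \<forall>j<m. u (n + k) $ j = (\<Sum>i<k. \<gamma> i * u (n + i) $ j))"
proof -
  \<comment> \<open>A row of ones, m rows of coordinates, and a zero row that makes the matrix
    square and singular.\<close>
  define X where "X = mat (m + 2) (m + 2) (\<lambda>(s, i). if s = 0 then 1 else if s \<le> m then u i $ (s - 1) else (0 :: complex))"
  have X: "X \<in> carrier_mat (m + 2) (m + 2)" by (simp add: X_def)
  have "X\<^sup>T *\<^sub>v unit_vec (m + 2) (m + 1) = 0\<^sub>v (m + 2)" by (rule eq_vecI) (simp_all add: X_def)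
  moreover have "X\<^sup>T \<in> carrier_mat (m + 2) (m + 2)" using X by simp
  ultimately have "det X\<^sup>T = 0" using det_0_iff_vec_prod_zero[of "X\<^sup>T" "m + 2"] by force
  hence "det X = 0" using det_transpose[OF X] by simp
  then obtain c where c: "c \<in> carrier_vec (m + 2)" "c \<noteq> 0\<^sub>v (m + 2)" "X *\<^sub>v c = 0\<^sub>v (m + 2)"
    using det_0_iff_vec_prod_zero[OF X] by blast
  have row: "(\<Sum>i<m + 2. X $$ (s, i) * c $ i) = 0" if "s < m + 2" for s
  proof -
    have "(X *\<^sub>v c) $ s = (\<Sum>i<m + 2. X $$ (s, i) * c $ i)"
      using that c(1) X by (simp add: scalar_prod_def atLeast0LessThan del: add_2_eq_Suc' sum.lessThan_Suc)
    thus ?thesis using that by (simp add: c(3))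
  qed
  have c0: "(\<Sum>i<m + 2. c $ i) = 0" using row[of 0] by (simp add: X_def del: add_2_eq_Suc' sum.lessThan_Suc)
  have cu0: "(\<Sum>i<m + 2. c $ i * u i $ j) = 0" if "j < m" for j
    using row[of "Suc j"] that by (simp add: X_def mult.commute del: add_2_eq_Suc' sum.lessThan_Suc)
  have cu: "\<forall>j<m. (\<Sum>i<m + 2. c $ i * u (i + n) $ j) = 0" for n
  proof (induction n)
    case (Suc n)
    have "(\<Sum>i<m + 2. c $ i * u (i + Suc n) $ j) = 0" if j: "j < m" for j
    proof -
    have "(\<Sum>i<m + 2. c $ i * mp_eval (($) (u (i + n))) (T $ j)) = 0"
    proof (rule affine_combination[OF _ c0])
      show "mp_total_degree (T $ j) \<le> 1" using assms j by (simp add: pm_affine_linear_def carriers(3))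
      show "(\<Sum>i<m + 2. c $ i * u (i + n) $ v) = 0" if "v \<in> mp_vars (T $ j)" for v using Suc.IH vars_T[OF j] that by auto
    qed
    thus ?thesis using j by (simp add: u_Suc pm_eval_index del: add_2_eq_Suc' sum.lessThan_Suc)
    qed
    thus ?case by blast
  qed (use cu0 in simp)
  let ?S = "{i. i < m + 2 \<and> c $ i \<noteq> 0}"
  have S: "finite ?S" "?S \<noteq> {}" using c(1,2) by (auto intro: eq_vecI)
  define i0 where "i0 = Min ?S"
  define i1 where "i1 = Max ?S"
  have i: "i0 < m + 2" "c $ i0 \<noteq> 0" "i1 < m + 2" "c $ i1 \<noteq> 0" using Min_in[OF S] Max_in[OF S] by (simp_all add: i0_def i1_def)
  have out: "c $ i = 0" if "i < i0 \<or> i1 < i" "i < m + 2" for i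
  proof (rule ccontr)
    assume "c $ i \<noteq> 0"
    hence "i \<in> ?S" using that by simp
    thus False using Min_le[OF S(1)] Max_ge[OF S(1)] that(1) unfolding i0_def i1_def by fastforce
  qed
  have le: "i0 \<le> i1" unfolding i0_def by (rule Min_le[OF S(1)]) (use i in auto)
  have reduce: "(\<Sum>i<m + 2. c $ i * f i) = (\<Sum>i=i0..i1. c $ i * f i)" for f by (rule sum.mono_neutral_right) (use out i in auto)
  \<comment> \<open>A single nonzero weight could not sum to zero.\<close>
  have "i0 \<noteq> i1"
  proof
    assume "i0 = i1"
    hence "c $ i0 = 0" using c0 reduce[of "\<lambda>_. 1"] by simp
    thus False using i by simp
  qed
  hence lt: "i0 < i1" using le by simp
  define k where "k = i1 - i0"
  define \<gamma> where "\<gamma> i = - c $ (i0 + i) / c $ i1" for i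
  have rec: "u (n + k) $ j = (\<Sum>i<k. \<gamma> i * u (n + i) $ j)" if "i0 \<le> n" "j < m" for n j
  proof -
    define n' where "n' = n - i0"
    have n: "n = i0 + n'" using that by (simp add: n'_def)
    have "0 = (\<Sum>i=i0..i1. c $ i * u (i + n') $ j)" using cu[of n'] that(2) by (simp only: reduce)
    also have "\<dots> = (\<Sum>i=i0..<i1. c $ i * u (i + n') $ j) + c $ i1 * u (i1 + n') $ j" using lt by (simp add: sum.last_plus add.commute)
    also have "(\<Sum>i=i0..<i1. c $ i * u (i + n') $ j) = (\<Sum>i<k. c $ (i0 + i) * u (n + i) $ j)"
      by (rule sum.reindex_bij_witness[of _ "\<lambda>i. i0 + i" "\<lambda>i. i - i0"]) (use lt in "auto simp: k_def n ac_simps")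
    also have "i1 + n' = n + k" using lt by (simp add: n k_def)
    finally have "u (n + k) $ j = - (\<Sum>i<k. c $ (i0 + i) * u (n + i) $ j) / c $ i1" using i(4) by (simp add: field_simps add_eq_0_iff2)
    also have "\<dots> = (\<Sum>i<k. \<gamma> i * u (n + i) $ j)" by (simp add: \<gamma>_def sum_divide_distrib sum_negf)
    finally show ?thesis .
  qed
  have "k \<ge> 1" "\<gamma> 0 \<noteq> 0" using lt i by (simp_all add: k_def \<gamma>_def)
  thus ?thesis using rec by (intro exI[of _ i0] exI[of _ k] exI[of _ \<gamma>]) simp
qed

text \<open>The companion system consists of k consecutive base points. It has degree one, so q = 1
  and \<delta> = 1 < d, and its derivative is injective once \<open>R\<close> contains the inverse
  of the lowest coefficient.\<close>

lemma progression_zeros_affine: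
  assumes aff: "pm_affine_linear T"
    and crit: "(F ^^ l) ` critical_locus r \<rho> M ((pm_eval T ^^ N) ` carrier_vec m) \<subseteq> S \<times> {0\<^sub>v r}"
  shows "\<exists>p\<ge>1. progression_zeros (state_coords m r a) UNIV x p"
proof -
  obtain i0 k \<gamma> where k: "k \<ge> 1" and \<gamma>: "\<gamma> 0 \<noteq> 0"
    and rec: "\<forall>n\<ge>i0. \<forall>j<m. u (n + k) $ j = (\<Sum>i<k. \<gamma> i * u (n + i) $ j)"
    using affine_recurrence[OF aff] by (elim exE conjE)
  \<comment> \<open>From i0 on the recurrence holds; from N on the base points lie in the image of
    the N-th iterate, where the critical locus is taken.\<close>
  define n0 where "n0 = max i0 N"
  define y where "y n i = u (n0 + n + i div m) $ (i mod m)" for n i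
  \<comment> \<open>Blocks of length m: all but the last are copied from the next block, and the
    last is given by the recurrence.\<close>
  define B where "B i = (if i + m < k * m then PVar (i + m)
    else psum (map (\<lambda>s. PMul (PConst (\<gamma> s)) (PVar (s * m + i mod m))) [0..<k]))" for i
  have m0: "m > 0" if "i < k * m" for i using that by (cases m) auto
  have ind: "s * m + i mod m < k * m" if "s < k" "m > 0" for s i
  proof -
    have "s * m + i mod m < Suc s * m" using that(2) by simp
    also have "\<dots> \<le> k * m" using that(1) by (intro mult_right_mono) auto
    finally show ?thesis .
  qed
  have B_vars: "pvars (B i) \<subseteq> {..<k * m}" if "i < k * m" for i using ind[OF _ m0[OF that]] by (auto simp: B_def pvars_psum)
  have B_deg: "pdeg (B i) \<le> 1" for i by (auto simp: B_def intro!: pdeg_psum_le)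
  have y_Suc: "y (Suc n) i = peval (y n) (B i)" if i: "i < k * m" for n i
  proof (cases "i + m < k * m")
    case True
    thus ?thesis using m0[OF i] by (simp add: B_def y_def)
  next
    case False
    have "i div m = k - 1"
    proof (rule div_nat_eqI)
      show "m * (k - 1) \<le> i" using False by (simp add: algebra_simps)
      show "i < m * Suc (k - 1)" using i k by (simp add: mult.commute)
    qed
    hence "y (Suc n) i = u (n0 + n + k) $ (i mod m)" using k by (simp add: y_def)
    also have "\<dots> = (\<Sum>s<k. \<gamma> s * u (n0 + n + s) $ (i mod m))" using rec m0[OF i] by (simp add: n0_def)
    also have "\<dots> = peval (y n) (B i)" using False m0[OF i] by (simp add: B_def y_def peval_psum o_def sum_list_upt)
    finally show ?thesis .
  qed
  show ?thesis
  proof (rule progression_zeros_base_system[where y = y and b = "k * m" and N = N and ?n0.0 = n0 and B = B and e = B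
        and q = 1 and \<delta> = 1 and K = "insert (inverse (\<gamma> 0)) (\<gamma> ` {..<k})" and l = l])
    show "m \<le> k * m" using k by simp
    show "N \<le> n0" by (simp add: n0_def)
    show "y n i = u (n0 + n) $ i" if "i < m" for n i using that by (simp add: y_def)
    show "pvars (B i) \<subseteq> {..<k * m} \<and> pdeg (B i) \<le> 1" if "i < k * m" for i using B_vars[OF that] B_deg by simp
    show "y (n + 1) i = peval (y n) (B i)" if "i < k * m" for n i using y_Suc[OF that] by simp
    show "1 < d ^ 1" using d2 by simp
    show "snd ((F ^^ l) (v, w)) = 0\<^sub>v r"
      if "v \<in> (pm_eval T ^^ N) ` carrier_vec m" "w \<in> carrier_vec r" "total_eval v w J = 0" for v w
    proof -
      have "(v, w) \<in> critical_locus r \<rho> M ((pm_eval T ^^ N) ` carrier_vec m)" using that by (simp add: critical_locus_def)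
      hence "(F ^^ l) (v, w) \<in> S \<times> {0\<^sub>v r}" using crit by blast
      thus ?thesis by (auto simp: mem_Times_iff)
    qed
    fix R I p n t i
    assume F: "filtered_ring R I p" and K: "insert (inverse (\<gamma> 0)) (\<gamma> ` {..<k}) \<subseteq> R"
      and t: "\<And>i. i < k * m ==> t i \<in> R" and dt: "\<And>i. i < k * m ==> pdiff (y n) t (B i) \<in> I 2" and i: "i < k * m"
    interpret filtered_ring R I p by (rule F)
    have high: "t i \<in> I 2" if "m \<le> i" "i < k * m" for i using dt[of "i - m"] that m0[OF that(2)] by (simp add: B_def)
    show "t i \<in> I 2"
    proof (cases "m \<le> i")
      case True
      thus ?thesis using high[OF _ i] by simp
    next
      case False
      \<comment> \<open>Position of coordinate i in the last block. All higher blocks of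
        \<open>t\<close> are already in \<open>I 2\<close>, so the recurrence leaves the lowest
        coefficient times \<open>t i\<close>.\<close>
      let ?j = "(k - 1) * m + i"
      have "(k - 1) * m + m = k * m" using k by (cases k) simp_all
      hence j: "?j < k * m" "\<not> ?j + m < k * m" "?j mod m = i" using False by simp_all
      have *: "(\<Sum>s<k. \<gamma> s * t (s * m + i)) \<in> I 2" using dt[OF j(1)] j(2,3) by (simp add: B_def pdiff_psum o_def sum_list_upt)
      have "(\<Sum>s\<in>{..<k} - {0}. \<gamma> s * t (s * m + i)) \<in> I 2"
      proof (rule ideal_set_sum[OF I_ideal], rule ideal_setD(4)[OF I_ideal])
        fix s assume s: "s \<in> {..<k} - {0}"
        thus "\<gamma> s \<in> R" using K by auto
        have "m \<le> s * m + i" using s by (cases s) auto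
        thus "t (s * m + i) \<in> I 2" using ind[of s i] s False m0[OF i] by (intro high) auto
      qed
      from ideal_set_minus[OF subring I_ideal * this] have "\<gamma> 0 * t i \<in> I 2" using k by (simp add: sum.remove[of "{..<k}" 0])
      moreover have "inverse (\<gamma> 0) \<in> R" using K by simp
      ultimately have "inverse (\<gamma> 0) * (\<gamma> 0 * t i) \<in> I 2" using ideal_setD(4)[OF I_ideal] by simp
      thus ?thesis using \<gamma> by (simp add: mult.assoc[symmetric])
    qed
  qed (simp_all add: B_vars y_Suc)
qed

end

section \<open>Classes modulo the least period\<close>

text \<open>Class k consists of the n congruent to -k modulo t. With this sign the shift of
  sequences takes the indicator of class k to that of class k + 1.\<close>

definition vanishes :: "nat => (nat => complex) => nat => bool" where
  "vanishes t a k \<longleftrightarrow> ev (\<lambda>n. t dvd n + k --> a n = 0)"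

lemma dvd_add_mod_cong: "k mod t = k' mod t ==> t dvd n + k \<longleftrightarrow> t dvd n + (k' :: nat)" by (metis dvd_eq_mod_eq_0 mod_add_right_eq)

lemma class_unique:
  assumes "p dvd n + k" "p dvd n + (k' :: nat)"
  shows "k mod p = k' mod p"
proof -
  have "k mod p = k' mod p" if "p dvd n + k" "p dvd n + k'" "k' \<le> k" for k k'
  proof -
    have "p dvd (n + k) - (n + k')" using that(1,2) by (rule dvd_diff_nat)
    thus ?thesis using that(3) by (simp add: mod_eq_dvd_iff_nat)
  qed
  thus ?thesis using assms by (metis linorder_linear)
qed

lemma class_exists:
  assumes "(p :: nat) \<ge> 1"
  shows "\<exists>k<p. p dvd n + k"
proof -
  have "n + (p - 1) * n = p * n" using assms by (cases p) auto
  hence "p dvd n + (p - 1) * n mod p" using dvd_add_mod_cong[of "(p - 1) * n mod p" p "(p - 1) * n"] by simp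
  thus ?thesis using assms by (intro exI[of _ "(p - 1) * n mod p"]) simp
qed

lemma vanishes_mod_cong: "k mod t = k' mod t ==> vanishes t a k \<longleftrightarrow> vanishes t a k'"
  unfolding vanishes_def using dvd_add_mod_cong[of k t k'] by simp

lemma vanishes_shift: "vanishes t (\<lambda>n. a (n + j)) (k + j) \<longleftrightarrow> vanishes t a k"
  unfolding vanishes_def using eventually_sequentially_seg[of "\<lambda>n. t dvd n + k --> a n = 0" j] by (simp add: ac_simps)

lemma frequently_class:
  assumes "(p :: nat) \<ge> 1" "eventually P sequentially"
  obtains n where "p dvd n + k" "P n"
proof -
  obtain N where N: "\<And>n. n \<ge> N ==> P n" using assms(2) by (auto simp: eventually_sequentially)
  have "N * p + (p - 1) * k + k = p * (N + k)" using assms(1) by (cases p) (auto simp: algebra_simps)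
  hence "p dvd N * p + (p - 1) * k + k" by simp
  moreover have "N \<le> N * p + (p - 1) * k" using assms(1) by (simp add: trans_le_add1)
  ultimately show thesis using that N by blast
qed

lemma eventually_classes:
  assumes "(p :: nat) \<ge> 1" "\<And>k. k < p ==> ev (\<lambda>n. p dvd n + k --> P n)"
  shows "eventually P sequentially"
proof -
  have "ev (\<lambda>n. \<forall>k\<in>{..<p}. p dvd n + k --> P n)" using assms(2) by (intro eventually_ball_finite) auto
  thus ?thesis
  proof (rule eventually_mono)
    fix n assume P: "\<forall>k\<in>{..<p}. p dvd n + k --> P n"
    obtain k where "k < p" "p dvd n + k" using class_exists[OF assms(1), of n] by blast
    thus "P n" using P[rule_format, of k] by simp
  qed
qed

text \<open>\<open>zeros\<close> is the zero-set property for period p, \<open>minimal\<close> its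
  failure for every smaller period.\<close>

locale shift_algebra =
  fixes \<A> :: "(nat => complex) set" and p :: nat
  assumes const: "(\<lambda>n. c) \<in> \<A>"
    and add: "a \<in> \<A> ==> b \<in> \<A> ==> (\<lambda>n. a n + b n) \<in> \<A>"
    and mult: "a \<in> \<A> ==> b \<in> \<A> ==> (\<lambda>n. a n * b n) \<in> \<A>"
    and shift: "a \<in> \<A> ==> (\<lambda>n. a (Suc n)) \<in> \<A>"
    and p: "p \<ge> 1"
    and zeros: "a \<in> \<A> ==> infinite {n. p dvd n + k \<and> a n = 0} ==> vanishes p a k"
    and minimal: "1 \<le> t ==> t < p ==> \<exists>a\<in>\<A>. \<exists>k. infinite {n. t dvd n + k \<and> a n = 0} \<and> \<not> vanishes t a k"
begin

lemma shifts: "a \<in> \<A> ==> (\<lambda>n. a (n + j)) \<in> \<A>"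
proof (induction j)
  case (Suc j)
  thus ?case using shift[of "\<lambda>n. a (n + j)"] by simp
qed simp

text \<open>On each class an element is eventually zero or eventually nonzero, so the elements
  vanishing on a class form a prime ideal.\<close>

lemma nonvanishing:
  assumes a: "a \<in> \<A>" "\<not> vanishes p a k"
  shows "ev (\<lambda>n. p dvd n + k --> a n \<noteq> 0)"
proof -
  have "finite {n. p dvd n + k \<and> a n = 0}" using zeros a by blast
  thus ?thesis by (simp add: eventually_cofinite flip: cofinite_eq_sequentially)
qed

lemma not_vanishesI: "ev (\<lambda>n. p dvd n + k --> a n \<noteq> 0) ==> \<not> vanishes p a k"
proof
  assume "ev (\<lambda>n. p dvd n + k --> a n \<noteq> 0)" "vanishes p a k"
  hence "ev (\<lambda>n. (p dvd n + k --> a n \<noteq> 0) \<and> (p dvd n + k --> a n = 0))"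
    unfolding vanishes_def by (rule eventually_conj)
  from frequently_class[OF p this, of k] show False by blast
qed

text \<open>If the sequences vanishing on class \<open>k\<close> vanished on class \<open>k + t\<close>, then \<open>t\<close> would be a smaller period.\<close>

lemma not_contained:
  assumes t: "1 \<le> t" "t < p"
  shows "\<exists>a\<in>\<A>. vanishes p a k \<and> \<not> vanishes p a (k + t)"
proof (rule ccontr)
  assume "\<not> ?thesis"
  hence contained: "\<And>a. a \<in> \<A> ==> vanishes p a k ==> vanishes p a (k + t)" by blast
  have step: "vanishes p a (i + t)" if a: "a \<in> \<A>" "vanishes p a i" for a i
  proof -
    \<comment> \<open>Translation by j takes class i to class k modulo p, so the containment at k
      spreads to every class.\<close>
    define j where "j = k + (p - 1) * i"
    have eq: "i + j = k + p * i" using p by (cases p) (auto simp: j_def algebra_simps)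
    have "i + t + j = k + t + p * i" using eq by simp
    have "vanishes p (\<lambda>n. a (n + j)) (i + j)" using a(2) by (simp add: vanishes_shift)
    hence "vanishes p (\<lambda>n. a (n + j)) k" unfolding eq by (simp add: vanishes_mod_cong[of "k + p * i" p k])
    hence "vanishes p (\<lambda>n. a (n + j)) (k + t)" by (rule contained[OF shifts[OF a(1)]])
    moreover have "(k + t) mod p = (i + t + j) mod p" unfolding \<open>i + t + j = k + t + p * i\<close> by simp
    ultimately have "vanishes p (\<lambda>n. a (n + j)) (i + t + j)" using vanishes_mod_cong[of "k + t" p "i + t + j"] by simp
    thus ?thesis by (simp only: vanishes_shift)
  qed
  have steps: "vanishes p a (i + t * s)" if a: "a \<in> \<A>" "vanishes p a i" for a i s
  proof (induction s)
    case (Suc s)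
    thus ?case using step[OF a(1), of "i + t * s"] by (simp add: algebra_simps)
  qed (use a in simp)
  \<comment> \<open>Infinitely many zeros in class i modulo t fall infinitely often into one class
    modulo p that meets it. There \<open>a\<close> vanishes, and steps of t carry this to all
    classes modulo p meeting class i modulo t. So t would have the zero-set property.\<close>
  have "vanishes t a i" if a: "a \<in> \<A>" and inf: "infinite {n. t dvd n + i \<and> a n = 0}" for a i
  proof -
    have "{n. t dvd n + i \<and> a n = 0} \<subseteq> (\<Union>c<p. {n. t dvd n + i \<and> a n = 0 \<and> p dvd n + c})"
    proof
      fix n assume "n \<in> {n. t dvd n + i \<and> a n = 0}"
      moreover obtain c where "c < p" "p dvd n + c" using class_exists[OF p, of n] by blast
      ultimately show "n \<in> (\<Union>c<p. {n. t dvd n + i \<and> a n = 0 \<and> p dvd n + c})" by auto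
    qed
    hence "infinite (\<Union>c<p. {n. t dvd n + i \<and> a n = 0 \<and> p dvd n + c})" using inf finite_subset by blast
    then obtain c where c: "infinite {n. t dvd n + i \<and> a n = 0 \<and> p dvd n + c}" by auto
    obtain n0 where n0: "t dvd n0 + i" "p dvd n0 + c" using infinite_imp_nonempty[OF c] by auto
    obtain s where s: "n0 + i = t * s" using n0(1) by (rule dvdE)
    \<comment> \<open>Class c is reached from i by -s steps of t; modulo p,
      \<open>(p - 1) * s\<close> steps do the same.\<close>
    have "n0 + (i + t * ((p - 1) * s)) = p * (t * s)" using s p by (cases p) (auto simp: algebra_simps)
    hence ci: "(i + t * ((p - 1) * s)) mod p = c mod p" using n0(2) by (intro class_unique[of p n0]) simp_all
    have "infinite {n. p dvd n + c \<and> a n = 0}" by (rule infinite_super[OF _ c]) auto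
    hence "vanishes p a c" by (rule zeros[OF a])
    hence van: "vanishes p a (i + t * ((p - 1) * s))" using vanishes_mod_cong[OF ci] by simp
    define s0 where "s0 = (p - 1) * s"
    show ?thesis unfolding vanishes_def
    proof (rule eventually_classes[OF p])
      fix c' assume "c' < p"
      show "ev (\<lambda>n. p dvd n + c' --> t dvd n + i --> a n = 0)"
      proof (cases "\<exists>n1. p dvd n1 + c' \<and> t dvd n1 + i")
        case True
        then obtain n1 s where n1: "p dvd n1 + c'" "n1 + i = t * s" by (auto simp: dvd_def)
        have "vanishes p a (i + t * s0 + t * ((p - 1) * (s + s0)))" unfolding s0_def by (rule steps[OF a van])
        moreover have "(i + t * s0 + t * ((p - 1) * (s + s0))) mod p = c' mod p"
        proof -
          have "i + t * s0 + t * ((p - 1) * (s + s0)) + n1 = p * (t * (s + s0))" using n1(2) p by (cases p) (auto simp: algebra_simps)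
          hence "p dvd n1 + (i + t * s0 + t * ((p - 1) * (s + s0)))" by (simp add: add.commute)
          thus ?thesis using n1(1) by (rule class_unique)
        qed
        ultimately have "vanishes p a c'" using vanishes_mod_cong by blast
        thus ?thesis unfolding vanishes_def by (rule eventually_mono) simp
      qed simp
    qed
  qed
  thus False using minimal[OF t] by blast
qed

lemma incomparable:
  assumes "i mod p \<noteq> j mod p"
  shows "\<exists>a\<in>\<A>. vanishes p a i \<and> \<not> vanishes p a j"
proof -
  define t where "t = (j + (p - 1) * i) mod p"
  have eq: "i + (j + (p - 1) * i) = j + p * i" using p by (cases p) (auto simp: algebra_simps)
  have it: "(i + t) mod p = j mod p" unfolding t_def mod_add_right_eq eq by simp
  have "t < p" using p by (simp add: t_def)
  moreover have "t \<noteq> 0" using assms it by (intro notI) simp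
  ultimately obtain a where "a \<in> \<A>" "vanishes p a i" "\<not> vanishes p a (i + t)" using not_contained[of t i] by auto
  thus ?thesis using vanishes_mod_cong[OF it] by blast
qed

text \<open>Multiply the elements obtained for the single classes; the product still does not vanish
  on class i because elements not vanishing there are eventually nonzero there.\<close>

lemma separating:
  assumes "finite J" "\<And>j. j \<in> J ==> j mod p \<noteq> i mod p"
  shows "\<exists>a\<in>\<A>. \<not> vanishes p a i \<and> (\<forall>j\<in>J. vanishes p a j)" using assms
proof (induction J)
  case empty
  have "\<not> vanishes p (\<lambda>n. 1) i" by (rule not_vanishesI) simp
  thus ?case using const[of 1] by blast
next
  case (insert j J)
  then obtain a where a: "a \<in> \<A>" "\<not> vanishes p a i" "\<forall>j\<in>J. vanishes p a j" by auto
  have "j mod p \<noteq> i mod p" using insert.prems by simp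
  from incomparable[OF this] obtain b where b: "b \<in> \<A>" "vanishes p b j" "\<not> vanishes p b i" by blast
  have "ev (\<lambda>n. p dvd n + i --> a n * b n \<noteq> 0)"
    using nonvanishing[OF a(1,2)] nonvanishing[OF b(1,3)] by eventually_elim simp
  hence "\<not> vanishes p (\<lambda>n. a n * b n) i" by (rule not_vanishesI)
  moreover have "vanishes p (\<lambda>n. a n * b n) k" if "k \<in> insert j J" for k
    using that b(2) a(3) unfolding vanishes_def by (auto elim: eventually_mono)
  ultimately show ?case using mult[OF a(1) b(1)] by blast
qed

definition quotients :: "(nat => complex) set" where
  "quotients = {q. \<exists>a\<in>\<A>. \<exists>s\<in>\<A>. ev (\<lambda>n. s n \<noteq> 0) \<and> ev (\<lambda>n. q n * s n = a n)}"

lemma quotientsI: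
  "a \<in> \<A> ==> s \<in> \<A> ==> ev (\<lambda>n. s n \<noteq> 0) ==> ev (\<lambda>n. q n * s n = a n) ==> q \<in> quotients"
  by (auto simp: quotients_def)

lemma quotientsE:
  assumes "q \<in> quotients"
  obtains a s where "a \<in> \<A>" "s \<in> \<A>" "ev (\<lambda>n. s n \<noteq> 0)" "ev (\<lambda>n. q n * s n = a n)"
  using assms by (auto simp: quotients_def)

lemma algebra_quotients: "a \<in> \<A> ==> a \<in> quotients" by (rule quotientsI[of a "\<lambda>n. 1"]) (auto intro: const)

lemma quotients_common_denominator:
  assumes "q \<in> quotients" "q' \<in> quotients"
  obtains a b s where "a \<in> \<A>" "b \<in> \<A>" "s \<in> \<A>" "ev (\<lambda>n. s n \<noteq> 0)"
    "ev (\<lambda>n. q n * s n = a n)" "ev (\<lambda>n. q' n * s n = b n)"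
proof -
  obtain a s where as: "a \<in> \<A>" "s \<in> \<A>" and s: "ev (\<lambda>n. s n \<noteq> 0)" "ev (\<lambda>n. q n * s n = a n)"
    using assms(1) by (rule quotientsE)
  obtain b t where bt: "b \<in> \<A>" "t \<in> \<A>" and t: "ev (\<lambda>n. t n \<noteq> 0)" "ev (\<lambda>n. q' n * t n = b n)"
    using assms(2) by (rule quotientsE)
  show thesis
  proof (rule that[OF mult[OF as(1) bt(2)] mult[OF bt(1) as(2)] mult[OF as(2) bt(2)]])
    show "ev (\<lambda>n. s n * t n \<noteq> 0)" using s(1) t(1) by eventually_elim simp
    show "ev (\<lambda>n. q n * (s n * t n) = a n * t n)" using s(2) by eventually_elim (simp flip: mult.assoc)
    show "ev (\<lambda>n. q' n * (s n * t n) = b n * s n)" using t(2) by eventually_elim (simp add: mult_ac)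
  qed
qed

lemma
  assumes "q \<in> quotients" "q' \<in> quotients"
  shows quotients_mult: "(\<lambda>n. q n * q' n) \<in> quotients" and quotients_add: "(\<lambda>n. q n + q' n) \<in> quotients"
proof -
  obtain a b s where abs: "a \<in> \<A>" "b \<in> \<A>" "s \<in> \<A>" and s: "ev (\<lambda>n. s n \<noteq> 0)"
    and ev: "ev (\<lambda>n. q n * s n = a n)" "ev (\<lambda>n. q' n * s n = b n)"
    using assms by (rule quotients_common_denominator)
  have "ev (\<lambda>n. s n * s n \<noteq> 0)" using s by eventually_elim simp
  moreover have "ev (\<lambda>n. q n * q' n * (s n * s n) = a n * b n)" using ev by eventually_elim (simp add: mult_ac)
  ultimately show "(\<lambda>n. q n * q' n) \<in> quotients" by (rule quotientsI[OF mult[OF abs(1,2)] mult[OF abs(3,3)]])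
  have "ev (\<lambda>n. (q n + q' n) * s n = a n + b n)" using ev by eventually_elim (simp add: distrib_right)
  thus "(\<lambda>n. q n + q' n) \<in> quotients" by (rule quotientsI[OF add[OF abs(1,2)] abs(3) s])
qed

lemma quotients_const: "(\<lambda>n. c) \<in> quotients" by (rule algebra_quotients[OF const])

lemma quotients_uminus: "q \<in> quotients ==> (\<lambda>n. - q n) \<in> quotients" using quotients_mult[OF quotients_const[of "- 1"]] by simp

lemma quotients_shift: "q \<in> quotients ==> (\<lambda>n. q (Suc n)) \<in> quotients"
proof -
  assume q: "q \<in> quotients"
  obtain a s where as: "a \<in> \<A>" "s \<in> \<A>" and s: "ev (\<lambda>n. s n \<noteq> 0)" "ev (\<lambda>n. q n * s n = a n)"
    using q by (rule quotientsE)
  show ?thesis by (rule quotientsI[OF shift[OF as(1)] shift[OF as(2)]])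
       (use s in \<open>simp_all add: eventually_sequentially_Suc[of "\<lambda>n. s n \<noteq> 0"] eventually_sequentially_Suc[of "\<lambda>n. q n * s n = a n"]\<close>)
qed

lemma quotients_sum: "(\<And>i. i \<in> S ==> f i \<in> quotients) ==> (\<lambda>n. \<Sum>i\<in>S. f i n) \<in> quotients"
  by (induction S rule: infinite_finite_induct) (auto intro: quotients_const quotients_add)

lemma quotients_dichotomy:
  assumes "q \<in> quotients"
  shows "vanishes p q k \<or> ev (\<lambda>n. p dvd n + k --> q n \<noteq> 0)"
proof -
  obtain a s where as: "a \<in> \<A>" "s \<in> \<A>" and s: "ev (\<lambda>n. s n \<noteq> 0)" "ev (\<lambda>n. q n * s n = a n)"
    using assms by (rule quotientsE)
  show ?thesis
  proof (cases "vanishes p a k")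
    case True
    hence "vanishes p q k" using s unfolding vanishes_def by eventually_elim auto
    thus ?thesis by blast
  next
    case False
    have "ev (\<lambda>n. p dvd n + k --> q n \<noteq> 0)" using s nonvanishing[OF as(1) False] by eventually_elim auto
    thus ?thesis by blast
  qed
qed

lemma quotients_inverse:
  assumes q: "q \<in> quotients" "ev (\<lambda>n. q n \<noteq> 0)"
  shows "(\<lambda>n. inverse (q n)) \<in> quotients"
proof -
  obtain a s where as: "a \<in> \<A>" "s \<in> \<A>" and s: "ev (\<lambda>n. s n \<noteq> 0)" "ev (\<lambda>n. q n * s n = a n)"
    using q(1) by (rule quotientsE)
  have "ev (\<lambda>n. a n \<noteq> 0)" using s q(2) by eventually_elim auto
  moreover have "ev (\<lambda>n. inverse (q n) * a n = s n)" using s q(2) by eventually_elim (auto simp: field_simps)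
  ultimately show ?thesis by (rule quotientsI[OF as(2,1)])
qed

definition ind_class :: "nat => nat => complex" where
  "ind_class k n = (if p dvd n + k then 1 else 0)"

lemma ind_class_mod: "k mod p = k' mod p ==> ind_class k = ind_class k'" unfolding ind_class_def using dvd_add_mod_cong[of k p k'] by auto

text \<open>Let \<open>a i\<close> be eventually supported on class i and nonzero there. Their sum
  is eventually nonzero everywhere and can serve as denominator; the indicator is the quotient of
  one summand by it.\<close>

lemma indicator_quotients: "ind_class k \<in> quotients"
proof -
  have "\<exists>a\<in>\<A>. \<not> vanishes p a i \<and> (\<forall>j\<in>{..<p} - {i}. vanishes p a j)" if "i < p" for i
    by (rule separating) (use that in auto)
  then obtain a where a: "\<And>i. i < p ==> a i \<in> \<A>" "\<And>i. i < p ==> \<not> vanishes p (a i) i"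
    "\<And>i j. i < p ==> j < p ==> j \<noteq> i ==> vanishes p (a i) j" by (metis DiffI lessThan_iff singletonD)
  define s where "s n = (\<Sum>i<p. a i n)" for n
  have sA: "s \<in> \<A>" unfolding s_def
  proof -
    have "finite S ==> S \<subseteq> {..<p} ==> (\<lambda>n. \<Sum>i\<in>S. a i n) \<in> \<A>" for S
      by (induction S rule: finite_induct) (auto intro: const add a)
    thus "(\<lambda>n. \<Sum>i<p. a i n) \<in> \<A>" by simp
  qed
  have ev: "ev (\<lambda>n. p dvd n + j --> s n = a j n \<and> s n \<noteq> 0 \<and> (\<forall>i<p. i \<noteq> j --> a i n = 0))" if j: "j < p" for j
  proof -
    have "ev (\<lambda>n. \<forall>i\<in>{..<p} - {j}. p dvd n + j --> a i n = 0)"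
      using a(3)[OF _ j] unfolding vanishes_def by (intro eventually_ball_finite) auto
    moreover have "ev (\<lambda>n. p dvd n + j --> a j n \<noteq> 0)" by (rule nonvanishing[OF a(1,2)[OF j]])
    ultimately show ?thesis
    proof eventually_elim
      case (elim n)
      have "s n = a j n" if "p dvd n + j" unfolding s_def by (subst sum.remove[of _ j]) (use elim(1) j that in auto)
      thus ?case using elim by auto
    qed
  qed
  have "ev (\<lambda>n. s n \<noteq> 0)"
  proof (rule eventually_classes[OF p])
    fix j assume "j < p"
    from ev[OF this] show "ev (\<lambda>n. p dvd n + j --> s n \<noteq> 0)" by (rule eventually_mono) blast
  qed
  moreover have "ev (\<lambda>n. ind_class (k mod p) n * s n = a (k mod p) n)"
  proof (rule eventually_classes[OF p])
    fix j assume j: "j < p"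
    show "ev (\<lambda>n. p dvd n + j --> ind_class (k mod p) n * s n = a (k mod p) n)" using ev[OF j]
    proof eventually_elim
      case (elim n)
      show ?case
      proof
        assume n: "p dvd n + j"
        have "p dvd n + k mod p \<longleftrightarrow> k mod p = j" using class_unique[OF n, of "k mod p"] n j by auto
        thus "ind_class (k mod p) n * s n = a (k mod p) n" using elim n p by (auto simp: ind_class_def)
      qed
    qed
  qed
  ultimately have "ind_class (k mod p) \<in> quotients" using p by (intro quotientsI[OF a(1)[of "k mod p"] sA]) auto
  thus ?thesis using ind_class_mod[of "k mod p" k] by simp
qed

end

section \<open>Fractions of sequences\<close>

type_synonym seq_fraction = "((nat => complex) set \<times> (nat => complex) set) set"

text \<open>The unit \<open>e\<close> need not be the constant 1: for a component of the total
  quotient ring it is the indicator of a class.\<close>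

lemma cring_of_sequences:
  fixes K :: "('x, 'y) ring_scheme" and f :: "(nat => complex) => 'x"
  assumes carrier: "carrier K = f ` S"
    and closed: "\<And>q q'. q \<in> S ==> q' \<in> S ==> (\<lambda>n. q n + q' n) \<in> S" "\<And>q q'. q \<in> S ==> q' \<in> S ==> (\<lambda>n. q n * q' n) \<in> S"
      "\<And>q. q \<in> S ==> (\<lambda>n. - q n) \<in> S" "(\<lambda>n. 0) \<in> S" "e \<in> S"
    and e: "\<And>q. q \<in> S ==> (\<lambda>n. e n * q n) = q"
    and ops: "\<And>q q'. q \<in> S ==> q' \<in> S ==> f q \<oplus>\<^bsub>K\<^esub> f q' = f (\<lambda>n. q n + q' n)"
      "\<And>q q'. q \<in> S ==> q' \<in> S ==> f q \<otimes>\<^bsub>K\<^esub> f q' = f (\<lambda>n. q n * q' n)"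
      "\<zero>\<^bsub>K\<^esub> = f (\<lambda>n. 0)" "\<one>\<^bsub>K\<^esub> = f e"
  shows "cring K"
proof (rule cringI)
  note simps = carrier ops closed e
  show "abelian_group K"
  proof (rule abelian_groupI)
    fix x assume "x \<in> carrier K"
    then obtain q where q: "q \<in> S" "x = f q" by (auto simp: carrier)
    have "f (\<lambda>n. - q n) \<oplus>\<^bsub>K\<^esub> x = \<zero>\<^bsub>K\<^esub>" using q by (simp add: simps)
    moreover have "f (\<lambda>n. - q n) \<in> carrier K" using q by (simp add: simps)
    ultimately show "\<exists>y\<in>carrier K. y \<oplus>\<^bsub>K\<^esub> x = \<zero>\<^bsub>K\<^esub>" by blast
  qed (auto simp: simps add_ac)
  show "Group.comm_monoid K" by (rule comm_monoidI) (auto simp: simps, auto simp: mult_ac)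
  show "(x \<oplus>\<^bsub>K\<^esub> y) \<otimes>\<^bsub>K\<^esub> z = x \<otimes>\<^bsub>K\<^esub> z \<oplus>\<^bsub>K\<^esub> y \<otimes>\<^bsub>K\<^esub> z"
    if "x \<in> carrier K" "y \<in> carrier K" "z \<in> carrier K" for x y z using that by (auto simp: simps distrib_right)
qed

lemma seq_class_eq_iff: "seq_class s = seq_class t \<longleftrightarrow> ev (\<lambda>n. s n = t n)"
proof
  assume "seq_class s = seq_class t"
  moreover have "s \<in> seq_class s" by (simp add: seq_class_eq)
  ultimately show "ev (\<lambda>n. s n = t n)" by (simp add: seq_class_eq)
next
  assume st: "ev (\<lambda>n. s n = t n)"
  have "ev (\<lambda>n. r n = s n) \<longleftrightarrow> ev (\<lambda>n. r n = t n)" for r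
    by (rule eventually_subst) (use st in "auto elim: eventually_mono")
  thus "seq_class s = seq_class t" by (simp add: seq_class_eq)
qed

lemma Seq_carrier: "carrier Seq = range seq_class"
  by (auto simp: Seq_def FactRing_def A_RCOSETS_def RCOSETS_def seq_class_def a_r_coset_def all_seqs_def)

lemma Seq_mult: "seq_class s \<otimes>\<^bsub>Seq\<^esub> seq_class t = seq_class (\<lambda>n. s n * t n)"
proof -
  have "seq_class s \<otimes>\<^bsub>Seq\<^esub> seq_class t = (\<Union>a\<in>seq_class s. \<Union>b\<in>seq_class t. seq_class (\<lambda>n. a n * b n))"
    by (simp add: Seq_def FactRing_def rcoset_mult_def seq_class_def[symmetric] all_seqs_def[THEN arg_cong[of _ _ mult]])
  also have "\<dots> = (\<Union>a\<in>seq_class s. \<Union>b\<in>seq_class t. seq_class (\<lambda>n. s n * t n))"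
  proof (intro SUP_cong refl)
    fix a b assume "a \<in> seq_class s" "b \<in> seq_class t"
    hence "ev (\<lambda>n. a n = s n)" "ev (\<lambda>n. b n = t n)" by (simp_all add: seq_class_eq)
    thus "seq_class (\<lambda>n. a n * b n) = seq_class (\<lambda>n. s n * t n)" unfolding seq_class_eq_iff by eventually_elim simp
  qed
  also have "\<dots> = seq_class (\<lambda>n. s n * t n)" using seq_class_eq[of s] seq_class_eq[of t] by (auto intro: always_eventually)
  finally show ?thesis .
qed

lemma Seq_add: "seq_class s \<oplus>\<^bsub>Seq\<^esub> seq_class t = seq_class (\<lambda>n. s n + t n)"
proof -
  have "seq_class s \<oplus>\<^bsub>Seq\<^esub> seq_class t = (\<Union>a\<in>seq_class s. \<Union>b\<in>seq_class t. {\<lambda>n. a n + b n})"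
    by (simp add: Seq_def FactRing_def set_add_def set_mult_def all_seqs_def[THEN arg_cong[of _ _ add]])
  also have "\<dots> = seq_class (\<lambda>n. s n + t n)"
  proof (intro equalityI subsetI)
    fix r assume "r \<in> (\<Union>a\<in>seq_class s. \<Union>b\<in>seq_class t. {\<lambda>n. a n + b n})"
    then obtain a b where ab: "ev (\<lambda>n. a n = s n)" "ev (\<lambda>n. b n = t n)" "r = (\<lambda>n. a n + b n)"
      by (auto simp: seq_class_eq)
    have "ev (\<lambda>n. r n = s n + t n)" using ab(1,2) by eventually_elim (simp add: ab(3))
    thus "r \<in> seq_class (\<lambda>n. s n + t n)" by (simp add: seq_class_eq)
  next
    fix r assume "r \<in> seq_class (\<lambda>n. s n + t n)"
    hence r: "ev (\<lambda>n. r n = s n + t n)" by (simp add: seq_class_eq)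
    have "s \<in> seq_class s" by (simp add: seq_class_eq)
    moreover have "(\<lambda>n. r n - s n) \<in> seq_class t" unfolding seq_class_eq mem_Collect_eq using r by eventually_elim simp
    ultimately show "r \<in> (\<Union>a\<in>seq_class s. \<Union>b\<in>seq_class t. {\<lambda>n. a n + b n})"
      by (intro UN_I[of s] UN_I[of "\<lambda>n. r n - s n"]) auto
  qed
  finally show ?thesis .
qed

lemma Seq_zero: "\<zero>\<^bsub>Seq\<^esub> = seq_class (\<lambda>n. 0)" by (simp add: Seq_def FactRing_def seq_class_eq null_seqs_def)

lemma Seq_one: "\<one>\<^bsub>Seq\<^esub> = seq_class (\<lambda>n. 1)" by (simp add: Seq_def FactRing_def seq_class_def all_seqs_def)

lemma cring_Seq: "cring Seq"
  by (rule cring_of_sequences[of _ seq_class UNIV "\<lambda>n. 1"]) (simp_all add: Seq_carrier Seq_add Seq_mult Seq_zero Seq_one)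

lemma Seq_uminus: "\<ominus>\<^bsub>Seq\<^esub> seq_class s = seq_class (\<lambda>n. - s n)"
proof -
  interpret cring Seq by (rule cring_Seq)
  show ?thesis by (rule minus_equality) (simp_all add: Seq_carrier Seq_add Seq_zero)
qed

section \<open>The total quotient ring as a ring of sequences\<close>

context shift_algebra
begin

abbreviation "R \<equiv> Seq\<lparr>carrier := seq_class ` \<A>\<rparr>"
abbreviation "L \<equiv> total_quotient_ring R"

lemma uminus: "a \<in> \<A> ==> (\<lambda>n. - a n) \<in> \<A>" using mult[OF const[of "- 1"]] by simp

lemma cring_R: "cring R" by (rule cring_of_sequences[of _ seq_class \<A> "\<lambda>n. 1"])
     (simp_all add: Seq_add Seq_mult Seq_zero Seq_one const add mult uminus)

text \<open>If \<open>s\<close> vanishes on a class, an element supported on just that class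
  annihilates it. Otherwise \<open>s\<close> is eventually nonzero on each class.\<close>

lemma nonzerodivisor_iff:
  assumes s: "s \<in> \<A>"
  shows "seq_class s \<in> nonzerodivisors R \<longleftrightarrow> ev (\<lambda>n. s n \<noteq> 0)"
proof
  assume nz: "seq_class s \<in> nonzerodivisors R"
  show "ev (\<lambda>n. s n \<noteq> 0)"
  proof (rule eventually_classes[OF p])
    fix k assume k: "k < p"
    have "\<not> vanishes p s k"
    proof
      assume van: "vanishes p s k"
      have "\<exists>a\<in>\<A>. \<not> vanishes p a k \<and> (\<forall>j\<in>{..<p} - {k}. vanishes p a j)" by (rule separating) (use k in auto)
      then obtain a where a: "a \<in> \<A>" "\<not> vanishes p a k" "\<forall>j\<in>{..<p} - {k}. vanishes p a j" by blast
      have "ev (\<lambda>n. s n * a n = 0)"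
      proof (rule eventually_classes[OF p])
        fix j assume j: "j < p"
        show "ev (\<lambda>n. p dvd n + j --> s n * a n = 0)"
        proof (cases "j = k")
          case True
          show ?thesis using van unfolding vanishes_def True by eventually_elim simp
        next
          case False
          hence "vanishes p a j" using a(3) j by simp
          thus ?thesis unfolding vanishes_def by eventually_elim simp
        qed
      qed
      hence "seq_class s \<otimes>\<^bsub>R\<^esub> seq_class a = \<zero>\<^bsub>R\<^esub>" by (simp add: Seq_mult Seq_zero seq_class_eq_iff)
      hence "seq_class a = \<zero>\<^bsub>R\<^esub>" using nz a(1) by (simp add: nonzerodivisors_def)
      hence "ev (\<lambda>n. a n = 0)" by (simp add: Seq_zero seq_class_eq_iff)
      hence "vanishes p a k" unfolding vanishes_def by eventually_elim simp
      thus False using a(2) by contradiction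
    qed
    thus "ev (\<lambda>n. p dvd n + k --> s n \<noteq> 0)" by (rule nonvanishing[OF s])
  qed
next
  assume ev: "ev (\<lambda>n. s n \<noteq> 0)"
  have "seq_class x = \<zero>\<^bsub>R\<^esub>" if "seq_class s \<otimes>\<^bsub>R\<^esub> seq_class x = \<zero>\<^bsub>R\<^esub>" for x
  proof -
    have "ev (\<lambda>n. s n * x n = 0)" using that by (simp add: Seq_mult Seq_zero seq_class_eq_iff)
    hence "ev (\<lambda>n. x n = 0)" using ev by eventually_elim simp
    thus ?thesis by (simp add: Seq_zero seq_class_eq_iff)
  qed
  thus "seq_class s \<in> nonzerodivisors R" using s by (auto simp: nonzerodivisors_def)
qed

text \<open>The fraction with value sequence \<open>q\<close>; by \<open>frac_eq\<close> every
  admissible numerator and denominator give the same one.\<close>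

definition seq_frac :: "(nat => complex) => seq_fraction" where
  "seq_frac q = (SOME X. \<exists>a\<in>\<A>. \<exists>s\<in>\<A>. ev (\<lambda>n. s n \<noteq> 0) \<and>
     ev (\<lambda>n. q n * s n = a n) \<and> X = fraction R (seq_class a) (seq_class s))"

lemma frac_eq:
  assumes as: "a \<in> \<A>" "s \<in> \<A>" and s: "ev (\<lambda>n. s n \<noteq> 0)" and q: "ev (\<lambda>n. q n * s n = a n)"
  shows "seq_frac q = fraction R (seq_class a) (seq_class s)" unfolding seq_frac_def
proof (rule some_equality)
  show "\<exists>a'\<in>\<A>. \<exists>s'\<in>\<A>. ev (\<lambda>n. s' n \<noteq> 0) \<and>
     ev (\<lambda>n. q n * s' n = a' n) \<and> fraction R (seq_class a) (seq_class s) = fraction R (seq_class a') (seq_class s')"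
    by (rule bexI[OF _ as(1)], rule bexI[OF _ as(2)]) (simp add: s q)
  fix X assume "\<exists>b\<in>\<A>. \<exists>t\<in>\<A>. ev (\<lambda>n. t n \<noteq> 0) \<and>
     ev (\<lambda>n. q n * t n = b n) \<and> X = fraction R (seq_class b) (seq_class t)"
  then obtain b t where bt: "b \<in> \<A>" "t \<in> \<A>" and t: "ev (\<lambda>n. t n \<noteq> 0)"
    and qt: "ev (\<lambda>n. q n * t n = b n)" and X: "X = fraction R (seq_class b) (seq_class t)" by (elim bexE conjE)
  have "ev (\<lambda>n. b n * s n = a n * t n)" using q qt
  proof eventually_elim
    case (elim n)
    show ?case unfolding elim[symmetric] by (simp only: mult_ac)
  qed
  hence "seq_class b \<otimes>\<^bsub>R\<^esub> seq_class s = seq_class a \<otimes>\<^bsub>R\<^esub> seq_class t" by (simp add: Seq_mult seq_class_eq_iff)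
  thus "X = fraction R (seq_class a) (seq_class s)"
    unfolding X using as bt s t by (subst cring.fraction_eq_iff[OF cring_R]) (simp_all add: nonzerodivisor_iff)
qed

lemma frac_carrier: "carrier L = seq_frac ` quotients"
proof (intro equalityI subsetI)
  fix X assume "X \<in> carrier L"
  then obtain b t where "b \<in> carrier R" "t \<in> nonzerodivisors R" and X: "X = fraction R b t" unfolding total_quotient_ring_def by auto
  then obtain a s where as: "a \<in> \<A>" "s \<in> \<A>" "b = seq_class a" "t = seq_class s" by (auto simp: nonzerodivisors_def)
  hence s: "ev (\<lambda>n. s n \<noteq> 0)" using \<open>t \<in> _\<close> by (simp add: nonzerodivisor_iff)
  have q: "ev (\<lambda>n. a n / s n * s n = a n)" using s by eventually_elim simp
  show "X \<in> seq_frac ` quotients"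
    using frac_eq[OF as(1,2) s q] quotientsI[OF as(1,2) s q] X as by (intro image_eqI[of _ _ "\<lambda>n. a n / s n"]) simp_all
next
  fix X assume "X \<in> seq_frac ` quotients"
  then obtain q where q: "q \<in> quotients" "X = seq_frac q" by blast
  obtain a s where as: "a \<in> \<A>" "s \<in> \<A>" "ev (\<lambda>n. s n \<noteq> 0)" "ev (\<lambda>n. q n * s n = a n)"
    using q(1) by (rule quotientsE)
  have "fraction R (seq_class a) (seq_class s) \<in> carrier L" unfolding total_quotient_ring_def partial_object.simps
    by (intro CollectI exI[of _ "seq_class a"] exI[of _ "seq_class s"] conjI refl)
       (use as in "simp_all add: nonzerodivisor_iff")
  thus "X \<in> carrier L" using frac_eq[OF as] q(2) by simp
qed

lemma
  assumes "q \<in> quotients" "q' \<in> quotients"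
  shows frac_mult: "seq_frac q \<otimes>\<^bsub>L\<^esub> seq_frac q' = seq_frac (\<lambda>n. q n * q' n)"
    and frac_add: "seq_frac q \<oplus>\<^bsub>L\<^esub> seq_frac q' = seq_frac (\<lambda>n. q n + q' n)"
    and frac_eq_iff: "seq_frac q = seq_frac q' \<longleftrightarrow> ev (\<lambda>n. q n = q' n)"
proof -
  obtain a b s where abs: "a \<in> \<A>" "b \<in> \<A>" "s \<in> \<A>" and s: "ev (\<lambda>n. s n \<noteq> 0)"
    and ev: "ev (\<lambda>n. q n * s n = a n)" "ev (\<lambda>n. q' n * s n = b n)"
    using assms by (rule quotients_common_denominator)
  note q = frac_eq[OF abs(1,3) s ev(1)] frac_eq[OF abs(2,3) s ev(2)]
  note car = imageI[OF abs(1), of seq_class] imageI[OF abs(2), of seq_class] nonzerodivisor_iff[OF abs(3)]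
  have s2: "ev (\<lambda>n. s n * s n \<noteq> 0)" using s by eventually_elim simp
  have "ev (\<lambda>n. q n * q' n * (s n * s n) = a n * b n)" using ev by eventually_elim (simp add: mult_ac)
  from frac_eq[OF mult[OF abs(1,2)] mult[OF abs(3,3)] s2 this]
  show "seq_frac q \<otimes>\<^bsub>L\<^esub> seq_frac q' = seq_frac (\<lambda>n. q n * q' n)"
    unfolding q by (subst cring.mult_fraction[OF cring_R]) (simp_all add: car s Seq_mult)
  have "ev (\<lambda>n. (q n + q' n) * (s n * s n) = a n * s n + b n * s n)"
    using ev by eventually_elim (simp add: algebra_simps)
  from frac_eq[OF add[OF mult[OF abs(1,3)] mult[OF abs(2,3)]] mult[OF abs(3,3)] s2 this]
  show "seq_frac q \<oplus>\<^bsub>L\<^esub> seq_frac q' = seq_frac (\<lambda>n. q n + q' n)"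
    unfolding q by (subst cring.add_fraction[OF cring_R]) (simp_all add: car s Seq_mult Seq_add)
  have "seq_frac q = seq_frac q' \<longleftrightarrow> ev (\<lambda>n. a n * s n = b n * s n)"
    unfolding q by (subst cring.fraction_eq_iff[OF cring_R]) (simp_all add: car s Seq_mult seq_class_eq_iff)
  also have "\<dots> \<longleftrightarrow> ev (\<lambda>n. q n = q' n)"
  proof (rule eventually_subst)
    show "ev (\<lambda>n. (a n * s n = b n * s n) = (q n = q' n))" using s ev
    proof eventually_elim
      case (elim n)
      show ?case unfolding elim(2,3)[symmetric] using elim(1) by simp
    qed
  qed
  finally show "seq_frac q = seq_frac q' \<longleftrightarrow> ev (\<lambda>n. q n = q' n)" .
qed

lemma frac_algebra: "a \<in> \<A> ==> seq_frac a = to_quotient R (seq_class a)"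
  unfolding to_quotient_def by (subst frac_eq[of a "\<lambda>n. 1"]) (simp_all add: const Seq_one)

lemma frac_one: "\<one>\<^bsub>L\<^esub> = seq_frac (\<lambda>n. 1)"
  unfolding frac_algebra[OF const] by (simp add: total_quotient_ring_def to_quotient_def Seq_one)

lemma frac_zero: "\<zero>\<^bsub>L\<^esub> = seq_frac (\<lambda>n. 0)"
  unfolding frac_algebra[OF const] by (simp add: total_quotient_ring_def to_quotient_def Seq_zero Seq_one)

end

lemma RDirProd_list_ops:
  assumes "xs \<in> carrier (RDirProd_list Ks)" "ys \<in> carrier (RDirProd_list Ks)"
  shows "xs \<otimes>\<^bsub>RDirProd_list Ks\<^esub> ys = map (\<lambda>(K, x, y). x \<otimes>\<^bsub>K\<^esub> y) (zip Ks (zip xs ys))"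
    and "xs \<oplus>\<^bsub>RDirProd_list Ks\<^esub> ys = map (\<lambda>(K, x, y). x \<oplus>\<^bsub>K\<^esub> y) (zip Ks (zip xs ys))" using assms
proof (induction Ks arbitrary: xs ys)
  case Nil
  {
    case 1
    thus ?case by (simp add: monoid.defs)
  next
    case 2
    thus ?case by (simp add: monoid.defs)
  }
next
  case (Cons K Ks)
  have "xs \<otimes>\<^bsub>RDirProd_list (K # Ks)\<^esub> ys = map (\<lambda>(K, x, y). x \<otimes>\<^bsub>K\<^esub> y) (zip (K # Ks) (zip xs ys)) \<and>
      xs \<oplus>\<^bsub>RDirProd_list (K # Ks)\<^esub> ys = map (\<lambda>(K, x, y). x \<oplus>\<^bsub>K\<^esub> y) (zip (K # Ks) (zip xs ys))"
    if mem: "xs \<in> carrier (RDirProd_list (K # Ks))" "ys \<in> carrier (RDirProd_list (K # Ks))" for xs ys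
  proof -
    obtain a as b bs where ab: "a \<in> carrier K" "as \<in> carrier (RDirProd_list Ks)" "xs = a # as"
      "b \<in> carrier K" "bs \<in> carrier (RDirProd_list Ks)" "ys = b # bs" using mem by (auto simp: RDirProd_list_carrier)
    let ?P = "RDirProd K (RDirProd_list Ks)"
    have car: "(a, as) \<in> carrier ?P" "(b, bs) \<in> carrier ?P" using ab by (simp_all add: RDirProd_carrier)
    have ops: "(a, as) \<otimes>\<^bsub>?P\<^esub> (b, bs) = (a \<otimes>\<^bsub>K\<^esub> b, as \<otimes>\<^bsub>RDirProd_list Ks\<^esub> bs)"
      "(a, as) \<oplus>\<^bsub>?P\<^esub> (b, bs) = (a \<oplus>\<^bsub>K\<^esub> b, as \<oplus>\<^bsub>RDirProd_list Ks\<^esub> bs)"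
      by (simp_all add: RDirProd_def DirProd_def monoid.defs)
    show ?thesis using ring_hom_mult[OF RDirProd_list_hom1 car] ring_hom_add[OF RDirProd_list_hom1 car]
        Cons.IH[OF ab(2,5)] by (simp add: ops ab)
  qed
  note * = this
  {
    case 1
    thus ?case using * by blast
  next
    case 2
    thus ?case using * by blast
  }
qed

lemma RDirProd_list_one_map: "\<one>\<^bsub>RDirProd_list Ks\<^esub> = map one Ks" unfolding RDirProd_list_one by (induction Ks) auto

section \<open>Embedding, shift, idempotents and decomposition\<close>

context shift_algebra
begin

definition rep :: "seq_fraction => nat => complex" where
  "rep X = (SOME q. q \<in> quotients \<and> X = seq_frac q)"

lemma rep: "X \<in> carrier L ==> rep X \<in> quotients \<and> X = seq_frac (rep X)"
  using someI_ex[of "\<lambda>q. q \<in> quotients \<and> X = seq_frac q"] unfolding rep_def frac_carrier by blast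

lemma rep_frac: "q \<in> quotients ==> ev (\<lambda>n. rep (seq_frac q) n = q n)"
  using rep[of "seq_frac q"] frac_eq_iff[of q "rep (seq_frac q)"] by (auto simp: frac_carrier eq_commute)

definition to_Seq :: "seq_fraction => (nat => complex) set" where
  "to_Seq X = seq_class (rep X)"

definition shift_frac :: "seq_fraction => seq_fraction" where
  "shift_frac X = seq_frac (\<lambda>n. rep X (Suc n))"

lemma to_Seq: "q \<in> quotients ==> to_Seq (seq_frac q) = seq_class q" unfolding to_Seq_def seq_class_eq_iff by (rule rep_frac)

lemma shift_frac:
  assumes "q \<in> quotients"
  shows "shift_frac (seq_frac q) = seq_frac (\<lambda>n. q (Suc n))"
proof -
  have "ev (\<lambda>n. rep (seq_frac q) (Suc n) = q (Suc n))"
    using rep_frac[OF assms] eventually_sequentially_Suc[of "\<lambda>n. rep (seq_frac q) n = q n"] by simp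
  moreover have "rep (seq_frac q) \<in> quotients" using rep[of "seq_frac q"] assms by (simp add: frac_carrier)
  ultimately show ?thesis unfolding shift_frac_def using frac_eq_iff[OF quotients_shift quotients_shift[OF assms]] by simp
qed

lemma ring_hom_fracI:
  assumes "\<And>q. q \<in> quotients ==> f (seq_frac q) \<in> carrier S"
    and "\<And>q q'. q \<in> quotients ==> q' \<in> quotients ==> f (seq_frac (\<lambda>n. q n * q' n)) = f (seq_frac q) \<otimes>\<^bsub>S\<^esub> f (seq_frac q')"
    and "\<And>q q'. q \<in> quotients ==> q' \<in> quotients ==> f (seq_frac (\<lambda>n. q n + q' n)) = f (seq_frac q) \<oplus>\<^bsub>S\<^esub> f (seq_frac q')"
    and "f (seq_frac (\<lambda>n. 1)) = \<one>\<^bsub>S\<^esub>"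
  shows "f \<in> Ring.ring_hom L S" by (rule ring_hom_memI) (auto simp: frac_carrier frac_mult frac_add frac_one assms)

lemma to_Seq_hom: "to_Seq \<in> Ring.ring_hom L Seq" by (rule ring_hom_fracI)
     (simp_all add: to_Seq Seq_carrier Seq_mult Seq_add Seq_one quotients_mult quotients_add quotients_const)

lemma shift_frac_hom: "shift_frac \<in> Ring.ring_hom L L" by (rule ring_hom_fracI)
     (simp_all add: shift_frac frac_carrier frac_mult frac_add frac_one quotients_mult quotients_add quotients_const quotients_shift)

lemma inj_on_fracI:
  assumes "\<And>q q'. q \<in> quotients ==> q' \<in> quotients ==> f (seq_frac q) = f (seq_frac q') ==> ev (\<lambda>n. q n = q' n)"
  shows "inj_on f (carrier L)" unfolding frac_carrier
proof (intro inj_onI, elim imageE)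
  fix X Y q q' assume "f X = f Y" "X = seq_frac q" "q \<in> quotients" "Y = seq_frac q'" "q' \<in> quotients"
  thus "X = Y" using assms[of q q'] by (simp add: frac_eq_iff)
qed

lemma inj_to_Seq: "inj_on to_Seq (carrier L)" by (rule inj_on_fracI) (simp add: to_Seq seq_class_eq_iff)

lemma inj_shift_frac: "inj_on shift_frac (carrier L)"
proof (rule inj_on_fracI)
  fix q q' assume "q \<in> quotients" "q' \<in> quotients" "shift_frac (seq_frac q) = shift_frac (seq_frac q')"
  hence "ev (\<lambda>n. q (Suc n) = q' (Suc n))" by (simp add: shift_frac frac_eq_iff quotients_shift)
  thus "ev (\<lambda>n. q n = q' n)" by (simp only: eventually_sequentially_Suc[of "\<lambda>n. q n = q' n"])
qed

definition idem :: "nat => seq_fraction" where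
  "idem k = seq_frac (ind_class k)"

lemma shift_idem: "shift_frac (idem k) = idem (Suc k)"
proof -
  have "(\<lambda>n. ind_class k (Suc n)) = ind_class (Suc k)" by (simp add: ind_class_def fun_eq_iff)
  thus ?thesis by (simp add: idem_def shift_frac indicator_quotients)
qed

lemma idem_add_period: "idem (k + p * j) = idem k" using ind_class_mod[of "k + p * j" k] by (simp add: idem_def)

lemma shift_idem_power: "(shift_frac ^^ j) (idem k) = idem (k + j)" by (induction j) (simp_all add: shift_idem)

lemma idempotent_values:
  assumes q: "q \<in> quotients"
  shows "seq_frac q \<in> idempotents L \<longleftrightarrow> ev (\<lambda>n. q n = 0 \<or> q n = 1)"
proof -
  have "seq_frac q \<in> idempotents L \<longleftrightarrow> ev (\<lambda>n. q n * q n = q n)"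
    using q quotients_mult[OF q q] by (simp add: idempotents_def frac_carrier frac_mult frac_eq_iff)
  thus ?thesis by (simp add: mult_cancel_left1 disj_commute)
qed

lemma idem_nonzero: "idem k \<noteq> \<zero>\<^bsub>L\<^esub>"
proof
  assume "idem k = \<zero>\<^bsub>L\<^esub>"
  hence "ev (\<lambda>n. ind_class k n = 0)" by (simp add: idem_def frac_zero frac_eq_iff indicator_quotients quotients_const)
  from frequently_class[OF p this, of k] show False by (auto simp: ind_class_def)
qed

lemma nonzero_class:
  assumes "q \<in> quotients" "seq_frac q \<noteq> \<zero>\<^bsub>L\<^esub>"
  obtains k where "k < p" "ev (\<lambda>n. p dvd n + k --> q n \<noteq> 0)"
proof -
  have "\<not> ev (\<lambda>n. q n = 0)" using assms by (simp add: frac_zero frac_eq_iff quotients_const)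
  have "\<exists>k<p. \<not> vanishes p q k"
  proof (rule ccontr)
    assume "\<not> ?thesis"
    hence "vanishes p q k" if "k < p" for k using that by simp
    hence "ev (\<lambda>n. q n = 0)" unfolding vanishes_def by (rule eventually_classes[OF p])
    thus False using \<open>\<not> ev (\<lambda>n. q n = 0)\<close> by contradiction
  qed
  then obtain k where k: "k < p" "\<not> vanishes p q k" by blast
  thus thesis using that[OF k(1)] quotients_dichotomy[OF assms(1), of k] by simp
qed

text \<open>In a splitting of the indicator of class k both summands take values 0 and 1. Each is
  eventually nonzero on some class, which can only be class k, so their product is not zero.\<close>

lemma primitive_idem: "idem k \<in> primitive_idempotents L"
proof -
  have idem: "idem k \<in> idempotents L" unfolding idem_def by (subst idempotent_values) (simp_all add: indicator_quotients ind_class_def)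
  have no_split: False if fg: "f \<in> idempotents L" "g \<in> idempotents L" "f \<noteq> \<zero>\<^bsub>L\<^esub>" "g \<noteq> \<zero>\<^bsub>L\<^esub>" "f \<otimes>\<^bsub>L\<^esub> g = \<zero>\<^bsub>L\<^esub>"
    "idem k = f \<oplus>\<^bsub>L\<^esub> g" for f g
  proof -
    obtain q q' where q: "q \<in> quotients" "q' \<in> quotients" "f = seq_frac q" "g = seq_frac q'"
      using fg(1,2) by (auto simp: idempotents_def frac_carrier)
    have ev: "ev (\<lambda>n. q n = 0 \<or> q n = 1)" "ev (\<lambda>n. q' n = 0 \<or> q' n = 1)"
      using fg(1,2) idempotent_values q by simp_all
    have prod: "ev (\<lambda>n. q n * q' n = 0)"
      using fg(5) by (simp add: q frac_mult frac_zero frac_eq_iff quotients_mult quotients_const)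
    have sum: "ev (\<lambda>n. ind_class k n = q n + q' n)"
      using fg(6) by (simp add: q frac_add idem_def frac_eq_iff quotients_add indicator_quotients)
    have only: "ev (\<lambda>n. p dvd n + k --> q n \<noteq> 0)"
      if s: "ev (\<lambda>n. (q n = 0 \<or> q n = 1) \<and> (q' n = 0 \<or> q' n = 1) \<and> ind_class k n = q n + q' n)"
        and qq: "q \<in> quotients" "seq_frac q \<noteq> \<zero>\<^bsub>L\<^esub>" for q q'
    proof -
      obtain j where j: "ev (\<lambda>n. p dvd n + j --> q n \<noteq> 0)" using qq by (rule nonzero_class)
      have "ev (\<lambda>n. p dvd n + j --> p dvd n + k)"
        using s j by eventually_elim (auto simp: ind_class_def split: if_splits)
      then obtain n where "p dvd n + j" "p dvd n + j --> p dvd n + k" by (rule frequently_class[OF p])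
      hence "k mod p = j mod p" using class_unique[of p n k j] by simp
      thus ?thesis using j dvd_add_mod_cong[of k p j] by simp
    qed
    have "ev (\<lambda>n. (q n = 0 \<or> q n = 1) \<and> (q' n = 0 \<or> q' n = 1) \<and> ind_class k n = q n + q' n)"
      using ev sum by eventually_elim simp
    hence "ev (\<lambda>n. p dvd n + k --> q n \<noteq> 0)" by (rule only) (use q fg(3) in simp_all)
    moreover have "ev (\<lambda>n. (q' n = 0 \<or> q' n = 1) \<and> (q n = 0 \<or> q n = 1) \<and> ind_class k n = q' n + q n)"
      using ev sum by eventually_elim (simp add: add.commute)
    hence "ev (\<lambda>n. p dvd n + k --> q' n \<noteq> 0)" by (rule only) (use q fg(4) in simp_all)
    ultimately have "ev (\<lambda>n. \<not> p dvd n + k)" using prod by eventually_elim auto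
    from frequently_class[OF p this, of k] show False by blast
  qed
  have "\<not> (\<exists>f\<in>idempotents L. \<exists>g\<in>idempotents L. f \<noteq> \<zero>\<^bsub>L\<^esub> \<and> g \<noteq> \<zero>\<^bsub>L\<^esub> \<and> f \<otimes>\<^bsub>L\<^esub> g = \<zero>\<^bsub>L\<^esub> \<and> idem k = f \<oplus>\<^bsub>L\<^esub> g)"
    by (intro notI, elim bexE conjE) (rule no_split)
  thus ?thesis using idem idem_nonzero[of k] unfolding primitive_idempotents_def by simp
qed

lemma primitive_idempotents_eq: "primitive_idempotents L = range idem"
proof (intro equalityI subsetI)
  fix e assume e: "e \<in> primitive_idempotents L"
  then obtain q where q: "q \<in> quotients" "e = seq_frac q" by (auto simp: primitive_idempotents_def idempotents_def frac_carrier)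
  have id: "seq_frac q \<in> idempotents L" and nz: "seq_frac q \<noteq> \<zero>\<^bsub>L\<^esub>" using e q by (auto simp: primitive_idempotents_def)
  have ev: "ev (\<lambda>n. q n = 0 \<or> q n = 1)" using id idempotent_values[OF q(1)] by simp
  obtain k where k: "ev (\<lambda>n. p dvd n + k --> q n \<noteq> 0)" using q(1) nz by (rule nonzero_class)
  \<comment> \<open>\<open>q\<close> is eventually 1 on class k, so \<open>q'\<close> is again
    idempotent and orthogonal to \<open>idem k\<close>; were it nonzero, it would split e.\<close>
  define q' where "q' n = q n + - ind_class k n" for n
  have q': "q' \<in> quotients" unfolding q'_def by (rule quotients_add[OF q(1) quotients_uminus[OF indicator_quotients]])
  have ev': "ev (\<lambda>n. q' n = 0 \<or> q' n = 1)" using ev k by eventually_elim (auto simp: q'_def ind_class_def)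
  have "seq_frac q' = \<zero>\<^bsub>L\<^esub>"
  proof (rule ccontr)
    assume nz': "seq_frac q' \<noteq> \<zero>\<^bsub>L\<^esub>"
    have "seq_frac q = idem k \<oplus>\<^bsub>L\<^esub> seq_frac q'" by (simp add: idem_def frac_add indicator_quotients q') (simp add: q'_def)
    moreover have "idem k \<otimes>\<^bsub>L\<^esub> seq_frac q' = \<zero>\<^bsub>L\<^esub>"
    proof -
      have "ev (\<lambda>n. ind_class k n * q' n = 0)" using ev k by eventually_elim (auto simp: q'_def ind_class_def)
      thus ?thesis by (simp add: idem_def frac_mult frac_zero frac_eq_iff indicator_quotients q' quotients_mult quotients_const)
    qed
    moreover have "seq_frac q' \<in> idempotents L" using ev' idempotent_values[OF q'] by simp
    moreover have "idem k \<in> idempotents L" using primitive_idem by (auto simp: primitive_idempotents_def)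
    ultimately show False using e nz' idem_nonzero[of k] unfolding primitive_idempotents_def q(2) by blast
  qed
  hence "ev (\<lambda>n. q' n = 0)" by (simp add: frac_zero frac_eq_iff q' quotients_const)
  hence "ev (\<lambda>n. q n = ind_class k n)" by eventually_elim (simp add: q'_def)
  hence "e = idem k" by (simp add: q idem_def frac_eq_iff indicator_quotients)
  thus "e \<in> range idem" by blast
qed (use primitive_idem in auto)

lemma shift_primitive_idempotents:
  "bij_betw shift_frac (primitive_idempotents L) (primitive_idempotents L)"
  "cyclic_on shift_frac (primitive_idempotents L)"
proof -
  \<comment> \<open>The predecessor of \<open>idem k\<close> is reached by going round the cycle p -
    1 steps forward.\<close>
  have Suc: "idem k = idem (Suc (k + (p - 1)))" for k using p idem_add_period[of k 1] by simp
  have "range idem \<subseteq> carrier L" by (auto simp: idem_def frac_carrier indicator_quotients)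
  hence "inj_on shift_frac (range idem)" by (rule inj_on_subset[OF inj_shift_frac])
  moreover have "shift_frac ` range idem = range idem" using Suc by (auto simp: image_image shift_idem)
  ultimately show "bij_betw shift_frac (primitive_idempotents L) (primitive_idempotents L)" by (simp add: bij_betw_def primitive_idempotents_eq)
  have "range idem = orbit shift_frac (idem 0)"
  proof (intro equalityI subsetI)
    fix X assume "X \<in> range idem"
    then obtain k where "X = idem k" by blast
    hence "X = (shift_frac ^^ (k + p)) (idem 0)" using idem_add_period[of k 1] by (simp add: shift_idem_power)
    moreover have "0 < k + p" using p by simp
    ultimately show "X \<in> orbit shift_frac (idem 0)" unfolding orbit_altdef by blast
  qed (auto simp: orbit_altdef shift_idem_power)
  thus "cyclic_on shift_frac (primitive_idempotents L)" unfolding cyclic_on_def primitive_idempotents_eq by blast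
qed

lemma shift_fixed: "{y \<in> carrier L. shift_frac y = y} = range (\<lambda>c. to_quotient R (const_seq c))"
proof (intro equalityI subsetI)
  fix y assume y: "y \<in> {y \<in> carrier L. shift_frac y = y}"
  hence "y \<in> carrier L" "shift_frac y = y" by blast+
  then obtain q where q: "q \<in> quotients" "y = seq_frac q" unfolding frac_carrier by blast
  have "seq_frac (\<lambda>n. q (Suc n)) = seq_frac q" using \<open>shift_frac y = y\<close> unfolding q(2) shift_frac[OF q(1)] .
  hence "ev (\<lambda>n. q (Suc n) = q n)" using frac_eq_iff[OF quotients_shift[OF q(1)] q(1)] by simp
  then obtain N where N: "\<And>n. n \<ge> N ==> q (Suc n) = q n" by (auto simp: eventually_sequentially)
  have "q n = q N" if "n \<ge> N" for n using that by (induction n rule: dec_induct) (simp_all add: N)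
  hence "ev (\<lambda>n. q n = q N)" by (rule eventually_sequentiallyI)
  hence "y = seq_frac (\<lambda>n. q N)" by (simp add: q frac_eq_iff quotients_const)
  thus "y \<in> range (\<lambda>c. to_quotient R (const_seq c))" by (simp add: frac_algebra const const_seq_def)
next
  fix y assume "y \<in> range (\<lambda>c. to_quotient R (const_seq c))"
  then obtain c where y: "y = seq_frac (\<lambda>n. c)" by (auto simp: frac_algebra const const_seq_def)
  have "shift_frac y = y" unfolding y by (rule shift_frac[OF quotients_const])
  moreover have "y \<in> carrier L" unfolding y frac_carrier by (rule imageI[OF quotients_const])
  ultimately show "y \<in> {y \<in> carrier L. shift_frac y = y}" by blast
qed

text \<open>The factor of the ring cut out by \<open>idem k\<close>, given by fractions supported on
  class k; operations are those of the whole ring, only the unit changes.\<close>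

definition component :: "nat => seq_fraction ring" where
  "component k = L\<lparr>carrier := seq_frac ` {q \<in> quotients. \<forall>n. \<not> p dvd n + k --> q n = 0}, one := idem k\<rparr>"

lemma field_component: "field (component k)"
proof -
  let ?S = "{q \<in> quotients. \<forall>n. \<not> p dvd n + k --> q n = 0}"
  have "cring (component k)" by (rule cring_of_sequences[of _ seq_frac ?S "ind_class k"])
       (auto simp: component_def idem_def frac_add frac_mult frac_zero quotients_add quotients_mult quotients_uminus
          quotients_const indicator_quotients ind_class_def)
  thus ?thesis
  proof (rule cring.cring_fieldI2)
    show "\<zero>\<^bsub>component k\<^esub> \<noteq> \<one>\<^bsub>component k\<^esub>" using idem_nonzero[of k] by (simp add: component_def)
    fix X assume "X \<in> carrier (component k)" "X \<noteq> \<zero>\<^bsub>component k\<^esub>"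
    then obtain q where q: "q \<in> quotients" "\<And>n. \<not> p dvd n + k ==> q n = 0" "X = seq_frac q" "seq_frac q \<noteq> \<zero>\<^bsub>L\<^esub>"
      by (auto simp: component_def)
    obtain j where j: "ev (\<lambda>n. p dvd n + j --> q n \<noteq> 0)" using q(1,4) by (rule nonzero_class)
    have "ev (\<lambda>n. p dvd n + j --> p dvd n + k)" using j by (rule eventually_mono) (use q(2) in blast)
    then obtain n where "p dvd n + j" "p dvd n + j --> p dvd n + k" by (rule frequently_class[OF p])
      hence "k mod p = j mod p" using class_unique[of p n k j] by simp
    hence nz: "ev (\<lambda>n. p dvd n + k --> q n \<noteq> 0)" using j dvd_add_mod_cong[of k p j] by simp
    \<comment> \<open>Adding 1 off class k makes the sequence eventually nonzero everywhere, hence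
      invertible; the indicator then restricts the inverse to class k.\<close>
    define q1 where "q1 n = q n + (1 + - ind_class k n)" for n
    have "q1 \<in> quotients" unfolding q1_def
      by (rule quotients_add[OF q(1) quotients_add[OF quotients_const quotients_uminus[OF indicator_quotients]]])
    moreover have "ev (\<lambda>n. q1 n \<noteq> 0)"
      using nz by eventually_elim (use q(2) in "auto simp: q1_def ind_class_def")
    ultimately have "(\<lambda>n. ind_class k n * inverse (q1 n)) \<in> quotients" by (intro quotients_mult indicator_quotients quotients_inverse)
    hence inv: "(\<lambda>n. ind_class k n * inverse (q1 n)) \<in> ?S" by (auto simp: ind_class_def)
    have "ev (\<lambda>n. q n * (ind_class k n * inverse (q1 n)) = ind_class k n)"
      using nz by eventually_elim (auto simp: q1_def ind_class_def)
    hence "X \<otimes>\<^bsub>component k\<^esub> seq_frac (\<lambda>n. ind_class k n * inverse (q1 n)) = \<one>\<^bsub>component k\<^esub>"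
      using inv q(1) by (simp add: q(3) component_def frac_mult idem_def frac_eq_iff indicator_quotients quotients_mult)
    moreover have "seq_frac (\<lambda>n. ind_class k n * inverse (q1 n)) \<in> carrier (component k)"
      using imageI[OF inv, of seq_frac] by (simp add: component_def)
    ultimately show "\<exists>Y\<in>carrier (component k). X \<otimes>\<^bsub>component k\<^esub> Y = \<one>\<^bsub>component k\<^esub>" by blast
  qed
qed

lemma decomposition: "L \<simeq> RDirProd_list (map component [0..<p])"
proof -
  let ?Ks = "map component [0..<p]"
  define \<phi> where "\<phi> X = map (\<lambda>k. idem k \<otimes>\<^bsub>L\<^esub> X) [0..<p]" for X
  have \<phi>_frac: "\<phi> (seq_frac q) = map (\<lambda>k. seq_frac (\<lambda>n. ind_class k n * q n)) [0..<p]" if "q \<in> quotients" for q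
    using that by (simp add: \<phi>_def idem_def frac_mult indicator_quotients)
  have mem: "seq_frac (\<lambda>n. ind_class k n * q n) \<in> carrier (component k)" if "q \<in> quotients" for q k
    using that by (auto simp: component_def ind_class_def intro!: imageI quotients_mult[OF indicator_quotients, unfolded ind_class_def])
  have car: "\<phi> (seq_frac q) \<in> carrier (RDirProd_list ?Ks)" if "q \<in> quotients" for q
    by (rule RDirProd_list_carrier_memI) (simp_all add: that \<phi>_frac mem)
  have hom: "\<phi> \<in> Ring.ring_hom L (RDirProd_list ?Ks)"
  proof (rule ring_hom_fracI[where f = \<phi>])
    fix q q' assume q: "q \<in> quotients" "q' \<in> quotients"
    have "(\<lambda>n. ind_class k n * (q n * q' n)) = (\<lambda>n. (ind_class k n * q n) * (ind_class k n * q' n))" for k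
      by (auto simp: ind_class_def)
    thus "\<phi> (seq_frac (\<lambda>n. q n * q' n)) = \<phi> (seq_frac q) \<otimes>\<^bsub>RDirProd_list ?Ks\<^esub> \<phi> (seq_frac q')"
      unfolding RDirProd_list_ops(1)[OF car[OF q(1)] car[OF q(2)]]
      by (intro nth_equalityI) (simp_all add: q \<phi>_frac frac_mult quotients_mult indicator_quotients component_def)
    show "\<phi> (seq_frac (\<lambda>n. q n + q' n)) = \<phi> (seq_frac q) \<oplus>\<^bsub>RDirProd_list ?Ks\<^esub> \<phi> (seq_frac q')"
      unfolding RDirProd_list_ops(2)[OF car[OF q(1)] car[OF q(2)]]
      by (intro nth_equalityI) (simp_all add: q \<phi>_frac frac_add quotients_add quotients_mult indicator_quotients component_def distrib_left)
    show "\<phi> (seq_frac q) \<in> carrier (RDirProd_list ?Ks)" by (rule car[OF q(1)])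
  qed (simp add: RDirProd_list_one_map \<phi>_frac quotients_const component_def idem_def)
  have "inj_on \<phi> (carrier L)"
  proof (rule inj_on_fracI[where f = \<phi>])
    fix q q' assume q: "q \<in> quotients" "q' \<in> quotients" and eq: "\<phi> (seq_frac q) = \<phi> (seq_frac q')"
    show "ev (\<lambda>n. q n = q' n)"
    proof (rule eventually_classes[OF p])
      fix k assume k: "k < p"
      have "\<phi> (seq_frac q) ! k = \<phi> (seq_frac q') ! k" by (simp add: eq)
      hence "ev (\<lambda>n. ind_class k n * q n = ind_class k n * q' n)"
        using k q by (simp add: \<phi>_frac frac_eq_iff quotients_mult indicator_quotients)
      thus "ev (\<lambda>n. p dvd n + k --> q n = q' n)" by eventually_elim (auto simp: ind_class_def)
    qed
  qed
  moreover have "carrier (RDirProd_list ?Ks) \<subseteq> \<phi> ` carrier L"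
  proof
    fix Ys assume Ys: "Ys \<in> carrier (RDirProd_list ?Ks)"
    have len: "length Ys = p" using RDirProd_list_carrier_mem(1)[OF Ys] by simp
    have "\<exists>q\<in>quotients. (\<forall>n. \<not> p dvd n + k --> q n = 0) \<and> Ys ! k = seq_frac q" if "k < p" for k
      using RDirProd_list_carrier_mem(2)[OF Ys, of k] that by (auto simp: component_def)
    then obtain q where q: "\<And>k. k < p ==> q k \<in> quotients" "\<And>k n. k < p ==> \<not> p dvd n + k ==> q k n = 0"
      "\<And>k. k < p ==> Ys ! k = seq_frac (q k)" by metis
    define s where "s n = (\<Sum>k<p. q k n)" for n
    have sQ: "s \<in> quotients" unfolding s_def by (rule quotients_sum) (simp add: q)
    have "ind_class k n * s n = q k n" if k: "k < p" for k n
    proof (cases "p dvd n + k")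
      case True
      have "q j n = 0" if "j < p" "j \<noteq> k" for j by (rule q(2)[OF that(1)]) (use class_unique[OF True, of j] that k in auto)
      hence "s n = q k n" unfolding s_def by (subst sum.remove[of _ k]) (use k in auto)
      thus ?thesis using True by (simp add: ind_class_def)
    qed (simp add: ind_class_def q(2)[OF k])
    hence "Ys = \<phi> (seq_frac s)" using len q(3) by (intro nth_equalityI) (simp_all add: \<phi>_frac[OF sQ])
    thus "Ys \<in> \<phi> ` carrier L" using sQ by (auto simp: frac_carrier)
  qed
  moreover have "\<phi> ` carrier L \<subseteq> carrier (RDirProd_list ?Ks)" using car by (auto simp: frac_carrier)
  ultimately have "bij_betw \<phi> (carrier L) (carrier (RDirProd_list ?Ks))" by (auto simp: bij_betw_def)
  hence "\<phi> \<in> ring_iso L (RDirProd_list ?Ks)" using hom by (simp add: ring_iso_def)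
  thus ?thesis by (auto simp: is_ring_iso_def)
qed

theorem total_quotient_ring_structure:
  "(\<exists>Ks :: seq_fraction ring list.
      length Ks = p \<and> (\<forall>K\<in>set Ks. field K) \<and> L \<simeq> RDirProd_list Ks)
   \<and> (\<exists>\<iota>\<in>Ring.ring_hom L Seq. \<exists>\<tau>\<in>Ring.ring_hom L L.
        inj_on \<iota> (carrier L) \<and> (\<forall>b\<in>carrier R. \<iota> (to_quotient R b) = b)
      \<and> inj_on \<tau> (carrier L)
      \<and> (\<forall>b\<in>carrier R. seq_shift b \<in> carrier R \<and>
            \<tau> (to_quotient R b) = to_quotient R (seq_shift b))
      \<and> (\<forall>y\<in>carrier L. \<iota> (\<tau> y) = seq_shift (\<iota> y))
      \<and> bij_betw \<tau> (primitive_idempotents L) (primitive_idempotents L)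
      \<and> cyclic_on \<tau> (primitive_idempotents L)
      \<and> {y \<in> carrier L. \<tau> y = y} = range (\<lambda>c. to_quotient R (const_seq c)))"
proof (intro conjI exI[of _ "map component [0..<p]"] bexI[OF _ to_Seq_hom] bexI[OF _ shift_frac_hom] ballI
    inj_to_Seq inj_shift_frac shift_primitive_idempotents shift_fixed decomposition)
  fix b assume b: "b \<in> carrier R"
  thus "to_Seq (to_quotient R b) = b" by (auto simp: to_Seq algebra_quotients simp flip: frac_algebra)
  show "seq_shift b \<in> carrier R" "shift_frac (to_quotient R b) = to_quotient R (seq_shift b)"
    using b by (auto simp: seq_shift_class shift shift_frac algebra_quotients simp flip: frac_algebra)
qed (auto simp: field_component frac_carrier shift_frac to_Seq quotients_shift seq_shift_class)

end

section \<open>State sequences\<close>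

lemma progression_vanishes:
  assumes t: "t \<ge> 1" and ik: "t dvd i + k" and v: "vanishes t a k"
  shows "ev (\<lambda>n. a (i + t * n) = 0)"
proof -
  obtain N where N: "\<And>n. n \<ge> N ==> t dvd n + k ==> a n = 0" using v by (auto simp: vanishes_def eventually_sequentially)
  show ?thesis
  proof (rule eventually_sequentiallyI)
    fix n assume n: "N \<le> n"
    have "n \<le> t * n" using t by simp
    hence "N \<le> i + t * n" using n by linarith
    moreover have "i + t * n + k = (i + k) + t * n" by simp
    hence "t dvd i + t * n + k" using ik by (metis dvd_add dvd_triv_left)
    ultimately show "a (i + t * n) = 0" by (rule N)
  qed
qed

lemma progression_zeros_class:
  fixes a :: "nat => complex"
  assumes t: "t \<ge> 1" and ik: "t dvd i + k" and inf: "infinite {n. a (i + t * n) = 0}"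
  shows "infinite {n. t dvd n + k \<and> a n = 0}"
proof
  assume fin: "finite {n. t dvd n + k \<and> a n = 0}"
  have "i + t * n + k = (i + k) + t * n" for n by simp
  hence "t dvd i + t * n + k" for n using ik by (metis dvd_add dvd_triv_left)
  hence "(\<lambda>n. i + t * n) ` {n. a (i + t * n) = 0} \<subseteq> {n. t dvd n + k \<and> a n = 0}" by auto
  hence "finite ((\<lambda>n. i + t * n) ` {n. a (i + t * n) = 0})" using fin by (rule finite_subset)
  moreover have "inj_on (\<lambda>n. i + t * n) {n. a (i + t * n) = 0}" by (rule inj_onI) (use t in simp)
  ultimately show False using inf finite_imageD by blast
qed

text \<open>\<open>k * (t - 1)\<close> is a natural number congruent to -k, so the progression
  starting there is the tail of class k.\<close>

lemma class_progression:
  assumes t: "(t :: nat) \<ge> 1" and n: "t dvd n + k" "k * (t - 1) \<le> n"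
  shows "\<exists>j. n = k * (t - 1) + t * j"
proof -
  have "k * (t - 1) + k = t * k" using t by (cases t) auto
  hence "n + k = (n - k * (t - 1)) + t * k" using n(2) by simp
  hence "t dvd n - k * (t - 1)" using n(1) by (metis dvd_add_left_iff dvd_triv_left)
  then obtain j where "n - k * (t - 1) = t * j" by (rule dvdE)
  thus ?thesis using n(2) by (intro exI[of _ j]) simp
qed

lemma vanishes_progression:
  assumes t: "t \<ge> 1" and ev: "ev (\<lambda>n. a (k * (t - 1) + t * n) = 0)"
  shows "vanishes t a k"
proof -
  obtain N where N: "\<And>n. n \<ge> N ==> a (k * (t - 1) + t * n) = 0" using ev by (auto simp: eventually_sequentially)
  show ?thesis unfolding vanishes_def
  proof (rule eventually_sequentiallyI[of "k * (t - 1) + t * N"], rule impI)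
    fix n assume n: "k * (t - 1) + t * N \<le> n" "t dvd n + k"
    then obtain j where j: "n = k * (t - 1) + t * j" using class_progression[OF t n(2)] by auto
    hence "N \<le> j" using n(1) t by simp
    thus "a n = 0" unfolding j by (rule N)
  qed
qed

lemma class_zeros_progression:
  fixes a :: "nat => complex"
  assumes t: "t \<ge> 1" and inf: "infinite {n. t dvd n + k \<and> a n = 0}"
  shows "infinite {n. a (k * (t - 1) + t * n) = 0}"
proof
  assume fin: "finite {n. a (k * (t - 1) + t * n) = 0}"
  have "{n. t dvd n + k \<and> a n = 0} \<subseteq> {..<k * (t - 1)} \<union> (\<lambda>n. k * (t - 1) + t * n) ` {n. a (k * (t - 1) + t * n) = 0}"
  proof
    fix n assume "n \<in> {n. t dvd n + k \<and> a n = 0}"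
    thus "n \<in> {..<k * (t - 1)} \<union> (\<lambda>n. k * (t - 1) + t * n) ` {n. a (k * (t - 1) + t * n) = 0}"
      using class_progression[OF t, of n k] by (cases "n < k * (t - 1)") auto
  qed
  thus False using inf fin finite_subset by blast
qed

section \<open>Zero sets and polynomial functions of the state\<close>

context shift_algebra
begin

lemma zero_set_periodic:
  assumes a: "a \<in> \<A>" and b: "b \<in> \<A>"
  shows "\<exists>J\<subseteq>{..<p}. finite (sym_diff {n. a n = 0 \<and> b n \<noteq> 0} {n. n mod p \<in> J})"
proof -
  \<comment> \<open>The residues of the classes on which \<open>a\<close> vanishes and
    \<open>b\<close> does not; residue j belongs to class k when p divides
    \<open>j + k\<close>.\<close>
  define J where "J = {j \<in> {..<p}. \<exists>k. p dvd j + k \<and> vanishes p a k \<and> \<not> vanishes p b k}"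
  have "ev (\<lambda>n. a n = 0 \<and> b n \<noteq> 0 \<longleftrightarrow> n mod p \<in> J)"
  proof (rule eventually_classes[OF p])
    fix k assume k: "k < p"
    have J: "n mod p \<in> J \<longleftrightarrow> vanishes p a k \<and> \<not> vanishes p b k" if n: "p dvd n + k" for n
    proof -
      have n': "p dvd n mod p + k" using n by (simp add: dvd_eq_mod_eq_0 mod_add_left_eq)
      have eq: "vanishes p a j \<longleftrightarrow> vanishes p a k" "vanishes p b j \<longleftrightarrow> vanishes p b k" if "p dvd n mod p + j" for j
        by (rule vanishes_mod_cong[OF class_unique[OF that n']])+
      have "n mod p \<in> J \<longleftrightarrow> (\<exists>j. p dvd n mod p + j \<and> vanishes p a j \<and> \<not> vanishes p b j)" using p by (simp add: J_def)
      also have "\<dots> \<longleftrightarrow> vanishes p a k \<and> \<not> vanishes p b k"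
      proof
        assume "\<exists>j. p dvd n mod p + j \<and> vanishes p a j \<and> \<not> vanishes p b j"
        then obtain j where j: "p dvd n mod p + j" "vanishes p a j \<and> \<not> vanishes p b j" by blast
        thus "vanishes p a k \<and> \<not> vanishes p b k" by (simp add: eq[OF j(1)])
      qed (use n' in blast)
      finally show ?thesis .
    qed
    consider "vanishes p a k" "vanishes p b k" | "vanishes p a k" "\<not> vanishes p b k" | "\<not> vanishes p a k" by blast
    thus "ev (\<lambda>n. p dvd n + k --> (a n = 0 \<and> b n \<noteq> 0 \<longleftrightarrow> n mod p \<in> J))"
    proof cases
      case 1
      hence "ev (\<lambda>n. p dvd n + k --> b n = 0)" by (simp add: vanishes_def)
      thus ?thesis by (rule eventually_mono) (use 1 J in simp)
    next
      case 2
      hence "ev (\<lambda>n. p dvd n + k --> a n = 0)" by (simp add: vanishes_def)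
      thus ?thesis using nonvanishing[OF b 2(2)] by eventually_elim (use 2 J in simp)
    next
      case 3
      show ?thesis using nonvanishing[OF a 3] by (rule eventually_mono) (use 3 J in simp)
    qed
  qed
  hence "finite {n. \<not> (a n = 0 \<and> b n \<noteq> 0 \<longleftrightarrow> n mod p \<in> J)}"
    by (simp add: eventually_cofinite flip: cofinite_eq_sequentially)
  hence "finite (sym_diff {n. a n = 0 \<and> b n \<noteq> 0} {n. n mod p \<in> J})" by (rule rev_finite_subset) auto
  moreover have "J \<subseteq> {..<p}" by (auto simp: J_def)
  ultimately show ?thesis by blast
qed

end

context skew_system
begin

abbreviation "V \<equiv> state_coords m r a"

definition state_functions :: "(nat => complex) set" where
  "state_functions = {\<lambda>n. peval (x n) e |e. pvars e \<subseteq> V}"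

lemma sf_exp: "pvars e \<subseteq> V ==> (\<lambda>n. peval (x n) e) \<in> state_functions" by (auto simp: state_functions_def)

lemma sf_const: "(\<lambda>n. c) \<in> state_functions" using sf_exp[of "PConst c"] by simp

lemma sf_var: "c \<in> V ==> (\<lambda>n. x n c) \<in> state_functions" using sf_exp[of "PVar c"] by simp

lemma
  assumes "f \<in> state_functions" "g \<in> state_functions"
  shows sf_add: "(\<lambda>n. f n + g n) \<in> state_functions" and sf_mult: "(\<lambda>n. f n * g n) \<in> state_functions"
proof -
  obtain e e' where "f = (\<lambda>n. peval (x n) e)" "g = (\<lambda>n. peval (x n) e')" "pvars e \<subseteq> V" "pvars e' \<subseteq> V"
    using assms by (auto simp: state_functions_def)
  thus "(\<lambda>n. f n + g n) \<in> state_functions" "(\<lambda>n. f n * g n) \<in> state_functions"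
    using sf_exp[of "PAdd e e'"] sf_exp[of "PMul e e'"] by simp_all
qed

lemma sf_sum: "(\<And>i. i \<in> S ==> f i \<in> state_functions) ==> (\<lambda>n. \<Sum>i\<in>S. f i n) \<in> state_functions"
  by (induction S rule: infinite_finite_induct) (auto intro: sf_const sf_add)

lemma sf_prod: "(\<And>i. i \<in> S ==> f i \<in> state_functions) ==> (\<lambda>n. \<Prod>i\<in>S. f i n) \<in> state_functions"
  by (induction S rule: infinite_finite_induct) (auto intro: sf_const sf_mult)

lemma sf_power: "f \<in> state_functions ==> (\<lambda>n. f n ^ k) \<in> state_functions" by (induction k) (auto intro: sf_const sf_mult)

lemma sf_mp_eval:
  assumes "\<And>v. v \<in> mp_vars f ==> h v \<in> state_functions"
  shows "(\<lambda>n. mp_eval (\<lambda>v. h v n) f) \<in> state_functions" unfolding mp_eval_altdef monomial_value_def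
proof (rule sf_sum, rule sf_mult[OF sf_const], rule sf_prod, rule sf_power, rule assms)
  fix \<mu> v assume "\<mu> \<in> keys f" "v \<in> keys \<mu>"
  thus "v \<in> mp_vars f" by (auto simp: mp_vars_def)
qed

lemma sf_shift_var:
  assumes "c \<in> V"
  shows "(\<lambda>n. x (Suc n) c) \<in> state_functions"
proof -
  have inV: "Time \<in> V" "i < m ==> Base i \<in> V" "j < r ==> Fiber j \<in> V" "k < a ==> l < a ==> Entry k l \<in> V" for i j k l
    by (auto simp: state_coords_def)
  have base: "(\<lambda>n. mp_eval (\<lambda>i. x n (Base i)) f) \<in> state_functions" if "mp_vars f \<subseteq> {..<m}" for f
    by (rule sf_mp_eval) (use that in "auto intro: sf_var inV")
  consider "c = Time" | i where "c = Base i" "i < m" | j where "c = Fiber j" "j < r" | i j where "c = Entry i j" "i < a" "j < a"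
    using assms by (auto simp: state_coords_def)
  thus ?thesis
  proof cases
    case 1
    thus ?thesis using sf_add[OF sf_var[OF inV(1)] sf_const[of 1]] by (simp add: x_simps add.commute)
  next
    case (2 i)
    thus ?thesis using base[OF vars_T[OF 2(2)]] by (simp add: x_simps u_Suc pm_eval_index)
  next
    case (3 j)
    have eq: "x (Suc n) c = mp_eval (\<lambda>v. x n (case_sum Base Fiber v)) \<rho> *
        (\<Sum>k<r. mp_eval (\<lambda>i. x n (Base i)) (M $$ (j, k)) * x n (Fiber k))" for n
    proof -
      have "case_sum (($) (u n)) (($) (z n)) = (\<lambda>v. x n (case_sum Base Fiber v))" by (rule ext) (simp add: x_simps split: sum.splits)
      thus ?thesis using 3 mp_eval_fiber_map[OF carriers(1) 3(2)] by (simp add: x_simps z_Suc total_eval_def)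
    qed
    have rho: "(\<lambda>n. mp_eval (\<lambda>v. x n (case_sum Base Fiber v)) \<rho>) \<in> state_functions"
    proof (rule sf_mp_eval, rule sf_var)
      fix v assume "v \<in> mp_vars \<rho>"
      hence "v \<in> Inl ` {..<m} \<union> Inr ` {..<r}" using vars_rho by blast
      thus "case_sum Base Fiber v \<in> V" by (auto intro: inV)
    qed
    have "(\<lambda>n. \<Sum>k<r. mp_eval (\<lambda>i. x n (Base i)) (M $$ (j, k)) * x n (Fiber k)) \<in> state_functions"
    proof (rule sf_sum)
      fix k assume "k \<in> {..<r}"
      hence k: "k < r" by simp
      show "(\<lambda>n. mp_eval (\<lambda>i. x n (Base i)) (M $$ (j, k)) * x n (Fiber k)) \<in> state_functions"
        by (rule sf_mult[OF base[OF vars_M[OF 3(2) k]] sf_var[OF inV(3)[OF k]]])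
    qed
    from sf_mult[OF rho this] show ?thesis by (simp only: eq)
  next
    case (4 i j)
    have "(\<lambda>n. \<Sum>k<a. poly (A $$ (i, k)) (x n Time) * x n (Entry k j)) \<in> state_functions"
    proof (rule sf_sum, rule sf_mult)
      fix k assume "k \<in> {..<a}"
      thus "(\<lambda>n. x n (Entry k j)) \<in> state_functions" using 4 by (intro sf_var inV) simp_all
      obtain e where "pvars e \<subseteq> {Time}" "\<forall>y. peval y e = poly (A $$ (i, k)) (y Time)"
        using poly_as_pexp[of Time "A $$ (i, k)"] by (elim exE conjE)
      thus "(\<lambda>n. poly (A $$ (i, k)) (x n Time)) \<in> state_functions" using sf_exp[of e] inV(1) by auto
    qed
    thus ?thesis using cocycle_Suc[OF 4(2,3)] by (simp add: x_simps 4(1))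
  qed
qed

lemma sf_shift:
  assumes "f \<in> state_functions"
  shows "(\<lambda>n. f (Suc n)) \<in> state_functions"
proof -
  obtain e where e: "f = (\<lambda>n. peval (x n) e)" "pvars e \<subseteq> V" using assms by (auto simp: state_functions_def)
  have "(\<lambda>n. peval (x (Suc n)) e) \<in> state_functions" using e(2) by (induction e) (auto intro: sf_const sf_shift_var sf_add sf_mult)
  thus ?thesis by (simp add: e(1))
qed

lemma sf_shifts: "f \<in> state_functions ==> (\<lambda>n. f (n + k)) \<in> state_functions"
proof (induction k)
  case (Suc k)
  thus ?case using sf_shift[of "\<lambda>n. f (n + k)"] by simp
qed simp

lemma sf_window: "P \<in> state_polys m r a h ==> (\<lambda>n. window_eval x n P) \<in> state_functions"
proof -
  assume P: "P \<in> state_polys m r a h"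
  have "(\<lambda>n. mp_eval (\<lambda>v. (\<lambda>(k, c) n. x (n + k) c) v n) P) \<in> state_functions"
  proof (rule sf_mp_eval)
    fix v assume "v \<in> mp_vars P"
    then obtain k c where "v = (k, c)" "c \<in> V" using P by (auto simp: state_polys_def)
    thus "(\<lambda>(k, c) n. x (n + k) c) v \<in> state_functions" using sf_shifts[OF sf_var, of c k] by simp
  qed
  thus ?thesis by (simp add: window_eval_def case_prod_beta')
qed

lemma state_algebra_eq: "state_algebra m r a x = Seq\<lparr>carrier := seq_class ` state_functions\<rparr>"
proof -
  let ?G = "range const_seq \<union> (\<lambda>c. seq_class (\<lambda>n. x n c)) ` V"
  have "X \<in> seq_class ` state_functions" if "X \<in> generate_ring Seq ?G" for X using that
  proof (induction rule: generate_ring.induct)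
    case one
    thus ?case unfolding Seq_one by (rule imageI[OF sf_const])
  next
    case (incl h)
    thus ?case by (auto simp: const_seq_def intro!: imageI sf_const sf_var)
  next
    case (a_inv h)
    then obtain f where "f \<in> state_functions" "h = seq_class f" by blast
    thus ?case using imageI[OF sf_mult[OF sf_const[of "- 1"]], of f seq_class] by (simp add: Seq_uminus)
  next
    case (eng_add h1 h2)
    then obtain f g where "f \<in> state_functions" "h1 = seq_class f" "g \<in> state_functions" "h2 = seq_class g" by blast
    thus ?case by (simp add: Seq_add imageI sf_add)
  next
    case (eng_mult h1 h2)
    then obtain f g where "f \<in> state_functions" "h1 = seq_class f" "g \<in> state_functions" "h2 = seq_class g" by blast
    thus ?case by (simp add: Seq_mult imageI sf_mult)
  qed
  moreover have "seq_class (\<lambda>n. peval (x n) e) \<in> generate_ring Seq ?G" if "pvars e \<subseteq> V" for e using that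
  proof (induction e)
    case (PConst c)
    have "const_seq c \<in> generate_ring Seq ?G" by (rule generate_ring.incl) blast
    thus ?case by (simp add: const_seq_def)
  next
    case (PVar c)
    thus ?case by (intro generate_ring.incl) auto
  next
    case (PAdd e e')
    thus ?case using generate_ring.eng_add[of _ Seq ?G] by (simp flip: Seq_add)
  next
    case (PMul e e')
    thus ?case using generate_ring.eng_mult[of _ Seq ?G] by (simp flip: Seq_mult)
  qed
  ultimately have "generate_ring Seq ?G = seq_class ` state_functions" by (auto simp: state_functions_def)
  thus ?thesis by (simp add: state_algebra_def)
qed

text \<open>Taking the least period makes one p serve the zero sets and the decomposition into
  fields.\<close>

lemma shift_algebra_minimal:
  assumes "\<exists>p\<ge>1. progression_zeros V UNIV x p"
  shows "\<exists>p. shift_algebra state_functions p"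
proof -
  define p where "p = (LEAST p. p \<ge> 1 \<and> progression_zeros V UNIV x p)"
  have p: "p \<ge> 1" "progression_zeros V UNIV x p"
    using LeastI_ex[of "\<lambda>p. p \<ge> 1 \<and> progression_zeros V UNIV x p"] assms by (auto simp: p_def)
  have least: "\<not> progression_zeros V UNIV x t" if "1 \<le> t" "t < p" for t
    using not_less_Least[of t "\<lambda>p. p \<ge> 1 \<and> progression_zeros V UNIV x p"] that by (simp add: p_def)
  have "shift_algebra state_functions p"
  proof
    show "vanishes p f k" if f: "f \<in> state_functions" "infinite {n. p dvd n + k \<and> f n = 0}" for f k
    proof (rule vanishes_progression[OF p(1)])
      obtain e where e: "f = (\<lambda>n. peval (x n) e)" "pvars e \<subseteq> V" using f(1) by (auto simp: state_functions_def)
      show "ev (\<lambda>n. f (k * (p - 1) + p * n) = 0)"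
        using p(2)[unfolded progression_zeros_def, rule_format, OF e(2) subset_UNIV, of "k * (p - 1)"]
          class_zeros_progression[OF p(1) f(2)] unfolding e(1) by simp
    qed
    show "\<exists>f\<in>state_functions. \<exists>k. infinite {n. t dvd n + k \<and> f n = 0} \<and> \<not> vanishes t f k" if t: "1 \<le> t" "t < p" for t
    proof -
      have "\<exists>e i. pvars e \<subseteq> V \<and> infinite {n. peval (x (i + t * n)) e = 0} \<and>
          \<not> ev (\<lambda>n. peval (x (i + t * n)) e = 0)" using least[OF t] by (simp add: progression_zeros_def)
      then obtain e i where e: "pvars e \<subseteq> V" "infinite {n. peval (x (i + t * n)) e = 0}"
        "\<not> ev (\<lambda>n. peval (x (i + t * n)) e = 0)" by (elim exE conjE)
      define f where "f n = peval (x n) e" for n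
      \<comment> \<open>The progression starting at i is a tail of the class with index
        \<open>i * (t - 1)\<close>, which is congruent to -i.\<close>
      have "i + i * (t - 1) = t * i" using t(1) by (cases t) auto
      hence dvd: "t dvd i + i * (t - 1)" by simp
      have "infinite {n. t dvd n + i * (t - 1) \<and> f n = 0}"
        by (rule progression_zeros_class[OF t(1) dvd]) (use e(2) in "simp add: f_def")
      moreover have "\<not> vanishes t f (i * (t - 1))" using progression_vanishes[OF t(1) dvd, of f] e(3) by (auto simp: f_def)
      moreover have "f \<in> state_functions" using sf_exp[OF e(1)] by (simp add: f_def[abs_def])
      ultimately show ?thesis by blast
    qed
  qed (rule sf_const p(1) | (rule sf_add sf_mult sf_shift; assumption))+
  thus ?thesis by (rule exI)
qed

end

theorem theorem7p4:
  fixes m r d a :: nat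
    and T :: "nat cpoly vec"
    and M :: "nat cpoly mat"
    and \<rho> :: "(nat + nat) cpoly"
    and A :: "complex poly mat"
    and u\<^sub>0 z\<^sub>0 :: "complex vec"
    and F :: "complex vec \<times> complex vec \<Rightarrow> complex vec \<times> complex vec"
    and x :: "nat \<Rightarrow> coord \<Rightarrow> complex"
  defines "F \<equiv> skew_product r T \<rho> M"
    and "x \<equiv> state F (u\<^sub>0, z\<^sub>0) A"
  assumes "r \<ge> 1" and "d \<ge> 2"
    and "polynomial_map m T"
    and "M \<in> GL r {f. mp_vars f \<subseteq> {..<m}}"
    and "\<rho> \<noteq> 0"
    and "mp_vars \<rho> \<subseteq> Inl ` {..<m} \<union> Inr ` {..<r}"
    and "fiber_order_ge r (d - 1) \<rho>"
    and "(pm_affine_linear T \<and>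
           (\<exists>N S. S = (pm_eval T ^^ N) ` carrier_vec m \<and>
                  S = (pm_eval T ^^ (N + 1)) ` carrier_vec m \<and>
                  (\<exists>l\<ge>1. (F ^^ l) ` critical_locus r \<rho> M S \<subseteq> S \<times> {0\<^sub>v r})))
       \<or> (m \<ge> 1 \<and> pm_etale T \<and>
           (\<exists>q\<ge>1. \<exists>l\<ge>1. pm_degree (pm_iterate T q) < d ^ q \<and>
                  (F ^^ l) ` critical_locus r \<rho> M (carrier_vec m) \<subseteq> carrier_vec m \<times> {0\<^sub>v r}))"
    and "u\<^sub>0 \<in> carrier_vec m" and "z\<^sub>0 \<in> carrier_vec r"
    and "a \<ge> 1" and "A \<in> GL a UNIV"
  shows "\<exists>p\<ge>1.
    (\<forall>h. \<forall>P\<in>state_polys m r a h. \<forall>D\<in>state_polys m r a h. \<exists>J\<subseteq>{..<p}.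
       finite (sym_diff {n. window_eval x n P = 0 \<and> window_eval x n D \<noteq> 0} {n. n mod p \<in> J}))
    \<and> (let R = state_algebra m r a x; L = total_quotient_ring R in
       (\<exists>Ks :: ((nat \<Rightarrow> complex) set \<times> (nat \<Rightarrow> complex) set) set ring list.
          length Ks = p \<and> (\<forall>K\<in>set Ks. field K) \<and> L \<simeq> RDirProd_list Ks)
       \<and> (\<exists>\<iota>\<in>Ring.ring_hom L Seq. \<exists>\<tau>\<in>Ring.ring_hom L L.
            inj_on \<iota> (carrier L) \<and> (\<forall>b\<in>carrier R. \<iota> (to_quotient R b) = b)
          \<and> inj_on \<tau> (carrier L)
          \<and> (\<forall>b\<in>carrier R. seq_shift b \<in> carrier R \<and>
                \<tau> (to_quotient R b) = to_quotient R (seq_shift b))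
          \<and> (\<forall>y\<in>carrier L. \<iota> (\<tau> y) = seq_shift (\<iota> y))
          \<and> bij_betw \<tau> (primitive_idempotents L) (primitive_idempotents L)
          \<and> cyclic_on \<tau> (primitive_idempotents L)
          \<and> {y \<in> carrier L. \<tau> y = y} = range (\<lambda>c. to_quotient R (const_seq c))))"
proof -
  interpret S: skew_system m r d a T M \<rho> A u\<^sub>0 z\<^sub>0 by unfold_locales fact+
  have F: "S.F = F" and x: "S.x = x" by (simp_all add: S.F_def S.x_def F_def x_def)
  have "\<exists>p\<ge>1. progression_zeros (state_coords m r a) UNIV S.x p" using assms(10)
  proof (elim disjE conjE exE)
    fix N S l
    assume "pm_affine_linear T" "S = (pm_eval T ^^ N) ` carrier_vec m"
      "(F ^^ l) ` critical_locus r \<rho> M S \<subseteq> S \<times> {0\<^sub>v r}"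
    thus ?thesis using S.progression_zeros_affine[of l N S] by (simp add: F)
  next
    fix q l
    assume "pm_etale T" "q \<ge> 1" "pm_degree (pm_iterate T q) < d ^ q"
      "(F ^^ l) ` critical_locus r \<rho> M (carrier_vec m) \<subseteq> carrier_vec m \<times> {0\<^sub>v r}"
    thus ?thesis using S.progression_zeros_etale[of q l] by (simp add: F)
  qed
  then obtain p where "shift_algebra S.state_functions p" using S.shift_algebra_minimal by blast
  then interpret A: shift_algebra S.state_functions p .
  show ?thesis unfolding Let_def x[symmetric] S.state_algebra_eq
  proof (intro exI[of _ p] conjI allI ballI)
    show "p \<ge> 1" by (rule A.p)
    show "\<exists>J\<subseteq>{..<p}. finite (sym_diff {n. window_eval S.x n P = 0 \<and> window_eval S.x n D \<noteq> 0} {n. n mod p \<in> J})"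
      if "P \<in> state_polys m r a h" "D \<in> state_polys m r a h" for h P D
      by (rule A.zero_set_periodic[OF S.sf_window[OF that(1)] S.sf_window[OF that(2)]])
  qed (fact conjunct1[OF A.total_quotient_ring_structure], fact conjunct2[OF A.total_quotient_ring_structure])
qed

end
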